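(* Let $S^7$ carry its standard nearly parallel $G_2$-structure and let $S^6=S^7\cap\{x_0=0\}$ be the totally geodesic 6-sphere, carrying its nearly Kähler structure (automorphism group $G_2\subset\mathrm{Spin}(7)$). Let $M$ be any one of the following associative submanifolds of $S^7$ contained in $S^6$: the totally geodesic $S^3$, $L_1$, $L_2$, $L_3$, $L_4$ (defined in the context). Then every infinitesimal associative deformation of $M$ in $S^7$ is the sum of an infinitesimal Lagrangian deformation of $M$ inside the nearly Kähler $S^6$ and an infinitesimal deformation induced by $\mathrm{Spin}(7)$. Equivalently, all associative, non-Lagrangian infinitesimal deformations of these submanifolds are trivial, i.e. induced by elements of $\mathfrak{spin}(7)$ not in $\mathfrak{g}_2$.
   Context: Notation for $S^7$, $\varphi$, $\mathrm{Spin}(7)$, associative submanifolds, infinitesimal associative deformations and trivial (Spin(7)-induced) deformations: on $\mathbb{R}^8=\mathbb{C}^4$ with coordinates $(x_0,\dots,x_7)$, $z_1=x_0+ix_1,\dots,z_4=x_6+ix_7$, $\Phi_0=\frac12\omega_0^2+\mathrm{Re}(dz_1\wedge dz_2\wedge dz_3\wedge dz_4)$, $\omega_0=\frac i2\sum dz_j\wedge d\bar z_j$; $\varphi=\iota(r\partial_r)\Phi_0|_{S^7}$; associative means $\varphi|_{TM}=\mathrm{vol}_M$; infinitesimal associative deformations are normal sections in the kernel of the linearization of $\sigma\mapsto \chi$ restricted to $\exp_\sigma(M)$, $\chi$ defined by $g(v_1,\chi(v_2,v_3,v_4))=*\varphi(v_1,\dots,v_4)$. Writing $\mathbb{R}^8=\mathbb{R}\oplus\mathbb{R}^7$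 with $x_0$ the first coordinate, $\Phi_0=dx_0\wedge\varphi_0+*\varphi_0$ with $\varphi_0=dx_{123}+dx_1(dx_{45}+dx_{67})+dx_2(dx_{46}-dx_{57})-dx_3(dx_{47}+dx_{56})$; $G_2$ is the stabilizer of $\varphi_0$. The nearly Kähler structure on $S^6\subset\mathbb{R}^7$ has $\sigma=\iota(r\partial_r)\varphi_0|_{S^6}$ and almost complex structure $J$ with $\sigma=k(J\cdot,\cdot)$; a 3-submanifold $L\subset S^6$ is Lagrangian if $\sigma|_{TL}=0$ (such $L$ are associative in $S^7$). An infinitesimal Lagrangian deformation of $L$ is a normal field $Jv$, $v\in\mathfrak X(L)$, with $(\mathcal L_{Jv}\sigma)|_{TL}=0$. Identify $\mathbb{R}^7=\mathbb{R}\oplus\mathbb{C}^3$ by $(x_1,x_2+ix_3,x_4+ix_5,x_6+ix_7)$ and let $\epsilon_1,\dots,\epsilon_7$ be the standard basis. $L_1=SU(2)\cdot(\frac{\sqrt5}3,0,\frac23,0)$ where $\begin{pmatrix}a&-\bar b\\ b&\bar a\end{pmatrix}$ acts by $(x_1,z_1,z_2,z_3)\mapsto((|a|^2-|b|^2)x_1-2\mathrm{Im}(\bar a\bar bz_1),\ 2i\bar abx_1+\bar a^2z_1+b^2\bar z_1,\ az_2-\bar b\bar z_3,\ \bar b\bar z_2+az_3)$. $L_2=\{(0,z_1,z_2,z_3):|z|=1,\ z_1^2+z_2^2+z_3^2=0\}$. $L_3=SU(2)\cdot\epsilon_2$, $L_4=SU(2)\cdot\epsilon_6$, where $\mathbb{R}^7$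 is identified with harmonic cubics on $\mathbb{R}^3$ via $\epsilon_1\mapsto\frac{\sqrt{10}}{10}x(2x^2-3y^2-3z^2)$, $\epsilon_2\mapsto-\sqrt6xyz$, $\epsilon_3\mapsto\frac{\sqrt6}2x(y^2-z^2)$, $\epsilon_4\mapsto-\frac{\sqrt{15}}{10}y(4x^2-y^2-z^2)$, $\epsilon_5\mapsto-\frac{\sqrt{15}}{10}z(4x^2-y^2-z^2)$, $\epsilon_6\mapsto\frac12y(y^2-3z^2)$, $\epsilon_7\mapsto\frac12z(z^2-3y^2)$, and $A\in SU(2)$ acts by $(A\cdot f)(x,y,z)=f((x,y,z)\varpi(A))$, with $\varpi:SU(2)\to SO(3)$ the double cover $\begin{pmatrix}a&-\bar b\\ b&\bar a\end{pmatrix}\mapsto\begin{pmatrix}|a|^2-|b|^2&2\mathrm{Im}(ab)&-2\mathrm{Re}(ab)\\ -2\mathrm{Im}(\bar ab)&\mathrm{Re}(a^2+b^2)&\mathrm{Im}(a^2+b^2)\\ 2\mathrm{Re}(\bar ab)&\mathrm{Im}(-a^2+b^2)&\mathrm{Re}(a^2-b^2)\end{pmatrix}$. The totally geodesic $S^3$ is, up to $G_2$, a totally geodesic 3-sphere in $S^6$ that is Lagrangian. *)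

theory Defs
  imports "HOL-Analysis.Analysis"
begin

text \<open>Points of R^8 are \<open>real^8\<close>; the coordinate \<open>x_k\<close> is \<open>x $ k\<close> for k = 0..7.\<close>

definition mk8 :: "real \<Rightarrow> real \<Rightarrow> real \<Rightarrow> real \<Rightarrow> real \<Rightarrow> real \<Rightarrow> real \<Rightarrow> real \<Rightarrow> real^8" where
  "mk8 a0 a1 a2 a3 a4 a5 a6 a7 = (\<chi> i. if i = 0 then a0 else if i = 1 then a1 else if i = 2 then a2
      else if i = 3 then a3 else if i = 4 then a4 else if i = 5 then a5 else if i = 6 then a6 else a7)"

definition from7 :: "real \<Rightarrow> complex \<Rightarrow> complex \<Rightarrow> complex \<Rightarrow> real^8" where
  "from7 x1 z1 z2 z3 = mk8 0 x1 (Re z1) (Im z1) (Re z2) (Im z2) (Re z3) (Im z3)"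

definition omega0 :: "real^8 \<Rightarrow> real^8 \<Rightarrow> real" where
  "omega0 a b = (a$0*b$1 - a$1*b$0) + (a$2*b$3 - a$3*b$2) + (a$4*b$5 - a$5*b$4) + (a$6*b$7 - a$7*b$6)"

text \<open>\<open>(1/2) omega0 \<and> omega0\<close> evaluated on four vectors.\<close>
definition half_omega_sq :: "real^8 \<Rightarrow> real^8 \<Rightarrow> real^8 \<Rightarrow> real^8 \<Rightarrow> real" where
  "half_omega_sq a b c d = omega0 a b * omega0 c d - omega0 a c * omega0 b d + omega0 a d * omega0 b c"

definition dzv :: "real^8 \<Rightarrow> complex^4" where
  "dzv v = (\<chi> j. if j = 0 then Complex (v$0) (v$1) else if j = 1 then Complex (v$2) (v$3)
              else if j = 2 then Complex (v$4) (v$5) else Complex (v$6) (v$7))"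

definition Phi0 :: "real^8 \<Rightarrow> real^8 \<Rightarrow> real^8 \<Rightarrow> real^8 \<Rightarrow> real" where
  "Phi0 a b c d = half_omega_sq a b c d +
     Re (det ((\<chi> k. if k = 0 then dzv a else if k = 1 then dzv b else if k = 2 then dzv c else dzv d) :: complex^4^4))"

definition det3 :: "real \<Rightarrow> real \<Rightarrow> real \<Rightarrow> real \<Rightarrow> real \<Rightarrow> real \<Rightarrow> real \<Rightarrow> real \<Rightarrow> real \<Rightarrow> real" where
  "det3 a b c d e f g h i = a*(e*i - f*h) - b*(d*i - f*g) + c*(d*h - e*g)"

definition dx3 :: "8 \<Rightarrow> 8 \<Rightarrow> 8 \<Rightarrow> real^8 \<Rightarrow> real^8 \<Rightarrow> real^8 \<Rightarrow> real" where
  "dx3 i j k a b c = det3 (a$i) (a$j) (a$k) (b$i) (b$j) (b$k) (c$i) (c$j) (c$k)"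

definition phi0 :: "real^8 \<Rightarrow> real^8 \<Rightarrow> real^8 \<Rightarrow> real" where
  "phi0 a b c = dx3 1 2 3 a b c + dx3 1 4 5 a b c + dx3 1 6 7 a b c + dx3 2 4 6 a b c
     - dx3 2 5 7 a b c - dx3 3 4 7 a b c - dx3 3 5 6 a b c"

definition S7 :: "(real^8) set" where "S7 = {x. norm x = 1}"
definition S6 :: "(real^8) set" where "S6 = {x \<in> S7. x$0 = 0}"

definition expS :: "real^8 \<Rightarrow> real^8 \<Rightarrow> real^8" where
  "expS p v = cos (norm v) *\<^sub>R p + (sin (norm v) / norm v) *\<^sub>R v"

definition tangent_space :: "(real^8) set \<Rightarrow> real^8 \<Rightarrow> (real^8) set" where
  "tangent_space M p = {v. \<exists>\<gamma> :: real \<Rightarrow> real^8. (\<forall>t. \<gamma> t \<in> M) \<and> \<gamma> 0 = p \<and> (\<gamma> has_vector_derivative v) (at 0)}"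

text \<open>C^1 vector fields on R^8 (vector fields along M are taken as restrictions of these).\<close>
definition C1_field :: "(real^8 \<Rightarrow> real^8) \<Rightarrow> bool" where
  "C1_field V \<longleftrightarrow> (\<forall>x. V differentiable (at x)) \<and>
     (\<forall>i. continuous_on UNIV (\<lambda>x. frechet_derivative V (at x) (axis i 1)))"

definition flowmap :: "(real^8 \<Rightarrow> real^8) \<Rightarrow> real \<Rightarrow> real^8 \<Rightarrow> real^8" where
  "flowmap V t = (\<lambda>q. expS q (t *\<^sub>R V q))"

text \<open>\<open>chi\<close> on S^7: \<open>g(v1, chi(b,c,d)) = *phi(v1,b,c,d)\<close>, where \<open>*phi = Phi0|_{TS^7}\<close>
  (cone relation \<open>Phi0 = r^3 dr \<and> phi + r^4 *phi\<close>); so chi is the tangential part of the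
  vector dual to \<open>Phi0(., b, c, d)\<close>.\<close>
definition chi :: "real^8 \<Rightarrow> real^8 \<Rightarrow> real^8 \<Rightarrow> real^8 \<Rightarrow> real^8" where
  "chi p b c d = (let w = (\<chi> i. Phi0 (axis i 1) b c d) in w - (w \<bullet> p) *\<^sub>R p)"

definition normal_field_S7 :: "(real^8) set \<Rightarrow> (real^8 \<Rightarrow> real^8) \<Rightarrow> bool" where
  "normal_field_S7 M V \<longleftrightarrow> (\<forall>p\<in>M. V p \<bullet> p = 0 \<and> (\<forall>u\<in>tangent_space M p. V p \<bullet> u = 0))"

text \<open>V is an infinitesimal associative deformation of M: a normal section in the kernel of the
  linearisation at 0 of \<open>\<sigma> \<mapsto> chi|_{exp_\<sigma>(M)}\<close>.\<close>
definition assoc_inf_deformation :: "(real^8) set \<Rightarrow> (real^8 \<Rightarrow> real^8) \<Rightarrow> bool" where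
  "assoc_inf_deformation M V \<longleftrightarrow> C1_field V \<and> normal_field_S7 M V \<and>
     (\<forall>p\<in>M. \<forall>a\<in>tangent_space M p. \<forall>b\<in>tangent_space M p. \<forall>c\<in>tangent_space M p.
        ((\<lambda>t. let f = flowmap V t; D = frechet_derivative f (at p)
              in chi (f p) (D a) (D b) (D c)) has_vector_derivative 0) (at 0))"

definition sigmaNK :: "real^8 \<Rightarrow> real^8 \<Rightarrow> real^8 \<Rightarrow> real" where
  "sigmaNK p a b = phi0 p a b"

text \<open>\<open>J_p\<close> on S^6, determined by \<open>sigma_p(a,b) = <J_p a, b>\<close>.\<close>
definition Jmap :: "real^8 \<Rightarrow> real^8 \<Rightarrow> real^8" where
  "Jmap p a = (\<chi> i. sigmaNK p a (axis i 1))"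

text \<open>\<open>J v\<close> (v tangent to L) is an infinitesimal Lagrangian deformation of L in S^6:
  \<open>(L_{Jv} sigma)|_{TL} = 0\<close>, computed as the t-derivative at 0 of the pull-back of sigma
  under the variation \<open>exp_{t Jv}\<close>.\<close>
definition lag_inf_deformation :: "(real^8) set \<Rightarrow> (real^8 \<Rightarrow> real^8) \<Rightarrow> bool" where
  "lag_inf_deformation L v \<longleftrightarrow> C1_field v \<and> (\<forall>p\<in>L. v p \<in> tangent_space L p) \<and>
     (\<forall>p\<in>L. \<forall>a\<in>tangent_space L p. \<forall>b\<in>tangent_space L p.
        ((\<lambda>t. let f = flowmap (\<lambda>q. Jmap q (v q)) t; D = frechet_derivative f (at p)
              in sigmaNK (f p) (D a) (D b)) has_real_derivative 0) (at 0))"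

definition spin7 :: "(real^8^8) set" where
  "spin7 = {X. \<forall>a b c d. Phi0 (X *v a) b c d + Phi0 a (X *v b) c d + Phi0 a b (X *v c) d
                        + Phi0 a b c (X *v d) = 0}"

definition S3_tg :: "(real^8) set" where
  "S3_tg = {x \<in> S6. x$1 = 0 \<and> x$2 = 0 \<and> x$3 = 0}"

definition su2 :: "(complex \<times> complex) set" where
  "su2 = {(a, b). (cmod a)^2 + (cmod b)^2 = 1}"

definition act1 :: "complex \<Rightarrow> complex \<Rightarrow> real \<Rightarrow> complex \<Rightarrow> complex \<Rightarrow> complex \<Rightarrow> real^8" where
  "act1 a b x1 z1 z2 z3 = from7
     (((cmod a)^2 - (cmod b)^2) * x1 - 2 * Im (cnj a * cnj b * z1))
     (2 * \<i> * cnj a * b * of_real x1 + (cnj a)^2 * z1 + b^2 * cnj z1)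
     (a * z2 - cnj b * cnj z3)
     (cnj b * cnj z2 + a * z3)"

definition L1 :: "(real^8) set" where
  "L1 = {act1 a b (sqrt 5 / 3) 0 (2/3) 0 | a b. (a, b) \<in> su2}"

definition L2 :: "(real^8) set" where
  "L2 = {from7 0 z1 z2 z3 | z1 z2 z3. (cmod z1)^2 + (cmod z2)^2 + (cmod z3)^2 = 1 \<and> z1^2 + z2^2 + z3^2 = 0}"

text \<open>Harmonic cubics corresponding to \<open>\<epsilon>_1, ..., \<epsilon>_7\<close> (index i :: 8, i = 1..7; 0 unused).\<close>
definition hcubic :: "8 \<Rightarrow> real \<Rightarrow> real \<Rightarrow> real \<Rightarrow> real" where
  "hcubic i x y z =
    (if i = 1 then sqrt 10 / 10 * x * (2*x^2 - 3*y^2 - 3*z^2)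
     else if i = 2 then - sqrt 6 * x * y * z
     else if i = 3 then sqrt 6 / 2 * x * (y^2 - z^2)
     else if i = 4 then - sqrt 15 / 10 * y * (4*x^2 - y^2 - z^2)
     else if i = 5 then - sqrt 15 / 10 * z * (4*x^2 - y^2 - z^2)
     else if i = 6 then 1/2 * y * (y^2 - 3*z^2)
     else if i = 7 then 1/2 * z * (z^2 - 3*y^2)
     else 0)"

text \<open>The double cover \<open>\<varpi> : SU(2) \<rightarrow> SO(3)\<close>, entries \<open>varpi a b r s\<close> (row r, column s, 1-based).\<close>
definition varpi :: "complex \<Rightarrow> complex \<Rightarrow> nat \<Rightarrow> nat \<Rightarrow> real" where
  "varpi a b r s =
    (if r = 1 then (if s = 1 then (cmod a)^2 - (cmod b)^2 else if s = 2 then 2 * Im (a*b) else - 2 * Re (a*b))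
     else if r = 2 then (if s = 1 then - 2 * Im (cnj a * b) else if s = 2 then Re (a^2 + b^2) else Im (a^2 + b^2))
     else (if s = 1 then 2 * Re (cnj a * b) else if s = 2 then Im (b^2 - a^2) else Re (a^2 - b^2)))"

definition act_cubic :: "complex \<Rightarrow> complex \<Rightarrow> (real \<Rightarrow> real \<Rightarrow> real \<Rightarrow> real) \<Rightarrow> real \<Rightarrow> real \<Rightarrow> real \<Rightarrow> real" where
  "act_cubic a b f x y z =
     f (x * varpi a b 1 1 + y * varpi a b 2 1 + z * varpi a b 3 1)
       (x * varpi a b 1 2 + y * varpi a b 2 2 + z * varpi a b 3 2)
       (x * varpi a b 1 3 + y * varpi a b 2 3 + z * varpi a b 3 3)"

definition cubic_orbit :: "8 \<Rightarrow> (real^8) set" where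
  "cubic_orbit k = {q. q$0 = 0 \<and> (\<exists>a b. (a, b) \<in> su2 \<and>
      (\<forall>x y z. (\<Sum>i\<in>UNIV. q$i * hcubic i x y z) = act_cubic a b (hcubic k) x y z))}"

definition L3 :: "(real^8) set" where "L3 = cubic_orbit 2"
definition L4 :: "(real^8) set" where "L4 = cubic_orbit 6"

end

theory Submission
  imports Defs
begin

text \<open>Each of the five submanifolds is an orbit of SU(2) inside G2, and a normal field is a pair
  \<open>(f, nu)\<close>, where \<open>f\<close> is its component in the direction \<open>e0\<close> normal to S^6 and \<open>J nu\<close> is the rest. In a
  left-invariant frame the associative equation says that nu is divergence free and that its curl
  expression equals a multiple of \<open>df\<close>, so \<open>f\<close> is a weak eigenfunction of the Laplacian with eigenvalue 3.
  By the Peter-Weyl decomposition, the products \<open>X^p Y^q\<close> of matrix coefficients turn this into a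
  condition on \<open>(p, q)\<close>; invariance under the stabiliser leaves only those products that are restrictions of linear
  functions of R^7. Hence \<open>f\<close> is the restriction of a linear function, which is the \<open>e0\<close>-component of the
  field of an element of spin(7). Subtracting that field leaves \<open>f = 0\<close>, and then the equation for \<open>nu\<close> is the
  infinitesimal Lagrangian one.\<close>

section \<open>Invariant mean on the unit quaternions\<close>

text \<open>Deformations are only C^1, so \<open>f\<close> need not have second derivatives; hence
  the Laplace equation appears only after integration against smooth test functions. The eigenvalue
  3 is the dimension of \<open>M\<close>: on a minimal 3-fold in a unit sphere every coordinate
  function solves the same equation, so the work lies in excluding all other solutions that descend
  to the orbit. The products \<open>X^p Y^q\<close> diagonalise the Laplacian because in every case
  two of the three frame vectors have equal length. Two features of the statement shape the rest.
  \<open>tangent_space\<close> is defined by curves in the bare point set \<open>M\<close> that are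
  differentiable at one instant, with no chart and no lift to the group, and the Lagrangian
  condition ranges over all such vectors; a quadratic estimate for orbits controls them. The field
  to be produced must be C^1 on all of R^8 and not only along \<open>M\<close>, so the tangential
  projection has to be given by a formula polynomial in the point. A field from spin(7) is not
  normal to \<open>M\<close>, which is why the decomposition holds modulo tangent vectors.\<close>

type_synonym quat = "complex \<times> complex"

text \<open>A pair (a, b) stands for the SU(2) matrix with columns (a, b) and (-cnj b, cnj a); this
  is the first column of the product of two such matrices. In this convention (\<i>, 0) times (0, 1)
  is (0, -\<i>), which is the source of the negative structure constants further on.\<close>

definition qmult :: "quat \<Rightarrow> quat \<Rightarrow> quat" where
  "qmult g h = (fst g * fst h - cnj (snd g) * snd h, snd g * fst h + cnj (fst g) * snd h)"

definition S3q :: "quat set" where "S3q = {g. (cmod (fst g))\<^sup>2 + (cmod (snd g))\<^sup>2 = 1}"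

text \<open>For a unit vector \<open>u\<close> this is the one-parameter subgroup generated by the
  imaginary quaternion with coordinates \<open>u\<close>.\<close>

definition rot :: "real^3 \<Rightarrow> real \<Rightarrow> quat" where
  "rot u t = (Complex (cos t) (u$1 * sin t), Complex (u$2 * sin t) (u$3 * sin t))"

lemma qmult_assoc: "qmult (qmult g h) k = qmult g (qmult h k)"
  by (simp add: qmult_def algebra_simps)

lemma qmult_one [simp]: "qmult (1, 0) g = g" "qmult g (1, 0) = g"
  by (simp_all add: qmult_def)

lemma S3q_norm: "g \<in> S3q \<longleftrightarrow> norm g = 1"
  by (simp add: S3q_def norm_prod_def)

lemma S3q_eq_sphere: "S3q = sphere 0 1"
  by (auto simp: S3q_norm)

lemma compact_S3q [simp]: "compact S3q"
  by (simp add: S3q_eq_sphere)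

lemma one_in_S3q [simp]: "(1, 0) \<in> S3q"
  by (simp add: S3q_def)

lemma norm_quat_sq: "(norm g)\<^sup>2 = (Re (fst g))\<^sup>2 + (Im (fst g))\<^sup>2 + (Re (snd g))\<^sup>2 + (Im (snd g))\<^sup>2" for g :: quat
  by (simp add: norm_prod_def cmod_power2)

lemma norm_qmult: "norm (qmult g h) = norm g * norm h"
proof -
  have "(norm (qmult g h))\<^sup>2 = (norm g)\<^sup>2 * (norm h)\<^sup>2"
    unfolding norm_quat_sq qmult_def by (simp add: power2_eq_square algebra_simps)
  then have "(norm (qmult g h))\<^sup>2 = (norm g * norm h)\<^sup>2"
    by (simp only: power_mult_distrib)
  then show ?thesis
    by (simp add: power2_eq_iff_nonneg)
qed

lemma qmult_in_S3q [simp]: "g \<in> S3q \<Longrightarrow> h \<in> S3q \<Longrightarrow> qmult g h \<in> S3q"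
  by (simp add: S3q_norm norm_qmult)

definition qconj :: "quat \<Rightarrow> quat" where "qconj g = (cnj (fst g), - snd g)"

lemma qconj_in_S3q [simp]: "g \<in> S3q \<Longrightarrow> qconj g \<in> S3q"
  by (simp add: S3q_def qconj_def)

lemma S3q_sq: "g \<in> S3q \<longleftrightarrow> (Re (fst g))\<^sup>2 + (Im (fst g))\<^sup>2 + (Re (snd g))\<^sup>2 + (Im (snd g))\<^sup>2 = 1"
  by (simp add: S3q_def cmod_power2 add.assoc)

lemma qmult_qconj [simp]:
  assumes "g \<in> S3q"
  shows "qmult g (qconj g) = (1, 0)" "qmult (qconj g) g = (1, 0)"
  using assms by (simp_all add: qmult_def qconj_def S3q_sq complex_eq_iff power2_eq_square algebra_simps)

lemma norm3_eq_1: "norm (u::real^3) = 1 \<longleftrightarrow> (u$1)\<^sup>2 + (u$2)\<^sup>2 + (u$3)\<^sup>2 = 1"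
  by (simp add: norm_eq_1 inner_vec_def sum_3 power2_eq_square)

lemma rot_in_S3q [simp]:
  assumes "norm u = 1"
  shows "rot u t \<in> S3q"
proof -
  have "(cmod (fst (rot u t)))\<^sup>2 + (cmod (snd (rot u t)))\<^sup>2
      = (cos t)\<^sup>2 + ((u$1)\<^sup>2 + (u$2)\<^sup>2 + (u$3)\<^sup>2) * (sin t)\<^sup>2"
    by (simp add: rot_def cmod_power2 power_mult_distrib distrib_right)
  also have "\<dots> = 1"
    using assms[unfolded norm3_eq_1] by simp
  finally show ?thesis
    by (simp add: S3q_def)
qed

lemma norm_axis_one [simp]: "norm (axis k (1::real) :: real^'n) = 1"
  by (simp add: norm_eq_1 inner_axis_axis)

lemma rot_0 [simp]: "rot u 0 = (1, 0)"
  by (simp add: rot_def complex_eq_iff)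

lemma qmult_rot_rot:
  assumes "norm u = 1"
  shows "qmult (rot u s) (rot u t) = rot u (s + t)"
proof -
  have "cos s * cos t - u$1 * sin s * (u$1 * sin t) - (u$2 * sin s * (u$2 * sin t) + u$3 * sin s * (u$3 * sin t))
      = cos s * cos t - sin s * sin t"
    using assms[unfolded norm3_eq_1] by algebra
  then show ?thesis
    by (simp add: qmult_def rot_def complex_eq_iff cos_add sin_add distrib_left)
qed

section \<open>The Haar integral as a Lebesgue integral over a spherical shell in R^4\<close>

definition toQ :: "real^4 \<Rightarrow> quat" where
  "toQ x = (Complex (x$1) (x$2), Complex (x$3) (x$4))"

definition fromQ :: "quat \<Rightarrow> real^4" where
  "fromQ g = (\<chi> i. if i = 1 then Re (fst g) else if i = 2 then Im (fst g) else if i = 3 then Re (snd g) else Im (snd g))"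

lemma fromQ_nth: "fromQ g $ 1 = Re (fst g)" "fromQ g $ 2 = Im (fst g)"
    "fromQ g $ 3 = Re (snd g)" "fromQ g $ 4 = Im (snd g)"
  by (simp_all add: fromQ_def)

lemma toQ_fromQ [simp]: "toQ (fromQ g) = g"
  by (simp add: toQ_def fromQ_nth)

lemma norm_toQ [simp]: "norm (toQ x) = norm x"
  by (simp add: norm_prod_def toQ_def norm_vec_def L2_set_def sum_4 cmod_power2 add.assoc)

lemma norm_fromQ [simp]: "norm (fromQ g) = norm g"
  by (metis norm_toQ toQ_fromQ)

lemma linear_toQ: "linear toQ"
  by (rule linearI) (simp_all add: toQ_def complex_eq_iff)

lemma linear_fromQ: "linear fromQ"
  by (rule linearI) (simp_all add: vec_eq_iff forall_4 fromQ_nth)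

lemma linear_qmult_left: "linear (\<lambda>g. qmult g h)"
  by (rule linearI) (simp_all add: qmult_def prod_eq_iff algebra_simps scaleR_conv_of_real)

definition annulus :: "(real^4) set" where "annulus = cball 0 2 - ball 0 1"

lemma compact_annulus: "compact annulus"
  by (simp add: annulus_def compact_diff)

lemma annulus_iff: "x \<in> annulus \<longleftrightarrow> 1 \<le> norm x \<and> norm x \<le> 2"
  by (auto simp: annulus_def)

definition sph :: "real^4 \<Rightarrow> quat" where "sph x = toQ (x /\<^sub>R norm x)"

lemma sph_in_S3q: "x \<noteq> 0 \<Longrightarrow> sph x \<in> S3q"
  by (simp add: sph_def S3q_norm)

text \<open>The integrand is constant along rays, so this is the Haar integral up to a positive
  factor, the volume of the shell. The shell, unlike the ball, stays away from the origin, where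
  \<open>sph\<close> is singular.\<close>

definition mean :: "(quat \<Rightarrow> real) \<Rightarrow> real" where
  "mean F = integral annulus (\<lambda>x. F (sph x))"

lemma continuous_on_sph: "continuous_on annulus sph"
  unfolding sph_def
  by (intro linear_continuous_on_compose[OF _ linear_toQ] continuous_intros) (auto simp: annulus_iff)

lemma sph_annulus: "sph ` annulus \<subseteq> S3q"
  by (auto simp: annulus_iff intro!: sph_in_S3q)

lemma continuous_on_sph_comp:
  "continuous_on S3q F \<Longrightarrow> continuous_on annulus (\<lambda>x. F (sph x))"
  by (rule continuous_on_compose2[OF _ continuous_on_sph sph_annulus])

lemma absolutely_integrable_compact:
  fixes f :: "'a::euclidean_space \<Rightarrow> 'b::euclidean_space"
  assumes "compact S" "continuous_on S f"
  shows "f absolutely_integrable_on S"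
proof -
  define g where "g = (\<lambda>x. indicator S x *\<^sub>R f x)"
  have i: "integrable lborel g"
    unfolding g_def by (rule borel_integrable_compact[OF assms])
  have "g \<in> borel_measurable lborel"
    using i by (rule borel_measurable_integrable)
  then have "integrable lebesgue g \<longleftrightarrow> integrable lborel g"
    by (rule integrable_completion)
  then show ?thesis
    using i unfolding set_integrable_def g_def by blast
qed

lemma integrable_on_compact:
  fixes f :: "'a::euclidean_space \<Rightarrow> 'b::euclidean_space"
  assumes "compact S" "continuous_on S f"
  shows "f integrable_on S"
  by (rule set_lebesgue_integral_eq_integral(1)[OF absolutely_integrable_compact[OF assms]])

lemma mean_integrable: "continuous_on S3q (F :: quat \<Rightarrow> real) \<Longrightarrow> (\<lambda>x. F (sph x)) integrable_on annulus"
  by (intro integrable_on_compact compact_annulus continuous_on_sph_comp)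

lemma mean_add: "continuous_on S3q F \<Longrightarrow> continuous_on S3q G \<Longrightarrow> mean (\<lambda>x. F x + G x) = mean F + mean G"
  unfolding mean_def by (intro integral_add mean_integrable)

lemma mean_diff: "continuous_on S3q F \<Longrightarrow> continuous_on S3q G \<Longrightarrow> mean (\<lambda>x. F x - G x) = mean F - mean G"
  unfolding mean_def by (intro integral_diff mean_integrable)

lemma mean_cmult: "mean (\<lambda>x. c * F x) = c * mean F"
  unfolding mean_def by (metis integral_mult_right)

lemma mean_cong: "(\<And>x. x \<in> S3q \<Longrightarrow> F x = G x) \<Longrightarrow> mean F = mean G"
  unfolding mean_def using sph_annulus by (intro integral_cong) blast

lemma mean_abs_le:
  assumes "continuous_on S3q F" "\<And>x. x \<in> S3q \<Longrightarrow> \<bar>F x\<bar> \<le> B"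
  shows "\<bar>mean F\<bar> \<le> B * mean (\<lambda>x. 1)"
proof -
  have "norm (integral annulus (\<lambda>x. F (sph x))) \<le> integral annulus (\<lambda>x. B)"
  proof (rule integral_norm_bound_integral)
    show "(\<lambda>x. B) integrable_on annulus"
      using mean_integrable[of "\<lambda>_. B"] by simp
    show "norm (F (sph x)) \<le> B" if "x \<in> annulus" for x
      using assms(2) sph_annulus that by (metis image_subset_iff real_norm_def)
  qed (rule mean_integrable[OF assms(1)])
  then show ?thesis
    using mean_cmult[of B "\<lambda>_. 1"] by (simp add: mean_def)
qed

text \<open>Right multiplication by a unit quaternion is an orthogonal map of R^4; it preserves the
  shell and commutes with the radial projection.\<close>

lemma mean_right_mult:
  assumes F: "continuous_on S3q F" and u: "u \<in> S3q"
  shows "mean (\<lambda>g. F (qmult g u)) = mean F"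
proof -
  define R where "R = (\<lambda>x. fromQ (qmult (toQ x) u))"
  have linR: "linear R"
    unfolding R_def using linear_compose[OF linear_compose[OF linear_toQ linear_qmult_left] linear_fromQ]
    by (simp add: o_def)
  have nR: "norm (R x) = norm x" for x
    using u by (simp add: R_def norm_qmult S3q_norm)
  have orth: "orthogonal_transformation R"
    by (simp add: orthogonal_transformation linR nR)
  have det: "\<bar>det (matrix R)\<bar> = 1"
    using orth by (metis det_orthogonal_matrix orthogonal_transformation_matrix abs_1 abs_minus)
  have im: "R ` annulus = annulus"
  proof -
    have "x \<in> R ` annulus" if "x \<in> annulus" for x
    proof -
      obtain y where "x = R y"
        using orthogonal_transformation_surj[OF orth] by blast
      then show ?thesis
        using that nR by (auto simp: annulus_iff)
    qed
    then show ?thesis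
      using nR by (auto simp: annulus_iff)
  qed
  have sphR: "sph (R x) = qmult (sph x) u" for x
    using linear_scale[OF linear_qmult_left, of "inverse (norm x)" _ u] linear_scale[OF linear_toQ]
    by (simp add: sph_def nR linear_scale[OF linear_toQ]) (simp add: R_def)
  \<comment> \<open>The linear change of variables is stated for vector-valued integrands, so the
    function is given a single component.\<close>
  define f :: "real^4 \<Rightarrow> real^1" where "f = (\<lambda>x. vec (F (sph x)))"
  have cf: "continuous_on annulus f"
    unfolding f_def vec_def by (intro continuous_on_vec_lambda continuous_on_sph_comp F)
  have "integral (R ` annulus) f = \<bar>det (matrix R)\<bar> *\<^sub>R integral annulus (f \<circ> R)"
    by (rule integral_change_of_variables_linear[OF linR])
      (simp add: im absolutely_integrable_compact[OF compact_annulus cf])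
  then have eq: "integral annulus f = integral annulus (f \<circ> R)"
    by (simp add: im det)
  have c2: "continuous_on annulus (f \<circ> R)"
    by (rule continuous_on_compose) (use cf im linear_continuous_on[OF linR[unfolded linear_conv_bounded_linear]] in auto)
  have fi: "f integrable_on annulus" "(f \<circ> R) integrable_on annulus"
    by (rule integrable_on_compact[OF compact_annulus cf], rule integrable_on_compact[OF compact_annulus c2])
  have "integral annulus (\<lambda>x. f x $ 1) = integral annulus (\<lambda>x. (f \<circ> R) x $ 1)"
    using integral_component_eq_cart[OF fi(1), of 1] integral_component_eq_cart[OF fi(2), of 1] eq by metis
  then show ?thesis
    by (simp add: mean_def f_def sphR o_def)
qed

text \<open>A positive value at \<open>g\<close> persists on a small ball of the shell around a
  point of the ray through \<open>g\<close>, and that ball already contributes a positive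
  integral.\<close>

lemma mean_pos_eq_0:
  assumes F: "continuous_on S3q F" and nn: "\<And>x. x \<in> S3q \<Longrightarrow> 0 \<le> F x" and 0: "mean F = 0" and g: "g \<in> S3q"
  shows "F g = 0"
proof (rule ccontr)
  assume "F g \<noteq> 0"
  then have pos: "F g > 0"
    using nn[OF g] by simp
  \<comment> \<open>Radius 3/2 is the middle of the shell, so balls of radius at most 1/2 about
    \<open>x0\<close> lie inside it.\<close>
  define x0 where "x0 = (3/2) *\<^sub>R fromQ g"
  have nx0: "norm x0 = 3/2"
    using g by (simp add: x0_def S3q_norm)
  have s0: "sph x0 = g"
    using g by (simp add: sph_def nx0) (simp add: x0_def)
  have x0: "x0 \<in> annulus"
    by (simp add: annulus_iff nx0)
  obtain d where d: "d > 0" "\<And>x. x \<in> annulus \<Longrightarrow> dist x x0 < d \<Longrightarrow> dist (F (sph x)) (F (sph x0)) < F g / 2"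
    using continuous_on_sph_comp[OF F] x0 pos unfolding continuous_on_iff by (meson half_gt_zero)
  define r where "r = min (d/2) (1/2)"
  have r: "r > 0" "r < d" "r \<le> 1/2"
    using d by (auto simp: r_def)
  have sub: "cball x0 r \<subseteq> annulus"
  proof
    fix x assume "x \<in> cball x0 r"
    then have "norm (x0 - x) \<le> 1/2"
      using r by (simp add: dist_norm)
    then show "x \<in> annulus"
      using norm_triangle_ineq2[of x0 x] norm_triangle_ineq2[of x x0] nx0
      by (simp add: annulus_iff norm_minus_commute)
  qed
  have low: "F g / 2 \<le> F (sph x)" if "x \<in> cball x0 r" for x
  proof -
    have "dist (F (sph x)) (F (sph x0)) < F g / 2"
      using that sub r d(2)[of x] by (auto simp: dist_commute)
    then show ?thesis
      using abs_ge_minus_self[of "F (sph x) - F g"] by (simp add: s0 dist_real_def)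
  qed
  have i2: "(\<lambda>x. F (sph x)) integrable_on cball x0 r"
    by (rule integrable_on_compact[OF compact_cball continuous_on_subset[OF continuous_on_sph_comp[OF F] sub]])
  have ci: "(\<lambda>x. F g / 2) integrable_on cball x0 r"
    by (simp add: integrable_on_const)
  have "integral (cball x0 r) (\<lambda>x. F g / 2) \<le> integral (cball x0 r) (\<lambda>x. F (sph x))"
    by (rule integral_le[OF ci i2]) (use low in auto)
  also have "\<dots> \<le> integral annulus (\<lambda>x. F (sph x))"
    by (rule integral_subset_le[OF sub i2 mean_integrable[OF F]]) (use nn sph_annulus in blast)
  finally have "integral (cball x0 r) (\<lambda>x. F g / 2) \<le> 0"
    using 0 by (simp add: mean_def)
  moreover have "integral (cball x0 r) (\<lambda>x. F g / 2) = F g / 2 * measure lebesgue (cball x0 r)"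
    using lmeasure_integral[OF lmeasurable_cball[of x0 r]] integral_mult_right[of "cball x0 r" "F g / 2" "\<lambda>_. 1"]
    by simp
  moreover have "measure lebesgue (cball x0 r) > 0"
    using content_cball_pos[OF r(1), of x0] by (simp del: zero_less_measure_iff)
  ultimately have "F g / 2 * measure lebesgue (cball x0 r) \<le> 0" "0 < F g / 2 * measure lebesgue (cball x0 r)"
    using pos by (simp_all only: mult_pos_pos half_gt_zero)
  then show False
    by linarith
qed

section \<open>Left-invariant derivatives\<close>

text \<open>Derivative along the left-invariant vector field of the \<open>k\<close>-th imaginary
  unit, whose flow is right multiplication. It constrains \<open>G\<close> on \<open>S3q\<close>
  only, so formulas that use |g| = 1 may replace it.\<close>

definition flow_deriv :: "3 \<Rightarrow> (quat \<Rightarrow> 'a::real_normed_vector) \<Rightarrow> (quat \<Rightarrow> 'a) \<Rightarrow> bool" where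
  "flow_deriv k F G \<longleftrightarrow>
     (\<forall>g\<in>S3q. ((\<lambda>t. F (qmult g (rot (axis k 1) t))) has_vector_derivative G g) (at 0))"

lemma flow_derivD:
  "flow_deriv k F G \<Longrightarrow> g \<in> S3q \<Longrightarrow> ((\<lambda>t. F (qmult g (rot (axis k 1) t))) has_vector_derivative G g) (at 0)"
  by (simp add: flow_deriv_def)

lemma flow_deriv_const: "flow_deriv k (\<lambda>g. c) (\<lambda>g. 0)"
  by (simp add: flow_deriv_def)

lemma flow_deriv_add: "flow_deriv k F F' \<Longrightarrow> flow_deriv k G G' \<Longrightarrow> flow_deriv k (\<lambda>g. F g + G g) (\<lambda>g. F' g + G' g)"
  by (simp add: flow_deriv_def has_vector_derivative_add)

lemma flow_deriv_diff: "flow_deriv k F F' \<Longrightarrow> flow_deriv k G G' \<Longrightarrow> flow_deriv k (\<lambda>g. F g - G g) (\<lambda>g. F' g - G' g)"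
  by (simp add: flow_deriv_def has_vector_derivative_diff)

lemma flow_deriv_bounded_linear:
  "bounded_linear L \<Longrightarrow> flow_deriv k F F' \<Longrightarrow> flow_deriv k (\<lambda>g. L (F g)) (\<lambda>g. L (F' g))"
  unfolding flow_deriv_def using bounded_linear.has_vector_derivative by fast

lemma flow_deriv_mult:
  fixes F G :: "quat \<Rightarrow> 'a::real_normed_algebra"
  assumes "flow_deriv k F F'" "flow_deriv k G G'"
  shows "flow_deriv k (\<lambda>g. F g * G g) (\<lambda>g. F g * G' g + F' g * G g)"
  unfolding flow_deriv_def
proof
  fix g assume g: "g \<in> S3q"
  show "((\<lambda>t. F (qmult g (rot (axis k 1) t)) * G (qmult g (rot (axis k 1) t)))
      has_vector_derivative F g * G' g + F' g * G g) (at 0)"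
    using has_vector_derivative_mult[OF flow_derivD[OF assms(1) g] flow_derivD[OF assms(2) g]] by simp
qed

lemma flow_deriv_cmult:
  fixes F :: "quat \<Rightarrow> 'a::real_normed_algebra"
  shows "flow_deriv k F F' \<Longrightarrow> flow_deriv k (\<lambda>g. c * F g) (\<lambda>g. c * F' g)"
  by (rule flow_deriv_bounded_linear[OF bounded_linear_mult_right])

lemma flow_deriv_cong:
  "flow_deriv k F F' \<Longrightarrow> (\<And>g. g \<in> S3q \<Longrightarrow> F g = G g) \<Longrightarrow> (\<And>g. g \<in> S3q \<Longrightarrow> F' g = G' g) \<Longrightarrow> flow_deriv k G G'"
  by (simp add: flow_deriv_def)

lemma flow_deriv_unique:
  "flow_deriv k F G \<Longrightarrow> flow_deriv k F G' \<Longrightarrow> g \<in> S3q \<Longrightarrow> G g = G' g"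
  using vector_derivative_unique_at unfolding flow_deriv_def by blast

text \<open>The flow is restarted from the point reached at time \<open>s\<close>.\<close>

lemma flow_deriv_at:
  assumes "flow_deriv k F G" "g \<in> S3q"
  shows "((\<lambda>t. F (qmult g (rot (axis k 1) t))) has_vector_derivative G (qmult g (rot (axis k 1) s))) (at s)"
proof -
  define h where "h = qmult g (rot (axis k 1) s)"
  have "((\<lambda>t. F (qmult h (rot (axis k 1) t))) has_vector_derivative G h) (at (s - s))"
    using flow_derivD[OF assms(1), of h] assms(2) by (simp add: h_def)
  then have "((\<lambda>t. F (qmult h (rot (axis k 1) (t - s)))) has_vector_derivative G h) (at s)"
    using vector_diff_chain_at[of "\<lambda>t. t - s" 1 s "\<lambda>t. F (qmult h (rot (axis k 1) t))" "G h"]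
      has_vector_derivative_diff[OF has_vector_derivative_id has_vector_derivative_const]
    by (simp add: o_def)
  then show ?thesis
    by (simp add: h_def qmult_assoc qmult_rot_rot)
qed

text \<open>The flow consists of right translations, which preserve the mean, so every difference
  quotient has mean 0. By the mean value theorem the quotients are bounded by the supremum of |G|,
  and dominated convergence passes to the limit.\<close>

lemma mean_flow_deriv:
  fixes F G :: "quat \<Rightarrow> real"
  assumes FG: "flow_deriv k F G" and F: "continuous_on S3q F" and G: "continuous_on S3q G"
  shows "mean G = 0"
proof -
  define t where "t = (\<lambda>n. 1 / real (Suc n))"
  define \<phi> where "\<phi> = (\<lambda>n g. (F (qmult g (rot (axis k 1) (t n))) - F g) * inverse (t n))"
  have t: "t n > 0" for n
    by (simp add: t_def)
  have tlim: "t \<longlonglongrightarrow> 0"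
    unfolding t_def by (rule lim_1_over_n[THEN LIMSEQ_Suc])
  have contR: "continuous_on S3q (\<lambda>g. F (qmult g (rot (axis k 1) s)))" for s
    by (rule continuous_on_compose2[OF F])
      (use linear_continuous_on[OF linear_qmult_left[unfolded linear_conv_bounded_linear]] in auto)
  have cont\<phi>: "continuous_on S3q (\<phi> n)" for n
    unfolding \<phi>_def by (intro continuous_intros contR F)
  have mean\<phi>: "mean (\<phi> n) = 0" for n
  proof -
    have "mean (\<phi> n) = inverse (t n) * mean (\<lambda>g. F (qmult g (rot (axis k 1) (t n))) - F g)"
      unfolding mean_cmult[symmetric] by (simp add: \<phi>_def mult.commute)
    then show ?thesis
      using mean_diff[OF contR F] mean_right_mult[OF F, of "rot (axis k 1) (t n)"] by simp
  qed
  obtain B where B: "\<And>g. g \<in> S3q \<Longrightarrow> norm (G g) \<le> B"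
    using compact_imp_bounded[OF compact_continuous_image[OF G compact_S3q]]
    unfolding bounded_iff by auto
  have bound: "norm (\<phi> n g) \<le> B" if g: "g \<in> S3q" for n g
  proof -
    have "\<exists>s>0. s < t n \<and> F (qmult g (rot (axis k 1) (t n))) - F (qmult g (rot (axis k 1) 0))
        = (t n - 0) * G (qmult g (rot (axis k 1) s))"
      by (rule MVT2[OF t]) (use flow_deriv_at[OF FG g] in \<open>simp add: has_real_derivative_iff_has_vector_derivative\<close>)
    then obtain s where "F (qmult g (rot (axis k 1) (t n))) - F g = t n * G (qmult g (rot (axis k 1) s))"
      by auto
    then have "\<phi> n g = G (qmult g (rot (axis k 1) s))"
      using t[of n] by (simp add: \<phi>_def)
    then show ?thesis
      using B g by simp
  qed
  have lim: "(\<lambda>n. \<phi> n g) \<longlonglongrightarrow> G g" if g: "g \<in> S3q" for g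
  proof -
    have "((\<lambda>h. (F (qmult g (rot (axis k 1) (0 + h))) - F (qmult g (rot (axis k 1) 0))) / h) \<longlongrightarrow> G g) (at 0)"
      using flow_derivD[OF FG g] unfolding has_real_derivative_iff_has_vector_derivative[symmetric] DERIV_def .
    moreover have "filterlim t (at 0) sequentially"
      using tlim t by (auto simp: filterlim_at intro!: always_eventually) (metis less_irrefl)
    ultimately have "(\<lambda>n. (F (qmult g (rot (axis k 1) (0 + t n))) - F (qmult g (rot (axis k 1) 0))) / t n) \<longlonglongrightarrow> G g"
      by (rule filterlim_compose)
    then show ?thesis
      by (simp add: \<phi>_def divide_inverse)
  qed
  have "(\<lambda>n. integral annulus (\<lambda>x. \<phi> n (sph x))) \<longlonglongrightarrow> integral annulus (\<lambda>x. G (sph x))"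
  proof (rule dominated_convergence(2))
    show "(\<lambda>x. \<phi> n (sph x)) integrable_on annulus" for n
      by (rule mean_integrable[OF cont\<phi>])
    show "(\<lambda>x. B) integrable_on annulus"
      using mean_integrable[of "\<lambda>_. B"] by simp
    show "norm (\<phi> n (sph x)) \<le> B" if "x \<in> annulus" for n x
      using bound sph_annulus that by blast
    show "(\<lambda>n. \<phi> n (sph x)) \<longlonglongrightarrow> G (sph x)" if "x \<in> annulus" for x
      using lim sph_annulus that by blast
  qed
  then have "(\<lambda>n. 0) \<longlonglongrightarrow> mean G"
    unfolding mean_def[symmetric] mean\<phi> .
  then show ?thesis
    by (simp add: LIMSEQ_const_iff)
qed

text \<open>Integration by parts in the form that a divergence has mean 0. The equations
  \<open>B1\<close> to \<open>B3\<close> eliminate the derivatives of \<open>f\<close>, the equation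
  \<open>A\<close> turns the divergence of \<open>nu\<close> into \<open>f\<close>, and the
  commutators in \<open>comm\<close> turn the antisymmetrised second derivatives of \<open>h\<close>
  into first derivatives that cancel the terms with \<open>2 * \<mu> k * nu k\<close>. All second
  derivatives fall on \<open>h\<close>, so one derivative of \<open>f\<close> and \<open>nu\<close>
  is enough. The remaining operator on \<open>h\<close> is the Laplacian of the metric whose
  orthogonal frame has squared lengths \<open>\<mu> k\<close>.\<close>

lemma weak_laplace:
  fixes \<mu> :: "3 \<Rightarrow> real" and f h :: "quat \<Rightarrow> real" and nu F h1 :: "3 \<Rightarrow> quat \<Rightarrow> real"
    and N h2 :: "3 \<Rightarrow> 3 \<Rightarrow> quat \<Rightarrow> real"
  assumes nz: "\<And>k. \<mu> k \<noteq> 0" "c \<noteq> 0"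
    and d: "\<And>i. flow_deriv i f (F i)" "\<And>i k. flow_deriv i (nu k) (N i k)"
    and cont: "continuous_on S3q f" "\<And>i. continuous_on S3q (F i)" "\<And>i. continuous_on S3q (nu i)"
      "\<And>i k. continuous_on S3q (N i k)"
    and A: "\<And>g. g \<in> S3q \<Longrightarrow> f g = N 1 1 g + N 2 2 g + N 3 3 g"
    and B1: "\<And>g. g \<in> S3q \<Longrightarrow> \<mu> 1 * ((3*c - 2*\<mu> 1) * nu 1 g - (\<mu> 3 * N 2 3 g - \<mu> 2 * N 3 2 g)) + c * F 1 g = 0"
    and B2: "\<And>g. g \<in> S3q \<Longrightarrow> \<mu> 2 * ((3*c - 2*\<mu> 2) * nu 2 g - (\<mu> 1 * N 3 1 g - \<mu> 3 * N 1 3 g)) + c * F 2 g = 0"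
    and B3: "\<And>g. g \<in> S3q \<Longrightarrow> \<mu> 3 * ((3*c - 2*\<mu> 3) * nu 3 g - (\<mu> 2 * N 1 2 g - \<mu> 1 * N 2 1 g)) + c * F 3 g = 0"
    and h: "\<And>i. flow_deriv i h (h1 i)" "\<And>i k. flow_deriv i (h1 k) (h2 i k)"
    and conth: "continuous_on S3q h" "\<And>i. continuous_on S3q (h1 i)" "\<And>i k. continuous_on S3q (h2 i k)"
    and comm: "\<And>g. g \<in> S3q \<Longrightarrow> h2 1 2 g - h2 2 1 g = - 2 * h1 3 g"
      "\<And>g. g \<in> S3q \<Longrightarrow> h2 2 3 g - h2 3 2 g = - 2 * h1 1 g"
      "\<And>g. g \<in> S3q \<Longrightarrow> h2 3 1 g - h2 1 3 g = - 2 * h1 2 g"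
  shows "mean (\<lambda>g. f g * (h2 1 1 g / \<mu> 1 + h2 2 2 g / \<mu> 2 + h2 3 3 g / \<mu> 3) + 3 * (f g * h g)) = 0"
proof -
  \<comment> \<open>For cyclic (i, j, k) these are the components of one vector field: a gradient
    term, a transport term and a cross product of \<open>nu\<close> with the gradient of
    \<open>h\<close>. \<open>Q\<close> holds their derivatives along the \<open>i\<close>-th field,
    and the divergence is the sum of the three cyclic instances.\<close>
  define P where "P = (\<lambda>i j k g. 1 / \<mu> i * (f g * h1 i g) + 3 * (nu i g * h g)
      - 1 / c * (\<mu> j * (nu j g * h1 k g) - \<mu> k * (nu k g * h1 j g)))"
  define Q where "Q = (\<lambda>i j k g. 1 / \<mu> i * (f g * h2 i i g + F i g * h1 i g) + 3 * (nu i g * h1 i g + N i i g * h g)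
      - 1 / c * (\<mu> j * (nu j g * h2 i k g + N i j g * h1 k g) - \<mu> k * (nu k g * h2 i j g + N i k g * h1 j g)))"
  have PQ: "flow_deriv i (P i j k) (Q i j k)" for i j k
    unfolding P_def Q_def by (intro flow_deriv_add flow_deriv_diff flow_deriv_cmult flow_deriv_mult d h)
  have cP: "continuous_on S3q (P i j k)" and cQ: "continuous_on S3q (Q i j k)" for i j k
    unfolding P_def Q_def by (intro continuous_intros cont conth)+
  have 0: "mean (Q i j k) = 0" for i j k
    by (rule mean_flow_deriv[OF PQ cP cQ])
  have "mean (\<lambda>g. Q 1 2 3 g + Q 2 3 1 g + Q 3 1 2 g) = 0"
    using 0 by (simp add: mean_add continuous_on_add cQ)
  moreover have "Q 1 2 3 g + Q 2 3 1 g + Q 3 1 2 g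
      = f g * (h2 1 1 g / \<mu> 1 + h2 2 2 g / \<mu> 2 + h2 3 3 g / \<mu> 3) + 3 * (f g * h g)" if g: "g \<in> S3q" for g
  proof -
    define r where "r = 1 / c"
    have F1: "F 1 g / \<mu> 1 = (2*\<mu> 1 * nu 1 g + \<mu> 3 * N 2 3 g - \<mu> 2 * N 3 2 g) * r - 3 * nu 1 g"
      using B1[OF g] nz(1)[of 1] nz(2) by (simp add: r_def field_simps)
    have F2: "F 2 g / \<mu> 2 = (2*\<mu> 2 * nu 2 g + \<mu> 1 * N 3 1 g - \<mu> 3 * N 1 3 g) * r - 3 * nu 2 g"
      using B2[OF g] nz(1)[of 2] nz(2) by (simp add: r_def field_simps)
    have F3: "F 3 g / \<mu> 3 = (2*\<mu> 3 * nu 3 g + \<mu> 2 * N 1 2 g - \<mu> 1 * N 2 1 g) * r - 3 * nu 3 g"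
      using B3[OF g] nz(1)[of 3] nz(2) by (simp add: r_def field_simps)
    have e: "h2 1 2 g = h2 2 1 g - 2 * h1 3 g" "h2 2 3 g = h2 3 2 g - 2 * h1 1 g" "h2 3 1 g = h2 1 3 g - 2 * h1 2 g"
      using comm[OF g] by simp_all
    have "Q i j k g = f g * (h2 i i g / \<mu> i) + F i g / \<mu> i * h1 i g + 3 * (nu i g * h1 i g + N i i g * h g)
      - r * (\<mu> j * (nu j g * h2 i k g + N i j g * h1 k g) - \<mu> k * (nu k g * h2 i j g + N i k g * h1 j g))" for i j k
      unfolding Q_def r_def by (simp add: add_divide_distrib)
    then show ?thesis
      by (simp only: F1 F2 F3 e A[OF g]) (simp add: algebra_simps)
  qed
  ultimately show ?thesis
    using mean_cong[of "\<lambda>g. Q 1 2 3 g + Q 2 3 1 g + Q 3 1 2 g"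
        "\<lambda>g. f g * (h2 1 1 g / \<mu> 1 + h2 2 2 g / \<mu> 2 + h2 3 3 g / \<mu> 3) + 3 * (f g * h g)"]
    by (simp only:)
qed

section \<open>Density of matrix coefficients\<close>

text \<open>\<open>XX\<close> and \<open>YY\<close> are the two entries of the row vector (\<alpha>,
  \<beta>) times the SU(2) matrix of \<open>g\<close>. Thus \<open>MM\<close> is a matrix
  coefficient of the symmetric power of degree p + q, of weight p - q under right multiplication by
  the diagonal torus.\<close>

definition XX :: "complex \<Rightarrow> complex \<Rightarrow> quat \<Rightarrow> complex" where
  "XX \<alpha> \<beta> g = \<alpha> * fst g + \<beta> * snd g"

definition YY :: "complex \<Rightarrow> complex \<Rightarrow> quat \<Rightarrow> complex" where
  "YY \<alpha> \<beta> g = \<beta> * cnj (fst g) - \<alpha> * cnj (snd g)"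

definition MM :: "complex \<Rightarrow> complex \<Rightarrow> nat \<Rightarrow> nat \<Rightarrow> quat \<Rightarrow> complex" where
  "MM \<alpha> \<beta> p q g = XX \<alpha> \<beta> g ^ p * YY \<alpha> \<beta> g ^ q"

lemma S3q_cnj: "g \<in> S3q \<Longrightarrow> fst g * cnj (fst g) + snd g * cnj (snd g) = 1"
  by (simp add: S3q_sq complex_eq_iff power2_eq_square)

text \<open>The matrix with rows (\<alpha>, \<beta>) and (\<gamma>, \<delta>) is multiplied by
  \<open>g\<close>, which has determinant 1.\<close>

lemma XX_YY_wronskian:
  assumes "g \<in> S3q"
  shows "XX \<alpha> \<beta> g * YY \<gamma> \<delta> g - XX \<gamma> \<delta> g * YY \<alpha> \<beta> g = \<alpha> * \<delta> - \<beta> * \<gamma>"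
proof -
  have "XX \<alpha> \<beta> g * YY \<gamma> \<delta> g - XX \<gamma> \<delta> g * YY \<alpha> \<beta> g
      = (\<alpha> * \<delta> - \<beta> * \<gamma>) * (fst g * cnj (fst g) + snd g * cnj (snd g))"
    by (simp add: XX_def YY_def algebra_simps)
  then show ?thesis
    by (simp only: S3q_cnj[OF assms] mult_1_right)
qed

text \<open>The complex span of the \<open>MM\<close>, with functions compared on \<open>S3q\<close>
  alone because the reductions below use |g| = 1.\<close>

inductive_set peter_weyl :: "(quat \<Rightarrow> complex) set" where
  base: "(\<And>g. g \<in> S3q \<Longrightarrow> h g = MM \<alpha> \<beta> p q g) \<Longrightarrow> h \<in> peter_weyl"
| add: "h1 \<in> peter_weyl \<Longrightarrow> h2 \<in> peter_weyl \<Longrightarrow> (\<And>g. g \<in> S3q \<Longrightarrow> h g = h1 g + h2 g) \<Longrightarrow> h \<in> peter_weyl"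
| scale: "h1 \<in> peter_weyl \<Longrightarrow> (\<And>g. g \<in> S3q \<Longrightarrow> h g = c * h1 g) \<Longrightarrow> h \<in> peter_weyl"

lemma peter_weyl_0: "(\<lambda>g. 0) \<in> peter_weyl"
  by (rule peter_weyl.scale[where c = 0, OF peter_weyl.base[where p = 0 and q = 0]]) simp_all

lemma peter_weyl_sum:
  "finite I \<Longrightarrow> (\<And>i. i \<in> I \<Longrightarrow> h i \<in> peter_weyl) \<Longrightarrow> (\<lambda>g. \<Sum>i\<in>I. h i g) \<in> peter_weyl"
proof (induction I rule: finite_induct)
  case empty
  then show ?case by (simp add: peter_weyl_0)
next
  case (insert x F)
  show ?case
    by (rule peter_weyl.add[where ?h1.0 = "h x" and ?h2.0 = "\<lambda>g. \<Sum>i\<in>F. h i g"]) (use insert in auto)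
qed

text \<open>Combining the values at \<open>s\<close> and \<open>2 s\<close> eliminates the leading coefficient.\<close>

lemma peter_weyl_coeff:
  assumes "\<And>s::real. (\<lambda>g. \<Sum>j\<le>n. c j g * of_real s ^ j) \<in> peter_weyl" "j \<le> n"
  shows "c j \<in> peter_weyl"
  using assms
proof (induction n arbitrary: c j)
  case 0
  show ?case
    by (rule peter_weyl.scale[where c = 1, OF "0.prems"(1)[of 0]]) (use "0.prems"(2) in simp)
next
  case (Suc n)
  define d where "d = (\<lambda>j. (2::complex) ^ j - 2 ^ Suc n)"
  have dnz: "d i \<noteq> 0" if "i \<le> n" for i
  proof -
    have "(2::real) ^ i < 2 ^ Suc n"
      using that by (intro power_strict_increasing) auto
    then have "complex_of_real (2 ^ i) \<noteq> of_real (2 ^ Suc n)"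
      unfolding of_real_eq_iff by simp
    then show ?thesis
      by (simp add: d_def)
  qed
  have low: "c i \<in> peter_weyl" if i: "i \<le> n" for i
  proof -
    have "(\<lambda>g. \<Sum>j\<le>n. d j * c j g * of_real s ^ j) \<in> peter_weyl" for s :: real
    proof (rule peter_weyl.add[OF Suc.prems(1)[of "2 * s"]
          peter_weyl.scale[where c = "- (2 ^ Suc n)" and h = "\<lambda>g. - (2 ^ Suc n) * (\<Sum>j\<le>Suc n. c j g * of_real s ^ j)", OF Suc.prems(1)[of s]]])
      fix g
      show "(\<Sum>j\<le>n. d j * c j g * of_real s ^ j)
          = (\<Sum>j\<le>Suc n. c j g * of_real (2 * s) ^ j) + - (2 ^ Suc n) * (\<Sum>j\<le>Suc n. c j g * of_real s ^ j)"
        by (simp add: d_def sum_distrib_left sum.distrib[symmetric] power_mult_distrib algebra_simps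
            flip: sum_negf sum_subtractf)
    qed simp
    then have "(\<lambda>g. d i * c i g) \<in> peter_weyl"
      by (rule Suc.IH[where c = "\<lambda>j g. d j * c j g"]) (use i in auto)
    then show ?thesis
      by (rule peter_weyl.scale[where c = "1 / d i"]) (use dnz[OF i] in simp)
  qed
  have "c (Suc n) \<in> peter_weyl"
  proof (rule peter_weyl.add[OF Suc.prems(1)[of 1] peter_weyl.scale[where c = "- 1" and h = "\<lambda>g. (-1) * (\<Sum>j\<le>n. c j g)"]])
    show "(\<lambda>g. \<Sum>j\<le>n. c j g) \<in> peter_weyl"
      by (rule peter_weyl_sum) (use low in auto)
  qed simp_all
  then show ?case
    using low Suc.prems(2) le_Suc_eq by blast
qed

text \<open>This is the derivative of \<open>MM\<close> with respect to (\<alpha>, \<beta>) in the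
  direction (\<gamma>, \<delta>). It is the coefficient of s in a polynomial in s whose values,
  \<open>MM\<close> at (\<alpha> + s \<gamma>, \<beta> + s \<delta>), all belong to the
  span.\<close>

lemma peter_weyl_deriv:
  "(\<lambda>g. of_nat p * XX \<gamma> \<delta> g * XX \<alpha> \<beta> g ^ (p - 1) * YY \<alpha> \<beta> g ^ q
      + of_nat q * YY \<gamma> \<delta> g * XX \<alpha> \<beta> g ^ p * YY \<alpha> \<beta> g ^ (q - 1)) \<in> peter_weyl" (is "?h \<in> _")
proof (cases "p + q = 0")
  case True
  then show ?thesis by (simp add: peter_weyl_0)
next
  case False
  define P where "P = (\<lambda>g. [:XX \<alpha> \<beta> g, XX \<gamma> \<delta> g:] ^ p * [:YY \<alpha> \<beta> g, YY \<gamma> \<delta> g:] ^ q)"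
  have deg: "degree (P g) \<le> p + q" for g
  proof -
    have "degree ([:a, b:] ^ m) \<le> m" for a b :: complex and m
      using degree_power_le[of "[:a, b:]" m] by (simp split: if_splits)
    then show ?thesis
      unfolding P_def by (meson degree_mult_le add_mono order_trans)
  qed
  have "(\<lambda>g. \<Sum>j\<le>p + q. poly.coeff (P g) j * of_real s ^ j) \<in> peter_weyl" for s :: real
  proof (rule peter_weyl.base[where \<alpha> = "\<alpha> + of_real s * \<gamma>" and \<beta> = "\<beta> + of_real s * \<delta>" and p = p and q = q])
    fix g
    have "(\<Sum>j\<le>p + q. poly.coeff (P g) j * of_real s ^ j) = poly (\<Sum>j\<le>p + q. monom (poly.coeff (P g) j) j) (of_real s)"
      by (simp add: poly_sum poly_monom)
    also have "\<dots> = poly (P g) (of_real s)"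
      by (simp only: poly_as_sum_of_monoms'[OF deg])
    also have "\<dots> = MM (\<alpha> + of_real s * \<gamma>) (\<beta> + of_real s * \<delta>) p q g"
      by (simp add: P_def MM_def XX_def YY_def algebra_simps)
    finally show "(\<Sum>j\<le>p + q. poly.coeff (P g) j * of_real s ^ j) = MM (\<alpha> + of_real s * \<gamma>) (\<beta> + of_real s * \<delta>) p q g" .
  qed
  then have "(\<lambda>g. poly.coeff (P g) 1) \<in> peter_weyl"
    by (rule peter_weyl_coeff[where c = "\<lambda>j g. poly.coeff (P g) j"]) (use False in linarith)
  moreover have "poly.coeff (P g) 1 = ?h g" for g
  proof -
    have "poly.coeff (P g) 1 = poly (pderiv (P g)) 0"
      by (simp add: poly_0_coeff_0 coeff_pderiv)
    also have "\<dots> = ?h g"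
      by (simp add: P_def pderiv_mult pderiv_power pderiv_pCons algebra_simps)
    finally show ?thesis .
  qed
  ultimately show ?thesis
    by (simp cong: if_cong)
qed

text \<open>An explicit Clebsch-Gordan rule. Write X, Y for (\<alpha>, \<beta>) and X', Y' for
  (\<gamma>, \<delta>). The derivative of X^(p+1) Y^q contains X' X^p Y^q and Y' X^(p+1) Y^(q-1);
  the Wronskian replaces X Y' by X' Y plus a constant, so that the total is p + q + 1 times the
  wanted product plus a multiple of X^p Y^(q-1). For q = 0 the factor q kills the truncated
  exponent.\<close>

lemma peter_weyl_mult_XX: "(\<lambda>g. XX \<gamma> \<delta> g * MM \<alpha> \<beta> p q g) \<in> peter_weyl"
proof -
  let ?h1 = "\<lambda>g. of_nat (Suc p) * XX \<gamma> \<delta> g * XX \<alpha> \<beta> g ^ (Suc p - 1) * YY \<alpha> \<beta> g ^ q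
      + of_nat q * YY \<gamma> \<delta> g * XX \<alpha> \<beta> g ^ Suc p * YY \<alpha> \<beta> g ^ (q - 1)"
  let ?h2 = "\<lambda>g. - of_nat q * (\<alpha> * \<delta> - \<beta> * \<gamma>) * MM \<alpha> \<beta> p (q - 1) g"
  have 2: "?h2 \<in> peter_weyl"
    by (rule peter_weyl.scale[where c = "- of_nat q * (\<alpha> * \<delta> - \<beta> * \<gamma>)" and ?h1.0 = "MM \<alpha> \<beta> p (q - 1)", OF peter_weyl.base]) (rule refl)+
  have "(\<lambda>g. ?h1 g + ?h2 g) \<in> peter_weyl"
    by (rule peter_weyl.add[OF peter_weyl_deriv[of "Suc p" \<gamma> \<delta> \<alpha> \<beta> q] 2]) (rule refl)
  then show ?thesis
  proof (rule peter_weyl.scale[where c = "1 / of_nat (Suc p + q)"])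
    fix g assume g: "g \<in> S3q"
    have "of_nat (Suc p + q) * (XX \<gamma> \<delta> g * MM \<alpha> \<beta> p q g) = ?h1 g + ?h2 g"
    proof (cases q)
      case 0
      then show ?thesis by (simp add: MM_def)
    next
      case (Suc r)
      have "?h1 g + ?h2 g = of_nat (Suc p) * XX \<gamma> \<delta> g * MM \<alpha> \<beta> p q g
        + of_nat q * MM \<alpha> \<beta> p r g * (XX \<alpha> \<beta> g * YY \<gamma> \<delta> g - (\<alpha> * \<delta> - \<beta> * \<gamma>))"
        by (simp add: Suc MM_def algebra_simps)
      also have "XX \<alpha> \<beta> g * YY \<gamma> \<delta> g - (\<alpha> * \<delta> - \<beta> * \<gamma>) = XX \<gamma> \<delta> g * YY \<alpha> \<beta> g"
        using XX_YY_wronskian[OF g, of \<alpha> \<beta> \<gamma> \<delta>] by (simp add: algebra_simps)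
      finally show ?thesis
        by (simp add: Suc MM_def algebra_simps)
    qed
    moreover have "of_nat (Suc p + q) \<noteq> (0::complex)"
      unfolding of_nat_eq_0_iff by simp
    ultimately show "XX \<gamma> \<delta> g * MM \<alpha> \<beta> p q g = 1 / of_nat (Suc p + q) * (?h1 g + ?h2 g)"
      by (metis nonzero_mult_div_cancel_left times_divide_eq_left mult_1)
  qed
qed

lemma peter_weyl_mult_YY: "(\<lambda>g. YY \<gamma> \<delta> g * MM \<alpha> \<beta> p q g) \<in> peter_weyl"
proof -
  let ?h1 = "\<lambda>g. of_nat p * XX \<gamma> \<delta> g * XX \<alpha> \<beta> g ^ (p - 1) * YY \<alpha> \<beta> g ^ Suc q
      + of_nat (Suc q) * YY \<gamma> \<delta> g * XX \<alpha> \<beta> g ^ p * YY \<alpha> \<beta> g ^ (Suc q - 1)"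
  let ?h2 = "\<lambda>g. of_nat p * (\<alpha> * \<delta> - \<beta> * \<gamma>) * MM \<alpha> \<beta> (p - 1) q g"
  have 2: "?h2 \<in> peter_weyl"
    by (rule peter_weyl.scale[where c = "of_nat p * (\<alpha> * \<delta> - \<beta> * \<gamma>)" and ?h1.0 = "MM \<alpha> \<beta> (p - 1) q", OF peter_weyl.base]) (rule refl)+
  have "(\<lambda>g. ?h1 g + ?h2 g) \<in> peter_weyl"
    by (rule peter_weyl.add[OF peter_weyl_deriv[of p \<gamma> \<delta> \<alpha> \<beta> "Suc q"] 2]) (rule refl)
  then show ?thesis
  proof (rule peter_weyl.scale[where c = "1 / of_nat (p + Suc q)"])
    fix g assume g: "g \<in> S3q"
    have "of_nat (p + Suc q) * (YY \<gamma> \<delta> g * MM \<alpha> \<beta> p q g) = ?h1 g + ?h2 g"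
    proof (cases p)
      case 0
      then show ?thesis by (simp add: MM_def)
    next
      case (Suc r)
      have "?h1 g + ?h2 g = of_nat (Suc q) * YY \<gamma> \<delta> g * MM \<alpha> \<beta> p q g
        + of_nat p * MM \<alpha> \<beta> r q g * (XX \<gamma> \<delta> g * YY \<alpha> \<beta> g + (\<alpha> * \<delta> - \<beta> * \<gamma>))"
        by (simp add: Suc MM_def algebra_simps)
      also have "XX \<gamma> \<delta> g * YY \<alpha> \<beta> g + (\<alpha> * \<delta> - \<beta> * \<gamma>) = XX \<alpha> \<beta> g * YY \<gamma> \<delta> g"
        using XX_YY_wronskian[OF g, of \<alpha> \<beta> \<gamma> \<delta>] by (simp add: algebra_simps)
      finally show ?thesis
        by (simp add: Suc MM_def algebra_simps)
    qed
    moreover have "of_nat (p + Suc q) \<noteq> (0::complex)"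
      unfolding of_nat_eq_0_iff by simp
    ultimately show "YY \<gamma> \<delta> g * MM \<alpha> \<beta> p q g = 1 / of_nat (p + Suc q) * (?h1 g + ?h2 g)"
      by (metis nonzero_mult_div_cancel_left times_divide_eq_left mult_1)
  qed
qed

lemma peter_weyl_closed:
  assumes m: "\<And>\<alpha> \<beta> p q. (\<lambda>g. m g * MM \<alpha> \<beta> p q g) \<in> peter_weyl" and "h \<in> peter_weyl"
  shows "(\<lambda>g. m g * h g) \<in> peter_weyl"
  using assms(2)
proof induction
  case (base h \<alpha> \<beta> p q)
  show ?case
    by (rule peter_weyl.scale[where c = 1, OF m[of \<alpha> \<beta> p q]]) (simp add: base)
next
  case (add h1 h2 h)
  show ?case
    by (rule peter_weyl.add[OF add.IH]) (simp add: add distrib_left)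
next
  case (scale h1 h c)
  show ?case
    by (rule peter_weyl.scale[where c = c, OF scale.IH]) (simp add: scale)
qed

lemma peter_weyl_real_polynomial:
  assumes "real_polynomial_function f" "h \<in> peter_weyl"
  shows "(\<lambda>g. of_real (f g) * h g) \<in> peter_weyl"
  using assms
proof (induction arbitrary: h)
  case (linear f)
  have f: "f g = Re (fst g) * f (1, 0) + Im (fst g) * f (\<i>, 0) + Re (snd g) * f (0, 1) + Im (snd g) * f (0, \<i>)" for g
  proof -
    interpret f: bounded_linear f by fact
    have "g = Re (fst g) *\<^sub>R (1, 0) + Im (fst g) *\<^sub>R (\<i>, 0) + Re (snd g) *\<^sub>R (0, 1) + Im (snd g) *\<^sub>R (0, \<i>)"
      by (simp add: prod_eq_iff complex_eq_iff)
    then have "f g = f (Re (fst g) *\<^sub>R (1, 0) + Im (fst g) *\<^sub>R (\<i>, 0) + Re (snd g) *\<^sub>R (0, 1) + Im (snd g) *\<^sub>R (0, \<i>))"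
      by simp
    then show ?thesis
      by (simp only: f.add f.scaleR real_scaleR_def)
  qed
  \<comment> \<open>Obtained from Re c = (c + cnj c)/2 and Im c = (c - cnj c)/(2\<i>); the sign in
    \<open>z\<close> compensates the minus sign in \<open>YY\<close>.\<close>
  define u v w z where "u = (complex_of_real (f (1, 0)) - \<i> * f (\<i>, 0)) / 2" and "v = (f (0, 1) - \<i> * f (0, \<i>)) / 2"
    and "w = (f (1, 0) + \<i> * f (\<i>, 0)) / 2" and "z = - (f (0, 1) + \<i> * f (0, \<i>)) / 2"
  have eq: "of_real (f g) = XX u v g + YY z w g" for g
    by (subst f) (simp add: XX_def YY_def u_def v_def w_def z_def complex_eq_iff field_simps)
  show ?case
    by (rule peter_weyl.add[OF peter_weyl_closed[OF peter_weyl_mult_XX[of u v] \<open>h \<in> peter_weyl\<close>]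
          peter_weyl_closed[OF peter_weyl_mult_YY[of z w] \<open>h \<in> peter_weyl\<close>]])
      (simp add: eq distrib_right)
next
  case (const c)
  show ?case
    by (rule peter_weyl.scale[where c = "of_real c", OF const]) simp
next
  case (add f1 f2)
  show ?case
    by (rule peter_weyl.add[OF add.IH(1)[OF add.prems] add.IH(2)[OF add.prems]]) (simp add: distrib_right)
next
  case (mult f1 f2)
  show ?case
    by (rule peter_weyl.scale[where c = 1, OF mult.IH(1)[OF mult.IH(2)[OF mult.prems]]]) simp
qed

lemma continuous_on_MM [continuous_intros]: "continuous_on S (MM \<alpha> \<beta> p q)"
  unfolding MM_def XX_def YY_def by (intro continuous_intros)

text \<open>Completeness: orthogonality to the \<open>MM\<close> extends to all polynomials, since
  the span is closed under multiplication by coordinates. Approximating \<open>f\<close> uniformly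
  by a polynomial h gives mean (f f) = mean (f (f - h)), which is arbitrarily small.\<close>

lemma mean_eq_0_imp_eq_0:
  fixes f :: "quat \<Rightarrow> real"
  assumes f: "continuous_on S3q f"
    and 0: "\<And>\<alpha> \<beta> p q. mean (\<lambda>g. f g * Re (MM \<alpha> \<beta> p q g)) = 0 \<and> mean (\<lambda>g. f g * Im (MM \<alpha> \<beta> p q g)) = 0"
    and g: "g \<in> S3q"
  shows "f g = 0"
proof -
  have pw: "continuous_on S3q h \<and> mean (\<lambda>g. f g * Re (h g)) = 0 \<and> mean (\<lambda>g. f g * Im (h g)) = 0"
    if "h \<in> peter_weyl" for h
    using that
  proof induction
    case (base h \<alpha> \<beta> p q)
    have "continuous_on S3q h"
      using continuous_on_cong[OF refl base] continuous_on_MM by fast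
    moreover have "mean (\<lambda>g. f g * Re (h g)) = mean (\<lambda>g. f g * Re (MM \<alpha> \<beta> p q g))"
      "mean (\<lambda>g. f g * Im (h g)) = mean (\<lambda>g. f g * Im (MM \<alpha> \<beta> p q g))"
      by (rule mean_cong, simp add: base)+
    ultimately show ?case
      using 0 by simp
  next
    case (add h1 h2 h)
    then have c: "continuous_on S3q h1" "continuous_on S3q h2" by auto
    have "continuous_on S3q h"
      using continuous_on_cong[OF refl add.hyps(3), of S3q] continuous_on_add[OF c] by fast
    moreover have "mean (\<lambda>g. f g * Re (h g)) = mean (\<lambda>g. f g * Re (h1 g) + f g * Re (h2 g))"
      "mean (\<lambda>g. f g * Im (h g)) = mean (\<lambda>g. f g * Im (h1 g) + f g * Im (h2 g))"
      by (rule mean_cong, simp add: add.hyps(3) distrib_left)+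
    ultimately show ?case
      using add.IH by (simp add: mean_add continuous_intros c f)
  next
    case (scale h1 h c)
    then have c: "continuous_on S3q h1" by auto
    have "continuous_on S3q h"
      using continuous_on_cong[OF refl scale.hyps(2), of S3q] continuous_on_mult_left[OF c] by fast
    moreover have "mean (\<lambda>g. f g * Re (h g)) = mean (\<lambda>g. Re c * (f g * Re (h1 g)) - Im c * (f g * Im (h1 g)))"
      "mean (\<lambda>g. f g * Im (h g)) = mean (\<lambda>g. Re c * (f g * Im (h1 g)) + Im c * (f g * Re (h1 g)))"
      by (rule mean_cong, simp add: scale.hyps(2) algebra_simps)+
    ultimately show ?case
      using scale.IH by (simp add: mean_add mean_diff mean_cmult continuous_intros c f)
  qed
  have poly: "mean (\<lambda>g. f g * h g) = 0" if "real_polynomial_function h" for h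
  proof -
    have "(\<lambda>g. of_real (h g) * MM 0 0 0 0 g) \<in> peter_weyl"
      by (rule peter_weyl_real_polynomial[OF that peter_weyl.base]) simp
    then have "mean (\<lambda>g. f g * Re (of_real (h g) * MM 0 0 0 0 g)) = 0"
      using pw by blast
    then show ?thesis
      by (simp add: MM_def)
  qed
  obtain B where B: "\<And>g. g \<in> S3q \<Longrightarrow> \<bar>f g\<bar> \<le> B"
    using compact_imp_bounded[OF compact_continuous_image[OF f compact_S3q]]
    unfolding bounded_iff by auto
  have B0: "0 \<le> B"
    using B[OF g] by linarith
  have one: "0 \<le> mean (\<lambda>x. 1)"
    using mean_abs_le[of "\<lambda>_. 0" 0] mean_abs_le[of "\<lambda>_. 1" 1] by simp
  have small: "\<bar>mean (\<lambda>g. f g * f g)\<bar> \<le> e * (B * mean (\<lambda>x. 1))" if "e > 0" for e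
  proof -
    obtain h where h: "real_polynomial_function h" "\<And>x. x \<in> S3q \<Longrightarrow> \<bar>f x - h x\<bar> < e"
      by (rule Stone_Weierstrass_real_polynomial_function[OF compact_S3q f \<open>e > 0\<close>]) blast
    have ch: "continuous_on S3q h"
      by (rule continuous_on_polymonial_function) (use h(1) in \<open>simp add: real_polynomial_function_eq\<close>)
    have "mean (\<lambda>g. f g * f g) = mean (\<lambda>g. f g * h g + f g * (f g - h g))"
      by (rule mean_cong) (simp add: algebra_simps)
    also have "\<dots> = mean (\<lambda>g. f g * (f g - h g))"
      by (subst mean_add) (auto intro!: continuous_intros f ch simp: poly[OF h(1)])
    also have "\<bar>\<dots>\<bar> \<le> (B * e) * mean (\<lambda>x. 1)"
    proof (rule mean_abs_le)
      show "continuous_on S3q (\<lambda>g. f g * (f g - h g))"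
        by (intro continuous_intros f ch)
      show "\<bar>f x * (f x - h x)\<bar> \<le> B * e" if "x \<in> S3q" for x
        unfolding abs_mult by (rule mult_mono[OF B[OF that] less_imp_le[OF h(2)[OF that]] B0 abs_ge_zero])
    qed
    finally show ?thesis
      by (simp add: mult_ac)
  qed
  have "mean (\<lambda>g. f g * f g) = 0"
  proof (rule ccontr)
    assume nz: "mean (\<lambda>g. f g * f g) \<noteq> 0"
    define K where "K = B * mean (\<lambda>x. 1)"
    have "K \<ge> 0"
      using B0 one by (simp add: K_def)
    \<comment> \<open>\<open>K + 1\<close> keeps the denominator positive when \<open>K\<close> is
      0, and the choice makes the bound at most half of the value it is compared with.\<close>
    define e where "e = \<bar>mean (\<lambda>g. f g * f g)\<bar> / (2 * (K + 1))"
    have "e > 0"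
      using nz \<open>K \<ge> 0\<close> by (simp add: e_def)
    have "e * K \<le> e * (K + 1)"
      using \<open>e > 0\<close> by simp
    also have "e * (K + 1) = \<bar>mean (\<lambda>g. f g * f g)\<bar> / 2"
      using \<open>K \<ge> 0\<close> by (simp add: e_def field_simps)
    also have "\<dots> < \<bar>mean (\<lambda>g. f g * f g)\<bar>"
      using nz by simp
    finally show False
      using small[OF \<open>e > 0\<close>] by (simp add: K_def)
  qed
  then have "f g * f g = 0"
    using mean_pos_eq_0[of "\<lambda>g. f g * f g" g] continuous_on_mult[OF f f] g by simp
  then show ?thesis
    by simp
qed

section \<open>Left-invariant derivatives of the matrix coefficients\<close>

lemma flow_deriv_power:
  fixes F :: "quat \<Rightarrow> complex"
  assumes "flow_deriv k F F'"
  shows "flow_deriv k (\<lambda>g. F g ^ n) (\<lambda>g. of_nat n * F g ^ (n - 1) * F' g)"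
proof (induction n)
  case 0
  then show ?case by (simp add: flow_deriv_const)
next
  case (Suc n)
  have "F g * (of_nat n * F g ^ (n - 1) * F' g) + F' g * F g ^ n = of_nat (Suc n) * F g ^ (Suc n - 1) * F' g" for g
    by (cases n) (simp_all add: algebra_simps)
  then show ?case
    using flow_deriv_mult[OF assms Suc] by simp
qed

text \<open>Together with \<open>flow_snd\<close>: the components of \<open>g\<close> multiplied on
  the right by (\<i>, 0), (0, 1) and (0, \<i>), the velocities of the three flows.\<close>

definition flow_fst :: "3 \<Rightarrow> quat \<Rightarrow> complex" where
  "flow_fst k g = (if k = 1 then \<i> * fst g else if k = 2 then - cnj (snd g) else - \<i> * cnj (snd g))"

definition flow_snd :: "3 \<Rightarrow> quat \<Rightarrow> complex" where
  "flow_snd k g = (if k = 1 then \<i> * snd g else if k = 2 then cnj (fst g) else \<i> * cnj (fst g))"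

lemma has_vector_derivative_Complex:
  "(x has_vector_derivative x') (at t) \<Longrightarrow> (y has_vector_derivative y') (at t) \<Longrightarrow>
    ((\<lambda>t. Complex (x t) (y t)) has_vector_derivative Complex x' y') (at t)"
  unfolding Complex_eq
  by (intro has_vector_derivative_add has_vector_derivative_mult_right bounded_linear.has_vector_derivative[OF bounded_linear_of_real])

lemma has_vector_derivative_rot:
  "((\<lambda>t. fst (rot u t)) has_vector_derivative Complex 0 (u$1)) (at 0)"
  "((\<lambda>t. snd (rot u t)) has_vector_derivative Complex (u$2) (u$3)) (at 0)"
proof -
  have s: "((\<lambda>t. c * sin t) has_vector_derivative c) (at 0)" for c :: real
    unfolding has_real_derivative_iff_has_vector_derivative[symmetric]
    by (auto intro!: derivative_eq_intros)
  have c: "(cos has_vector_derivative 0) (at (0::real))"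
    unfolding has_real_derivative_iff_has_vector_derivative[symmetric]
    by (auto intro!: derivative_eq_intros)
  show "((\<lambda>t. fst (rot u t)) has_vector_derivative Complex 0 (u$1)) (at 0)"
    "((\<lambda>t. snd (rot u t)) has_vector_derivative Complex (u$2) (u$3)) (at 0)"
    unfolding rot_def fst_conv snd_conv by (intro has_vector_derivative_Complex s c)+
qed

lemma axis3: "axis (1::3) (1::real) $ 1 = 1" "axis (1::3) (1::real) $ 2 = 0" "axis (1::3) (1::real) $ 3 = 0"
  "axis (2::3) (1::real) $ 1 = 0" "axis (2::3) (1::real) $ 2 = 1" "axis (2::3) (1::real) $ 3 = 0"
  "axis (3::3) (1::real) $ 1 = 0" "axis (3::3) (1::real) $ 2 = 0" "axis (3::3) (1::real) $ 3 = 1"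
  by (simp_all add: axis_def)

lemma flow_deriv_fst: "flow_deriv k fst (flow_fst k)"
  and flow_deriv_snd: "flow_deriv k snd (flow_snd k)"
proof -
  have 1: "((\<lambda>t. fst (qmult g (rot u t))) has_vector_derivative
      fst g * Complex 0 (u$1) - cnj (snd g) * Complex (u$2) (u$3)) (at 0)" for g u
    unfolding qmult_def fst_conv
    by (intro has_vector_derivative_diff has_vector_derivative_mult_right has_vector_derivative_rot)
  have 2: "((\<lambda>t. snd (qmult g (rot u t))) has_vector_derivative
      snd g * Complex 0 (u$1) + cnj (fst g) * Complex (u$2) (u$3)) (at 0)" for g u
    unfolding qmult_def snd_conv
    by (intro has_vector_derivative_add has_vector_derivative_mult_right has_vector_derivative_rot)
  have k: "k = 1 \<or> k = 2 \<or> k = 3"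
    using exhaust_3 by blast
  have e1: "fst g * Complex 0 (axis k 1 $ 1) - cnj (snd g) * Complex (axis k 1 $ 2) (axis k 1 $ 3) = flow_fst k g" for g
    using k by (auto simp: flow_fst_def axis3 complex_eq_iff)
  have e2: "snd g * Complex 0 (axis k 1 $ 1) + cnj (fst g) * Complex (axis k 1 $ 2) (axis k 1 $ 3) = flow_snd k g" for g
    using k by (auto simp: flow_snd_def axis3 complex_eq_iff)
  show "flow_deriv k fst (flow_fst k)" "flow_deriv k snd (flow_snd k)"
    unfolding flow_deriv_def using 1[of _ "axis k 1"] 2[of _ "axis k 1"] by (simp_all add: e1 e2)
qed

definition dXX :: "3 \<Rightarrow> complex \<Rightarrow> complex \<Rightarrow> quat \<Rightarrow> complex" where
  "dXX k \<alpha> \<beta> g = (if k = 1 then \<i> * XX \<alpha> \<beta> g else if k = 2 then YY \<alpha> \<beta> g else \<i> * YY \<alpha> \<beta> g)"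

definition dYY :: "3 \<Rightarrow> complex \<Rightarrow> complex \<Rightarrow> quat \<Rightarrow> complex" where
  "dYY k \<alpha> \<beta> g = (if k = 1 then - \<i> * YY \<alpha> \<beta> g else if k = 2 then - XX \<alpha> \<beta> g else \<i> * XX \<alpha> \<beta> g)"

lemma flow_deriv_XX: "flow_deriv k (XX \<alpha> \<beta>) (dXX k \<alpha> \<beta>)"
proof (rule flow_deriv_cong)
  show "flow_deriv k (\<lambda>g. \<alpha> * fst g + \<beta> * snd g) (\<lambda>g. \<alpha> * flow_fst k g + \<beta> * flow_snd k g)"
    by (intro flow_deriv_add flow_deriv_cmult flow_deriv_fst flow_deriv_snd)
qed (simp_all add: XX_def YY_def dXX_def flow_fst_def flow_snd_def algebra_simps)

lemma flow_deriv_YY: "flow_deriv k (YY \<alpha> \<beta>) (dYY k \<alpha> \<beta>)"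
proof (rule flow_deriv_cong)
  show "flow_deriv k (\<lambda>g. \<beta> * cnj (fst g) - \<alpha> * cnj (snd g)) (\<lambda>g. \<beta> * cnj (flow_fst k g) - \<alpha> * cnj (flow_snd k g))"
    by (intro flow_deriv_diff flow_deriv_cmult flow_deriv_bounded_linear[OF bounded_linear_cnj] flow_deriv_fst flow_deriv_snd)
qed (simp_all add: XX_def YY_def dYY_def flow_fst_def flow_snd_def algebra_simps)

text \<open>The first field acts diagonally by the weight; the other two combine the raising and
  lowering operators. Truncated subtraction is harmless because each lowered exponent comes with the
  vanishing factor p or q.\<close>

definition dMM :: "3 \<Rightarrow> complex \<Rightarrow> complex \<Rightarrow> nat \<Rightarrow> nat \<Rightarrow> quat \<Rightarrow> complex" where
  "dMM k \<alpha> \<beta> p q g = (if k = 1 then \<i> * (of_nat p - of_nat q) * MM \<alpha> \<beta> p q g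
     else if k = 2 then of_nat p * MM \<alpha> \<beta> (p - 1) (Suc q) g - of_nat q * MM \<alpha> \<beta> (Suc p) (q - 1) g
     else \<i> * (of_nat p * MM \<alpha> \<beta> (p - 1) (Suc q) g + of_nat q * MM \<alpha> \<beta> (Suc p) (q - 1) g))"

text \<open>The derivative along field \<open>k\<close> is taken first and the one along field
  \<open>l\<close> second.\<close>

definition ddMM :: "3 \<Rightarrow> 3 \<Rightarrow> complex \<Rightarrow> complex \<Rightarrow> nat \<Rightarrow> nat \<Rightarrow> quat \<Rightarrow> complex" where
  "ddMM l k \<alpha> \<beta> p q g = (if k = 1 then \<i> * (of_nat p - of_nat q) * dMM l \<alpha> \<beta> p q g
     else if k = 2 then of_nat p * dMM l \<alpha> \<beta> (p - 1) (Suc q) g - of_nat q * dMM l \<alpha> \<beta> (Suc p) (q - 1) g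
     else \<i> * (of_nat p * dMM l \<alpha> \<beta> (p - 1) (Suc q) g + of_nat q * dMM l \<alpha> \<beta> (Suc p) (q - 1) g))"

lemma flow_deriv_MM: "flow_deriv k (MM \<alpha> \<beta> p q) (dMM k \<alpha> \<beta> p q)"
proof (rule flow_deriv_cong)
  let ?X = "XX \<alpha> \<beta>" and ?Y = "YY \<alpha> \<beta>"
  show "flow_deriv k (\<lambda>g. ?X g ^ p * ?Y g ^ q)
     (\<lambda>g. ?X g ^ p * (of_nat q * ?Y g ^ (q - 1) * dYY k \<alpha> \<beta> g) + of_nat p * ?X g ^ (p - 1) * dXX k \<alpha> \<beta> g * ?Y g ^ q)"
    by (intro flow_deriv_mult flow_deriv_power flow_deriv_XX flow_deriv_YY)
  fix g
  show "?X g ^ p * (of_nat q * ?Y g ^ (q - 1) * dYY k \<alpha> \<beta> g) + of_nat p * ?X g ^ (p - 1) * dXX k \<alpha> \<beta> g * ?Y g ^ q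
      = dMM k \<alpha> \<beta> p q g"
    by (cases p; cases q) (simp_all add: dMM_def MM_def dXX_def dYY_def algebra_simps)
qed (simp add: MM_def)

lemma flow_deriv_dMM: "flow_deriv l (dMM k \<alpha> \<beta> p q) (ddMM l k \<alpha> \<beta> p q)"
proof -
  have k: "k = 1 \<or> k = 2 \<or> k = 3"
    using exhaust_3 by blast
  have 1: "flow_deriv l (\<lambda>g. \<i> * (of_nat p - of_nat q) * MM \<alpha> \<beta> p q g)
     (\<lambda>g. \<i> * (of_nat p - of_nat q) * dMM l \<alpha> \<beta> p q g)"
    by (intro flow_deriv_cmult flow_deriv_MM)
  have 2: "flow_deriv l (\<lambda>g. of_nat p * MM \<alpha> \<beta> (p - 1) (Suc q) g - of_nat q * MM \<alpha> \<beta> (Suc p) (q - 1) g)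
     (\<lambda>g. of_nat p * dMM l \<alpha> \<beta> (p - 1) (Suc q) g - of_nat q * dMM l \<alpha> \<beta> (Suc p) (q - 1) g)"
    by (intro flow_deriv_diff flow_deriv_cmult flow_deriv_MM)
  have 3: "flow_deriv l (\<lambda>g. \<i> * (of_nat p * MM \<alpha> \<beta> (p - 1) (Suc q) g + of_nat q * MM \<alpha> \<beta> (Suc p) (q - 1) g))
     (\<lambda>g. \<i> * (of_nat p * dMM l \<alpha> \<beta> (p - 1) (Suc q) g + of_nat q * dMM l \<alpha> \<beta> (Suc p) (q - 1) g))"
    by (intro flow_deriv_add flow_deriv_cmult flow_deriv_MM)
  show ?thesis
    using k 1 2 3 unfolding dMM_def ddMM_def by auto
qed

text \<open>The constant is -2 because in this model of the quaternions the third unit (0, \<i>) is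
  minus the product of the first two.\<close>

lemma ddMM_comm:
  "ddMM 1 2 \<alpha> \<beta> p q g - ddMM 2 1 \<alpha> \<beta> p q g = - 2 * dMM 3 \<alpha> \<beta> p q g"
  "ddMM 2 3 \<alpha> \<beta> p q g - ddMM 3 2 \<alpha> \<beta> p q g = - 2 * dMM 1 \<alpha> \<beta> p q g"
  "ddMM 3 1 \<alpha> \<beta> p q g - ddMM 1 3 \<alpha> \<beta> p q g = - 2 * dMM 2 \<alpha> \<beta> p q g"
  by (cases p; cases q; simp add: ddMM_def dMM_def algebra_simps)+

text \<open>Only the sum of the second and third squares acts diagonally, which is what makes the
  condition \<open>\<mu> 2 = \<mu> 3\<close> useful. With n = p + q the two eigenvalues add up to
  the Casimir value -n (n + 2).\<close>

lemma ddMM_eigen: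
  "ddMM 1 1 \<alpha> \<beta> p q g = - of_real ((real p - real q)\<^sup>2) * MM \<alpha> \<beta> p q g"
  "ddMM 2 2 \<alpha> \<beta> p q g + ddMM 3 3 \<alpha> \<beta> p q g = - of_real (2 * (2 * real p * real q + real p + real q)) * MM \<alpha> \<beta> p q g"
  by (cases p; cases q; simp add: ddMM_def dMM_def algebra_simps power2_eq_square)+

lemma continuous_on_dMM: "continuous_on S (dMM k \<alpha> \<beta> p q)" and continuous_on_ddMM: "continuous_on S (ddMM l k \<alpha> \<beta> p q)"
proof -
  have k: "k = 1 \<or> k = 2 \<or> k = 3" for k :: 3
    using exhaust_3 by blast
  show 1: "continuous_on S (dMM k \<alpha> \<beta> p q)" for k p q
    using k[of k] unfolding dMM_def by (elim disjE) (simp_all add: continuous_intros)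
  show "continuous_on S (ddMM l k \<alpha> \<beta> p q)"
    using k[of k] unfolding ddMM_def by (elim disjE) (simp_all add: continuous_intros 1)
qed

text \<open>\<open>f\<close> and \<open>nu\<close> are the components of a deformation in a left-invariant frame; \<open>F i\<close> and
  \<open>N i k\<close> are the derivatives of \<open>f\<close> and \<open>nu k\<close> along the \<open>i\<close>-th field of the frame.\<close>

definition frame_system :: "(3 \<Rightarrow> real) \<Rightarrow> real \<Rightarrow> (quat \<Rightarrow> real) \<Rightarrow> (3 \<Rightarrow> quat \<Rightarrow> real) \<Rightarrow>
    (3 \<Rightarrow> quat \<Rightarrow> real) \<Rightarrow> (3 \<Rightarrow> 3 \<Rightarrow> quat \<Rightarrow> real) \<Rightarrow> bool" where
  "frame_system \<mu> c f F nu N \<longleftrightarrow>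
     (\<forall>i. flow_deriv i f (F i)) \<and> (\<forall>i k. flow_deriv i (nu k) (N i k)) \<and>
     continuous_on S3q f \<and> (\<forall>i. continuous_on S3q (F i)) \<and> (\<forall>i. continuous_on S3q (nu i)) \<and>
     (\<forall>i k. continuous_on S3q (N i k)) \<and>
     (\<forall>g\<in>S3q. f g = N 1 1 g + N 2 2 g + N 3 3 g \<and>
       \<mu> 1 * ((3*c - 2*\<mu> 1) * nu 1 g - (\<mu> 3 * N 2 3 g - \<mu> 2 * N 3 2 g)) + c * F 1 g = 0 \<and>
       \<mu> 2 * ((3*c - 2*\<mu> 2) * nu 2 g - (\<mu> 1 * N 3 1 g - \<mu> 3 * N 1 3 g)) + c * F 2 g = 0 \<and>
       \<mu> 3 * ((3*c - 2*\<mu> 3) * nu 3 g - (\<mu> 2 * N 1 2 g - \<mu> 1 * N 2 1 g)) + c * F 3 g = 0)"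

text \<open>\<open>MM\<close> is an eigenfunction of the weighted Laplacian with eigenvalue
  \<open>- ev\<close>, so the weak equation says that 3 - ev times the pairing is 0. The mean is
  real, so the complex test function enters through its real and imaginary parts.\<close>

lemma frame_system_MM:
  assumes sys: "frame_system \<mu> c f F nu N" and nz: "\<And>k. \<mu> k \<noteq> 0" "c \<noteq> 0" and \<mu>23: "\<mu> 2 = \<mu> 3"
    and L: "L = Re \<or> L = Im"
    and ev: "(real p - real q)\<^sup>2 / \<mu> 1 + 2 * (2 * real p * real q + real p + real q) / \<mu> 3 \<noteq> 3"
  shows "mean (\<lambda>g. f g * L (MM \<alpha> \<beta> p q g)) = 0"
proof -
  have bl: "bounded_linear L"
    using L bounded_linear_Re bounded_linear_Im by auto
  interpret L: bounded_linear L by fact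
  have Lr: "L (of_real r * z) = r * L z" "L (- z) = - L z" for r z
    using L by auto
  have cL: "continuous_on S3q (\<lambda>g. L (F g))" if "continuous_on S3q F" for F :: "quat \<Rightarrow> complex"
    by (rule L.continuous_on[OF that])
  define ev where "ev = (real p - real q)\<^sup>2 / \<mu> 1 + 2 * (2 * real p * real q + real p + real q) / \<mu> 3"
  let ?h = "\<lambda>g. L (MM \<alpha> \<beta> p q g)" and ?h2 = "\<lambda>l k g. L (ddMM l k \<alpha> \<beta> p q g)"
  have lap: "?h2 1 1 g / \<mu> 1 + ?h2 2 2 g / \<mu> 2 + ?h2 3 3 g / \<mu> 3 = - ev * ?h g" for g
  proof -
    have "?h2 2 2 g / \<mu> 2 + ?h2 3 3 g / \<mu> 3 = L (ddMM 2 2 \<alpha> \<beta> p q g + ddMM 3 3 \<alpha> \<beta> p q g) / \<mu> 3"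
      by (simp add: \<mu>23 L.add add_divide_distrib)
    then show ?thesis
      unfolding ddMM_eigen by (simp only: add.assoc ddMM_eigen(1) Lr mult_minus_left) (simp add: ev_def field_simps nz)
  qed
  have "mean (\<lambda>g. f g * (?h2 1 1 g / \<mu> 1 + ?h2 2 2 g / \<mu> 2 + ?h2 3 3 g / \<mu> 3) + 3 * (f g * ?h g)) = 0"
  proof (rule weak_laplace[where F = F and nu = nu and N = N and c = c and \<mu> = \<mu> and f = f and h = ?h
        and ?h1.0 = "\<lambda>k g. L (dMM k \<alpha> \<beta> p q g)" and ?h2.0 = ?h2])
    show "flow_deriv i (\<lambda>g. L (MM \<alpha> \<beta> p q g)) (\<lambda>g. L (dMM i \<alpha> \<beta> p q g))" for i
      by (rule flow_deriv_bounded_linear[OF bl flow_deriv_MM])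
    show "flow_deriv i (\<lambda>g. L (dMM k \<alpha> \<beta> p q g)) (\<lambda>g. L (ddMM i k \<alpha> \<beta> p q g))" for i k
      by (rule flow_deriv_bounded_linear[OF bl flow_deriv_dMM])
    show "continuous_on S3q (\<lambda>g. L (MM \<alpha> \<beta> p q g))" "continuous_on S3q (\<lambda>g. L (dMM k \<alpha> \<beta> p q g))"
      "continuous_on S3q (\<lambda>g. L (ddMM i k \<alpha> \<beta> p q g))" for i k
      by (intro cL continuous_on_MM continuous_on_dMM continuous_on_ddMM)+
    have m2: "L (- 2 * z) = - 2 * L z" for z
      using Lr(1)[of "- 2" z] by simp
    show "L (ddMM 1 2 \<alpha> \<beta> p q g) - L (ddMM 2 1 \<alpha> \<beta> p q g) = - 2 * L (dMM 3 \<alpha> \<beta> p q g)"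
      "L (ddMM 2 3 \<alpha> \<beta> p q g) - L (ddMM 3 2 \<alpha> \<beta> p q g) = - 2 * L (dMM 1 \<alpha> \<beta> p q g)"
      "L (ddMM 3 1 \<alpha> \<beta> p q g) - L (ddMM 1 3 \<alpha> \<beta> p q g) = - 2 * L (dMM 2 \<alpha> \<beta> p q g)" for g
      unfolding L.diff[symmetric] ddMM_comm m2 by (rule refl)+
  qed (use sys nz in \<open>auto simp: frame_system_def\<close>)
  then have "mean (\<lambda>g. (3 - ev) * (f g * ?h g)) = 0"
    unfolding lap by (simp add: algebra_simps)
  then show ?thesis
    using assms(6) by (simp only: mean_cmult) (simp add: ev_def)
qed

lemma frame_system_eq_0:
  assumes sys: "frame_system \<mu> c f F nu N" and nz: "\<And>k. \<mu> k \<noteq> 0" "c \<noteq> 0" and \<mu>23: "\<mu> 2 = \<mu> 3"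
    and special: "\<And>\<alpha> \<beta> p q. (real p - real q)\<^sup>2 / \<mu> 1 + 2 * (2 * real p * real q + real p + real q) / \<mu> 3 = 3 \<Longrightarrow>
      mean (\<lambda>g. f g * Re (MM \<alpha> \<beta> p q g)) = 0 \<and> mean (\<lambda>g. f g * Im (MM \<alpha> \<beta> p q g)) = 0"
    and g: "g \<in> S3q"
  shows "f g = 0"
proof (rule mean_eq_0_imp_eq_0[OF _ _ g])
  show "continuous_on S3q f"
    using sys unfolding frame_system_def by blast
  show "mean (\<lambda>g. f g * Re (MM \<alpha> \<beta> p q g)) = 0 \<and> mean (\<lambda>g. f g * Im (MM \<alpha> \<beta> p q g)) = 0" for \<alpha> \<beta> p q
    using special[of p q \<alpha> \<beta>] frame_system_MM[OF sys nz \<mu>23, of Re p q \<alpha> \<beta>] frame_system_MM[OF sys nz \<mu>23, of Im p q \<alpha> \<beta>]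
    by blast
qed

section \<open>The Cayley form\<close>

lemma exhaust_8: fixes x :: 8 shows "x = 0 \<or> x = 1 \<or> x = 2 \<or> x = 3 \<or> x = 4 \<or> x = 5 \<or> x = 6 \<or> x = 7"
proof (induct x)
  case (of_int z)
  then have "0 \<le> z" and "z < 8" by simp_all
  then have "z = 0 \<or> z = 1 \<or> z = 2 \<or> z = 3 \<or> z = 4 \<or> z = 5 \<or> z = 6 \<or> z = 7" by arith
  then show ?case by auto
qed
lemma UNIV_8: "UNIV = {0,1,2,3,4,5,6,7::8}" using exhaust_8 by auto
lemma forall_8: "(\<forall>i::8. P i) \<longleftrightarrow> P 0 \<and> P 1 \<and> P 2 \<and> P 3 \<and> P 4 \<and> P 5 \<and> P 6 \<and> P 7"
  by (metis exhaust_8)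
lemma sum_8: "sum f (UNIV::8 set) = f 0 + f 1 + f 2 + f 3 + f 4 + f 5 + f 6 + f 7"
  unfolding UNIV_8 by (simp add: add.assoc)
lemma mk8_nth [simp]: "mk8 a0 a1 a2 a3 a4 a5 a6 a7 $ 0 = a0" "mk8 a0 a1 a2 a3 a4 a5 a6 a7 $ 1 = a1" "mk8 a0 a1 a2 a3 a4 a5 a6 a7 $ 2 = a2"
 "mk8 a0 a1 a2 a3 a4 a5 a6 a7 $ 3 = a3" "mk8 a0 a1 a2 a3 a4 a5 a6 a7 $ 4 = a4" "mk8 a0 a1 a2 a3 a4 a5 a6 a7 $ 5 = a5" "mk8 a0 a1 a2 a3 a4 a5 a6 a7 $ 6 = a6"
 "mk8 a0 a1 a2 a3 a4 a5 a6 a7 $ 7 = a7" by (simp_all add: mk8_def)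

text \<open>The wedge product of four coordinate forms, expanded along the index \<open>i\<close>;
  thus \<open>i\<close> enters only through one coordinate of each argument, which lets a matrix row
  be summed over it in \<open>dx4_sum\<close>.\<close>

definition dx4 :: "8 \<Rightarrow> 8 \<Rightarrow> 8 \<Rightarrow> 8 \<Rightarrow> real^8 \<Rightarrow> real^8 \<Rightarrow> real^8 \<Rightarrow> real^8 \<Rightarrow> real" where
  "dx4 i j k l a b c d = a$i * dx3 j k l b c d - b$i * dx3 j k l a c d + c$i * dx3 j k l a b d - d$i * dx3 j k l a b c"

lemma det_4: "det (A::'a::comm_ring_1^4^4) = 
   A$1$1 * (A$2$2 * (A$3$3 * A$4$4 - A$3$4 * A$4$3) - A$2$3 * (A$3$2 * A$4$4 - A$3$4 * A$4$2) + A$2$4 * (A$3$2 * A$4$3 - A$3$3 * A$4$2))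
 - A$1$2 * (A$2$1 * (A$3$3 * A$4$4 - A$3$4 * A$4$3) - A$2$3 * (A$3$1 * A$4$4 - A$3$4 * A$4$1) + A$2$4 * (A$3$1 * A$4$3 - A$3$3 * A$4$1))
 + A$1$3 * (A$2$1 * (A$3$2 * A$4$4 - A$3$4 * A$4$2) - A$2$2 * (A$3$1 * A$4$4 - A$3$4 * A$4$1) + A$2$4 * (A$3$1 * A$4$2 - A$3$2 * A$4$1))
 - A$1$4 * (A$2$1 * (A$3$2 * A$4$3 - A$3$3 * A$4$2) - A$2$2 * (A$3$1 * A$4$3 - A$3$3 * A$4$1) + A$2$3 * (A$3$1 * A$4$2 - A$3$2 * A$4$1))"
proof -
  have f1: "finite {2::4, 3, 4}" "1 \<notin> {2::4, 3, 4}" by auto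
  have f2: "finite {3::4, 4}" "2 \<notin> {3::4, 4}" by auto
  have f3: "finite {4::4}" "3 \<notin> {4::4}" by auto
  show ?thesis
    unfolding det_def UNIV_4
    unfolding sum_over_permutations_insert[OF f1]
    unfolding sum_over_permutations_insert[OF f2]
    unfolding sum_over_permutations_insert[OF f3]
    unfolding permutes_sing
    by (simp add: sign_swap_id permutation_swap_id permutation_compose sign_compose sign_id swap_id_eq algebra_simps)
qed

lemma Phi0_dx4: "Phi0 a b c d = dx4 0 1 2 3 a b c d + dx4 0 1 4 5 a b c d + dx4 0 1 6 7 a b c d + dx4 0 2 4 6 a b c d - dx4 0 2 5 7 a b c d - dx4 0 3 4 7 a b c d - dx4 0 3 5 6 a b c d - dx4 1 2 4 7 a b c d - dx4 1 2 5 6 a b c d - dx4 1 3 4 6 a b c d + dx4 1 3 5 7 a b c d + dx4 2 3 4 5 a b c d + dx4 2 3 6 7 a b c d + dx4 4 5 6 7 a b c d"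
  unfolding Phi0_def det_4 half_omega_sq_def omega0_def dx4_def dx3_def det3_def dzv_def
  by (simp add: algebra_simps)

lemma Phi0_axis0: "Phi0 (axis 0 1) b c d = phi0 b c d"
  by (simp add: Phi0_dx4 dx4_def phi0_def dx3_def det3_def axis_def)

lemma sum_cofactor:
  "(\<Sum>m\<in>I. x m * (a m * A - b m * B + c m * C - d m * D))
    = (\<Sum>m\<in>I. x m * a m) * A - (\<Sum>m\<in>I. x m * b m) * B + (\<Sum>m\<in>I. x m * c m) * C - (\<Sum>m\<in>I. x m * d m) * (D::real)"
  by (simp only: right_diff_distrib distrib_left sum.distrib sum_subtractf sum_distrib_right mult.assoc)

lemma dx4_sum:
  "(\<Sum>m\<in>UNIV. X$i$m * dx4 m j k l a b c d) = (X *v a)$i * dx3 j k l b c d - (X *v b)$i * dx3 j k l a c d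
     + (X *v c)$i * dx3 j k l a b d - (X *v d)$i * dx3 j k l a b c"
  by (simp only: dx4_def sum_cofactor matrix_vector_mult_def vec_lambda_beta)

text \<open>A matrix acts on a wedge product as a derivation: each coordinate form in turn is
  replaced by the linear form given by the corresponding row of \<open>X\<close>. The replaced
  factor is moved to the front, whence the alternating signs.\<close>

lemma dx4_deriv:
  "dx4 i j k l (X *v a) b c d + dx4 i j k l a (X *v b) c d + dx4 i j k l a b (X *v c) d + dx4 i j k l a b c (X *v d)
   = (\<Sum>m\<in>UNIV. X$i$m * dx4 m j k l a b c d) - (\<Sum>m\<in>UNIV. X$j$m * dx4 m i k l a b c d)
     + (\<Sum>m\<in>UNIV. X$k$m * dx4 m i j l a b c d) - (\<Sum>m\<in>UNIV. X$l$m * dx4 m i j k a b c d)"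
  unfolding dx4_sum by (simp add: dx4_def dx3_def det3_def algebra_simps)

lemma dx4_repeat: "dx4 i i k l a b c d = 0" "dx4 i j i l a b c d = 0" "dx4 i j k i a b c d = 0"
  by (simp_all add: dx4_def dx3_def det3_def algebra_simps)

lemma dx4_move:
  "dx4 m j k l = (\<lambda>a b c d. - dx4 j m k l a b c d)"
  "dx4 m j k l = (\<lambda>a b c d. dx4 j k m l a b c d)"
  "dx4 m j k l = (\<lambda>a b c d. - dx4 j k l m a b c d)"
  unfolding fun_eq_iff by (simp_all add: dx4_def dx3_def det3_def algebra_simps)

text \<open>Instances for an increasing triple and one index out of place. They bring all terms to
  the increasing basis 4-forms, and being oriented instances they make the rewriting
  terminate.\<close>

lemmas dx4_sort =
  dx4_move(3)[of 3 0 1 2] dx4_move(3)[of 4 0 1 2] dx4_move(3)[of 5 0 1 2] dx4_move(3)[of 6 0 1 2]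
  dx4_move(3)[of 7 0 1 2] dx4_move(2)[of 2 0 1 3] dx4_move(3)[of 4 0 1 3] dx4_move(3)[of 5 0 1 3]
  dx4_move(3)[of 6 0 1 3] dx4_move(3)[of 7 0 1 3] dx4_move(2)[of 2 0 1 4] dx4_move(2)[of 3 0 1 4]
  dx4_move(3)[of 5 0 1 4] dx4_move(3)[of 6 0 1 4] dx4_move(3)[of 7 0 1 4] dx4_move(2)[of 2 0 1 5]
  dx4_move(2)[of 3 0 1 5] dx4_move(2)[of 4 0 1 5] dx4_move(3)[of 6 0 1 5] dx4_move(3)[of 7 0 1 5]
  dx4_move(2)[of 2 0 1 6] dx4_move(2)[of 3 0 1 6] dx4_move(2)[of 4 0 1 6] dx4_move(2)[of 5 0 1 6]
  dx4_move(3)[of 7 0 1 6] dx4_move(2)[of 2 0 1 7] dx4_move(2)[of 3 0 1 7] dx4_move(2)[of 4 0 1 7]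
  dx4_move(2)[of 5 0 1 7] dx4_move(2)[of 6 0 1 7] dx4_move(1)[of 1 0 2 3] dx4_move(3)[of 4 0 2 3]
  dx4_move(3)[of 5 0 2 3] dx4_move(3)[of 6 0 2 3] dx4_move(3)[of 7 0 2 3] dx4_move(1)[of 1 0 2 4]
  dx4_move(2)[of 3 0 2 4] dx4_move(3)[of 5 0 2 4] dx4_move(3)[of 6 0 2 4] dx4_move(3)[of 7 0 2 4]
  dx4_move(1)[of 1 0 2 5] dx4_move(2)[of 3 0 2 5] dx4_move(2)[of 4 0 2 5] dx4_move(3)[of 6 0 2 5]
  dx4_move(3)[of 7 0 2 5] dx4_move(1)[of 1 0 2 6] dx4_move(2)[of 3 0 2 6] dx4_move(2)[of 4 0 2 6]
  dx4_move(2)[of 5 0 2 6] dx4_move(3)[of 7 0 2 6] dx4_move(1)[of 1 0 2 7] dx4_move(2)[of 3 0 2 7]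
  dx4_move(2)[of 4 0 2 7] dx4_move(2)[of 5 0 2 7] dx4_move(2)[of 6 0 2 7] dx4_move(1)[of 1 0 3 4]
  dx4_move(1)[of 2 0 3 4] dx4_move(3)[of 5 0 3 4] dx4_move(3)[of 6 0 3 4] dx4_move(3)[of 7 0 3 4]
  dx4_move(1)[of 1 0 3 5] dx4_move(1)[of 2 0 3 5] dx4_move(2)[of 4 0 3 5] dx4_move(3)[of 6 0 3 5]
  dx4_move(3)[of 7 0 3 5] dx4_move(1)[of 1 0 3 6] dx4_move(1)[of 2 0 3 6] dx4_move(2)[of 4 0 3 6]
  dx4_move(2)[of 5 0 3 6] dx4_move(3)[of 7 0 3 6] dx4_move(1)[of 1 0 3 7] dx4_move(1)[of 2 0 3 7]
  dx4_move(2)[of 4 0 3 7] dx4_move(2)[of 5 0 3 7] dx4_move(2)[of 6 0 3 7] dx4_move(1)[of 1 0 4 5]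
  dx4_move(1)[of 2 0 4 5] dx4_move(1)[of 3 0 4 5] dx4_move(3)[of 6 0 4 5] dx4_move(3)[of 7 0 4 5]
  dx4_move(1)[of 1 0 4 6] dx4_move(1)[of 2 0 4 6] dx4_move(1)[of 3 0 4 6] dx4_move(2)[of 5 0 4 6]
  dx4_move(3)[of 7 0 4 6] dx4_move(1)[of 1 0 4 7] dx4_move(1)[of 2 0 4 7] dx4_move(1)[of 3 0 4 7]
  dx4_move(2)[of 5 0 4 7] dx4_move(2)[of 6 0 4 7] dx4_move(1)[of 1 0 5 6] dx4_move(1)[of 2 0 5 6]
  dx4_move(1)[of 3 0 5 6] dx4_move(1)[of 4 0 5 6] dx4_move(3)[of 7 0 5 6] dx4_move(1)[of 1 0 5 7]
  dx4_move(1)[of 2 0 5 7] dx4_move(1)[of 3 0 5 7] dx4_move(1)[of 4 0 5 7] dx4_move(2)[of 6 0 5 7]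
  dx4_move(1)[of 1 0 6 7] dx4_move(1)[of 2 0 6 7] dx4_move(1)[of 3 0 6 7] dx4_move(1)[of 4 0 6 7]
  dx4_move(1)[of 5 0 6 7] dx4_move(3)[of 4 1 2 3] dx4_move(3)[of 5 1 2 3] dx4_move(3)[of 6 1 2 3]
  dx4_move(3)[of 7 1 2 3] dx4_move(2)[of 3 1 2 4] dx4_move(3)[of 5 1 2 4] dx4_move(3)[of 6 1 2 4]
  dx4_move(3)[of 7 1 2 4] dx4_move(2)[of 3 1 2 5] dx4_move(2)[of 4 1 2 5] dx4_move(3)[of 6 1 2 5]
  dx4_move(3)[of 7 1 2 5] dx4_move(2)[of 3 1 2 6] dx4_move(2)[of 4 1 2 6] dx4_move(2)[of 5 1 2 6]
  dx4_move(3)[of 7 1 2 6] dx4_move(2)[of 3 1 2 7] dx4_move(2)[of 4 1 2 7] dx4_move(2)[of 5 1 2 7]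
  dx4_move(2)[of 6 1 2 7] dx4_move(1)[of 2 1 3 4] dx4_move(3)[of 5 1 3 4] dx4_move(3)[of 6 1 3 4]
  dx4_move(3)[of 7 1 3 4] dx4_move(1)[of 2 1 3 5] dx4_move(2)[of 4 1 3 5] dx4_move(3)[of 6 1 3 5]
  dx4_move(3)[of 7 1 3 5] dx4_move(1)[of 2 1 3 6] dx4_move(2)[of 4 1 3 6] dx4_move(2)[of 5 1 3 6]
  dx4_move(3)[of 7 1 3 6] dx4_move(1)[of 2 1 3 7] dx4_move(2)[of 4 1 3 7] dx4_move(2)[of 5 1 3 7]
  dx4_move(2)[of 6 1 3 7] dx4_move(1)[of 2 1 4 5] dx4_move(1)[of 3 1 4 5] dx4_move(3)[of 6 1 4 5]
  dx4_move(3)[of 7 1 4 5] dx4_move(1)[of 2 1 4 6] dx4_move(1)[of 3 1 4 6] dx4_move(2)[of 5 1 4 6]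
  dx4_move(3)[of 7 1 4 6] dx4_move(1)[of 2 1 4 7] dx4_move(1)[of 3 1 4 7] dx4_move(2)[of 5 1 4 7]
  dx4_move(2)[of 6 1 4 7] dx4_move(1)[of 2 1 5 6] dx4_move(1)[of 3 1 5 6] dx4_move(1)[of 4 1 5 6]
  dx4_move(3)[of 7 1 5 6] dx4_move(1)[of 2 1 5 7] dx4_move(1)[of 3 1 5 7] dx4_move(1)[of 4 1 5 7]
  dx4_move(2)[of 6 1 5 7] dx4_move(1)[of 2 1 6 7] dx4_move(1)[of 3 1 6 7] dx4_move(1)[of 4 1 6 7]
  dx4_move(1)[of 5 1 6 7] dx4_move(3)[of 5 2 3 4] dx4_move(3)[of 6 2 3 4] dx4_move(3)[of 7 2 3 4]
  dx4_move(2)[of 4 2 3 5] dx4_move(3)[of 6 2 3 5] dx4_move(3)[of 7 2 3 5] dx4_move(2)[of 4 2 3 6]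
  dx4_move(2)[of 5 2 3 6] dx4_move(3)[of 7 2 3 6] dx4_move(2)[of 4 2 3 7] dx4_move(2)[of 5 2 3 7]
  dx4_move(2)[of 6 2 3 7] dx4_move(1)[of 3 2 4 5] dx4_move(3)[of 6 2 4 5] dx4_move(3)[of 7 2 4 5]
  dx4_move(1)[of 3 2 4 6] dx4_move(2)[of 5 2 4 6] dx4_move(3)[of 7 2 4 6] dx4_move(1)[of 3 2 4 7]
  dx4_move(2)[of 5 2 4 7] dx4_move(2)[of 6 2 4 7] dx4_move(1)[of 3 2 5 6] dx4_move(1)[of 4 2 5 6]
  dx4_move(3)[of 7 2 5 6] dx4_move(1)[of 3 2 5 7] dx4_move(1)[of 4 2 5 7] dx4_move(2)[of 6 2 5 7]
  dx4_move(1)[of 3 2 6 7] dx4_move(1)[of 4 2 6 7] dx4_move(1)[of 5 2 6 7] dx4_move(3)[of 6 3 4 5]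
  dx4_move(3)[of 7 3 4 5] dx4_move(2)[of 5 3 4 6] dx4_move(3)[of 7 3 4 6] dx4_move(2)[of 5 3 4 7]
  dx4_move(2)[of 6 3 4 7] dx4_move(1)[of 4 3 5 6] dx4_move(3)[of 7 3 5 6] dx4_move(1)[of 4 3 5 7]
  dx4_move(2)[of 6 3 5 7] dx4_move(1)[of 4 3 6 7] dx4_move(1)[of 5 3 6 7] dx4_move(3)[of 7 4 5 6]
  dx4_move(2)[of 6 4 5 7] dx4_move(1)[of 5 4 6 7]

text \<open>Inside the 28-dimensional space of skew matrices the seven equations cut out the
  21-dimensional algebra spin(7); the first one, for instance, is orthogonality to
  \<open>omega0\<close>. They express row 0 through the other entries, and after this substitution
  the coefficient of every basis 4-form cancels.\<close>

lemma spin7I: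
  assumes skew: "\<And>i j. X$j$i = - X$i$j"
    and e1: "X$0$1 + X$2$3 + X$4$5 + X$6$7 = 0"
    and e2: "X$0$2 - X$1$3 + X$4$6 - X$5$7 = 0"
    and e3: "X$0$3 + X$1$2 - X$4$7 - X$5$6 = 0"
    and e4: "X$0$4 - X$1$5 - X$2$6 + X$3$7 = 0"
    and e5: "X$0$5 + X$1$4 + X$2$7 + X$3$6 = 0"
    and e6: "X$0$6 - X$1$7 + X$2$4 - X$3$5 = 0"
    and e7: "X$0$7 + X$1$6 - X$2$5 - X$3$4 = 0"
  shows "X \<in> spin7"
proof -
  have x0: "X$i$i = 0" for i
    using skew[of i i] by simp
  have sk: "X$1$0 = - X$0$1" "X$2$0 = - X$0$2" "X$3$0 = - X$0$3" "X$4$0 = - X$0$4" "X$5$0 = - X$0$5" "X$6$0 = - X$0$6" "X$7$0 = - X$0$7" "X$2$1 = - X$1$2" "X$3$1 = - X$1$3" "X$4$1 = - X$1$4" "X$5$1 = - X$1$5" "X$6$1 = - X$1$6" "X$7$1 = - X$1$7" "X$3$2 = - X$2$3" "X$4$2 = - X$2$4" "X$5$2 = - X$2$5" "X$6$2 = - X$2$6" "X$7$2 = - X$2$7" "X$4$3 = - X$3$4" "X$5$3 = - X$3$5" "X$6$3 = - X$3$6" "X$7$3 = - X$3$7" "X$5$4 = - X$4$5" "X$6$4 = - X$4$6" "X$7$4 = - X$4$7" "X$6$5 = - X$5$6" "X$7$5 = - X$5$7" "X$7$6 = - X$6$7"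
    by (rule skew)+
  have s1: "X$0$1 = - (X$2$3 + X$4$5 + X$6$7)"
    using e1 by linarith
  have s2: "X$0$2 = - (- X$1$3 + X$4$6 - X$5$7)"
    using e2 by linarith
  have s3: "X$0$3 = - (X$1$2 - X$4$7 - X$5$6)"
    using e3 by linarith
  have s4: "X$0$4 = - (- X$1$5 - X$2$6 + X$3$7)"
    using e4 by linarith
  have s5: "X$0$5 = - (X$1$4 + X$2$7 + X$3$6)"
    using e5 by linarith
  have s6: "X$0$6 = - (- X$1$7 + X$2$4 - X$3$5)"
    using e6 by linarith
  have s7: "X$0$7 = - (X$1$6 - X$2$5 - X$3$4)"
    using e7 by linarith
  have "Phi0 (X *v a) b c d + Phi0 a (X *v b) c d + Phi0 a b (X *v c) d + Phi0 a b c (X *v d) = 0" for a b c d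
  proof -
    have "Phi0 (X *v a) b c d + Phi0 a (X *v b) c d + Phi0 a b (X *v c) d + Phi0 a b c (X *v d) =
      (dx4 0 1 2 3 (X *v a) b c d + dx4 0 1 2 3 a (X *v b) c d + dx4 0 1 2 3 a b (X *v c) d + dx4 0 1 2 3 a b c (X *v d))
      + (dx4 0 1 4 5 (X *v a) b c d + dx4 0 1 4 5 a (X *v b) c d + dx4 0 1 4 5 a b (X *v c) d + dx4 0 1 4 5 a b c (X *v d))
      + (dx4 0 1 6 7 (X *v a) b c d + dx4 0 1 6 7 a (X *v b) c d + dx4 0 1 6 7 a b (X *v c) d + dx4 0 1 6 7 a b c (X *v d))
      + (dx4 0 2 4 6 (X *v a) b c d + dx4 0 2 4 6 a (X *v b) c d + dx4 0 2 4 6 a b (X *v c) d + dx4 0 2 4 6 a b c (X *v d))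
      - (dx4 0 2 5 7 (X *v a) b c d + dx4 0 2 5 7 a (X *v b) c d + dx4 0 2 5 7 a b (X *v c) d + dx4 0 2 5 7 a b c (X *v d))
      - (dx4 0 3 4 7 (X *v a) b c d + dx4 0 3 4 7 a (X *v b) c d + dx4 0 3 4 7 a b (X *v c) d + dx4 0 3 4 7 a b c (X *v d))
      - (dx4 0 3 5 6 (X *v a) b c d + dx4 0 3 5 6 a (X *v b) c d + dx4 0 3 5 6 a b (X *v c) d + dx4 0 3 5 6 a b c (X *v d))
      - (dx4 1 2 4 7 (X *v a) b c d + dx4 1 2 4 7 a (X *v b) c d + dx4 1 2 4 7 a b (X *v c) d + dx4 1 2 4 7 a b c (X *v d))
      - (dx4 1 2 5 6 (X *v a) b c d + dx4 1 2 5 6 a (X *v b) c d + dx4 1 2 5 6 a b (X *v c) d + dx4 1 2 5 6 a b c (X *v d))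
      - (dx4 1 3 4 6 (X *v a) b c d + dx4 1 3 4 6 a (X *v b) c d + dx4 1 3 4 6 a b (X *v c) d + dx4 1 3 4 6 a b c (X *v d))
      + (dx4 1 3 5 7 (X *v a) b c d + dx4 1 3 5 7 a (X *v b) c d + dx4 1 3 5 7 a b (X *v c) d + dx4 1 3 5 7 a b c (X *v d))
      + (dx4 2 3 4 5 (X *v a) b c d + dx4 2 3 4 5 a (X *v b) c d + dx4 2 3 4 5 a b (X *v c) d + dx4 2 3 4 5 a b c (X *v d))
      + (dx4 2 3 6 7 (X *v a) b c d + dx4 2 3 6 7 a (X *v b) c d + dx4 2 3 6 7 a b (X *v c) d + dx4 2 3 6 7 a b c (X *v d))
      + (dx4 4 5 6 7 (X *v a) b c d + dx4 4 5 6 7 a (X *v b) c d + dx4 4 5 6 7 a b (X *v c) d + dx4 4 5 6 7 a b c (X *v d))"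
      unfolding Phi0_dx4 by simp
    also have "\<dots> = 0"
      unfolding dx4_deriv sum_8 by (simp only: dx4_sort dx4_repeat x0 sk s1 s2 s3 s4 s5 s6 s7) (simp add: algebra_simps)
    finally show ?thesis .
  qed
  then show ?thesis
    by (simp add: spin7_def)
qed

section \<open>Linearised deformation equations\<close>

text \<open>The norm in \<open>expS\<close> is not differentiable at the zero vector. Since cos x
  and sin x / x are power series in x^2, the exponential map depends on the squared norm only, which
  is differentiable everywhere.\<close>

lemma cos_sin_of_square:
  obtains C S C' S' :: "real \<Rightarrow> real" where
    "\<And>x. cos x = C (x\<^sup>2)" "\<And>x. sin x = x * S (x\<^sup>2)" "C 0 = 1" "S 0 = 1"
    "\<And>s. DERIV C s :> C' s" "\<And>s. DERIV S s :> S' s" "\<And>s. isCont C' s" "\<And>s. isCont S' s"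
proof -
  define c where "c = (\<lambda>n. (- 1) ^ n / fact (2 * n) :: real)"
  define d where "d = (\<lambda>n. (- 1) ^ n / fact (2 * n + 1) :: real)"
  have c: "(\<lambda>n. c n * (x\<^sup>2) ^ n) sums cos x" for x
    using cos_paired[of x] by (simp add: c_def power_mult)
  have d': "(\<lambda>n. x * (d n * (x\<^sup>2) ^ n)) sums sin x" for x
  proof -
    have "(- 1) ^ n / fact (2 * n + 1) * x ^ (2 * n + 1) = x * (d n * (x\<^sup>2) ^ n)" for n
      by (simp add: d_def flip: power_mult)
    then show ?thesis
      using sin_paired[of x] by (simp only:)
  qed
  have sc: "summable (\<lambda>n. c n * y ^ n)" for y
    by (rule powser_inside[of _ "(\<bar>y\<bar> + 1)\<^sup>2" ])
      (use c[of "\<bar>y\<bar> + 1"] in \<open>auto simp: summable_def power2_eq_square algebra_simps intro: add_pos_nonneg\<close>)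
  have sd: "summable (\<lambda>n. d n * y ^ n)" for y
  proof (rule powser_inside[of _ "(\<bar>y\<bar> + 1)\<^sup>2" ])
    show "summable (\<lambda>n. d n * ((\<bar>y\<bar> + 1)\<^sup>2) ^ n)"
      using summable_mult_D[OF sums_summable[OF d'[of "\<bar>y\<bar> + 1"]]] by simp
  qed (auto simp: power2_eq_square algebra_simps intro: add_pos_nonneg)
  define C where "C = (\<lambda>s. \<Sum>n. c n * s ^ n)"
  define S where "S = (\<lambda>s. \<Sum>n. d n * s ^ n)"
  define C' where "C' = (\<lambda>s. \<Sum>n. diffs c n * s ^ n)"
  define S' where "S' = (\<lambda>s. \<Sum>n. diffs d n * s ^ n)"
  have "DERIV C s :> C' s" "DERIV S s :> S' s" for s
    unfolding C_def C'_def S_def S'_def by (rule termdiffs_strong_converges_everywhere[OF sc] termdiffs_strong_converges_everywhere[OF sd])+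
  moreover have "isCont C' s" "isCont S' s" for s
    unfolding C'_def S'_def
    by (rule DERIV_isCont[OF termdiffs_strong_converges_everywhere], rule termdiff_converges_all, rule sc sd)+
  moreover have "cos x = C (x\<^sup>2)" for x
    unfolding C_def by (rule sums_unique[OF c])
  moreover have "sin x = x * S (x\<^sup>2)" for x
    unfolding S_def by (subst suminf_mult[OF sd, symmetric]) (rule sums_unique[OF d'])
  moreover have "C 0 = 1" "S 0 = 1"
    unfolding C_def S_def powser_zero by (simp_all add: c_def d_def)
  ultimately show ?thesis
    using that by blast
qed

text \<open>This interchanges the derivative in space with the one in time. \<open>V\<close> is
  assumed to be differentiable only once, so the spatial derivative \<open>D t\<close> is computed
  explicitly and then differentiated at t = 0.\<close>

lemma flowmap_derivative:
  assumes V: "(V has_derivative V') (at p)"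
  obtains D where "\<And>t. (flowmap V t has_derivative D t) (at p)" "D 0 = (\<lambda>a. a)"
    "\<And>a. ((\<lambda>t. D t a) has_vector_derivative V' a) (at 0)"
    "flowmap V 0 p = p" "((\<lambda>t. flowmap V t p) has_vector_derivative V p) (at 0)"
proof -
  obtain C S C' S' :: "real \<Rightarrow> real" where
    CS: "\<And>x. cos x = C (x\<^sup>2)" "\<And>x. sin x = x * S (x\<^sup>2)" "C 0 = 1" "S 0 = 1"
    "\<And>s. DERIV C s :> C' s" "\<And>s. DERIV S s :> S' s" "\<And>s. isCont C' s" "\<And>s. isCont S' s"
    using cos_sin_of_square by blast
  define Q where "Q = (\<lambda>t q. t\<^sup>2 * (V q \<bullet> V q))"
  have flow: "flowmap V t q = C (Q t q) *\<^sub>R q + (t * S (Q t q)) *\<^sub>R V q" for t q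
  proof -
    have n: "(norm (t *\<^sub>R V q))\<^sup>2 = Q t q"
      by (simp add: Q_def power_mult_distrib power2_norm_eq_inner)
    have "(sin (norm (t *\<^sub>R V q)) / norm (t *\<^sub>R V q)) *\<^sub>R t *\<^sub>R V q = (t * S (Q t q)) *\<^sub>R V q"
    proof (cases "t *\<^sub>R V q = 0")
      \<comment> \<open>Here division by zero yields 0, but the quotient is multiplied by the zero
        vector, so both sides vanish.\<close>
      case True
      then show ?thesis by auto
    next
      case False
      then have "sin (norm (t *\<^sub>R V q)) / norm (t *\<^sub>R V q) = S (Q t q)"
        unfolding CS(2) n by simp
      then show ?thesis
        by (simp add: mult.commute)
    qed
    then show ?thesis
      unfolding flowmap_def expS_def CS(1) n by simp
  qed
  define D where "D = (\<lambda>t a. C (Q t p) *\<^sub>R a + (C' (Q t p) * (t\<^sup>2 * (2 * (V p \<bullet> V' a)))) *\<^sub>R p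
      + ((t * S (Q t p)) *\<^sub>R V' a + (t * (S' (Q t p) * (t\<^sup>2 * (2 * (V p \<bullet> V' a))))) *\<^sub>R V p))"
  have 1: "(flowmap V t has_derivative D t) (at p)" for t
  proof -
    have dQ: "(Q t has_derivative (\<lambda>a. t\<^sup>2 * (2 * (V p \<bullet> V' a)))) (at p)"
      unfolding Q_def using V by (auto intro!: derivative_eq_intros simp: inner_commute)
    have dC: "((\<lambda>q. C (Q t q)) has_derivative (\<lambda>a. C' (Q t p) * (t\<^sup>2 * (2 * (V p \<bullet> V' a))))) (at p)"
      using has_derivative_compose[OF dQ CS(5)[unfolded has_field_derivative_def]] by simp
    have dS: "((\<lambda>q. S (Q t q)) has_derivative (\<lambda>a. S' (Q t p) * (t\<^sup>2 * (2 * (V p \<bullet> V' a))))) (at p)"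
      using has_derivative_compose[OF dQ CS(6)[unfolded has_field_derivative_def]] by simp
    show ?thesis
      unfolding flow[abs_def] D_def
      by (rule has_derivative_eq_rhs[OF has_derivative_add[OF has_derivative_scaleR[OF dC has_derivative_ident]
              has_derivative_scaleR[OF has_derivative_mult_right[OF dS] V]]])
        (simp add: fun_eq_iff algebra_simps)
  qed
  have Qt: "((\<lambda>t. Q t p) has_real_derivative 0) (at 0)"
    unfolding Q_def by (auto intro!: derivative_eq_intros)
  have Q0: "Q 0 p = 0"
    by (simp add: Q_def)
  have Ct: "((\<lambda>t. C (Q t p)) has_real_derivative 0) (at 0)"
    using DERIV_chain2[OF CS(5) Qt] by simp
  have St: "((\<lambda>t. t * S (Q t p)) has_real_derivative 1) (at 0)"
    using DERIV_mult[OF DERIV_ident DERIV_chain2[OF CS(6) Qt]] by (simp add: Q0 CS)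
  \<comment> \<open>\<open>C'\<close> and \<open>S'\<close> are only known to be continuous, so no
    product rule applies; the factor \<open>t\<^sup>2\<close> gives the derivative 0 straight from
    the difference quotient.\<close>
  have sq: "((\<lambda>t. t\<^sup>2 * h t) has_real_derivative 0) (at 0)" if "isCont h 0" for h :: "real \<Rightarrow> real"
  proof -
    have "((\<lambda>t. t * h t) \<longlongrightarrow> 0 * h 0) (at 0)"
      using that by (intro tendsto_intros) (simp add: isCont_def)
    moreover have "(\<lambda>t. t * h t) = (\<lambda>t. (t\<^sup>2 * h t) / t)"
      by (auto simp: fun_eq_iff power2_eq_square)
    ultimately have "((\<lambda>t. (t\<^sup>2 * h t) / t) \<longlongrightarrow> 0) (at 0)"
      by simp
    then show ?thesis
      by (simp add: DERIV_def)
  qed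
  have cQ: "isCont (\<lambda>t. Q t p) 0"
    using Qt DERIV_isCont by blast
  have cC: "isCont (\<lambda>t. C' (Q t p) * k) 0" and cS: "isCont (\<lambda>t. t * (S' (Q t p) * k)) 0" for k
    using isCont_o2[OF cQ CS(7)] isCont_o2[OF cQ CS(8)] by (auto intro!: continuous_intros)
  have 2: "((\<lambda>t. D t a) has_vector_derivative V' a) (at 0)" for a
  proof -
    define k where "k = 2 * (V p \<bullet> V' a)"
    have D: "D t a = C (Q t p) *\<^sub>R a + (t\<^sup>2 * (C' (Q t p) * k)) *\<^sub>R p
      + ((t * S (Q t p)) *\<^sub>R V' a + (t\<^sup>2 * (t * (S' (Q t p) * k))) *\<^sub>R V p)" for t
      by (simp add: D_def k_def mult_ac)
    have "((\<lambda>t. D t a) has_vector_derivative (0 *\<^sub>R a + 0 *\<^sub>R p + (1 *\<^sub>R V' a + 0 *\<^sub>R V p))) (at 0)"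
      unfolding D
      by (intro has_vector_derivative_add has_vector_derivative_scaleR[OF _ has_vector_derivative_const, simplified]
          Ct St sq cC cS)
    then show ?thesis
      by simp
  qed
  have 3: "((\<lambda>t. flowmap V t p) has_vector_derivative (0 *\<^sub>R p + 1 *\<^sub>R V p)) (at 0)"
    unfolding flow
    by (intro has_vector_derivative_add has_vector_derivative_scaleR[OF _ has_vector_derivative_const, simplified] Ct St)
  show ?thesis
  proof (rule that)
    show "D 0 = (\<lambda>a. a)"
      by (simp add: D_def Q0 CS fun_eq_iff)
    show "flowmap V 0 p = p"
      by (simp add: flow Q0 CS)
  qed (use 1 2 3 in simp_all)
qed

lemma has_vector_derivative_trilinear:
  fixes T :: "'a::euclidean_space \<Rightarrow> 'a \<Rightarrow> 'a \<Rightarrow> real"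
  assumes T: "\<And>y z. linear (\<lambda>x. T x y z)" "\<And>x z. linear (\<lambda>y. T x y z)" "\<And>x y. linear (\<lambda>z. T x y z)"
    and x: "(x has_vector_derivative x') (at t)" and y: "(y has_vector_derivative y') (at t)"
    and z: "(z has_vector_derivative z') (at t)"
  shows "((\<lambda>t. T (x t) (y t) (z t)) has_real_derivative
     T x' (y t) (z t) + T (x t) y' (z t) + T (x t) (y t) z') (at t)"
proof -
  have e: "T u v w = (\<Sum>b\<in>Basis. (u \<bullet> b) * T b v w)" for u v w
  proof -
    interpret L: linear "\<lambda>x. T x v w" by (rule T)
    have "T u v w = T (\<Sum>b\<in>Basis. (u \<bullet> b) *\<^sub>R b) v w"
      by (simp add: euclidean_representation)
    also have "\<dots> = (\<Sum>b\<in>Basis. (u \<bullet> b) * T b v w)"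
      by (simp add: L.sum L.scaleR)
    finally show ?thesis .
  qed
  have bb: "bounded_bilinear (T b)" for b
    using T(2,3) by (intro bilinear_conv_bounded_bilinear[THEN iffD1]) (simp add: bilinear_def)
  have "((\<lambda>t. \<Sum>b\<in>Basis. (x t \<bullet> b) * T b (y t) (z t)) has_real_derivative
      (\<Sum>b\<in>Basis. (x' \<bullet> b) * T b (y t) (z t) + (T b (y t) z' + T b y' (z t)) * (x t \<bullet> b))) (at t)"
    by (intro DERIV_sum DERIV_mult, unfold has_real_derivative_iff_has_vector_derivative)
      (intro bounded_bilinear.has_vector_derivative[OF bb y z]
        bounded_linear.has_vector_derivative[OF bounded_linear_inner_left x])+
  moreover have "(\<Sum>b\<in>Basis. (x' \<bullet> b) * T b (y t) (z t) + (T b (y t) z' + T b y' (z t)) * (x t \<bullet> b))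
      = T x' (y t) (z t) + T (x t) y' (z t) + T (x t) (y t) z'"
    unfolding e[of x'] e[of "x t"] by (simp add: sum.distrib algebra_simps)
  ultimately show ?thesis
    unfolding e[of "x _"] by simp
qed

lemma linear_dx3:
  "linear (\<lambda>x. dx3 i j k x b c)" "linear (\<lambda>x. dx3 i j k a x c)" "linear (\<lambda>x. dx3 i j k a b x)"
  by (rule linearI; simp add: dx3_def det3_def algebra_simps)+

lemma linear_dx4:
  "linear (\<lambda>x. dx4 i j k l x b c d)" "linear (\<lambda>x. dx4 i j k l a x c d)"
  "linear (\<lambda>x. dx4 i j k l a b x d)" "linear (\<lambda>x. dx4 i j k l a b c x)"
  by (rule linearI; simp add: dx4_def dx3_def det3_def algebra_simps)+

lemma linear_phi0:
  "linear (\<lambda>x. phi0 x b c)" "linear (\<lambda>x. phi0 a x c)" "linear (\<lambda>x. phi0 a b x)"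
  unfolding phi0_def by (intro linear_compose_add linear_compose_sub linear_dx3)+

lemma linear_Phi0:
  "linear (\<lambda>x. Phi0 x b c d)" "linear (\<lambda>x. Phi0 a x c d)" "linear (\<lambda>x. Phi0 a b x d)" "linear (\<lambda>x. Phi0 a b c x)"
  unfolding Phi0_dx4 by (intro linear_compose_add linear_compose_sub linear_dx4)+

lemma has_real_derivative_Phi0:
  assumes w: "(w has_vector_derivative w') (at t)" and x: "(x has_vector_derivative x') (at t)"
    and y: "(y has_vector_derivative y') (at t)" and z: "(z has_vector_derivative z') (at t)"
  shows "((\<lambda>t. Phi0 (w t) (x t) (y t) (z t)) has_real_derivative
     Phi0 w' (x t) (y t) (z t) + Phi0 (w t) x' (y t) (z t) + Phi0 (w t) (x t) y' (z t) + Phi0 (w t) (x t) (y t) z') (at t)"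
proof -
  have e: "Phi0 u a b c = (\<Sum>i\<in>Basis. (u \<bullet> i) * Phi0 i a b c)" for u a b c
  proof -
    interpret L: linear "\<lambda>x. Phi0 x a b c" by (rule linear_Phi0)
    have "Phi0 u a b c = Phi0 (\<Sum>b\<in>Basis. (u \<bullet> b) *\<^sub>R b) a b c"
      by (simp add: euclidean_representation)
    also have "\<dots> = (\<Sum>i\<in>Basis. (u \<bullet> i) * Phi0 i a b c)"
      by (simp add: L.sum L.scaleR)
    finally show ?thesis .
  qed
  have "((\<lambda>t. \<Sum>i\<in>Basis. (w t \<bullet> i) * Phi0 i (x t) (y t) (z t)) has_real_derivative
      (\<Sum>i\<in>Basis. (w' \<bullet> i) * Phi0 i (x t) (y t) (z t)
        + (Phi0 i x' (y t) (z t) + Phi0 i (x t) y' (z t) + Phi0 i (x t) (y t) z') * (w t \<bullet> i))) (at t)"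
    by (intro DERIV_sum DERIV_mult has_vector_derivative_trilinear linear_Phi0 x y z)
      (unfold has_real_derivative_iff_has_vector_derivative,
        intro bounded_linear.has_vector_derivative[OF bounded_linear_inner_left w])
  moreover have "(\<Sum>i\<in>Basis. (w' \<bullet> i) * Phi0 i (x t) (y t) (z t)
        + (Phi0 i x' (y t) (z t) + Phi0 i (x t) y' (z t) + Phi0 i (x t) (y t) z') * (w t \<bullet> i))
      = Phi0 w' (x t) (y t) (z t) + Phi0 (w t) x' (y t) (z t) + Phi0 (w t) (x t) y' (z t) + Phi0 (w t) (x t) (y t) z'"
    unfolding e[of w'] e[of "w t"] by (simp add: sum.distrib algebra_simps)
  ultimately show ?thesis
    unfolding e[of "w _"] by simp
qed

lemma chi_inner: "chi p b c d \<bullet> z = Phi0 z b c d - Phi0 p b c d * (p \<bullet> z)"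
proof -
  have e: "(\<chi> i. Phi0 (axis i 1) b c d) \<bullet> u = Phi0 u b c d" for u
  proof -
    interpret L: linear "\<lambda>x. Phi0 x b c d" by (rule linear_Phi0)
    have "Phi0 u b c d = Phi0 (\<Sum>i\<in>UNIV. u $ i *\<^sub>R axis i 1) b c d"
      by (simp add: basis_expansion[of u, unfolded scalar_mult_eq_scaleR])
    also have "\<dots> = (\<Sum>i\<in>UNIV. u $ i * Phi0 (axis i 1) b c d)"
      by (simp add: L.sum L.scaleR)
    finally show ?thesis
      by (simp add: inner_vec_def mult.commute)
  qed
  show ?thesis
    by (simp add: chi_def Let_def inner_diff_left e)
qed

text \<open>Pairing \<open>chi\<close> with a fixed \<open>z\<close> reduces the equation to scalar
  functions. The right-hand side comes from the projection inside \<open>chi\<close>: its base point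
  moves with velocity \<open>V p\<close>, and because \<open>p\<close> is orthogonal to
  \<open>z\<close> only the derivative of that inner product survives.\<close>

lemma assoc_linearised:
  assumes "assoc_inf_deformation M V" and p: "p \<in> M"
    and T: "a \<in> tangent_space M p" "b \<in> tangent_space M p" "c \<in> tangent_space M p"
    and V: "(V has_derivative V') (at p)" and z: "p \<bullet> z = 0"
  shows "Phi0 z (V' a) b c + Phi0 z a (V' b) c + Phi0 z a b (V' c) = Phi0 p a b c * (V p \<bullet> z)"
proof -
  obtain D where D: "\<And>t. (flowmap V t has_derivative D t) (at p)" "D 0 = (\<lambda>a. a)"
    "\<And>a. ((\<lambda>t. D t a) has_vector_derivative V' a) (at 0)"
    "flowmap V 0 p = p" "((\<lambda>t. flowmap V t p) has_vector_derivative V p) (at 0)"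
    using flowmap_derivative[OF V] by blast
  have fd: "frechet_derivative (flowmap V t) (at p) = D t" for t
    using frechet_derivative_at[OF D(1)] by simp
  have "((\<lambda>t. chi (flowmap V t p) (D t a) (D t b) (D t c)) has_vector_derivative 0) (at 0)"
    using assms by (auto simp: assoc_inf_deformation_def Let_def fd)
  then have "((\<lambda>t. chi (flowmap V t p) (D t a) (D t b) (D t c) \<bullet> z) has_vector_derivative 0 \<bullet> z) (at 0)"
    by (rule bounded_linear.has_vector_derivative[OF bounded_linear_inner_left])
  then have 1: "((\<lambda>t. Phi0 z (D t a) (D t b) (D t c)
      - Phi0 (flowmap V t p) (D t a) (D t b) (D t c) * (flowmap V t p \<bullet> z)) has_real_derivative 0) (at 0)"
    by (simp add: chi_inner has_real_derivative_iff_has_vector_derivative)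
  have in': "((\<lambda>t. flowmap V t p \<bullet> z) has_real_derivative V p \<bullet> z) (at 0)"
    unfolding has_real_derivative_iff_has_vector_derivative
    by (rule bounded_linear.has_vector_derivative[OF bounded_linear_inner_left D(5)])
  have 2: "((\<lambda>t. Phi0 z (D t a) (D t b) (D t c)
      - Phi0 (flowmap V t p) (D t a) (D t b) (D t c) * (flowmap V t p \<bullet> z)) has_real_derivative
      (Phi0 0 (D 0 a) (D 0 b) (D 0 c) + Phi0 z (V' a) (D 0 b) (D 0 c) + Phi0 z (D 0 a) (V' b) (D 0 c) + Phi0 z (D 0 a) (D 0 b) (V' c))
      - ((Phi0 (V p) (D 0 a) (D 0 b) (D 0 c) + Phi0 (flowmap V 0 p) (V' a) (D 0 b) (D 0 c)
          + Phi0 (flowmap V 0 p) (D 0 a) (V' b) (D 0 c) + Phi0 (flowmap V 0 p) (D 0 a) (D 0 b) (V' c)) * (flowmap V 0 p \<bullet> z)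
         + (V p \<bullet> z) * Phi0 (flowmap V 0 p) (D 0 a) (D 0 b) (D 0 c))) (at 0)"
    by (intro DERIV_diff DERIV_mult has_real_derivative_Phi0 D(3,5) in' has_vector_derivative_const)
  have "Phi0 0 a b c = 0"
    using linear_0[OF linear_Phi0(1)] by simp
  then show ?thesis
    using DERIV_unique[OF 1 2] by (simp add: D(2,4) z)
qed

text \<open>The reverse passage, from an algebraic identity to the vanishing derivative, because the
  Lagrangian deformation has to be constructed.\<close>

lemma lag_linearised:
  assumes N: "((\<lambda>q. Jmap q (v q)) has_derivative N') (at p)"
    and 0: "phi0 (Jmap p (v p)) a b + phi0 p (N' a) b + phi0 p a (N' b) = 0"
  shows "((\<lambda>t. let f = flowmap (\<lambda>q. Jmap q (v q)) t; D = frechet_derivative f (at p)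
              in sigmaNK (f p) (D a) (D b)) has_real_derivative 0) (at 0)"
proof -
  let ?N = "\<lambda>q. Jmap q (v q)"
  obtain D where D: "\<And>t. (flowmap ?N t has_derivative D t) (at p)" "D 0 = (\<lambda>a. a)"
    "\<And>a. ((\<lambda>t. D t a) has_vector_derivative N' a) (at 0)"
    "flowmap ?N 0 p = p" "((\<lambda>t. flowmap ?N t p) has_vector_derivative ?N p) (at 0)"
    using flowmap_derivative[OF N] by blast
  have fd: "frechet_derivative (flowmap ?N t) (at p) = D t" for t
    using frechet_derivative_at[OF D(1)] by simp
  show ?thesis
    using has_vector_derivative_trilinear[OF linear_phi0 D(5) D(3) D(3), of a b]
    by (simp add: Let_def fd sigmaNK_def D(2,4) 0)
qed

text \<open>Continuity of the derivative is tested on fixed directions, which involves no topology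
  on linear maps. The general types also cover the scalar factors from which the constructed field
  is assembled.\<close>

definition C1map :: "('a::real_normed_vector \<Rightarrow> 'b::real_normed_vector) \<Rightarrow> bool" where
  "C1map F \<longleftrightarrow> (\<exists>F'. (\<forall>x. (F has_derivative F' x) (at x)) \<and> (\<forall>h. continuous_on UNIV (\<lambda>x. F' x h)))"

lemma C1map_continuous: "C1map F \<Longrightarrow> continuous_on UNIV F"
  unfolding C1map_def
  by (meson continuous_at_imp_continuous_on has_derivative_continuous)

lemma C1map_linear: "bounded_linear F \<Longrightarrow> C1map F"
  unfolding C1map_def by (rule exI[of _ "\<lambda>x. F"]) (simp add: bounded_linear_imp_has_derivative)

lemma C1map_const: "C1map (\<lambda>x. c)"
  unfolding C1map_def by (rule exI[of _ "\<lambda>x h. 0"]) simp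

lemma C1map_add: "C1map F \<Longrightarrow> C1map G \<Longrightarrow> C1map (\<lambda>x. F x + G x)"
  unfolding C1map_def
proof (elim exE conjE)
  fix F' G'
  assume "\<forall>x. (F has_derivative F' x) (at x)" "\<forall>h. continuous_on UNIV (\<lambda>x. F' x h)"
    "\<forall>x. (G has_derivative G' x) (at x)" "\<forall>h. continuous_on UNIV (\<lambda>x. G' x h)"
  then show "\<exists>F'. (\<forall>x. ((\<lambda>x. F x + G x) has_derivative F' x) (at x)) \<and> (\<forall>h. continuous_on UNIV (\<lambda>x. F' x h))"
    by (intro exI[of _ "\<lambda>x h. F' x h + G' x h"]) (auto intro!: has_derivative_add continuous_intros)
qed

lemma C1map_bilinear:
  assumes B: "bounded_bilinear B" and F: "C1map F" and G: "C1map G"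
  shows "C1map (\<lambda>x. B (F x) (G x))"
proof -
  obtain F' G' where F': "\<And>x. (F has_derivative F' x) (at x)" "\<And>h. continuous_on UNIV (\<lambda>x. F' x h)"
    and G': "\<And>x. (G has_derivative G' x) (at x)" "\<And>h. continuous_on UNIV (\<lambda>x. G' x h)"
    using F G unfolding C1map_def by blast
  show ?thesis
    unfolding C1map_def
    by (intro exI[of _ "\<lambda>x h. B (F x) (G' x h) + B (F' x h) (G x)"] conjI allI
        bounded_bilinear.FDERIV[OF B] F' G' continuous_on_add bounded_bilinear.continuous_on[OF B]
        C1map_continuous F G)
qed

lemma C1map_bounded_linear:
  assumes L: "bounded_linear L" and F: "C1map F"
  shows "C1map (\<lambda>x. L (F x))"
proof -
  obtain F' where F': "\<And>x. (F has_derivative F' x) (at x)" "\<And>h. continuous_on UNIV (\<lambda>x. F' x h)"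
    using F unfolding C1map_def by blast
  show ?thesis
    unfolding C1map_def
    by (intro exI[of _ "\<lambda>x h. L (F' x h)"] conjI allI bounded_linear.has_derivative[OF L] F'
        bounded_linear.continuous_on[OF L])
qed

lemma C1_field_iff: "C1_field V \<longleftrightarrow> C1map V"
proof
  assume V: "C1_field V"
  define V' where "V' = (\<lambda>x. frechet_derivative V (at x))"
  have 1: "(V has_derivative V' x) (at x)" for x
    using V by (simp add: C1_field_def V'_def frechet_derivative_works)
  have "continuous_on UNIV (\<lambda>x. V' x h)" for h
  proof -
    have "V' x h = (\<Sum>i\<in>UNIV. h $ i *\<^sub>R V' x (axis i 1))" for x
    proof -
      interpret L: bounded_linear "V' x"
        using 1 by (rule has_derivative_bounded_linear)
      have "V' x h = V' x (\<Sum>i\<in>UNIV. h $ i *\<^sub>R axis i 1)"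
        by (simp add: basis_expansion[of h, unfolded scalar_mult_eq_scaleR])
      then show ?thesis
        by (simp add: L.sum L.scaleR)
    qed
    moreover have "continuous_on UNIV (\<lambda>x. V' x (axis i 1))" for i
      using V by (simp add: C1_field_def V'_def)
    ultimately show ?thesis
      by (simp add: continuous_on_sum continuous_on_scaleR)
  qed
  with 1 show "C1map V"
    unfolding C1map_def by blast
next
  assume "C1map V"
  then obtain V' where V': "\<And>x. (V has_derivative V' x) (at x)" "\<And>h. continuous_on UNIV (\<lambda>x. V' x h)"
    unfolding C1map_def by blast
  have "frechet_derivative V (at x) = V' x" for x
    using frechet_derivative_at[OF V'(1)] by simp
  then show "C1_field V"
    using V' unfolding C1_field_def differentiable_def by auto
qed

section \<open>Homogeneous Lagrangian submanifolds\<close>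

text \<open>The values of \<open>arccos\<close> lie in [0, pi], where the sine is nonnegative and so
  equals the length of the imaginary part. The angle is kept explicit because it tends to 0 as
  \<open>g\<close> approaches the identity.\<close>

lemma S3q_rot_arccos:
  assumes "g \<in> S3q"
  obtains u where "norm u = 1" "g = rot u (arccos (Re (fst g)))"
proof -
  define v :: "real^3" where "v = vector [Im (fst g), Re (snd g), Im (snd g)]"
  have v: "v$1 = Im (fst g)" "v$2 = Re (snd g)" "v$3 = Im (snd g)"
    by (simp_all add: v_def)
  have nv: "(norm v)\<^sup>2 = (Im (fst g))\<^sup>2 + (Re (snd g))\<^sup>2 + (Im (snd g))\<^sup>2"
    by (simp only: power2_norm_eq_inner inner_vec_def sum_3 v) (simp add: power2_eq_square)
  have 1: "(Re (fst g))\<^sup>2 + (norm v)\<^sup>2 = 1"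
    using assms by (simp add: nv S3q_sq)
  then have le: "\<bar>Re (fst g)\<bar> \<le> 1"
    by (metis abs_square_le_1 le_add_same_cancel1 zero_le_power2)
  define t where "t = arccos (Re (fst g))"
  have t1: "Re (fst g) = cos t"
    using le by (simp add: t_def cos_arccos_abs)
  have "sin t = sqrt (1 - (Re (fst g))\<^sup>2)"
    using le by (simp add: t_def sin_arccos_abs)
  also have "\<dots> = norm v"
    using 1 by (metis add_diff_cancel_left' norm_ge_zero real_sqrt_unique)
  finally have t: "Re (fst g) = cos t" "norm v = sin t"
    using t1 by simp_all
  show ?thesis
  proof (cases "v = 0")
    \<comment> \<open>The sine of the angle is 0 here, so any axis serves.\<close>
    case True
    have "g = rot (axis 1 1) t"
      using t True v by (simp add: rot_def prod_eq_iff complex_eq_iff)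
    then show ?thesis
      using that[of "axis 1 1"] by (simp add: t_def)
  next
    case False
    define u where "u = v /\<^sub>R norm v"
    have "norm u = 1"
      using False by (simp add: u_def)
    moreover have "g = rot u t"
      using False by (simp add: u_def rot_def prod_eq_iff complex_eq_iff t v[symmetric] flip: t(2))
    ultimately show ?thesis
      using that by (simp add: t_def)
  qed
qed

lemma Jmap_inner: "Jmap p a \<bullet> z = phi0 p a z"
proof -
  interpret L: linear "\<lambda>z. phi0 p a z" by (rule linear_phi0)
  have "phi0 p a z = phi0 p a (\<Sum>i\<in>UNIV. z $ i *\<^sub>R axis i 1)"
    by (simp add: basis_expansion[of z, unfolded scalar_mult_eq_scaleR])
  also have "\<dots> = (\<Sum>i\<in>UNIV. z $ i * phi0 p a (axis i 1))"
    by (simp add: L.sum L.scaleR)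
  finally show ?thesis
    by (simp add: Jmap_def sigmaNK_def inner_vec_def mult.commute)
qed

lemma phi0_alternating: "phi0 a a c = 0" "phi0 a b a = 0" "phi0 a b b = 0" "phi0 b a c = - phi0 a b c" "phi0 a c b = - phi0 a b c"
  by (simp_all add: phi0_def dx3_def det3_def algebra_simps)

lemma bilinear_Jmap: "bilinear Jmap"
  unfolding bilinear_def
proof (intro conjI allI)
  have e: "x = y" if "\<And>z. x \<bullet> z = y \<bullet> z" for x y :: "real^8"
    using that vector_eq_rdot by blast
  show "linear (\<lambda>y. Jmap x y)" for x
    by (rule linearI; rule e)
      (simp_all add: Jmap_inner inner_add_left linear_add[OF linear_phi0(2)] linear_scale[OF linear_phi0(2)])
  show "linear (\<lambda>x. Jmap x y)" for y
    by (rule linearI; rule e)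
      (simp_all add: Jmap_inner inner_add_left linear_add[OF linear_phi0(1)] linear_scale[OF linear_phi0(1)])
qed

lemma eq_by_inner: "(\<And>z. x \<bullet> z = y \<bullet> z) \<Longrightarrow> x = (y::'a::real_inner)"
  using vector_eq_rdot by blast

text \<open>An orbit of SU(2) acting by elements of Spin(7) that fix \<open>axis 0 1\<close>, hence
  by elements of G2, described by data at one point. The \<open>Y k\<close> generate the action, the
  \<open>U k\<close> are an orthogonal tangent frame with squared lengths \<open>\<mu> k\<close>,
  and the \<open>Nn k\<close> are their images under J. The assumption \<open>frame\<close> expands
  vectors in the orthogonal basis formed by \<open>p0\<close>, \<open>axis 0 1\<close>, the
  \<open>U k\<close> and the \<open>Nn k\<close>.\<close>

locale homogeneous_lagrangian =
  fixes rho :: "quat \<Rightarrow> real^8 \<Rightarrow> real^8" and Y :: "3 \<Rightarrow> real^8^8" and p0 :: "real^8"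
    and \<mu> :: "3 \<Rightarrow> real" and vol :: real and M :: "(real^8) set" and U Nn :: "3 \<Rightarrow> real^8"
  assumes rho_linear: "g \<in> S3q \<Longrightarrow> linear (rho g)"
    and rho_mult: "g \<in> S3q \<Longrightarrow> h \<in> S3q \<Longrightarrow> rho (qmult g h) x = rho g (rho h x)"
    and rho_one: "rho (1, 0) x = x"
    and rho_cont: "continuous_on S3q (\<lambda>g. rho g x)"
    and rho_deriv: "norm u = 1 \<Longrightarrow> ((\<lambda>t. rho (rot u t) x) has_vector_derivative
      (u$1 *\<^sub>R (Y 1 *v x) + u$2 *\<^sub>R (Y 2 *v x) + u$3 *\<^sub>R (Y 3 *v x))) (at 0)"
    and Y_skew: "Y k $ r $ s = - Y k $ s $ r"
    and Y_spin7: "Y k \<in> spin7"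
    and Y_axis0: "Y k *v axis 0 1 = 0"
    and Y_comm: "Y 1 *v (Y 2 *v x) - Y 2 *v (Y 1 *v x) = - 2 *\<^sub>R (Y 3 *v x)"
      "Y 2 *v (Y 3 *v x) - Y 3 *v (Y 2 *v x) = - 2 *\<^sub>R (Y 1 *v x)"
      "Y 3 *v (Y 1 *v x) - Y 1 *v (Y 3 *v x) = - 2 *\<^sub>R (Y 2 *v x)"
    and p0: "norm p0 = 1" "p0 $ 0 = 0"
    and M_eq: "M = (\<lambda>g. rho g p0) ` S3q"
    and \<mu>: "\<mu> k > 0" "\<mu> 2 = \<mu> 3" and vol: "vol \<noteq> 0"
    and U_def: "U k = Y k *v p0" and Nn_def: "Nn k = Jmap p0 (U k)"
    and gram: "U i \<bullet> U j = (if i = j then \<mu> i else 0)"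
    and J_Nn: "Jmap p0 (Nn k) = - U k"
    and frame: "x = (x \<bullet> p0) *\<^sub>R p0 + x $ 0 *\<^sub>R axis 0 1
        + ((x \<bullet> U 1) / \<mu> 1) *\<^sub>R U 1 + ((x \<bullet> U 2) / \<mu> 2) *\<^sub>R U 2 + ((x \<bullet> U 3) / \<mu> 3) *\<^sub>R U 3
        + ((x \<bullet> Nn 1) / \<mu> 1) *\<^sub>R Nn 1 + ((x \<bullet> Nn 2) / \<mu> 2) *\<^sub>R Nn 2 + ((x \<bullet> Nn 3) / \<mu> 3) *\<^sub>R Nn 3"
begin

definition Yv :: "real^3 \<Rightarrow> real^8 \<Rightarrow> real^8" where
  "Yv u x = u$1 *\<^sub>R (Y 1 *v x) + u$2 *\<^sub>R (Y 2 *v x) + u$3 *\<^sub>R (Y 3 *v x)"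

abbreviation e0 :: "real^8" where "e0 \<equiv> axis 0 1"

lemma Y_skew_inner: "(Y k *v x) \<bullet> y = - (x \<bullet> (Y k *v y))"
proof -
  have "transpose (Y k) = - Y k"
    unfolding vec_eq_iff transpose_def by (auto intro: Y_skew)
  then have "x v* Y k = - (Y k *v x)"
    unfolding transpose_matrix_vector[symmetric] by (simp add: vec_eq_iff matrix_vector_mult_def sum_negf)
  then show ?thesis
    using dot_lmul_matrix[of x "Y k" y] by simp
qed

lemma Yv_axis [simp]: "Yv (axis k 1) x = Y k *v x"
  using exhaust_3[of k] by (auto simp: Yv_def axis3)

lemma Yv_skew: "Yv u x \<bullet> y = - (x \<bullet> Yv u y)"
  by (simp add: Yv_def inner_add_left inner_add_right Y_skew_inner)

lemma Yv_spin7: "Phi0 (Yv u a) b c d + Phi0 a (Yv u b) c d + Phi0 a b (Yv u c) d + Phi0 a b c (Yv u d) = 0"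
proof -
  have Y: "Phi0 (Y k *v a) b c d + Phi0 a (Y k *v b) c d + Phi0 a b (Y k *v c) d + Phi0 a b c (Y k *v d) = 0" for k
    using Y_spin7[of k] by (simp add: spin7_def)
  have "Phi0 (Yv u a) b c d + Phi0 a (Yv u b) c d + Phi0 a b (Yv u c) d + Phi0 a b c (Yv u d)
     = u$1 * (Phi0 (Y 1 *v a) b c d + Phi0 a (Y 1 *v b) c d + Phi0 a b (Y 1 *v c) d + Phi0 a b c (Y 1 *v d))
     + u$2 * (Phi0 (Y 2 *v a) b c d + Phi0 a (Y 2 *v b) c d + Phi0 a b (Y 2 *v c) d + Phi0 a b c (Y 2 *v d))
     + u$3 * (Phi0 (Y 3 *v a) b c d + Phi0 a (Y 3 *v b) c d + Phi0 a b (Y 3 *v c) d + Phi0 a b c (Y 3 *v d))"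
    by (simp add: Yv_def linear_add[OF linear_Phi0(1)] linear_add[OF linear_Phi0(2)] linear_add[OF linear_Phi0(3)]
        linear_add[OF linear_Phi0(4)] linear_scale[OF linear_Phi0(1)] linear_scale[OF linear_Phi0(2)]
        linear_scale[OF linear_Phi0(3)] linear_scale[OF linear_Phi0(4)] distrib_left)
  then show ?thesis
    by (simp add: Y)
qed

lemma rho_flow:
  assumes u: "norm u = 1"
  shows "((\<lambda>t. rho (rot u t) x) has_vector_derivative rho (rot u s) (Yv u x)) (at s)"
    and "((\<lambda>t. rho (rot u t) x) has_vector_derivative Yv u (rho (rot u s) x)) (at s)"
proof -
  have sh: "((\<lambda>t. f (t - s)) has_vector_derivative f') (at s)" if "(f has_vector_derivative f') (at 0)"
    for f :: "real \<Rightarrow> real^8" and f'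
    using vector_diff_chain_at[of "\<lambda>t. t - s" 1 s f f'] that
      has_vector_derivative_diff[OF has_vector_derivative_id has_vector_derivative_const]
    by (simp add: o_def)
  have d: "((\<lambda>t. rho (rot u t) z) has_vector_derivative Yv u z) (at 0)" for z
    using rho_deriv[OF u] by (simp add: Yv_def)
  have bl: "bounded_linear (rho (rot u s))"
    using rho_linear u by (simp add: linear_conv_bounded_linear)
  have "((\<lambda>t. rho (rot u s) (rho (rot u (t - s)) x)) has_vector_derivative rho (rot u s) (Yv u x)) (at s)"
    by (rule bounded_linear.has_vector_derivative[OF bl sh[OF d]])
  then show "((\<lambda>t. rho (rot u t) x) has_vector_derivative rho (rot u s) (Yv u x)) (at s)"
    by (simp add: rho_mult[symmetric] qmult_rot_rot u)
  have "((\<lambda>t. rho (rot u (t - s)) (rho (rot u s) x)) has_vector_derivative Yv u (rho (rot u s) x)) (at s)"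
    by (rule sh[OF d])
  then show "((\<lambda>t. rho (rot u t) x) has_vector_derivative Yv u (rho (rot u s) x)) (at s)"
    by (simp add: rho_mult[symmetric] qmult_rot_rot u)
qed

text \<open>Every unit quaternion lies on a one-parameter subgroup, so invariance along those
  subgroups is invariance under the group.\<close>

lemma invariant_by_flow:
  assumes "\<And>u t. norm u = 1 \<Longrightarrow> ((\<lambda>t. f (rot u t)) has_real_derivative 0) (at t)" and "g \<in> S3q"
  shows "f g = f (1, 0)"
proof -
  obtain u t where "norm u = 1" "g = rot u t"
    using S3q_rot_arccos[OF assms(2)] by metis
  then show ?thesis
    using DERIV_isconst_all[of "\<lambda>t. f (rot u t)" t 0] assms(1) by simp
qed

lemma rho_inner: "g \<in> S3q \<Longrightarrow> rho g x \<bullet> rho g y = x \<bullet> y"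
proof -
  assume g: "g \<in> S3q"
  have "rho g x \<bullet> rho g y = rho (1, 0) x \<bullet> rho (1, 0) y"
  proof (rule invariant_by_flow[of "\<lambda>g. rho g x \<bullet> rho g y", OF _ g])
    fix u :: "real^3" and t assume u: "norm u = 1"
    have "((\<lambda>t. rho (rot u t) x \<bullet> rho (rot u t) y) has_vector_derivative
        (rho (rot u t) x \<bullet> Yv u (rho (rot u t) y) + Yv u (rho (rot u t) x) \<bullet> rho (rot u t) y)) (at t)"
      by (rule bounded_bilinear.has_vector_derivative[OF bounded_bilinear_inner rho_flow(2)[OF u] rho_flow(2)[OF u]])
    then show "((\<lambda>t. rho (rot u t) x \<bullet> rho (rot u t) y) has_real_derivative 0) (at t)"
      by (simp add: has_real_derivative_iff_has_vector_derivative Yv_skew)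
  qed
  then show ?thesis
    by (simp add: rho_one)
qed

lemma rho_Phi0: "g \<in> S3q \<Longrightarrow> Phi0 (rho g x) (rho g y) (rho g z) (rho g w) = Phi0 x y z w"
proof -
  assume g: "g \<in> S3q"
  have "Phi0 (rho g x) (rho g y) (rho g z) (rho g w) = Phi0 (rho (1, 0) x) (rho (1, 0) y) (rho (1, 0) z) (rho (1, 0) w)"
  proof (rule invariant_by_flow[of "\<lambda>g. Phi0 (rho g x) (rho g y) (rho g z) (rho g w)", OF _ g])
    fix u :: "real^3" and t assume u: "norm u = 1"
    show "((\<lambda>t. Phi0 (rho (rot u t) x) (rho (rot u t) y) (rho (rot u t) z) (rho (rot u t) w)) has_real_derivative 0) (at t)"
      using has_real_derivative_Phi0[OF rho_flow(2)[OF u, of x t] rho_flow(2)[OF u, of y t] rho_flow(2)[OF u, of z t] rho_flow(2)[OF u, of w t]]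
      by (simp add: Yv_spin7)
  qed
  then show ?thesis
    by (simp add: rho_one)
qed

lemma rho_qconj: "g \<in> S3q \<Longrightarrow> rho g (rho (qconj g) x) = x" "g \<in> S3q \<Longrightarrow> rho (qconj g) (rho g x) = x"
  by (simp_all add: rho_mult[symmetric] rho_one)

lemma rho_e0: "g \<in> S3q \<Longrightarrow> rho g e0 = e0"
proof (rule eq_by_inner)
  fix z assume g: "g \<in> S3q"
  have "rho g e0 \<bullet> z = rho (1, 0) e0 \<bullet> z"
  proof (rule invariant_by_flow[of "\<lambda>g. rho g e0 \<bullet> z", OF _ g])
    fix u :: "real^3" and t assume u: "norm u = 1"
    have "((\<lambda>t. rho (rot u t) e0 \<bullet> z) has_vector_derivative rho (rot u t) (Yv u e0) \<bullet> z) (at t)"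
      by (rule bounded_linear.has_vector_derivative[OF bounded_linear_inner_left rho_flow(1)[OF u]])
    moreover have "rho (rot u t) (Yv u e0) = 0"
      using linear_0[OF rho_linear] u by (simp add: Yv_def Y_axis0)
    ultimately show "((\<lambda>t. rho (rot u t) e0 \<bullet> z) has_real_derivative 0) (at t)"
      by (simp add: has_real_derivative_iff_has_vector_derivative)
  qed
  then show "rho g e0 \<bullet> z = e0 \<bullet> z"
    by (simp add: rho_one)
qed

lemma rho_nth0: "g \<in> S3q \<Longrightarrow> rho g x $ 0 = x $ 0"
  using rho_inner[of g x e0] by (simp add: rho_e0 inner_axis)

lemma rho_phi0: "g \<in> S3q \<Longrightarrow> phi0 (rho g x) (rho g y) (rho g z) = phi0 x y z"
  using rho_Phi0[of g e0 x y z] by (simp add: rho_e0 Phi0_axis0)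

lemma rho_Jmap:
  assumes g: "g \<in> S3q"
  shows "Jmap (rho g x) (rho g y) = rho g (Jmap x y)"
proof (rule eq_by_inner)
  fix z
  have "Jmap (rho g x) (rho g y) \<bullet> z = phi0 (rho g x) (rho g y) (rho g (rho (qconj g) z))"
    by (simp add: Jmap_inner rho_qconj g)
  also have "\<dots> = Jmap x y \<bullet> rho (qconj g) z"
    by (simp add: rho_phi0 g Jmap_inner)
  also have "\<dots> = rho g (Jmap x y) \<bullet> z"
    using rho_inner[OF g, of "Jmap x y" "rho (qconj g) z"] by (simp add: rho_qconj g)
  finally show "Jmap (rho g x) (rho g y) \<bullet> z = rho g (Jmap x y) \<bullet> z" .
qed

lemma p0_orth: "p0 \<bullet> p0 = 1" "p0 \<bullet> U k = 0" "p0 \<bullet> Nn k = 0" "Nn k $ 0 = 0" "U k $ 0 = 0" "U k \<bullet> Nn k = 0"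
proof -
  show "p0 \<bullet> p0 = 1"
    using p0(1) by (simp add: norm_eq_1)
  show "p0 \<bullet> U k = 0"
    using Y_skew_inner[of k p0 p0] by (simp add: U_def inner_commute)
  show "p0 \<bullet> Nn k = 0" "U k \<bullet> Nn k = 0"
    unfolding Nn_def by (simp_all add: inner_commute[of _ "Jmap _ _"] Jmap_inner phi0_alternating)
  have "Nn k \<bullet> e0 = 0"
    unfolding Nn_def Jmap_inner by (simp add: phi0_def dx3_def det3_def axis_def)
  then show "Nn k $ 0 = 0"
    by (simp add: inner_axis)
  show "U k $ 0 = 0"
    using Y_skew_inner[of k p0 e0] by (simp add: U_def Y_axis0 inner_axis)
qed

definition psi :: "quat \<Rightarrow> real^8" where "psi g = rho g p0"

lemma psi_in_M: "g \<in> S3q \<Longrightarrow> psi g \<in> M"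
  by (simp add: M_eq psi_def)

lemma psi_nth0: "g \<in> S3q \<Longrightarrow> psi g $ 0 = 0"
  by (simp add: psi_def rho_nth0 p0)

lemma M_cases: "p \<in> M \<Longrightarrow> (\<And>g. g \<in> S3q \<Longrightarrow> p = psi g \<Longrightarrow> thesis) \<Longrightarrow> thesis"
  by (auto simp: M_eq psi_def)

lemma tangentI:
  assumes g: "g \<in> S3q"
  shows "rho g (Yv a p0) \<in> tangent_space M (psi g)"
proof (cases "a = 0")
  case True
  then have "rho g (Yv a p0) = 0"
    using linear_0[OF rho_linear[OF g]] by (simp add: Yv_def)
  then show ?thesis
    unfolding tangent_space_def using psi_in_M[OF g] by (auto intro!: exI[of _ "\<lambda>t. psi g"])
next
  case False
  define u where "u = a /\<^sub>R norm a"
  have u: "norm u = 1" and a: "a = norm a *\<^sub>R u"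
    using False by (simp_all add: u_def)
  have Ya: "Yv a p0 = norm a *\<^sub>R Yv u p0"
    by (subst a) (simp add: Yv_def algebra_simps)
  have bl: "bounded_linear (rho g)"
    using rho_linear[OF g] by (simp add: linear_conv_bounded_linear)
  define \<gamma> where "\<gamma> = (\<lambda>t. rho g (rho (rot u (norm a * t)) p0))"
  have "((\<lambda>t. rho (rot u (norm a * t)) p0) has_vector_derivative norm a *\<^sub>R Yv u p0) (at 0)"
  proof -
    have l: "((\<lambda>t. norm a * t) has_vector_derivative norm a) (at 0)"
      unfolding has_real_derivative_iff_has_vector_derivative[symmetric] by (auto intro!: derivative_eq_intros)
    show ?thesis
      using vector_diff_chain_at[OF l, of "\<lambda>t. rho (rot u t) p0" "Yv u p0"] rho_flow(1)[OF u, of p0 0]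
      by (simp add: o_def rho_one)
  qed
  then have "(\<gamma> has_vector_derivative rho g (norm a *\<^sub>R Yv u p0)) (at 0)"
    unfolding \<gamma>_def by (rule bounded_linear.has_vector_derivative[OF bl])
  moreover have "\<gamma> t \<in> M" for t
    using psi_in_M[of "qmult g (rot u (norm a * t))"] g u by (simp add: \<gamma>_def psi_def rho_mult)
  moreover have "\<gamma> 0 = psi g"
    by (simp add: \<gamma>_def psi_def rho_one)
  ultimately show ?thesis
    unfolding tangent_space_def Ya by blast
qed

end

section \<open>Tangent spaces of an orbit\<close>

lemma second_order_bound:
  fixes h h' h'' :: "real \<Rightarrow> real"
  assumes h: "\<And>t. DERIV h t :> h' t" "\<And>t. DERIV h' t :> h'' t" "h 0 = 0" "h' 0 = 0"
    and B: "\<And>t. \<bar>h'' t\<bar> \<le> B"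
  shows "\<bar>h t\<bar> \<le> B * t\<^sup>2"
proof -
  have B0: "B \<ge> 0"
    using B[of 0] by linarith
  have 1: "\<bar>h' s\<bar> \<le> B * \<bar>s\<bar>" for s
    using field_differentiable_bound[of UNIV h' h'' B s 0] h B by simp
  have "norm (h t - h 0) \<le> (B * \<bar>t\<bar>) * norm (t - 0)"
  proof (rule field_differentiable_bound[of "closed_segment 0 t" h h'])
    show "norm (h' z) \<le> B * \<bar>t\<bar>" if "z \<in> closed_segment 0 t" for z
    proof -
      have "\<bar>z\<bar> \<le> \<bar>t\<bar>"
        using that by (auto simp: closed_segment_eq_real_ivl split: if_splits)
      then show ?thesis
        using 1[of z] mult_left_mono[OF _ B0] by fastforce
    qed
  qed (use has_field_derivative_at_within[OF h(1)] in auto)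
  then show ?thesis
    by (simp add: h power2_eq_square mult.assoc)
qed

context homogeneous_lagrangian
begin

lemma norm_rho: "g \<in> S3q \<Longrightarrow> norm (rho g x) = norm x"
  by (simp add: norm_eq_sqrt_inner rho_inner)

lemma Yv_bound: obtains K where "K > 0" "\<And>u x. norm u = 1 \<Longrightarrow> norm (Yv u x) \<le> K * norm x"
proof -
  \<comment> \<open>The summand 1 makes \<open>K\<close> strictly positive, so that it may be used
    as a divisor.\<close>
  define K where "K = onorm ((*v) (Y 1)) + onorm ((*v) (Y 2)) + onorm ((*v) (Y 3)) + 1"
  have o: "norm (Y k *v x) \<le> onorm ((*v) (Y k)) * norm x" "onorm ((*v) (Y k)) \<ge> 0" for k x
    by (rule onorm[OF matrix_vector_mul_bounded_linear], rule onorm_pos_le[OF matrix_vector_mul_bounded_linear])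
  have "norm (Yv u x) \<le> K * norm x" if u: "norm u = 1" for u x
  proof -
    have c: "norm (u$k *\<^sub>R (Y k *v x)) \<le> onorm ((*v) (Y k)) * norm x" for k
    proof -
      have "\<bar>u$k\<bar> * norm (Y k *v x) \<le> 1 * norm (Y k *v x)"
        using component_le_norm_cart[of u k] u by (intro mult_right_mono) auto
      then show ?thesis
        using o(1)[of k x] by simp
    qed
    have "norm (Yv u x) \<le> norm (u$1 *\<^sub>R (Y 1 *v x)) + norm (u$2 *\<^sub>R (Y 2 *v x)) + norm (u$3 *\<^sub>R (Y 3 *v x))"
      unfolding Yv_def by (intro norm_triangle_le add_mono norm_triangle_ineq order_refl)
    also have "\<dots> \<le> onorm ((*v) (Y 1)) * norm x + onorm ((*v) (Y 2)) * norm x + onorm ((*v) (Y 3)) * norm x"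
      by (intro add_mono c)
    also have "\<dots> \<le> K * norm x"
      by (simp add: K_def distrib_right)
    finally show ?thesis .
  qed
  moreover have "K > 0"
    unfolding K_def using o(2) by (simp add: add_nonneg_pos)
  ultimately show ?thesis
    using that by blast
qed

lemma Yv_p0: "Yv u p0 = u$1 *\<^sub>R U 1 + u$2 *\<^sub>R U 2 + u$3 *\<^sub>R U 3"
  by (simp add: Yv_def U_def)

text \<open>With y = \<open>Yv u p0\<close> the displacement is t y + O(t^2). Its leading term is
  orthogonal to \<open>z\<close>, so the left side is O(t^2); and y has length bounded below
  uniformly in \<open>u\<close>, so the displacement is at least a multiple of t.\<close>

lemma orbit_local_estimate:
  assumes z: "\<And>k. U k \<bullet> z = 0"
  obtains C d where "C \<ge> 0" "d > 0" "\<And>u t. norm u = 1 \<Longrightarrow> 0 \<le> t \<Longrightarrow> t \<le> d \<Longrightarrow>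
      \<bar>(rho (rot u t) p0 - p0) \<bullet> z\<bar> \<le> C * (norm (rho (rot u t) p0 - p0))\<^sup>2"
proof -
  obtain K where K: "K > 0" "\<And>u x. norm u = 1 \<Longrightarrow> norm (Yv u x) \<le> K * norm x"
    using Yv_bound by blast
  define m where "m = min (\<mu> 1) (\<mu> 3)"
  have m: "m > 0" "m \<le> \<mu> k" for k
    using \<mu> exhaust_3[of k] by (auto simp: m_def)
  have low: "m \<le> (norm (Yv u p0))\<^sup>2" if u: "norm u = 1" for u
  proof -
    have "(norm (Yv u p0))\<^sup>2 = (u$1)\<^sup>2 * \<mu> 1 + (u$2)\<^sup>2 * \<mu> 2 + (u$3)\<^sup>2 * \<mu> 3"
      unfolding power2_norm_eq_inner Yv_p0 by (simp add: inner_add_left inner_add_right gram power2_eq_square)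
    moreover have "(u$1)\<^sup>2 * m + (u$2)\<^sup>2 * m + (u$3)\<^sup>2 * m \<le> (u$1)\<^sup>2 * \<mu> 1 + (u$2)\<^sup>2 * \<mu> 2 + (u$3)\<^sup>2 * \<mu> 3"
      by (intro add_mono mult_left_mono m) auto
    moreover have "(u$1)\<^sup>2 * m + (u$2)\<^sup>2 * m + (u$3)\<^sup>2 * m = m"
      using u[unfolded norm3_eq_1] by (metis distrib_right mult_1)
    ultimately show ?thesis by linarith
  qed
  \<comment> \<open>For t at most \<open>d\<close> the remainder K^3 t^2 is at most t m / 2, half of
    the lower bound t m for the leading term. Then t is at most 2 K / m times the displacement, and
    \<open>C\<close> is the second-order bound K^2 |z| multiplied by the square of that
    factor.\<close>
  define d where "d = m / (2 * K^3)"
  define C where "C = K\<^sup>2 * norm z * (2 * K / m)\<^sup>2"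
  have est: "\<bar>(rho (rot u t) p0 - p0) \<bullet> z\<bar> \<le> C * (norm (rho (rot u t) p0 - p0))\<^sup>2"
    if u: "norm u = 1" and t: "0 \<le> t" "t \<le> d" for u t
  proof -
    have deriv: "((\<lambda>t. rho (rot u t) x \<bullet> y) has_real_derivative rho (rot u t) (Yv u x) \<bullet> y) (at t)" for x y t
      unfolding has_real_derivative_iff_has_vector_derivative
      by (rule bounded_linear.has_vector_derivative[OF bounded_linear_inner_left rho_flow(1)[OF u]])
    have bnd: "\<bar>rho (rot u t) (Yv u (Yv u p0)) \<bullet> y\<bar> \<le> K\<^sup>2 * norm y" for t y
    proof -
      have "norm (Yv u (Yv u p0)) \<le> K * (K * norm p0)"
        using order_trans[OF K(2)[OF u] mult_left_mono[OF K(2)[OF u]]] K(1) by simp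
      then have "norm (rho (rot u t) (Yv u (Yv u p0))) \<le> K\<^sup>2"
        using u by (simp add: norm_rho p0 power2_eq_square)
      then show ?thesis
        using order_trans[OF Cauchy_Schwarz_ineq2 mult_right_mono] by (metis norm_ge_zero)
    qed
    have 1: "\<bar>(rho (rot u t) p0 - p0) \<bullet> z\<bar> \<le> (K\<^sup>2 * norm z) * t\<^sup>2"
    proof (rule second_order_bound)
      show "((\<lambda>t. (rho (rot u t) p0 - p0) \<bullet> z) has_real_derivative rho (rot u s) (Yv u p0) \<bullet> z) (at s)" for s
        unfolding inner_diff_left by (auto intro!: derivative_eq_intros deriv)
      show "((\<lambda>s. rho (rot u s) (Yv u p0) \<bullet> z) has_real_derivative rho (rot u s) (Yv u (Yv u p0)) \<bullet> z) (at s)" for s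
        by (rule deriv)
      show "\<bar>rho (rot u s) (Yv u (Yv u p0)) \<bullet> z\<bar> \<le> K\<^sup>2 * norm z" for s
        by (rule bnd)
    qed (simp_all add: rho_one Yv_p0 inner_add_left z)
    define y where "y = Yv u p0"
    have yK: "norm y \<le> K"
      using K(2)[OF u, of p0] by (simp add: y_def p0)
    have 2: "\<bar>(rho (rot u t) p0 - p0) \<bullet> y - t * (y \<bullet> y)\<bar> \<le> (K\<^sup>2 * norm y) * t\<^sup>2"
    proof (rule second_order_bound)
      show "((\<lambda>t. (rho (rot u t) p0 - p0) \<bullet> y - t * (y \<bullet> y)) has_real_derivative rho (rot u s) (Yv u p0) \<bullet> y - y \<bullet> y) (at s)" for s
        unfolding inner_diff_left by (auto intro!: derivative_eq_intros deriv)
      show "((\<lambda>s. rho (rot u s) (Yv u p0) \<bullet> y - y \<bullet> y) has_real_derivative rho (rot u s) (Yv u (Yv u p0)) \<bullet> y) (at s)" for s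
        by (auto intro!: derivative_eq_intros deriv)
      show "\<bar>rho (rot u s) (Yv u (Yv u p0)) \<bullet> y\<bar> \<le> K\<^sup>2 * norm y" for s
        by (rule bnd)
    qed (simp_all add: rho_one y_def)
    have "(K\<^sup>2 * norm y) * t\<^sup>2 \<le> (K\<^sup>2 * K) * (t * d)"
      unfolding power2_eq_square[of t] using yK K t by (intro mult_mono mult_left_mono) auto
    also have "\<dots> = t * m / 2"
      using K by (simp add: d_def power2_eq_square power3_eq_cube)
    finally have "t * (y \<bullet> y) - t * m / 2 \<le> (rho (rot u t) p0 - p0) \<bullet> y"
      using 2 by linarith
    moreover have "t * m \<le> t * (y \<bullet> y)"
      using low[OF u] t by (intro mult_left_mono) (auto simp: y_def power2_norm_eq_inner)
    moreover have "(rho (rot u t) p0 - p0) \<bullet> y \<le> norm (rho (rot u t) p0 - p0) * K"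
      using order_trans[OF norm_cauchy_schwarz mult_left_mono[OF yK]] by simp
    ultimately have "t * m / 2 \<le> norm (rho (rot u t) p0 - p0) * K"
      by linarith
    then have "t \<le> (2 * K / m) * norm (rho (rot u t) p0 - p0)"
      using m by (simp add: field_simps)
    then have "t\<^sup>2 \<le> ((2 * K / m) * norm (rho (rot u t) p0 - p0))\<^sup>2"
      using t by (intro power_mono)
    then have "(K\<^sup>2 * norm z) * t\<^sup>2 \<le> (K\<^sup>2 * norm z) * ((2 * K / m) * norm (rho (rot u t) p0 - p0))\<^sup>2"
      by (intro mult_left_mono) auto
    also have "\<dots> = C * (norm (rho (rot u t) p0 - p0))\<^sup>2"
      by (simp only: C_def power_mult_distrib mult.assoc)
    finally show ?thesis
      using 1 by linarith
  qed
  have "C \<ge> 0" "d > 0"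
    using m K by (auto simp: C_def d_def)
  then show ?thesis
    using est that by blast
qed

lemma continuous_on_psi: "continuous_on S3q psi"
  unfolding psi_def by (rule rho_cont)

lemma continuous_on_qmult_right: "continuous_on UNIV (\<lambda>g. qmult g h)"
  by (rule linear_continuous_on[OF linear_qmult_left[unfolded linear_conv_bounded_linear]])

text \<open>Away from the stabiliser this is compactness; near it, translating by the limiting stabiliser
  element moves the estimate to the identity.\<close>

lemma orbit_estimate:
  assumes z: "\<And>k. U k \<bullet> z = 0"
  obtains C where "\<And>g. g \<in> S3q \<Longrightarrow> \<bar>(psi g - p0) \<bullet> z\<bar> \<le> C * (norm (psi g - p0))\<^sup>2"
proof -
  obtain C d where C: "C \<ge> 0" "d > 0" "\<And>u t. norm u = 1 \<Longrightarrow> 0 \<le> t \<Longrightarrow> t \<le> d \<Longrightarrow>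
      \<bar>(rho (rot u t) p0 - p0) \<bullet> z\<bar> \<le> C * (norm (rho (rot u t) p0 - p0))\<^sup>2"
    using orbit_local_estimate[OF z] by blast
  have "\<exists>C. \<forall>g\<in>S3q. \<bar>(psi g - p0) \<bullet> z\<bar> \<le> C * (norm (psi g - p0))\<^sup>2"
  proof (rule ccontr)
    assume "\<not> ?thesis"
    then have "\<forall>n::nat. \<exists>g\<in>S3q. \<bar>(psi g - p0) \<bullet> z\<bar> > real (Suc n) * (norm (psi g - p0))\<^sup>2"
      by (meson not_le)
    then obtain G where G: "\<And>n. G n \<in> S3q" "\<And>n. \<bar>(psi (G n) - p0) \<bullet> z\<bar> > real (Suc n) * (norm (psi (G n) - p0))\<^sup>2"
      by metis
    obtain h r where h: "h \<in> S3q" "strict_mono r" "(G \<circ> r) \<longlonglongrightarrow> h"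
      using compact_S3q G(1) unfolding compact_def by blast
    have psilim: "(\<lambda>n. psi (G (r n))) \<longlonglongrightarrow> psi h"
      using continuous_on_tendsto_compose[OF continuous_on_psi h(3) h(1)] G(1) by (simp add: o_def)
    have bnd: "norm (psi (G n) - p0) \<le> norm z / real (Suc n)" for n
    proof (cases "psi (G n) = p0")
      case False
      have "real (Suc n) * (norm (psi (G n) - p0))\<^sup>2 \<le> norm (psi (G n) - p0) * norm z"
        using G(2)[of n] Cauchy_Schwarz_ineq2[of "psi (G n) - p0" z] by linarith
      then have "real (Suc n) * norm (psi (G n) - p0) \<le> norm z"
        using False by (simp add: power2_eq_square mult.left_commute)
      then show ?thesis
        by (simp add: pos_le_divide_eq mult.commute del: of_nat_Suc)
    qed simp
    have lim0: "(\<lambda>n. norm z / real (Suc n)) \<longlonglongrightarrow> 0"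
      using tendsto_mult_right_zero[OF lim_1_over_n[THEN LIMSEQ_Suc], of "norm z"] by simp
    have "(\<lambda>n. psi (G n)) \<longlonglongrightarrow> p0"
      by (rule LIM_zero_cancel[OF Lim_null_comparison[OF always_eventually[OF allI[OF bnd]] lim0]])
    from LIMSEQ_subseq_LIMSEQ[OF this h(2)] have "(\<lambda>n. psi (G (r n))) \<longlonglongrightarrow> p0"
      by (simp add: o_def)
    with psilim have psih: "psi h = p0"
      by (rule LIMSEQ_unique)
    define k where "k = (\<lambda>n. qmult (G (r n)) (qconj h))"
    have kS: "k n \<in> S3q" for n
      using G(1) h(1) by (simp add: k_def)
    have psik: "psi (k n) = psi (G (r n))" for n
    proof -
      have "rho (qconj h) p0 = p0"
        using rho_qconj(2)[OF h(1), of p0] psih by (simp add: psi_def)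
      then show ?thesis
        using G(1) h(1) by (simp add: k_def psi_def rho_mult)
    qed
    have klim: "k \<longlonglongrightarrow> (1, 0)"
      using continuous_on_tendsto_compose[OF continuous_on_qmult_right h(3), of "qconj h"] h(1)
      by (simp add: k_def o_def)
    define t where "t = (\<lambda>n. arccos (Re (fst (k n))))"
    have re: "\<bar>Re (fst (k n))\<bar> \<le> 1" for n
    proof -
      have "(Re (fst (k n)))\<^sup>2 \<le> 1"
        using kS[of n] unfolding S3q_sq by (smt (verit) zero_le_power2)
      then show ?thesis
        by (simp add: abs_square_le_1)
    qed
    have "(\<lambda>n. arccos (Re (fst (k n)))) \<longlonglongrightarrow> arccos (Re (fst ((1::complex), (0::complex))))"
    proof (rule continuous_on_tendsto_compose[OF continuous_on_arccos'])
      show "(\<lambda>n. Re (fst (k n))) \<longlonglongrightarrow> Re (fst ((1::complex), (0::complex)))"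
        by (intro tendsto_intros klim)
    qed (use re in \<open>auto simp: abs_le_iff minus_le_iff\<close>)
    then have "t \<longlonglongrightarrow> 0"
      by (simp add: t_def)
    then have "eventually (\<lambda>n. t n < d) sequentially"
      using C(2) by (rule order_tendstoD)
    moreover have "eventually (\<lambda>n. C \<le> real (Suc (r n))) sequentially"
    proof -
      obtain N :: nat where "C \<le> real N"
        using real_arch_simple by blast
      then have "C \<le> real (Suc (r n))" if "N \<le> n" for n
        using seq_suble[OF h(2), of n] that by simp
      then show ?thesis
        unfolding eventually_sequentially by blast
    qed
    ultimately have "eventually (\<lambda>n. t n < d \<and> C \<le> real (Suc (r n))) sequentially"
      by (rule eventually_conj)
    then obtain n where n: "t n < d" "C \<le> real (Suc (r n))"
      unfolding eventually_sequentially by blast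
    obtain u where u: "norm u = 1" "k n = rot u (t n)"
      using S3q_rot_arccos[OF kS] unfolding t_def by metis
    have "0 \<le> t n"
      using re[of n] by (simp add: t_def arccos_lbound abs_le_iff minus_le_iff)
    then have "\<bar>(psi (k n) - p0) \<bullet> z\<bar> \<le> C * (norm (psi (k n) - p0))\<^sup>2"
      using C(3)[OF u(1), of "t n"] n(1) u(2) by (simp add: psi_def)
    also have "\<dots> \<le> real (Suc (r n)) * (norm (psi (k n) - p0))\<^sup>2"
      by (intro mult_right_mono n) auto
    finally show False
      using G(2)[of "r n"] by (simp add: psik)
  qed
  then show ?thesis
    using that by blast
qed

lemma tangent_base:
  assumes "v \<in> tangent_space M p0"
  shows "v = Yv (vector [(v \<bullet> U 1) / \<mu> 1, (v \<bullet> U 2) / \<mu> 2, (v \<bullet> U 3) / \<mu> 3]) p0"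
proof -
  obtain \<gamma> where \<gamma>: "\<And>t. \<gamma> t \<in> M" "\<gamma> 0 = p0" "(\<gamma> has_vector_derivative v) (at 0)"
    using assms by (auto simp: tangent_space_def)
  have perp: "v \<bullet> z = 0" if z: "\<And>k. U k \<bullet> z = 0" for z
  proof -
    obtain C where C: "\<And>g. g \<in> S3q \<Longrightarrow> \<bar>(psi g - p0) \<bullet> z\<bar> \<le> C * (norm (psi g - p0))\<^sup>2"
      using orbit_estimate[OF z] by blast
    have bound: "\<bar>(\<gamma> t - p0) \<bullet> z\<bar> \<le> C * (norm (\<gamma> t - p0))\<^sup>2" for t
      using C M_cases[OF \<gamma>(1)] by metis
    have d: "((\<lambda>t. (\<gamma> t - p0) /\<^sub>R t) \<longlongrightarrow> v) (at 0)"
    proof -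
      have "((\<lambda>t. (1 / t) *\<^sub>R (\<gamma> t - \<gamma> 0) - v) \<longlongrightarrow> 0) (at 0)"
      proof (rule tendsto_norm_zero_cancel, rule Lim_transform_eventually)
        show "((\<lambda>t. norm (\<gamma> t - \<gamma> 0 - (t - 0) *\<^sub>R v) / norm (t - 0)) \<longlongrightarrow> 0) (at 0)"
          using \<gamma>(3) unfolding has_vector_derivative_def has_derivative_iff_norm by blast
        show "\<forall>\<^sub>F t in at 0. norm (\<gamma> t - \<gamma> 0 - (t - 0) *\<^sub>R v) / norm (t - 0) = norm ((1 / t) *\<^sub>R (\<gamma> t - \<gamma> 0) - v)"
        proof (rule eventually_at_filter[THEN iffD2, OF always_eventually], intro allI impI)
          fix t :: real assume t: "t \<noteq> 0"
          have "(1 / t) *\<^sub>R (\<gamma> t - \<gamma> 0) - v = (1 / t) *\<^sub>R (\<gamma> t - \<gamma> 0 - (t - 0) *\<^sub>R v)"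
            using t by (simp add: algebra_simps)
          then show "norm (\<gamma> t - \<gamma> 0 - (t - 0) *\<^sub>R v) / norm (t - 0) = norm ((1 / t) *\<^sub>R (\<gamma> t - \<gamma> 0) - v)"
            by simp
        qed
      qed
      then show ?thesis
        unfolding LIM_zero_iff by (simp add: \<gamma>(2) divide_inverse)
    qed
    have 1: "((\<lambda>t. ((\<gamma> t - p0) /\<^sub>R t) \<bullet> z) \<longlongrightarrow> v \<bullet> z) (at 0)"
      by (intro tendsto_intros d)
    have "((\<lambda>t. C * \<bar>t\<bar> * (norm ((\<gamma> t - p0) /\<^sub>R t))\<^sup>2) \<longlongrightarrow> C * \<bar>0\<bar> * (norm v)\<^sup>2) (at 0)"
      by (intro tendsto_intros d)
    then have 2: "((\<lambda>t. C * \<bar>t\<bar> * (norm ((\<gamma> t - p0) /\<^sub>R t))\<^sup>2) \<longlongrightarrow> 0) (at 0)"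
      by simp
    have "((\<lambda>t. ((\<gamma> t - p0) /\<^sub>R t) \<bullet> z) \<longlongrightarrow> 0) (at 0)"
    proof (rule Lim_null_comparison[OF _ 2])
      show "\<forall>\<^sub>F t in at 0. norm (((\<gamma> t - p0) /\<^sub>R t) \<bullet> z) \<le> C * \<bar>t\<bar> * (norm ((\<gamma> t - p0) /\<^sub>R t))\<^sup>2"
      proof (rule eventually_at_filter[THEN iffD2, OF always_eventually], intro allI impI)
        fix t :: real assume t: "t \<noteq> 0"
        have "norm (((\<gamma> t - p0) /\<^sub>R t) \<bullet> z) = \<bar>(\<gamma> t - p0) \<bullet> z\<bar> / \<bar>t\<bar>"
          by (simp add: abs_mult divide_inverse)
        also have "\<dots> \<le> C * (norm (\<gamma> t - p0))\<^sup>2 / \<bar>t\<bar>"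
          by (intro divide_right_mono bound) auto
        also have "\<dots> = C * \<bar>t\<bar> * (norm ((\<gamma> t - p0) /\<^sub>R t))\<^sup>2"
        proof -
          have "norm ((\<gamma> t - p0) /\<^sub>R t) = norm (\<gamma> t - p0) / \<bar>t\<bar>"
            by (simp only: norm_scaleR abs_inverse divide_inverse mult.commute)
          then show ?thesis
            using t by (simp only:) (simp add: power2_eq_square field_simps)
        qed
        finally show "norm (((\<gamma> t - p0) /\<^sub>R t) \<bullet> z) \<le> C * \<bar>t\<bar> * (norm ((\<gamma> t - p0) /\<^sub>R t))\<^sup>2" .
      qed
    qed
    then show ?thesis
      using tendsto_unique[OF _ 1] by simp
  qed
  define a :: "real^3" where "a = vector [(v \<bullet> U 1) / \<mu> 1, (v \<bullet> U 2) / \<mu> 2, (v \<bullet> U 3) / \<mu> 3]"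
  \<comment> \<open>The part of \<open>v\<close> orthogonal to the \<open>U k\<close>. It is itself
    an admissible test vector, and this forces its squared length to be 0.\<close>
  define z where "z = v - Yv a p0"
  have Ya: "Yv a p0 = ((v \<bullet> U 1) / \<mu> 1) *\<^sub>R U 1 + ((v \<bullet> U 2) / \<mu> 2) *\<^sub>R U 2 + ((v \<bullet> U 3) / \<mu> 3) *\<^sub>R U 3"
    by (simp add: Yv_p0 a_def)
  have z0: "U k \<bullet> z = 0" for k
    using exhaust_3[of k] \<mu>(1)[THEN less_imp_neq] unfolding z_def Ya
    by (auto simp: inner_diff_right inner_add_right gram inner_commute)
  have "z \<bullet> z = v \<bullet> z - Yv a p0 \<bullet> z"
    by (simp add: z_def inner_diff_left)
  also have "\<dots> = 0"
    using perp[OF z0] z0 by (simp add: Yv_p0 inner_add_left)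
  finally show ?thesis
    by (simp add: z_def a_def)
qed

lemma tangentE:
  assumes g: "g \<in> S3q" and v: "v \<in> tangent_space M (psi g)"
  obtains a where "v = rho g (Yv a p0)"
proof -
  obtain \<gamma> where \<gamma>: "\<And>t. \<gamma> t \<in> M" "\<gamma> 0 = psi g" "(\<gamma> has_vector_derivative v) (at 0)"
    using v by (auto simp: tangent_space_def)
  have bl: "bounded_linear (rho (qconj g))"
    using rho_linear g by (simp add: linear_conv_bounded_linear)
  have "rho (qconj g) v \<in> tangent_space M p0"
    unfolding tangent_space_def
  proof (intro CollectI exI[of _ "\<lambda>t. rho (qconj g) (\<gamma> t)"] conjI allI)
    show "((\<lambda>t. rho (qconj g) (\<gamma> t)) has_vector_derivative rho (qconj g) v) (at 0)"
      by (rule bounded_linear.has_vector_derivative[OF bl \<gamma>(3)])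
    show "rho (qconj g) (\<gamma> 0) = p0"
      using g by (simp add: \<gamma> psi_def rho_qconj)
    show "rho (qconj g) (\<gamma> t) \<in> M" for t
    proof -
      obtain h where "h \<in> S3q" "\<gamma> t = psi h"
        using M_cases[OF \<gamma>(1)] by blast
      then show ?thesis
        using psi_in_M[of "qmult (qconj g) h"] g by (simp add: psi_def rho_mult)
    qed
  qed
  then show ?thesis
    using tangent_base that rho_qconj(1)[OF g, of v] by metis
qed

section \<open>The tangential projection as a polynomial in the point\<close>

definition Sm :: "real^8 \<Rightarrow> real^8 \<Rightarrow> real^8" where
  "Sm p w = ((Y 1 *v p) \<bullet> w) *\<^sub>R (Y 1 *v p) + ((Y 2 *v p) \<bullet> w) *\<^sub>R (Y 2 *v p) + ((Y 3 *v p) \<bullet> w) *\<^sub>R (Y 3 *v p)"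

lemma Yv_comm:
  "Y 1 *v Yv u x - Yv u (Y 1 *v x) = (2 * u$3) *\<^sub>R (Y 2 *v x) - (2 * u$2) *\<^sub>R (Y 3 *v x)"
  "Y 2 *v Yv u x - Yv u (Y 2 *v x) = (2 * u$1) *\<^sub>R (Y 3 *v x) - (2 * u$3) *\<^sub>R (Y 1 *v x)"
  "Y 3 *v Yv u x - Yv u (Y 3 *v x) = (2 * u$2) *\<^sub>R (Y 1 *v x) - (2 * u$1) *\<^sub>R (Y 2 *v x)"
proof -
  have 1: "Y 1 *v Yv u x - Yv u (Y 1 *v x) = u$2 *\<^sub>R (Y 1 *v (Y 2 *v x) - Y 2 *v (Y 1 *v x)) - u$3 *\<^sub>R (Y 3 *v (Y 1 *v x) - Y 1 *v (Y 3 *v x))"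
   and 2: "Y 2 *v Yv u x - Yv u (Y 2 *v x) = u$3 *\<^sub>R (Y 2 *v (Y 3 *v x) - Y 3 *v (Y 2 *v x)) - u$1 *\<^sub>R (Y 1 *v (Y 2 *v x) - Y 2 *v (Y 1 *v x))"
   and 3: "Y 3 *v Yv u x - Yv u (Y 3 *v x) = u$1 *\<^sub>R (Y 3 *v (Y 1 *v x) - Y 1 *v (Y 3 *v x)) - u$2 *\<^sub>R (Y 2 *v (Y 3 *v x) - Y 3 *v (Y 2 *v x))"
    by (simp_all add: Yv_def matrix_vector_right_distrib matrix_vector_mult_scaleR algebra_simps)
  show "Y 1 *v Yv u x - Yv u (Y 1 *v x) = (2 * u$3) *\<^sub>R (Y 2 *v x) - (2 * u$2) *\<^sub>R (Y 3 *v x)"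
    "Y 2 *v Yv u x - Yv u (Y 2 *v x) = (2 * u$1) *\<^sub>R (Y 3 *v x) - (2 * u$3) *\<^sub>R (Y 1 *v x)"
    "Y 3 *v Yv u x - Yv u (Y 3 *v x) = (2 * u$2) *\<^sub>R (Y 1 *v x) - (2 * u$1) *\<^sub>R (Y 2 *v x)"
    unfolding 1 2 3 Y_comm by (simp_all add: algebra_simps)
qed

text \<open>\<open>Sm\<close> is a sum of squares over the three generators. Conjugation by the
  group rotates the triple of generators, and such a sum is invariant under rotations.\<close>

lemma rho_Sm:
  assumes g: "g \<in> S3q"
  shows "Sm (rho g p) (rho g w) = rho g (Sm p w)"
proof (rule eq_by_inner)
  fix z
  define w' where "w' = rho (qconj g) z"
  have z: "z = rho g w'"
    using g by (simp add: w'_def rho_qconj)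
  define A where "A = (\<lambda>k w h. (Y k *v rho h p) \<bullet> rho h w)"
  have S: "Sm (rho h p) (rho h w) \<bullet> rho h w' = A 1 w h * A 1 w' h + A 2 w h * A 2 w' h + A 3 w h * A 3 w' h" for h w w'
    by (simp add: Sm_def A_def inner_add_left)
  have "A 1 w g * A 1 w' g + A 2 w g * A 2 w' g + A 3 w g * A 3 w' g
      = A 1 w (1, 0) * A 1 w' (1, 0) + A 2 w (1, 0) * A 2 w' (1, 0) + A 3 w (1, 0) * A 3 w' (1, 0)"
  proof (rule invariant_by_flow[of "\<lambda>g. A 1 w g * A 1 w' g + A 2 w g * A 2 w' g + A 3 w g * A 3 w' g", OF _ g])
    fix u :: "real^3" and t assume u: "norm u = 1"
    have dA: "((\<lambda>t. A k w (rot u t)) has_real_derivative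
        (Y k *v Yv u (rho (rot u t) p) - Yv u (Y k *v rho (rot u t) p)) \<bullet> rho (rot u t) w) (at t)" for k w
    proof -
      have "((\<lambda>t. Y k *v rho (rot u t) p) has_vector_derivative Y k *v Yv u (rho (rot u t) p)) (at t)"
        by (rule bounded_linear.has_vector_derivative[OF matrix_vector_mul_bounded_linear rho_flow(2)[OF u]])
      from bounded_bilinear.has_vector_derivative[OF bounded_bilinear_inner this rho_flow(2)[OF u, of w t]]
      show ?thesis
        unfolding A_def has_real_derivative_iff_has_vector_derivative
        by (simp add: inner_diff_left Yv_skew add.commute)
    qed
    \<comment> \<open>The triple (A 1, A 2, A 3) rotates about the axis \<open>u\<close> with speed
      2, so the inner product of two such triples is constant.\<close>
    have dA': "((\<lambda>t. A 1 w (rot u t)) has_real_derivative 2 * u$3 * A 2 w (rot u t) - 2 * u$2 * A 3 w (rot u t)) (at t)"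
      "((\<lambda>t. A 2 w (rot u t)) has_real_derivative 2 * u$1 * A 3 w (rot u t) - 2 * u$3 * A 1 w (rot u t)) (at t)"
      "((\<lambda>t. A 3 w (rot u t)) has_real_derivative 2 * u$2 * A 1 w (rot u t) - 2 * u$1 * A 2 w (rot u t)) (at t)" for w
      using dA[of 1 w] dA[of 2 w] dA[of 3 w] unfolding Yv_comm by (simp_all add: A_def inner_diff_left)
    have "((\<lambda>t. A 1 w (rot u t) * A 1 w' (rot u t) + A 2 w (rot u t) * A 2 w' (rot u t) + A 3 w (rot u t) * A 3 w' (rot u t))
        has_real_derivative
        ((2 * u$3 * A 2 w (rot u t) - 2 * u$2 * A 3 w (rot u t)) * A 1 w' (rot u t)
         + (2 * u$3 * A 2 w' (rot u t) - 2 * u$2 * A 3 w' (rot u t)) * A 1 w (rot u t)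
         + ((2 * u$1 * A 3 w (rot u t) - 2 * u$3 * A 1 w (rot u t)) * A 2 w' (rot u t)
         + (2 * u$1 * A 3 w' (rot u t) - 2 * u$3 * A 1 w' (rot u t)) * A 2 w (rot u t))
         + ((2 * u$2 * A 1 w (rot u t) - 2 * u$1 * A 2 w (rot u t)) * A 3 w' (rot u t)
         + (2 * u$2 * A 1 w' (rot u t) - 2 * u$1 * A 2 w' (rot u t)) * A 3 w (rot u t)))) (at t)"
      by (intro DERIV_add DERIV_mult dA')
    then show "((\<lambda>t. A 1 w (rot u t) * A 1 w' (rot u t) + A 2 w (rot u t) * A 2 w' (rot u t) + A 3 w (rot u t) * A 3 w' (rot u t))
        has_real_derivative 0) (at t)"
      by (simp add: algebra_simps)
  qed
  then show "Sm (rho g p) (rho g w) \<bullet> z = rho g (Sm p w) \<bullet> z"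
    unfolding z S rho_inner[OF g] by (simp add: A_def rho_one Sm_def inner_add_left)
qed

text \<open>\<open>Sm p\<close> has the eigenvalues \<open>\<mu> 1, \<mu> 2, \<mu> 2\<close> on the tangent space of the orbit and vanishes on its
  orthogonal complement, so that this polynomial in \<open>Sm p\<close> is the orthogonal projection.\<close>

definition PT :: "real^8 \<Rightarrow> real^8 \<Rightarrow> real^8" where
  "PT p w = (1 / \<mu> 1 + 1 / \<mu> 2) *\<^sub>R Sm p w - (1 / (\<mu> 1 * \<mu> 2)) *\<^sub>R Sm p (Sm p w)"

lemma PT_psi:
  assumes g: "g \<in> S3q"
  shows "PT (psi g) w = ((w \<bullet> rho g (U 1)) / \<mu> 1) *\<^sub>R rho g (U 1) + ((w \<bullet> rho g (U 2)) / \<mu> 2) *\<^sub>R rho g (U 2)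
      + ((w \<bullet> rho g (U 3)) / \<mu> 3) *\<^sub>R rho g (U 3)"
proof -
  define x where "x = rho (qconj g) w"
  have w: "w = rho g x"
    using g by (simp add: x_def rho_qconj)
  interpret L: linear "rho g" by (rule rho_linear[OF g])
  have S0: "Sm p0 x = (U 1 \<bullet> x) *\<^sub>R U 1 + (U 2 \<bullet> x) *\<^sub>R U 2 + (U 3 \<bullet> x) *\<^sub>R U 3" for x
    by (simp add: Sm_def U_def)
  have S1: "Sm p0 (Sm p0 x) = (\<mu> 1 * (U 1 \<bullet> x)) *\<^sub>R U 1 + (\<mu> 2 * (U 2 \<bullet> x)) *\<^sub>R U 2 + (\<mu> 3 * (U 3 \<bullet> x)) *\<^sub>R U 3"
    unfolding S0[of "Sm p0 x"] unfolding S0[of x] by (simp add: inner_add_right gram mult.commute)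
  have coef: "(1 / \<mu> 1 + 1 / \<mu> 2) * s - 1 / (\<mu> 1 * \<mu> 2) * (\<mu> k * s) = s / \<mu> k" for k s
  proof -
    have r: "(1 / a + 1 / b) * s - 1 / (a * b) * (a * s) = s / a" "(1 / a + 1 / b) * s - 1 / (a * b) * (b * s) = s / b"
      if "a > 0" "b > 0" for a b s :: real
      using that by (simp_all add: field_simps)
    have "\<mu> k = \<mu> 1 \<or> \<mu> k = \<mu> 2"
      using exhaust_3[of k] \<mu>(2) by metis
    then show ?thesis
      using r[OF \<mu>(1)[of 1] \<mu>(1)[of 2], of s] by metis
  qed
  have "PT p0 x = ((1 / \<mu> 1 + 1 / \<mu> 2) * (U 1 \<bullet> x) - 1 / (\<mu> 1 * \<mu> 2) * (\<mu> 1 * (U 1 \<bullet> x))) *\<^sub>R U 1 + ((1 / \<mu> 1 + 1 / \<mu> 2) * (U 2 \<bullet> x) - 1 / (\<mu> 1 * \<mu> 2) * (\<mu> 2 * (U 2 \<bullet> x))) *\<^sub>R U 2 + ((1 / \<mu> 1 + 1 / \<mu> 2) * (U 3 \<bullet> x) - 1 / (\<mu> 1 * \<mu> 2) * (\<mu> 3 * (U 3 \<bullet> x))) *\<^sub>R U 3"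
    unfolding PT_def S1 unfolding S0[of x]
    by (simp only: scaleR_right_distrib scaleR_left_diff_distrib scaleR_scaleR add_diff_eq diff_add_eq diff_diff_eq diff_diff_eq2 add_ac)
  then have "PT p0 x = ((U 1 \<bullet> x) / \<mu> 1) *\<^sub>R U 1 + ((U 2 \<bullet> x) / \<mu> 2) *\<^sub>R U 2 + ((U 3 \<bullet> x) / \<mu> 3) *\<^sub>R U 3"
    by (simp only: coef)
  moreover have "PT (psi g) w = rho g (PT p0 x)"
    unfolding PT_def psi_def w rho_Sm[OF g] by (simp add: L.diff L.scaleR)
  ultimately show ?thesis
    unfolding w rho_inner[OF g] by (simp add: L.add L.scaleR inner_commute)
qed

lemma C1map_PT: "C1map (\<lambda>p. PT p w)"
proof -
  have Y: "C1map (\<lambda>p. Y k *v p)" for k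
    by (rule C1map_linear[OF matrix_vector_mul_bounded_linear])
  have S: "C1map (\<lambda>p. Sm p (F p))" if F: "C1map F" for F
    unfolding Sm_def
    by (intro C1map_add C1map_bilinear[OF bounded_bilinear_scaleR] C1map_bilinear[OF bounded_bilinear_inner] Y F)
  have "PT p w = (1 / \<mu> 1 + 1 / \<mu> 2) *\<^sub>R Sm p w + (- (1 / (\<mu> 1 * \<mu> 2))) *\<^sub>R Sm p (Sm p w)" for p
    by (simp add: PT_def)
  then show ?thesis
    by (simp only:) (intro C1map_add C1map_bounded_linear[OF bounded_linear_scaleR_right] S C1map_const)
qed

end

section \<open>Infinitesimal rigidity\<close>

text \<open>The left-invariant derivative along the \<open>i\<close>-th frame field of the section with frame components
  \<open>f\<close> and \<open>nu\<close>, brought back to the base point; \<open>F\<close> and \<open>N\<close> are the derivatives of the components.\<close>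

definition frame_deriv :: "(3 \<Rightarrow> real^8^8) \<Rightarrow> (3 \<Rightarrow> real^8) \<Rightarrow> (3 \<Rightarrow> real) \<Rightarrow> (3 \<Rightarrow> real) \<Rightarrow> (3 \<Rightarrow> 3 \<Rightarrow> real) \<Rightarrow> 3 \<Rightarrow> real^8" where
  "frame_deriv Y Nn nu F N i = F i *\<^sub>R axis 0 1 + (N i 1 *\<^sub>R Nn 1 + N i 2 *\<^sub>R Nn 2 + N i 3 *\<^sub>R Nn 3)
     + (nu 1 *\<^sub>R (Y i *v Nn 1) + nu 2 *\<^sub>R (Y i *v Nn 2) + nu 3 *\<^sub>R (Y i *v Nn 3))"

text \<open>The left side of the linearised associative equation on the frame (U 1, U 2, U 3),
  tested against \<open>z\<close>, when the field has derivative \<open>D i\<close> along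
  \<open>U i\<close>.\<close>

definition assoc_form :: "(3 \<Rightarrow> real^8) \<Rightarrow> real^8 \<Rightarrow> (3 \<Rightarrow> real^8) \<Rightarrow> real" where
  "assoc_form U z D = Phi0 z (D 1) (U 2) (U 3) + Phi0 z (U 1) (D 2) (U 3) + Phi0 z (U 1) (U 2) (D 3)"

text \<open>Apart from \<open>special\<close> these are identities at the base point in free values
  \<open>nu\<close>, \<open>F\<close>, \<open>N\<close>. The term
  \<open>vol * (\<mu> k * nu k)\<close> in \<open>assoc_Nn\<close> equals the right side of the
  linearised equation, so equating the two leaves row \<open>k\<close> of
  \<open>frame_system\<close>; \<open>lag_form\<close> identifies the brackets of these rows with
  the linearised Lagrangian condition. In every instance \<open>vol\<close> squared is the product
  of the \<open>\<mu> k\<close>, as it must be on an associative orbit. \<open>minimal\<close> says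
  that the mean curvature in the unit sphere vanishes. \<open>special\<close> is the spectral input:
  a function that is constant on the fibres of the orbit map and orthogonal to linear functions
  pairs to 0 with every \<open>MM\<close> of eigenvalue 3.\<close>

locale rigid_lagrangian = homogeneous_lagrangian +
  assumes vol_eq: "Phi0 p0 (U 1) (U 2) (U 3) = vol"
    and assoc_e0: "assoc_form U (axis 0 1) (frame_deriv Y Nn nu F N) = vol * (N 1 1 + N 2 2 + N 3 3)"
    and assoc_Nn: "assoc_form U (Nn 1) (frame_deriv Y Nn nu F N) = vol * (\<mu> 1 * nu 1) - vol * F 1
        - \<mu> 1 * ((3 * vol - 2 * \<mu> 1) * nu 1 - (\<mu> 3 * N 2 3 - \<mu> 2 * N 3 2))"
      "assoc_form U (Nn 2) (frame_deriv Y Nn nu F N) = vol * (\<mu> 2 * nu 2) - vol * F 2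
        - \<mu> 2 * ((3 * vol - 2 * \<mu> 2) * nu 2 - (\<mu> 1 * N 3 1 - \<mu> 3 * N 1 3))"
      "assoc_form U (Nn 3) (frame_deriv Y Nn nu F N) = vol * (\<mu> 3 * nu 3) - vol * F 3
        - \<mu> 3 * ((3 * vol - 2 * \<mu> 3) * nu 3 - (\<mu> 2 * N 1 2 - \<mu> 1 * N 2 1))"
    and lag_form: "phi0 (nu 1 *\<^sub>R Nn 1 + nu 2 *\<^sub>R Nn 2 + nu 3 *\<^sub>R Nn 3) (U 1) (U 2)
        + phi0 p0 (frame_deriv Y Nn nu (\<lambda>_. 0) N 1) (U 2) + phi0 p0 (U 1) (frame_deriv Y Nn nu (\<lambda>_. 0) N 2)
        = (3 * vol - 2 * \<mu> 3) * nu 3 - (\<mu> 2 * N 1 2 - \<mu> 1 * N 2 1)"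
      "phi0 (nu 1 *\<^sub>R Nn 1 + nu 2 *\<^sub>R Nn 2 + nu 3 *\<^sub>R Nn 3) (U 2) (U 3)
        + phi0 p0 (frame_deriv Y Nn nu (\<lambda>_. 0) N 2) (U 3) + phi0 p0 (U 2) (frame_deriv Y Nn nu (\<lambda>_. 0) N 3)
        = (3 * vol - 2 * \<mu> 1) * nu 1 - (\<mu> 3 * N 2 3 - \<mu> 2 * N 3 2)"
      "phi0 (nu 1 *\<^sub>R Nn 1 + nu 2 *\<^sub>R Nn 2 + nu 3 *\<^sub>R Nn 3) (U 3) (U 1)
        + phi0 p0 (frame_deriv Y Nn nu (\<lambda>_. 0) N 3) (U 1) + phi0 p0 (U 3) (frame_deriv Y Nn nu (\<lambda>_. 0) N 1)
        = (3 * vol - 2 * \<mu> 2) * nu 2 - (\<mu> 1 * N 3 1 - \<mu> 3 * N 1 3)"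
    and minimal: "(1 / \<mu> 1) *\<^sub>R (Y 1 *v U 1) + (1 / \<mu> 2) *\<^sub>R (Y 2 *v U 2) + (1 / \<mu> 3) *\<^sub>R (Y 3 *v U 3) = - 3 *\<^sub>R p0"
    and special: "continuous_on S3q f \<Longrightarrow> (\<And>g h. g \<in> S3q \<Longrightarrow> h \<in> S3q \<Longrightarrow> rho g p0 = rho h p0 \<Longrightarrow> f g = f h) \<Longrightarrow>
        (\<And>w. mean (\<lambda>g. f g * (w \<bullet> rho g p0)) = 0) \<Longrightarrow>
        (real p - real q)\<^sup>2 / \<mu> 1 + 2 * (2 * real p * real q + real p + real q) / \<mu> 3 = 3 \<Longrightarrow>
        mean (\<lambda>g. f g * Re (MM \<alpha> \<beta> p q g)) = 0 \<and> mean (\<lambda>g. f g * Im (MM \<alpha> \<beta> p q g)) = 0"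

lemma frame_system_diff:
  assumes "frame_system \<mu> c f F nu N" "frame_system \<mu> c f' F' nu' N'"
  shows "frame_system \<mu> c (\<lambda>g. f g - f' g) (\<lambda>i g. F i g - F' i g) (\<lambda>k g. nu k g - nu' k g) (\<lambda>i k g. N i k g - N' i k g)"
proof -
  have e: "m * (a * (n - n') - (b * (y - y') - d * (z - z'))) + c * (r - r') = 0"
    if "m * (a * n - (b * y - d * z)) + c * r = 0" "m * (a * n' - (b * y' - d * z')) + c * r' = 0"
    for m a n n' b y y' d z z' r r' :: real
  proof -
    have "m * (a * (n - n') - (b * (y - y') - d * (z - z'))) + c * (r - r')
        = (m * (a * n - (b * y - d * z)) + c * r) - (m * (a * n' - (b * y' - d * z')) + c * r')"
      by (simp add: algebra_simps)
    then show ?thesis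
      by (simp only: that)
  qed
  show ?thesis
    using assms unfolding frame_system_def
    by (intro conjI allI ballI flow_deriv_diff continuous_on_diff e; (blast | simp))
qed

section \<open>Sections along the orbit and the projection onto linear functions\<close>

context homogeneous_lagrangian
begin

lemma flow_deriv_rho: "flow_deriv k (\<lambda>g. rho g x) (\<lambda>g. rho g (Y k *v x))"
  unfolding flow_deriv_def
proof
  fix g assume g: "g \<in> S3q"
  have "((\<lambda>t. rho g (rho (rot (axis k 1) t) x)) has_vector_derivative rho g (Yv (axis k 1) x)) (at 0)"
    using bounded_linear.has_vector_derivative[OF rho_linear[OF g, unfolded linear_conv_bounded_linear] rho_flow(1), of "axis k 1" x 0]
    by (simp add: rho_one)
  then show "((\<lambda>t. rho (qmult g (rot (axis k 1) t)) x) has_vector_derivative rho g (Y k *v x)) (at 0)"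
    using g by (simp add: rho_mult)
qed

lemma flow_deriv_psi: "flow_deriv k psi (\<lambda>g. rho g (U k))"
  unfolding psi_def U_def by (rule flow_deriv_rho)

lemma flow_deriv_inner_rho: "flow_deriv k (\<lambda>g. w \<bullet> rho g x) (\<lambda>g. w \<bullet> rho g (Y k *v x))"
  by (rule flow_deriv_bounded_linear[OF bounded_linear_inner_right flow_deriv_rho])

lemma flow_deriv_comp_psi:
  assumes "\<And>p. (V has_derivative V' p) (at p)"
  shows "flow_deriv k (\<lambda>g. V (psi g)) (\<lambda>g. V' (psi g) (rho g (U k)))"
  unfolding flow_deriv_def
proof
  fix g assume g: "g \<in> S3q"
  have "((V \<circ> (\<lambda>t. psi (qmult g (rot (axis k 1) t)))) has_vector_derivative V' (psi g) (rho g (U k))) (at 0)"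
    using vector_derivative_diff_chain_within[OF flow_derivD[OF flow_deriv_psi g], of V "V' (psi g)" k] assms[of "psi g"]
    by (simp add: has_derivative_at_withinI)
  then show "((\<lambda>t. V (psi (qmult g (rot (axis k 1) t)))) has_vector_derivative V' (psi g) (rho g (U k))) (at 0)"
    by (simp add: o_def)
qed

lemma continuous_on_deriv_psi:
  assumes "\<And>p. (V has_derivative V' p) (at p)" and "\<And>h. continuous_on UNIV (\<lambda>p. V' p h)"
  shows "continuous_on S3q (\<lambda>g. V' (psi g) (rho g x))"
proof -
  have eq: "V' p h = (\<Sum>b\<in>Basis. (h \<bullet> b) *\<^sub>R V' p b)" for p h
  proof -
    interpret L: bounded_linear "V' p"
      using assms(1) by (rule has_derivative_bounded_linear)
    have "V' p h = V' p (\<Sum>b\<in>Basis. (h \<bullet> b) *\<^sub>R b)"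
      by (simp add: euclidean_representation)
    then show ?thesis
      by (simp add: L.sum L.scaleR)
  qed
  have "continuous_on S3q (\<lambda>g. \<Sum>b\<in>Basis. (rho g x \<bullet> b) *\<^sub>R V' (psi g) b)"
    by (intro continuous_on_sum continuous_on_scaleR continuous_on_inner rho_cont continuous_on_const
        continuous_on_compose2[OF assms(2) continuous_on_psi]) auto
  then show ?thesis
    unfolding eq[symmetric] .
qed

text \<open>These are the normal equations A w = d of a least squares problem. The Gram operator
  \<open>A\<close> is singular when a linear function vanishes on the orbit, so solvability is shown
  through the part \<open>z\<close> of \<open>d\<close> orthogonal to the range: \<open>z\<close>
  vanishes on the orbit, hence pairs to 0 with \<open>f\<close>, hence is 0.\<close>

lemma linear_projection_exists:
  assumes f: "continuous_on S3q f"
  obtains w where "w $ 0 = 0" "\<And>w'. mean (\<lambda>g. (f g - w \<bullet> psi g) * (w' \<bullet> psi g)) = 0"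
proof -
  define B where "B = (\<lambda>w w'. mean (\<lambda>g. (w \<bullet> psi g) * (w' \<bullet> psi g)))"
  define l where "l = (\<lambda>w. mean (\<lambda>g. f g * (w \<bullet> psi g)))"
  have ci: "continuous_on S3q (\<lambda>g. w \<bullet> psi g)" for w
    by (intro continuous_on_inner continuous_on_const continuous_on_psi)
  have c2: "continuous_on S3q (\<lambda>g. (w \<bullet> psi g) * (w' \<bullet> psi g))" "continuous_on S3q (\<lambda>g. f g * (w \<bullet> psi g))" for w w'
    by (intro continuous_on_mult ci f)+
  have linB: "linear (\<lambda>w. B w w')" for w'
  proof (rule linearI)
    show "B (x + y) w' = B x w' + B y w'" for x y
      unfolding B_def by (simp add: inner_add_left distrib_right mean_add c2)
    show "B (r *\<^sub>R x) w' = r *\<^sub>R B x w'" for r x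
      unfolding B_def by (simp add: mult.assoc mean_cmult)
  qed
  have linl: "linear l"
  proof (rule linearI)
    show "l (x + y) = l x + l y" for x y
      unfolding l_def by (simp add: inner_add_left distrib_left mean_add c2)
    show "l (r *\<^sub>R x) = r *\<^sub>R l x" for r x
      unfolding l_def by (simp add: mult.left_commute mean_cmult)
  qed
  have symB: "B w w' = B w' w" for w w'
    by (simp add: B_def mult.commute)
  define A where "A = (\<lambda>w. \<Sum>i\<in>UNIV. B w (axis i 1) *\<^sub>R (axis i 1 :: real^8))"
  have Ai: "A w \<bullet> z = B w z" for w z
  proof -
    interpret L: linear "\<lambda>z. B w z"
      using linB[of w] by (simp add: symB[of w])
    have "B w z = B w (\<Sum>i\<in>UNIV. z $ i *\<^sub>R axis i 1)"
      by (simp add: basis_expansion[of z, unfolded scalar_mult_eq_scaleR])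
    also have "\<dots> = A w \<bullet> z"
      by (simp add: L.sum L.scaleR A_def inner_sum_left inner_axis' mult.commute)
    finally show ?thesis by simp
  qed
  define d where "d = (\<Sum>i\<in>UNIV. l (axis i 1) *\<^sub>R (axis i 1 :: real^8))"
  have di: "d \<bullet> z = l z" for z
  proof -
    interpret L: linear l by (rule linl)
    have "l z = l (\<Sum>i\<in>UNIV. z $ i *\<^sub>R axis i 1)"
      by (simp add: basis_expansion[of z, unfolded scalar_mult_eq_scaleR])
    also have "\<dots> = d \<bullet> z"
      by (simp add: L.sum L.scaleR d_def inner_sum_left inner_axis' mult.commute)
    finally show ?thesis by simp
  qed
  have linA: "linear A"
    by (rule linearI; rule eq_by_inner)
      (simp_all add: Ai inner_add_left linear_add[OF linB] linear_scale[OF linB])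
  have sub: "subspace (range A)"
    by (rule linear_subspace_image[OF linA subspace_UNIV])
  obtain y z where yz: "y \<in> span (range A)" "\<And>x. x \<in> span (range A) \<Longrightarrow> orthogonal z x" "d = y + z"
    using orthogonal_subspace_decomp_exists[of "range A" d] by blast
  then obtain w where w: "y = A w"
    using sub by (auto simp: span_eq_iff[THEN iffD2])
  have "B z z = 0"
    using yz(2)[of "A z"] by (simp add: span_base orthogonal_def Ai[symmetric] inner_commute)
  then have "(z \<bullet> psi g) * (z \<bullet> psi g) = 0" if "g \<in> S3q" for g
    using mean_pos_eq_0[of "\<lambda>g. (z \<bullet> psi g) * (z \<bullet> psi g)" g] c2(1) that by (simp add: B_def)
  then have z0: "z \<bullet> psi g = 0" if "g \<in> S3q" for g
    using that by simp
  have "l z = mean (\<lambda>g. 0)"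
    unfolding l_def by (rule mean_cong) (simp add: z0)
  then have "l z = 0"
    using mean_cmult[of 0 "\<lambda>_. 0"] by simp
  moreover have "z \<bullet> A w = 0"
    using yz(2)[of "A w"] by (simp add: span_base orthogonal_def)
  ultimately have "z \<bullet> z = 0"
    using di[of z] unfolding yz(3) w by (simp only: inner_add_left inner_commute[of "A w" z])
  then have dA: "d = A w"
    using yz(3) w by simp
  define w0 where "w0 = w - w $ 0 *\<^sub>R e0"
  have w0: "w0 \<bullet> psi g = w \<bullet> psi g" if "g \<in> S3q" for g
    using psi_nth0[OF that] by (simp add: w0_def inner_diff_left inner_axis' )
  have "mean (\<lambda>g. (f g - w0 \<bullet> psi g) * (w' \<bullet> psi g)) = 0" for w'
  proof -
    have "mean (\<lambda>g. (f g - w0 \<bullet> psi g) * (w' \<bullet> psi g)) = mean (\<lambda>g. f g * (w' \<bullet> psi g) - (w \<bullet> psi g) * (w' \<bullet> psi g))"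
      by (rule mean_cong) (simp add: w0 left_diff_distrib)
    also have "\<dots> = l w' - B w w'"
      by (simp add: mean_diff c2 l_def B_def)
    also have "\<dots> = 0"
      using di[of w'] Ai[of w w'] dA by simp
    finally show ?thesis .
  qed
  moreover have "w0 $ 0 = 0"
    by (simp add: w0_def axis_def)
  ultimately show ?thesis
    using that by blast
qed

end

text \<open>The complement of g2 in spin(7), which is a copy of R^7: row 0 is \<open>w\<close> and
  the 7 by 7 block is the contraction of \<open>phi0\<close> with \<open>w\<close>. The factor 1/3
  is forced by the equations of \<open>spin7I\<close>, since each coordinate occurs in three terms
  of \<open>phi0\<close>.\<close>

definition spin7_lift :: "real^8 \<Rightarrow> real^8^8" where
  "spin7_lift w = (\<chi> r s. if r = 0 then w $ s else if s = 0 then - w $ r else phi0 w (axis s 1) (axis r 1) / 3)"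

lemma spin7_lift:
  assumes "w $ 0 = 0"
  shows "spin7_lift w \<in> spin7"
proof (rule spin7I)
  show "spin7_lift w $ s $ r = - spin7_lift w $ r $ s" for r s
    using assms by (simp add: spin7_lift_def phi0_alternating(5)[of w "axis s 1"])
qed (simp_all add: spin7_lift_def phi0_def dx3_def det3_def axis_def)

lemma spin7_lift_mult:
  assumes w: "w $ 0 = 0" and p: "p $ 0 = 0"
  shows "spin7_lift w *v p = (w \<bullet> p) *\<^sub>R axis 0 1 - (1/3) *\<^sub>R Jmap p w"
proof (rule vec_eq_iff[THEN iffD2], rule allI)
  fix r :: 8
  show "(spin7_lift w *v p) $ r = ((w \<bullet> p) *\<^sub>R axis 0 1 - (1/3) *\<^sub>R Jmap p w) $ r"
  proof (cases "r = 0")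
    case True
    then show ?thesis
      by (simp add: spin7_lift_def matrix_vector_mult_def inner_vec_def Jmap_def sigmaNK_def phi0_def dx3_def det3_def axis_def)
  next
    case False
    interpret L: linear "\<lambda>x. phi0 w x (axis r 1)" by (rule linear_phi0)
    have "(spin7_lift w *v p) $ r = (\<Sum>s\<in>UNIV. p $ s * phi0 w (axis s 1) (axis r 1) / 3)"
      unfolding matrix_vector_mult_def vec_lambda_beta
      by (rule sum.cong) (use False p in \<open>auto simp: spin7_lift_def\<close>)
    also have "\<dots> = (\<Sum>s\<in>UNIV. p $ s * phi0 w (axis s 1) (axis r 1)) / 3"
      by (simp add: sum_divide_distrib)
    also have "(\<Sum>s\<in>UNIV. p $ s * phi0 w (axis s 1) (axis r 1)) = phi0 w (\<Sum>s\<in>UNIV. p $ s *\<^sub>R axis s 1) (axis r 1)"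
      by (simp add: L.sum L.scaleR)
    also have "(\<Sum>s\<in>UNIV. p $ s *\<^sub>R axis s 1) = p"
      by (rule basis_expansion[of p, unfolded scalar_mult_eq_scaleR])
    finally show ?thesis
      using False by (simp add: Jmap_def sigmaNK_def phi0_alternating(4)[of w p] axis_def)
  qed
qed

section \<open>Splitting off the deformation induced by Spin(7)\<close>

context rigid_lagrangian
begin

abbreviation D where "D nu F N \<equiv> frame_deriv Y Nn nu F N"

lemma e0_inner: "x \<bullet> e0 = x $ 0"
  by (simp add: inner_axis)

lemma normal_decomposition:
  assumes g: "g \<in> S3q" and n: "v \<bullet> psi g = 0" "\<And>k. v \<bullet> rho g (U k) = 0"
  shows "v = v $ 0 *\<^sub>R e0 + ((v \<bullet> rho g (Nn 1)) / \<mu> 1) *\<^sub>R rho g (Nn 1) + ((v \<bullet> rho g (Nn 2)) / \<mu> 2) *\<^sub>R rho g (Nn 2)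
     + ((v \<bullet> rho g (Nn 3)) / \<mu> 3) *\<^sub>R rho g (Nn 3)"
proof -
  define x where "x = rho (qconj g) v"
  have v: "v = rho g x"
    using g by (simp add: x_def rho_qconj)
  interpret L: linear "rho g" by (rule rho_linear[OF g])
  have x: "x \<bullet> p0 = 0" "x \<bullet> U k = 0" for k
    using n unfolding v psi_def rho_inner[OF g] by auto
  have "x = x $ 0 *\<^sub>R e0 + ((x \<bullet> Nn 1) / \<mu> 1) *\<^sub>R Nn 1 + ((x \<bullet> Nn 2) / \<mu> 2) *\<^sub>R Nn 2 + ((x \<bullet> Nn 3) / \<mu> 3) *\<^sub>R Nn 3"
    using frame[of x] by (simp add: x)
  then have "rho g x = rho g (x $ 0 *\<^sub>R e0 + ((x \<bullet> Nn 1) / \<mu> 1) *\<^sub>R Nn 1 + ((x \<bullet> Nn 2) / \<mu> 2) *\<^sub>R Nn 2 + ((x \<bullet> Nn 3) / \<mu> 3) *\<^sub>R Nn 3)"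
    by simp
  then show ?thesis
    unfolding v rho_inner[OF g] by (simp add: L.add L.scaleR rho_e0 g rho_nth0 p0_orth(4))
qed

lemma frame_deriv_of_section:
  assumes d: "\<And>p. (V has_derivative V' p) (at p)"
    and eq: "\<And>g. g \<in> S3q \<Longrightarrow> V (psi g) = f g *\<^sub>R e0 + (nu 1 g *\<^sub>R rho g (Nn 1) + nu 2 g *\<^sub>R rho g (Nn 2) + nu 3 g *\<^sub>R rho g (Nn 3))"
    and fd: "\<And>i. flow_deriv i f (F i)" "\<And>i k. flow_deriv i (nu k) (N i k)"
    and g: "g \<in> S3q"
  shows "V' (psi g) (rho g (U i)) = rho g (D (\<lambda>k. nu k g) (\<lambda>i. F i g) (\<lambda>i k. N i k g) i)"
proof -
  interpret L: linear "rho g" by (rule rho_linear[OF g])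
  have sc: "flow_deriv i (\<lambda>g. a g *\<^sub>R x g) (\<lambda>g. a g *\<^sub>R x' g + a' g *\<^sub>R x g)"
    if "flow_deriv i a a'" "flow_deriv i x x'" for a a' and x x' :: "quat \<Rightarrow> real^8"
    unfolding flow_deriv_def
  proof
    fix g assume g: "g \<in> S3q"
    show "((\<lambda>t. a (qmult g (rot (axis i 1) t)) *\<^sub>R x (qmult g (rot (axis i 1) t))) has_vector_derivative
        a g *\<^sub>R x' g + a' g *\<^sub>R x g) (at 0)"
      using bounded_bilinear.has_vector_derivative[OF bounded_bilinear_scaleR flow_derivD[OF that(1) g] flow_derivD[OF that(2) g]]
      by simp
  qed
  have 1: "flow_deriv i (\<lambda>g. V (psi g)) (\<lambda>g. V' (psi g) (rho g (U i)))"
    by (rule flow_deriv_comp_psi[OF d])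
  have 2: "flow_deriv i (\<lambda>g. f g *\<^sub>R e0 + (nu 1 g *\<^sub>R rho g (Nn 1) + nu 2 g *\<^sub>R rho g (Nn 2) + nu 3 g *\<^sub>R rho g (Nn 3)))
     (\<lambda>g. (f g *\<^sub>R 0 + F i g *\<^sub>R e0) + ((nu 1 g *\<^sub>R rho g (Y i *v Nn 1) + N i 1 g *\<^sub>R rho g (Nn 1))
       + (nu 2 g *\<^sub>R rho g (Y i *v Nn 2) + N i 2 g *\<^sub>R rho g (Nn 2)) + (nu 3 g *\<^sub>R rho g (Y i *v Nn 3) + N i 3 g *\<^sub>R rho g (Nn 3))))"
    by (intro flow_deriv_add sc fd flow_deriv_rho flow_deriv_const)
  have "V' (psi g) (rho g (U i)) = (f g *\<^sub>R 0 + F i g *\<^sub>R e0) + ((nu 1 g *\<^sub>R rho g (Y i *v Nn 1) + N i 1 g *\<^sub>R rho g (Nn 1))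
       + (nu 2 g *\<^sub>R rho g (Y i *v Nn 2) + N i 2 g *\<^sub>R rho g (Nn 2)) + (nu 3 g *\<^sub>R rho g (Y i *v Nn 3) + N i 3 g *\<^sub>R rho g (Nn 3)))"
    by (rule flow_deriv_unique[OF flow_deriv_cong[OF 1 eq refl] 2 g])
  then show ?thesis
    by (simp add: frame_deriv_def L.add L.scaleR rho_e0 g algebra_simps)
qed

text \<open>These are the frame components of the normal part of the field
  \<open>spin7_lift w *v p\<close>, namely the component (w, p) along \<open>axis 0 1\<close> and
  -1/3 times J of the tangential part of \<open>w\<close>. The divergence equation is minimality;
  the other three follow from the commutators of the generators.\<close>

lemma linear_frame_system:
  "frame_system \<mu> vol (\<lambda>g. w \<bullet> psi g) (\<lambda>i g. w \<bullet> rho g (U i))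
     (\<lambda>k g. - (1 / (3 * \<mu> k)) * (w \<bullet> rho g (U k))) (\<lambda>i k g. - (1 / (3 * \<mu> k)) * (w \<bullet> rho g (Y i *v U k)))"
  unfolding frame_system_def
proof (intro conjI allI ballI)
  show "flow_deriv i (\<lambda>g. w \<bullet> psi g) (\<lambda>g. w \<bullet> rho g (U i))" for i
    unfolding psi_def U_def by (rule flow_deriv_inner_rho)
  show "flow_deriv i (\<lambda>g. - (1 / (3 * \<mu> k)) * (w \<bullet> rho g (U k))) (\<lambda>g. - (1 / (3 * \<mu> k)) * (w \<bullet> rho g (Y i *v U k)))" for i k
    by (intro flow_deriv_cmult flow_deriv_inner_rho)
  show "continuous_on S3q (\<lambda>g. w \<bullet> psi g)" "continuous_on S3q (\<lambda>g. w \<bullet> rho g (U i))"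
    "continuous_on S3q (\<lambda>g. - (1 / (3 * \<mu> k)) * (w \<bullet> rho g (U k)))"
    "continuous_on S3q (\<lambda>g. - (1 / (3 * \<mu> k)) * (w \<bullet> rho g (Y i *v U k)))" for i k
    by (intro continuous_on_mult continuous_on_inner continuous_on_const continuous_on_psi rho_cont)+
next
  fix g assume g: "g \<in> S3q"
  interpret L: linear "rho g" by (rule rho_linear[OF g])
  have nz: "\<mu> k \<noteq> 0" for k
    using \<mu>(1)[of k] by simp
  have "w \<bullet> rho g ((1 / \<mu> 1) *\<^sub>R (Y 1 *v U 1) + (1 / \<mu> 2) *\<^sub>R (Y 2 *v U 2) + (1 / \<mu> 3) *\<^sub>R (Y 3 *v U 3)) = w \<bullet> rho g (- 3 *\<^sub>R p0)"
    by (simp only: minimal)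
  then have "(1 / \<mu> 1) * (w \<bullet> rho g (Y 1 *v U 1)) + (1 / \<mu> 2) * (w \<bullet> rho g (Y 2 *v U 2)) + (1 / \<mu> 3) * (w \<bullet> rho g (Y 3 *v U 3))
      = - 3 * (w \<bullet> psi g)"
    by (simp only: L.add L.scaleR inner_add_right inner_scaleR_right psi_def)
  then show "w \<bullet> psi g = - (1 / (3 * \<mu> 1)) * (w \<bullet> rho g (Y 1 *v U 1)) + - (1 / (3 * \<mu> 2)) * (w \<bullet> rho g (Y 2 *v U 2))
      + - (1 / (3 * \<mu> 3)) * (w \<bullet> rho g (Y 3 *v U 3))"
    by simp
  have comm: "w \<bullet> rho g (Y 1 *v U 2) - w \<bullet> rho g (Y 2 *v U 1) = - 2 * (w \<bullet> rho g (U 3))"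
    "w \<bullet> rho g (Y 2 *v U 3) - w \<bullet> rho g (Y 3 *v U 2) = - 2 * (w \<bullet> rho g (U 1))"
    "w \<bullet> rho g (Y 3 *v U 1) - w \<bullet> rho g (Y 1 *v U 3) = - 2 * (w \<bullet> rho g (U 2))"
    unfolding inner_diff_right[symmetric] L.diff[symmetric] U_def Y_comm by (simp_all only: L.scaleR inner_scaleR_right)
  have e: "m * ((3 * vol - 2 * m) * (- (1 / (3 * m)) * u) - (a * (- (1 / (3 * a)) * x) - b * (- (1 / (3 * b)) * y))) + vol * u = 0"
    if "x - y = - 2 * u" "m \<noteq> 0" "a \<noteq> 0" "b \<noteq> 0" for m a b u x y :: real
  proof -
    have x: "x = y - 2 * u"
      using that(1) by simp
    show ?thesis
      unfolding x using that(2-4) by (simp add: field_simps)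
  qed
  show "\<mu> 1 * ((3 * vol - 2 * \<mu> 1) * (- (1 / (3 * \<mu> 1)) * (w \<bullet> rho g (U 1))) - (\<mu> 3 * (- (1 / (3 * \<mu> 3)) * (w \<bullet> rho g (Y 2 *v U 3)))
      - \<mu> 2 * (- (1 / (3 * \<mu> 2)) * (w \<bullet> rho g (Y 3 *v U 2))))) + vol * (w \<bullet> rho g (U 1)) = 0"
    by (rule e[OF comm(2) nz nz nz])
  show "\<mu> 2 * ((3 * vol - 2 * \<mu> 2) * (- (1 / (3 * \<mu> 2)) * (w \<bullet> rho g (U 2))) - (\<mu> 1 * (- (1 / (3 * \<mu> 1)) * (w \<bullet> rho g (Y 3 *v U 1)))
      - \<mu> 3 * (- (1 / (3 * \<mu> 3)) * (w \<bullet> rho g (Y 1 *v U 3))))) + vol * (w \<bullet> rho g (U 2)) = 0"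
    by (rule e[OF comm(3) nz nz nz])
  show "\<mu> 3 * ((3 * vol - 2 * \<mu> 3) * (- (1 / (3 * \<mu> 3)) * (w \<bullet> rho g (U 3))) - (\<mu> 2 * (- (1 / (3 * \<mu> 2)) * (w \<bullet> rho g (Y 1 *v U 2)))
      - \<mu> 1 * (- (1 / (3 * \<mu> 1)) * (w \<bullet> rho g (Y 2 *v U 1))))) + vol * (w \<bullet> rho g (U 3)) = 0"
    by (rule e[OF comm(1) nz nz nz])
qed

lemma deformation_frame_system:
  assumes V: "assoc_inf_deformation M V" and d: "\<And>p. (V has_derivative V' p) (at p)"
    and cont: "\<And>h. continuous_on UNIV (\<lambda>p. V' p h)"
  defines "f \<equiv> \<lambda>g. V (psi g) $ 0" and "nu \<equiv> \<lambda>k g. (1 / \<mu> k) * (V (psi g) \<bullet> rho g (Nn k))"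
    and "F \<equiv> \<lambda>i g. V' (psi g) (rho g (U i)) $ 0"
    and "N \<equiv> \<lambda>i k g. (1 / \<mu> k) * (V (psi g) \<bullet> rho g (Y i *v Nn k) + V' (psi g) (rho g (U i)) \<bullet> rho g (Nn k))"
  shows "frame_system \<mu> vol f F nu N"
    and "\<And>g. g \<in> S3q \<Longrightarrow> V (psi g) = f g *\<^sub>R e0 + (nu 1 g *\<^sub>R rho g (Nn 1) + nu 2 g *\<^sub>R rho g (Nn 2) + nu 3 g *\<^sub>R rho g (Nn 3))"
proof -
  have tan: "rho g (U k) \<in> tangent_space M (psi g)" if "g \<in> S3q" for g k
    using tangentI[OF that, of "axis k 1"] by (simp add: U_def)
  have nrm: "V (psi g) \<bullet> psi g = 0" "V (psi g) \<bullet> rho g (U k) = 0" if "g \<in> S3q" for g k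
    using V psi_in_M[OF that] tan[OF that] by (auto simp: assoc_inf_deformation_def normal_field_S7_def)
  show eq: "V (psi g) = f g *\<^sub>R e0 + (nu 1 g *\<^sub>R rho g (Nn 1) + nu 2 g *\<^sub>R rho g (Nn 2) + nu 3 g *\<^sub>R rho g (Nn 3))"
    if "g \<in> S3q" for g
    using normal_decomposition[OF that nrm[OF that]] by (simp add: f_def nu_def add.assoc)
  have dV: "flow_deriv i (\<lambda>g. V (psi g)) (\<lambda>g. V' (psi g) (rho g (U i)))" for i
    by (rule flow_deriv_comp_psi[OF d])
  have df: "flow_deriv i f (F i)" for i
    unfolding f_def F_def by (rule flow_deriv_bounded_linear[OF bounded_linear_vec_nth dV])
  have dnu: "flow_deriv i (nu k) (N i k)" for i k
    unfolding nu_def N_def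
  proof (rule flow_deriv_cmult)
    show "flow_deriv i (\<lambda>g. V (psi g) \<bullet> rho g (Nn k)) (\<lambda>g. V (psi g) \<bullet> rho g (Y i *v Nn k) + V' (psi g) (rho g (U i)) \<bullet> rho g (Nn k))"
      unfolding flow_deriv_def
    proof
      fix g assume g: "g \<in> S3q"
      show "((\<lambda>t. V (psi (qmult g (rot (axis i 1) t))) \<bullet> rho (qmult g (rot (axis i 1) t)) (Nn k)) has_vector_derivative
          V (psi g) \<bullet> rho g (Y i *v Nn k) + V' (psi g) (rho g (U i)) \<bullet> rho g (Nn k)) (at 0)"
        using bounded_bilinear.has_vector_derivative[OF bounded_bilinear_inner flow_derivD[OF dV g] flow_derivD[OF flow_deriv_rho g]]
        by simp
    qed
  qed
  have cV: "continuous_on S3q (\<lambda>g. V (psi g))"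
  proof (rule continuous_on_compose2[OF _ continuous_on_psi])
    show "continuous_on UNIV V"
      using d has_derivative_continuous by (blast intro: continuous_at_imp_continuous_on)
  qed simp
  have cV': "continuous_on S3q (\<lambda>g. V' (psi g) (rho g x))" for x
    by (rule continuous_on_deriv_psi[OF d cont])
  have c: "continuous_on S3q f" "continuous_on S3q (F i)" "continuous_on S3q (nu k)" "continuous_on S3q (N i k)" for i k
    unfolding f_def F_def nu_def N_def
    by (intro continuous_on_mult continuous_on_add continuous_on_inner continuous_on_const cV cV' rho_cont
        bounded_linear.continuous_on[OF bounded_linear_vec_nth])+
  have eqs: "f g = N 1 1 g + N 2 2 g + N 3 3 g \<and>
       \<mu> 1 * ((3 * vol - 2*\<mu> 1) * nu 1 g - (\<mu> 3 * N 2 3 g - \<mu> 2 * N 3 2 g)) + vol * F 1 g = 0 \<and>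
       \<mu> 2 * ((3 * vol - 2*\<mu> 2) * nu 2 g - (\<mu> 1 * N 3 1 g - \<mu> 3 * N 1 3 g)) + vol * F 2 g = 0 \<and>
       \<mu> 3 * ((3 * vol - 2*\<mu> 3) * nu 3 g - (\<mu> 2 * N 1 2 g - \<mu> 1 * N 2 1 g)) + vol * F 3 g = 0" if g: "g \<in> S3q" for g
  proof -
    define G where "G = D (\<lambda>k. nu k g) (\<lambda>i. F i g) (\<lambda>i k. N i k g)"
    have G: "V' (psi g) (rho g (U i)) = rho g (G i)" for i
      unfolding G_def by (rule frame_deriv_of_section[OF d eq df dnu g])
    \<comment> \<open>\<open>rho g\<close> preserves \<open>Phi0\<close> and the inner product, so
      the equation at \<open>psi g\<close> is transported to the base point.\<close>
    have lin: "assoc_form U z G = vol * (V (psi g) \<bullet> rho g z)" if "p0 \<bullet> z = 0" for z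
      using assoc_linearised[OF V psi_in_M[OF g] tan[OF g, of 1] tan[OF g, of 2] tan[OF g, of 3] d, of "rho g z"]
      unfolding G by (simp add: psi_def rho_inner g that rho_Phi0 vol_eq assoc_form_def)
    have m: "\<mu> k * nu k g = V (psi g) \<bullet> rho g (Nn k)" for k
      using \<mu>(1)[of k] by (simp add: nu_def)
    have "p0 \<bullet> e0 = 0"
      by (simp add: e0_inner p0)
    from lin[OF this] have 0: "vol * (N 1 1 g + N 2 2 g + N 3 3 g) = vol * f g"
      unfolding G_def assoc_e0 by (simp add: rho_e0 g e0_inner f_def)
    note Nk = lin[OF p0_orth(3), folded m, unfolded G_def]
    show ?thesis
      using 0 Nk[of 1] Nk[of 2] Nk[of 3] vol unfolding assoc_Nn by simp
  qed
  show "frame_system \<mu> vol f F nu N"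
    unfolding frame_system_def using df dnu c eqs by blast
qed

theorem infinitesimal_rigidity:
  assumes V: "assoc_inf_deformation M V"
  shows "\<exists>v X. lag_inf_deformation M v \<and> X \<in> spin7 \<and>
           (\<forall>p\<in>M. V p - Jmap p (v p) - X *v p \<in> tangent_space M p)"
proof -
  have C1V: "C1map V"
    using V by (simp add: assoc_inf_deformation_def C1_field_iff)
  then obtain V' where d: "\<And>p. (V has_derivative V' p) (at p)" and cont: "\<And>h. continuous_on UNIV (\<lambda>p. V' p h)"
    unfolding C1map_def by blast
  define f where "f = (\<lambda>g. V (psi g) $ 0)"
  define nu where "nu = (\<lambda>k g. (1 / \<mu> k) * (V (psi g) \<bullet> rho g (Nn k)))"
  define F where "F = (\<lambda>i g. V' (psi g) (rho g (U i)) $ 0)"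
  define N where "N = (\<lambda>i k g. (1 / \<mu> k) * (V (psi g) \<bullet> rho g (Y i *v Nn k) + V' (psi g) (rho g (U i)) \<bullet> rho g (Nn k)))"
  have sys: "frame_system \<mu> vol f F nu N"
    and Veq: "\<And>g. g \<in> S3q \<Longrightarrow> V (psi g) = f g *\<^sub>R e0 + (nu 1 g *\<^sub>R rho g (Nn 1) + nu 2 g *\<^sub>R rho g (Nn 2) + nu 3 g *\<^sub>R rho g (Nn 3))"
    using deformation_frame_system[OF V d cont] unfolding f_def nu_def F_def N_def by blast+
  have cf: "continuous_on S3q f"
    using sys unfolding frame_system_def by blast
  \<comment> \<open>This vector determines the spin(7) element. Removing the linear part of
    \<open>f\<close> makes the rest orthogonal to all linear functions, which is the hypothesis of
    \<open>special\<close>.\<close>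
  obtain w where w: "w $ 0 = 0" "\<And>w'. mean (\<lambda>g. (f g - w \<bullet> psi g) * (w' \<bullet> psi g)) = 0"
    using linear_projection_exists[OF cf] by blast
  define f1 where "f1 = (\<lambda>g. f g - w \<bullet> psi g)"
  define F1 where "F1 = (\<lambda>i g. F i g - w \<bullet> rho g (U i))"
  define nu1 where "nu1 = (\<lambda>k g. nu k g - - (1 / (3 * \<mu> k)) * (w \<bullet> rho g (U k)))"
  define N1 where "N1 = (\<lambda>i k g. N i k g - - (1 / (3 * \<mu> k)) * (w \<bullet> rho g (Y i *v U k)))"
  have sys1: "frame_system \<mu> vol f1 F1 nu1 N1"
    unfolding f1_def F1_def nu1_def N1_def by (rule frame_system_diff[OF sys linear_frame_system])
  have cf1: "continuous_on S3q f1"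
    using sys1 unfolding frame_system_def by blast
  have psi_f1: "f1 g = f1 h" if "g \<in> S3q" "h \<in> S3q" "rho g p0 = rho h p0" for g h
    using that(3) by (simp add: f1_def f_def psi_def)
  have orth: "mean (\<lambda>g. f1 g * (w' \<bullet> rho g p0)) = 0" for w'
    using w(2) by (simp add: f1_def psi_def)
  have f10: "f1 g = 0" if "g \<in> S3q" for g
  proof (rule frame_system_eq_0[OF sys1 _ vol \<mu>(2) _ that])
    show "\<mu> k \<noteq> 0" for k
      using \<mu>(1)[of k] by simp
    show "mean (\<lambda>g. f1 g * Re (MM \<alpha> \<beta> p q g)) = 0 \<and> mean (\<lambda>g. f1 g * Im (MM \<alpha> \<beta> p q g)) = 0"
      if "(real p - real q)\<^sup>2 / \<mu> 1 + 2 * (2 * real p * real q + real p + real q) / \<mu> 3 = 3" for \<alpha> \<beta> p q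
      by (rule special[OF cf1 psi_f1 orth that])
  qed
  have fw: "f g = w \<bullet> psi g" if "g \<in> S3q" for g
    using f10[OF that] by (simp add: f1_def)
  have F10: "F1 i g = 0" if "g \<in> S3q" for i g
  proof (rule flow_deriv_unique[OF _ flow_deriv_const that])
    show "flow_deriv i (\<lambda>g. 0) (F1 i)"
      by (rule flow_deriv_cong[of i f1 "F1 i"]) (use sys1 f10 in \<open>auto simp: frame_system_def\<close>)
  qed
  have lag: "(3 * vol - 2*\<mu> 1) * nu1 1 g - (\<mu> 3 * N1 2 3 g - \<mu> 2 * N1 3 2 g) = 0"
    "(3 * vol - 2*\<mu> 2) * nu1 2 g - (\<mu> 1 * N1 3 1 g - \<mu> 3 * N1 1 3 g) = 0"
    "(3 * vol - 2*\<mu> 3) * nu1 3 g - (\<mu> 2 * N1 1 2 g - \<mu> 1 * N1 2 1 g) = 0" if g: "g \<in> S3q" for g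
  proof -
    have nz: "\<mu> k \<noteq> 0" for k
      using \<mu>(1)[of k] by simp
    have "\<mu> 1 * ((3 * vol - 2*\<mu> 1) * nu1 1 g - (\<mu> 3 * N1 2 3 g - \<mu> 2 * N1 3 2 g)) + vol * F1 1 g = 0 \<and>
       \<mu> 2 * ((3 * vol - 2*\<mu> 2) * nu1 2 g - (\<mu> 1 * N1 3 1 g - \<mu> 3 * N1 1 3 g)) + vol * F1 2 g = 0 \<and>
       \<mu> 3 * ((3 * vol - 2*\<mu> 3) * nu1 3 g - (\<mu> 2 * N1 1 2 g - \<mu> 1 * N1 2 1 g)) + vol * F1 3 g = 0"
      using sys1 g unfolding frame_system_def by blast
    then show "(3 * vol - 2*\<mu> 1) * nu1 1 g - (\<mu> 3 * N1 2 3 g - \<mu> 2 * N1 3 2 g) = 0"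
      "(3 * vol - 2*\<mu> 2) * nu1 2 g - (\<mu> 1 * N1 3 1 g - \<mu> 3 * N1 1 3 g) = 0"
      "(3 * vol - 2*\<mu> 3) * nu1 3 g - (\<mu> 2 * N1 1 2 g - \<mu> 1 * N1 2 1 g) = 0"
      using F10[OF g] nz by simp_all
  qed
  interpret J: bounded_bilinear Jmap
    using bilinear_Jmap by (simp add: bilinear_conv_bounded_bilinear)
  have Je0: "Jmap p0 e0 = 0"
    by (rule eq_by_inner) (simp add: Jmap_inner phi0_def dx3_def det3_def axis_def)
  \<comment> \<open>Along the orbit -J applied to \<open>V\<close> is the tangent field with
    coefficients \<open>nu\<close>, since J squares to -1 on the frame, and \<open>PT\<close> adds
    the tangential part of w / 3, which subtracts the spin(7) contribution. Written in this way,
    \<open>v\<close> is C^1 on all of R^8.\<close>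
  define v where "v = (\<lambda>q. (1/3) *\<^sub>R PT q w - Jmap q (V q))"
  have v_psi: "v (psi g) = rho g (nu1 1 g *\<^sub>R U 1 + nu1 2 g *\<^sub>R U 2 + nu1 3 g *\<^sub>R U 3)" if g: "g \<in> S3q" for g
  proof -
    interpret L: linear "rho g" by (rule rho_linear[OF g])
    have "V (psi g) = rho g (f g *\<^sub>R e0 + (nu 1 g *\<^sub>R Nn 1 + nu 2 g *\<^sub>R Nn 2 + nu 3 g *\<^sub>R Nn 3))"
      unfolding Veq[OF g] by (simp add: L.add L.scaleR rho_e0 g)
    then have "Jmap (psi g) (V (psi g)) = - rho g (nu 1 g *\<^sub>R U 1 + nu 2 g *\<^sub>R U 2 + nu 3 g *\<^sub>R U 3)"
      unfolding psi_def by (simp add: rho_Jmap g J.add_right J.scaleR_right Je0 J_Nn L.add L.scaleR L.neg)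
    then show ?thesis
      unfolding v_def PT_psi[OF g] nu1_def by (simp add: L.add L.scaleR algebra_simps)
  qed
  have N_psi: "Jmap (psi g) (v (psi g)) = 0 *\<^sub>R e0 + (nu1 1 g *\<^sub>R rho g (Nn 1) + nu1 2 g *\<^sub>R rho g (Nn 2) + nu1 3 g *\<^sub>R rho g (Nn 3))"
    if g: "g \<in> S3q" for g
  proof -
    interpret L: linear "rho g" by (rule rho_linear[OF g])
    show ?thesis
      unfolding v_psi[OF g] unfolding psi_def
      by (simp add: rho_Jmap g J.add_right J.scaleR_right Nn_def[symmetric] L.add L.scaleR)
  qed
  have C1v: "C1map v"
  proof -
    have "v = (\<lambda>q. (1/3) *\<^sub>R PT q w + (- 1) *\<^sub>R Jmap q (V q))"
      by (simp add: v_def fun_eq_iff)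
    then show ?thesis
      by (simp only:) (intro C1map_add C1map_bounded_linear[OF bounded_linear_scaleR_right] C1map_PT
          C1map_bilinear[OF J.bounded_bilinear_axioms] C1V C1map_linear[OF bounded_linear_ident])
  qed
  then have C1N: "C1map (\<lambda>q. Jmap q (v q))"
    by (intro C1map_bilinear[OF J.bounded_bilinear_axioms] C1map_linear[OF bounded_linear_ident])
  then obtain N' where dN: "\<And>p. ((\<lambda>q. Jmap q (v q)) has_derivative N' p) (at p)"
    unfolding C1map_def by blast
  have dnu1: "flow_deriv i (nu1 k) (N1 i k)" for i k
    using sys1 unfolding frame_system_def by blast
  have "lag_inf_deformation M v"
    unfolding lag_inf_deformation_def
  proof (intro conjI ballI)
    show "C1_field v"
      using C1v by (simp add: C1_field_iff)
    show "v p \<in> tangent_space M p" if p: "p \<in> M" for p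
    proof -
      obtain g where g: "g \<in> S3q" "p = psi g"
        using M_cases[OF p] by blast
      show ?thesis
        using tangentI[OF g(1), of "vector [nu1 1 g, nu1 2 g, nu1 3 g]"] by (simp add: g(2) v_psi[OF g(1)] Yv_p0)
    qed
    show "((\<lambda>t. let f = flowmap (\<lambda>q. Jmap q (v q)) t; D = frechet_derivative f (at p)
              in sigmaNK (f p) (D a) (D b)) has_real_derivative 0) (at 0)"
      if p: "p \<in> M" and a: "a \<in> tangent_space M p" and b: "b \<in> tangent_space M p" for p a b
    proof (rule lag_linearised[OF dN])
      obtain g where g: "g \<in> S3q" "p = psi g"
        using M_cases[OF p] by blast
      obtain x y where x: "a = rho g (Yv x p0)" and y: "b = rho g (Yv y p0)"
        using tangentE[OF g(1)] a b unfolding g(2) by metis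
      interpret L: linear "rho g" by (rule rho_linear[OF g(1)])
      interpret N': bounded_linear "N' p"
        using dN by (rule has_derivative_bounded_linear)
      define G where "G = D (\<lambda>k. nu1 k g) (\<lambda>_. 0) (\<lambda>i k. N1 i k g)"
      define W where "W = nu1 1 g *\<^sub>R Nn 1 + nu1 2 g *\<^sub>R Nn 2 + nu1 3 g *\<^sub>R Nn 3"
      have NU: "N' p (rho g (U i)) = rho g (G i)" for i
        unfolding G_def g(2)
        by (rule frame_deriv_of_section[where f = "\<lambda>_. 0" and F = "\<lambda>_ _. 0", OF dN N_psi flow_deriv_const dnu1 g(1)])
      have NY: "N' p (rho g (Yv x p0)) = rho g (x$1 *\<^sub>R G 1 + x$2 *\<^sub>R G 2 + x$3 *\<^sub>R G 3)" for x
        by (simp add: Yv_p0 L.add L.scaleR N'.add N'.scaleR NU)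
      \<comment> \<open>The linearised Lagrangian condition on a pair of frame vectors. It is
        alternating, so three values decide it, and these are the left sides of
        \<open>lag_form\<close>.\<close>
      define T where "T = (\<lambda>i j. phi0 W (U i) (U j) + phi0 p0 (G i) (U j) + phi0 p0 (U i) (G j))"
      have T0: "T 1 2 = 0" "T 2 3 = 0" "T 3 1 = 0"
        unfolding T_def W_def G_def
        using lag[OF g(1)] lag_form[where nu = "\<lambda>k. nu1 k g" and N = "\<lambda>i k. N1 i k g"] by (simp_all only:)
      have Ts: "T j i = - T i j" for i j
        using phi0_alternating(5)[of W "U i" "U j"] phi0_alternating(5)[of p0 "U i" "G j"]
          phi0_alternating(5)[of p0 "G i" "U j"] unfolding T_def by linarith
      have Tii: "T i i = 0" for i
        using Ts[of i i] by simp
      have "phi0 (Jmap p (v p)) a b + phi0 p (N' p a) b + phi0 p a (N' p b)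
          = phi0 W (Yv x p0) (Yv y p0) + phi0 p0 (x$1 *\<^sub>R G 1 + x$2 *\<^sub>R G 2 + x$3 *\<^sub>R G 3) (Yv y p0)
            + phi0 p0 (Yv x p0) (y$1 *\<^sub>R G 1 + y$2 *\<^sub>R G 2 + y$3 *\<^sub>R G 3)"
      proof -
        have "Jmap p (v p) = rho g W"
          unfolding g(2) N_psi[OF g(1)] W_def by (simp add: L.add L.scaleR)
        then show ?thesis
          unfolding x y NY using g by (simp add: psi_def rho_phi0)
      qed
      also have "\<dots> = x$1 * y$1 * T 1 1 + x$1 * y$2 * T 1 2 + x$1 * y$3 * T 1 3
          + x$2 * y$1 * T 2 1 + x$2 * y$2 * T 2 2 + x$2 * y$3 * T 2 3
          + x$3 * y$1 * T 3 1 + x$3 * y$2 * T 3 2 + x$3 * y$3 * T 3 3"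
        unfolding Yv_p0 T_def
        by (simp add: linear_add[OF linear_phi0(2)] linear_add[OF linear_phi0(3)]
            linear_scale[OF linear_phi0(2)] linear_scale[OF linear_phi0(3)] algebra_simps)
      also have "\<dots> = 0"
        using Ts[of 1 2] Ts[of 2 3] Ts[of 3 1] by (simp add: T0 Tii)
      finally show "phi0 (Jmap p (v p)) a b + phi0 p (N' p a) b + phi0 p a (N' p b) = 0" .
    qed
  qed
  moreover have "spin7_lift w \<in> spin7"
    by (rule spin7_lift[OF w(1)])
  moreover have "V p - Jmap p (v p) - spin7_lift w *v p \<in> tangent_space M p" if p: "p \<in> M" for p
  proof -
    obtain g where g: "g \<in> S3q" "p = psi g"
      using M_cases[OF p] by blast
    interpret L: linear "rho g" by (rule rho_linear[OF g(1)])
    define x where "x = rho (qconj g) w"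
    have wx: "w = rho g x"
      using g by (simp add: x_def rho_qconj)
    have "Jmap p0 x = Jmap p0 ((x \<bullet> p0) *\<^sub>R p0 + x $ 0 *\<^sub>R axis 0 1
        + ((x \<bullet> U 1) / \<mu> 1) *\<^sub>R U 1 + ((x \<bullet> U 2) / \<mu> 2) *\<^sub>R U 2 + ((x \<bullet> U 3) / \<mu> 3) *\<^sub>R U 3
        + ((x \<bullet> Nn 1) / \<mu> 1) *\<^sub>R Nn 1 + ((x \<bullet> Nn 2) / \<mu> 2) *\<^sub>R Nn 2 + ((x \<bullet> Nn 3) / \<mu> 3) *\<^sub>R Nn 3)"
      using frame[of x] by simp
    moreover have "Jmap p0 p0 = 0"
      by (rule eq_by_inner) (simp add: Jmap_inner phi0_alternating)
    ultimately have Jx: "Jmap p0 x = ((x \<bullet> U 1) / \<mu> 1) *\<^sub>R Nn 1 + ((x \<bullet> U 2) / \<mu> 2) *\<^sub>R Nn 2 + ((x \<bullet> U 3) / \<mu> 3) *\<^sub>R Nn 3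
        - ((x \<bullet> Nn 1) / \<mu> 1) *\<^sub>R U 1 - ((x \<bullet> Nn 2) / \<mu> 2) *\<^sub>R U 2 - ((x \<bullet> Nn 3) / \<mu> 3) *\<^sub>R U 3"
      by (simp add: J.add_right J.scaleR_right Je0 J_Nn Nn_def[symmetric])
    have Jw: "Jmap p w = rho g (Jmap p0 x)"
      unfolding wx g(2) psi_def by (rule rho_Jmap[OF g(1)])
    define b where "b = (\<lambda>k. (x \<bullet> Nn k) / \<mu> k)"
    define a where "a = (\<lambda>k. (x \<bullet> U k) / \<mu> k)"
    have n1: "nu1 k g = nu k g + (1/3) * a k" for k
      by (simp add: nu1_def a_def wx rho_inner g)
    have "V p - Jmap p (v p) - spin7_lift w *v p
        = rho g ((nu 1 g - nu1 1 g + (1/3) * a 1) *\<^sub>R Nn 1 + (nu 2 g - nu1 2 g + (1/3) * a 2) *\<^sub>R Nn 2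
          + (nu 3 g - nu1 3 g + (1/3) * a 3) *\<^sub>R Nn 3 - (1/3) *\<^sub>R (b 1 *\<^sub>R U 1 + b 2 *\<^sub>R U 2 + b 3 *\<^sub>R U 3))"
      unfolding spin7_lift_mult[OF w(1) psi_nth0[OF g(1), folded g(2)]] Jw Jx a_def b_def
      unfolding g(2) Veq[OF g(1)] N_psi[OF g(1)] fw[OF g(1)]
      by (simp add: L.add L.diff L.scaleR algebra_simps)
    \<comment> \<open>The coefficients of the \<open>Nn k\<close> cancel. What is left arises from J
      applied to the components of \<open>w\<close> along the \<open>Nn k\<close>, and is tangent to
      the orbit.\<close>
    also have "\<dots> = rho g (Yv (vector [- b 1 / 3, - b 2 / 3, - b 3 / 3]) p0)"
      unfolding n1 Yv_p0 by (simp add: L.add L.diff L.scaleR algebra_simps)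
    finally have "V p - Jmap p (v p) - spin7_lift w *v p = rho g (Yv (vector [- b 1 / 3, - b 2 / 3, - b 3 / 3]) p0)" .
    then show ?thesis
      using tangentI[OF g(1)] g(2) by simp
  qed
  ultimately show ?thesis
    by blast
qed

end

section \<open>The totally geodesic sphere\<close>

lemma mk8_axis: "mk8 a0 a1 a2 a3 a4 a5 a6 a7 = a0 *\<^sub>R axis 0 1 + a1 *\<^sub>R axis 1 1 + a2 *\<^sub>R axis 2 1 + a3 *\<^sub>R axis 3 1
    + a4 *\<^sub>R axis 4 1 + a5 *\<^sub>R axis 5 1 + a6 *\<^sub>R axis 6 1 + a7 *\<^sub>R axis 7 1"
  by (simp add: vec_eq_iff forall_8 axis_def)

lemma continuous_on_mk8:
  "continuous_on S a0 \<Longrightarrow> continuous_on S a1 \<Longrightarrow> continuous_on S a2 \<Longrightarrow> continuous_on S a3 \<Longrightarrow> continuous_on S a4 \<Longrightarrow>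
   continuous_on S a5 \<Longrightarrow> continuous_on S a6 \<Longrightarrow> continuous_on S a7 \<Longrightarrow>
   continuous_on S (\<lambda>g. mk8 (a0 g) (a1 g) (a2 g) (a3 g) (a4 g) (a5 g) (a6 g) (a7 g))"
  unfolding mk8_axis by (intro continuous_intros)

lemma has_vector_derivative_mk8:
  "(a0 has_real_derivative b0) F \<Longrightarrow> (a1 has_real_derivative b1) F \<Longrightarrow> (a2 has_real_derivative b2) F \<Longrightarrow>
   (a3 has_real_derivative b3) F \<Longrightarrow> (a4 has_real_derivative b4) F \<Longrightarrow> (a5 has_real_derivative b5) F \<Longrightarrow>
   (a6 has_real_derivative b6) F \<Longrightarrow> (a7 has_real_derivative b7) F \<Longrightarrow>
   ((\<lambda>t. mk8 (a0 t) (a1 t) (a2 t) (a3 t) (a4 t) (a5 t) (a6 t) (a7 t)) has_vector_derivative mk8 b0 b1 b2 b3 b4 b5 b6 b7) F"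
  unfolding mk8_axis has_real_derivative_iff_has_vector_derivative
  by (intro has_vector_derivative_add bounded_linear.has_vector_derivative[OF bounded_linear_scaleR_left])

lemma mk8_add: "mk8 a0 a1 a2 a3 a4 a5 a6 a7 + mk8 b0 b1 b2 b3 b4 b5 b6 b7
    = mk8 (a0 + b0) (a1 + b1) (a2 + b2) (a3 + b3) (a4 + b4) (a5 + b5) (a6 + b6) (a7 + b7)"
  by (simp add: vec_eq_iff forall_8)

lemma mk8_diff: "mk8 a0 a1 a2 a3 a4 a5 a6 a7 - mk8 b0 b1 b2 b3 b4 b5 b6 b7
    = mk8 (a0 - b0) (a1 - b1) (a2 - b2) (a3 - b3) (a4 - b4) (a5 - b5) (a6 - b6) (a7 - b7)"
  by (simp add: vec_eq_iff forall_8)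

lemma mk8_scaleR: "r *\<^sub>R mk8 a0 a1 a2 a3 a4 a5 a6 a7 = mk8 (r*a0) (r*a1) (r*a2) (r*a3) (r*a4) (r*a5) (r*a6) (r*a7)"
  by (simp add: vec_eq_iff forall_8)

lemma mk8_eq_iff: "mk8 a0 a1 a2 a3 a4 a5 a6 a7 = mk8 b0 b1 b2 b3 b4 b5 b6 b7 \<longleftrightarrow>
    a0 = b0 \<and> a1 = b1 \<and> a2 = b2 \<and> a3 = b3 \<and> a4 = b4 \<and> a5 = b5 \<and> a6 = b6 \<and> a7 = b7"
  by (simp add: vec_eq_iff forall_8)

lemma mk8_inner: "mk8 a0 a1 a2 a3 a4 a5 a6 a7 \<bullet> x = a0*x$0 + a1*x$1 + a2*x$2 + a3*x$3 + a4*x$4 + a5*x$5 + a6*x$6 + a7*x$7"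
  by (simp add: inner_vec_def sum_8)

lemma mk8_inner_right: "x \<bullet> mk8 a0 a1 a2 a3 a4 a5 a6 a7 = a0*x$0 + a1*x$1 + a2*x$2 + a3*x$3 + a4*x$4 + a5*x$5 + a6*x$6 + a7*x$7"
  by (simp add: inner_vec_def sum_8 mult.commute)

lemma axis0_mk8: "axis 0 1 = mk8 1 0 0 0 0 0 0 0"
  by (simp add: vec_eq_iff forall_8 axis_def)

text \<open>A general skew matrix on the coordinates 1 to 7, its arguments being the entries above
  the diagonal. As a function with values \<open>mk8\<close> it is evaluated by rewriting, without
  sums over indices.\<close>

definition skew8 :: "real \<Rightarrow> real \<Rightarrow> real \<Rightarrow> real \<Rightarrow> real \<Rightarrow> real \<Rightarrow> real \<Rightarrow> real \<Rightarrow> real \<Rightarrow> real \<Rightarrow> real \<Rightarrow> real \<Rightarrow> real \<Rightarrow> real \<Rightarrow> real \<Rightarrow>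
    real \<Rightarrow> real \<Rightarrow> real \<Rightarrow> real \<Rightarrow> real \<Rightarrow> real \<Rightarrow> real^8 \<Rightarrow> real^8" where
  "skew8 a12 a13 a14 a15 a16 a17 a23 a24 a25 a26 a27 a34 a35 a36 a37 a45 a46 a47 a56 a57 a67 x = mk8 0
     (a12*x$2 + a13*x$3 + a14*x$4 + a15*x$5 + a16*x$6 + a17*x$7)
     (- a12*x$1 + a23*x$3 + a24*x$4 + a25*x$5 + a26*x$6 + a27*x$7)
     (- a13*x$1 - a23*x$2 + a34*x$4 + a35*x$5 + a36*x$6 + a37*x$7)
     (- a14*x$1 - a24*x$2 - a34*x$3 + a45*x$5 + a46*x$6 + a47*x$7)
     (- a15*x$1 - a25*x$2 - a35*x$3 - a45*x$4 + a56*x$6 + a57*x$7)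
     (- a16*x$1 - a26*x$2 - a36*x$3 - a46*x$4 - a56*x$5 + a67*x$7)
     (- a17*x$1 - a27*x$2 - a37*x$3 - a47*x$4 - a57*x$5 - a67*x$6)"

lemma linear_skew8: "linear (skew8 a12 a13 a14 a15 a16 a17 a23 a24 a25 a26 a27 a34 a35 a36 a37 a45 a46 a47 a56 a57 a67)"
  by (rule linearI) (simp_all add: skew8_def mk8_add mk8_scaleR mk8_eq_iff algebra_simps)

lemma matrix_skew8_mult:
  "matrix (skew8 a12 a13 a14 a15 a16 a17 a23 a24 a25 a26 a27 a34 a35 a36 a37 a45 a46 a47 a56 a57 a67) *v x
    = skew8 a12 a13 a14 a15 a16 a17 a23 a24 a25 a26 a27 a34 a35 a36 a37 a45 a46 a47 a56 a57 a67 x"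
  by (rule matrix_works) (use linear_skew8 in \<open>simp add: linear_def scalar_mult_eq_scaleR[abs_def]\<close>)

lemma matrix_skew:
  fixes f :: "real^'n \<Rightarrow> real^'n"
  assumes "\<And>x y. f x \<bullet> y = - (x \<bullet> f y)"
  shows "matrix f $ r $ s = - matrix f $ s $ r"
proof -
  have "matrix f $ r $ s = f (axis s 1) \<bullet> axis r 1" for r s
    by (simp add: inner_axis matrix_def)
  then show ?thesis
    using assms by (metis inner_commute)
qed

lemma matrix_skew8_skew:
  "matrix (skew8 a12 a13 a14 a15 a16 a17 a23 a24 a25 a26 a27 a34 a35 a36 a37 a45 a46 a47 a56 a57 a67) $ r $ s = - matrix (skew8 a12 a13 a14 a15 a16 a17 a23 a24 a25 a26 a27 a34 a35 a36 a37 a45 a46 a47 a56 a57 a67) $ s $ r"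
  by (rule matrix_skew) (simp add: skew8_def inner_vec_def sum_8 algebra_simps)

text \<open>The equations of \<open>spin7I\<close> with row 0 equal to zero; they leave 21 - 7 = 14
  parameters, the dimension of g2.\<close>

lemma matrix_skew8_spin7:
  assumes "a23 + a45 + a67 = 0" "a46 = a13 + a57" "a12 = a47 + a56" "a37 = a15 + a26" "a14 + a27 + a36 = 0"
    "a24 = a17 + a35" "a16 = a25 + a34"
  shows "matrix (skew8 a12 a13 a14 a15 a16 a17 a23 a24 a25 a26 a27 a34 a35 a36 a37 a45 a46 a47 a56 a57 a67) \<in> spin7"
  by (rule spin7I[OF matrix_skew8_skew]) (use assms in \<open>simp_all add: matrix_def skew8_def axis_def\<close>)

lemma matrix_skew8_axis0:
  "matrix (skew8 a12 a13 a14 a15 a16 a17 a23 a24 a25 a26 a27 a34 a35 a36 a37 a45 a46 a47 a56 a57 a67) *v axis 0 1 = 0"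
  unfolding matrix_skew8_mult by (simp add: skew8_def vec_eq_iff forall_8 axis_def)

definition pick :: "'a \<Rightarrow> 'a \<Rightarrow> 'a \<Rightarrow> 3 \<Rightarrow> 'a" where
  "pick a b c k = (if k = 1 then a else if k = 2 then b else c)"

lemma pick_simps [simp]: "pick a b c 1 = a" "pick a b c 2 = b" "pick a b c 3 = c"
  by (simp_all add: pick_def)

lemma mean_linear_part:
  assumes "\<And>w. mean (\<lambda>g. f g * (w \<bullet> r g)) = 0" and "\<And>g. g \<in> S3q \<Longrightarrow> h g = w \<bullet> r g"
  shows "mean (\<lambda>g. f g * h g) = 0"
proof -
  have "mean (\<lambda>g. f g * h g) = mean (\<lambda>g. f g * (w \<bullet> r g))"
    by (rule mean_cong) (simp add: assms(2))
  then show ?thesis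
    by (simp add: assms(1))
qed

section \<open>The round sphere as an orbit of the standard representation on C^2\<close>

definition rhoS :: "quat \<Rightarrow> real^8 \<Rightarrow> real^8" where
  "rhoS g x = (let z2 = Complex (x$4) (x$5); z3 = Complex (x$6) (x$7); a = fst g; b = snd g;
      y2 = a * z2 - cnj b * z3; y3 = b * z2 + cnj a * z3
    in mk8 (x$0) (x$1) (x$2) (x$3) (Re y2) (Im y2) (Re y3) (Im y3))"

definition YS :: "3 \<Rightarrow> real^8^8" where
  "YS = pick (matrix (skew8 0 0 0 0 0 0 0 0 0 0 0 0 0 0 0 (-1) 0 0 0 0 1))
    (matrix (skew8 0 0 0 0 0 0 0 0 0 0 0 0 0 0 0 0 (-1) 0 0 (-1) 0))
    (matrix (skew8 0 0 0 0 0 0 0 0 0 0 0 0 0 0 0 0 0 (-1) 1 0 0))"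

lemma S3_homogeneous:
  "homogeneous_lagrangian rhoS YS (mk8 0 0 0 0 1 0 0 0) (\<lambda>_. 1) 1 S3_tg
     (pick (mk8 0 0 0 0 0 1 0 0) (mk8 0 0 0 0 0 0 1 0) (mk8 0 0 0 0 0 0 0 1))
     (pick (mk8 0 1 0 0 0 0 0 0) (mk8 0 0 1 0 0 0 0 0) (mk8 0 0 0 (-1) 0 0 0 0))"
proof (rule homogeneous_lagrangian.intro)
  fix g h :: quat and x :: "real^8" and u :: "real^3" and k i j :: 3 and r s :: 8
  show "linear (rhoS g)"
    by (rule linearI) (simp_all add: rhoS_def Let_def mk8_add mk8_scaleR mk8_eq_iff algebra_simps)
  show "rhoS (qmult g h) x = rhoS g (rhoS h x)"
    by (simp add: rhoS_def Let_def qmult_def mk8_eq_iff algebra_simps)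
  show "rhoS (1, 0) x = x"
    by (simp add: rhoS_def Let_def vec_eq_iff forall_8)
  show "continuous_on S3q (\<lambda>g. rhoS g x)"
    unfolding rhoS_def Let_def by (intro continuous_on_mk8 continuous_intros)
  show "((\<lambda>t. rhoS (rot u t) x) has_vector_derivative
      (u$1 *\<^sub>R (YS 1 *v x) + u$2 *\<^sub>R (YS 2 *v x) + u$3 *\<^sub>R (YS 3 *v x))) (at 0)"
    unfolding YS_def pick_simps matrix_skew8_mult skew8_def mk8_scaleR mk8_add rhoS_def Let_def rot_def
    by (rule has_vector_derivative_mk8) (auto intro!: derivative_eq_intros)
  show "YS k $ r $ s = - YS k $ s $ r"
    unfolding YS_def pick_def by (auto intro: matrix_skew8_skew)
  show "YS k \<in> spin7"
    unfolding YS_def pick_def by (auto intro: matrix_skew8_spin7)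
  show "YS k *v axis 0 1 = 0"
    unfolding YS_def pick_def by (auto intro: matrix_skew8_axis0)
  show "YS 1 *v (YS 2 *v x) - YS 2 *v (YS 1 *v x) = - 2 *\<^sub>R (YS 3 *v x)"
    "YS 2 *v (YS 3 *v x) - YS 3 *v (YS 2 *v x) = - 2 *\<^sub>R (YS 1 *v x)"
    "YS 3 *v (YS 1 *v x) - YS 1 *v (YS 3 *v x) = - 2 *\<^sub>R (YS 2 *v x)"
    unfolding YS_def pick_simps matrix_skew8_mult
    by (simp_all add: skew8_def mk8_diff mk8_scaleR mk8_eq_iff)
  show "norm (mk8 0 0 0 0 1 0 0 0) = 1"
    by (simp add: norm_eq_1 mk8_inner)
  show "S3_tg = (\<lambda>g. rhoS g (mk8 0 0 0 0 1 0 0 0)) ` S3q"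
  proof (intro equalityI subsetI)
    fix x assume "x \<in> S3_tg"
    then have x: "x$0 = 0" "x$1 = 0" "x$2 = 0" "x$3 = 0" "x \<bullet> x = 1"
      by (auto simp: S3_tg_def S6_def S7_def norm_eq_1)
    then have "(Complex (x$4) (x$5), Complex (x$6) (x$7)) \<in> S3q"
      by (simp add: S3q_sq inner_vec_def sum_8 power2_eq_square)
    moreover have "x = rhoS (Complex (x$4) (x$5), Complex (x$6) (x$7)) (mk8 0 0 0 0 1 0 0 0)"
      using x by (simp add: rhoS_def Let_def vec_eq_iff forall_8)
    ultimately show "x \<in> (\<lambda>g. rhoS g (mk8 0 0 0 0 1 0 0 0)) ` S3q"
      by blast
  next
    fix x assume "x \<in> (\<lambda>g. rhoS g (mk8 0 0 0 0 1 0 0 0)) ` S3q"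
    then show "x \<in> S3_tg"
      by (auto simp: S3_tg_def S6_def S7_def norm_eq_1 rhoS_def Let_def mk8_inner S3q_sq power2_eq_square)
  qed
  show "pick (mk8 0 0 0 0 0 1 0 0) (mk8 0 0 0 0 0 0 1 0) (mk8 0 0 0 0 0 0 0 1) k = YS k *v mk8 0 0 0 0 1 0 0 0"
    unfolding YS_def pick_def by (simp add: matrix_skew8_mult skew8_def mk8_eq_iff)
  show "pick (mk8 0 1 0 0 0 0 0 0) (mk8 0 0 1 0 0 0 0 0) (mk8 0 0 0 (-1) 0 0 0 0) k =
      Jmap (mk8 0 0 0 0 1 0 0 0) (pick (mk8 0 0 0 0 0 1 0 0) (mk8 0 0 0 0 0 0 1 0) (mk8 0 0 0 0 0 0 0 1) k)"
    unfolding pick_def by (simp add: Jmap_def sigmaNK_def phi0_def dx3_def det3_def vec_eq_iff forall_8 axis_def)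
  show "pick (mk8 0 0 0 0 0 1 0 0) (mk8 0 0 0 0 0 0 1 0) (mk8 0 0 0 0 0 0 0 1) i
      \<bullet> pick (mk8 0 0 0 0 0 1 0 0) (mk8 0 0 0 0 0 0 1 0) (mk8 0 0 0 0 0 0 0 1) j = (if i = j then 1 else 0)"
    using exhaust_3[of i] exhaust_3[of j] by (auto simp: mk8_inner)
  show "Jmap (mk8 0 0 0 0 1 0 0 0) (pick (mk8 0 1 0 0 0 0 0 0) (mk8 0 0 1 0 0 0 0 0) (mk8 0 0 0 (-1) 0 0 0 0) k)
      = - pick (mk8 0 0 0 0 0 1 0 0) (mk8 0 0 0 0 0 0 1 0) (mk8 0 0 0 0 0 0 0 1) k"
    unfolding pick_def by (simp add: Jmap_def sigmaNK_def phi0_def dx3_def det3_def vec_eq_iff forall_8 axis_def)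
qed (simp_all add: vec_eq_iff forall_8 mk8_inner mk8_inner_right axis_def)

text \<open>When the three \<open>\<mu> k\<close> agree, the eigenvalue depends on p + q only, as
  for the round metric.\<close>

lemma eigenvalue_round: "(p - q)\<^sup>2 + 2 * (2 * p * q + p + q) = (p + q)\<^sup>2 + 2 * (p + q)" for p q :: real
  by (simp add: power2_eq_square algebra_simps)

lemma S3_rigid:
  "rigid_lagrangian rhoS YS (mk8 0 0 0 0 1 0 0 0) (\<lambda>_. 1) 1 S3_tg
     (pick (mk8 0 0 0 0 0 1 0 0) (mk8 0 0 0 0 0 0 1 0) (mk8 0 0 0 0 0 0 0 1))
     (pick (mk8 0 1 0 0 0 0 0 0) (mk8 0 0 1 0 0 0 0 0) (mk8 0 0 0 (-1) 0 0 0 0))"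
proof (rule rigid_lagrangian.intro[OF S3_homogeneous], rule rigid_lagrangian_axioms.intro)
  fix nu F :: "3 \<Rightarrow> real" and N :: "3 \<Rightarrow> 3 \<Rightarrow> real"
  let ?U = "pick (mk8 0 0 0 0 0 1 0 0) (mk8 0 0 0 0 0 0 1 0) (mk8 0 0 0 0 0 0 0 1)"
  let ?n = "pick (mk8 0 1 0 0 0 0 0 0) (mk8 0 0 1 0 0 0 0 0) (mk8 0 0 0 (-1) 0 0 0 0)"
  have D: "frame_deriv YS ?n nu F N 1 = mk8 (F 1) (N 1 1) (N 1 2) (- N 1 3) 0 0 0 0"
    "frame_deriv YS ?n nu F N 2 = mk8 (F 2) (N 2 1) (N 2 2) (- N 2 3) 0 0 0 0"
    "frame_deriv YS ?n nu F N 3 = mk8 (F 3) (N 3 1) (N 3 2) (- N 3 3) 0 0 0 0" for F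
    by (simp_all add: frame_deriv_def YS_def matrix_skew8_mult skew8_def axis0_mk8 mk8_scaleR mk8_add)
  show "Phi0 (mk8 0 0 0 0 1 0 0 0) (?U 1) (?U 2) (?U 3) = 1"
    by (simp add: Phi0_dx4 dx4_def dx3_def det3_def)
  show "assoc_form ?U (axis 0 1) (frame_deriv YS ?n nu F N) = 1 * (N 1 1 + N 2 2 + N 3 3)"
    by (simp add: assoc_form_def D axis0_mk8 Phi0_dx4 dx4_def dx3_def det3_def)
  show "assoc_form ?U (?n 1) (frame_deriv YS ?n nu F N) = 1 * (1 * nu 1) - 1 * F 1
        - 1 * ((3 * 1 - 2 * 1) * nu 1 - (1 * N 2 3 - 1 * N 3 2))"
    "assoc_form ?U (?n 2) (frame_deriv YS ?n nu F N) = 1 * (1 * nu 2) - 1 * F 2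
        - 1 * ((3 * 1 - 2 * 1) * nu 2 - (1 * N 3 1 - 1 * N 1 3))"
    "assoc_form ?U (?n 3) (frame_deriv YS ?n nu F N) = 1 * (1 * nu 3) - 1 * F 3
        - 1 * ((3 * 1 - 2 * 1) * nu 3 - (1 * N 1 2 - 1 * N 2 1))"
    by (simp_all add: assoc_form_def D Phi0_dx4 dx4_def dx3_def det3_def)
  show "phi0 (nu 1 *\<^sub>R ?n 1 + nu 2 *\<^sub>R ?n 2 + nu 3 *\<^sub>R ?n 3) (?U 1) (?U 2)
        + phi0 (mk8 0 0 0 0 1 0 0 0) (frame_deriv YS ?n nu (\<lambda>_. 0) N 1) (?U 2)
        + phi0 (mk8 0 0 0 0 1 0 0 0) (?U 1) (frame_deriv YS ?n nu (\<lambda>_. 0) N 2)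
        = (3 * 1 - 2 * 1) * nu 3 - (1 * N 1 2 - 1 * N 2 1)"
      "phi0 (nu 1 *\<^sub>R ?n 1 + nu 2 *\<^sub>R ?n 2 + nu 3 *\<^sub>R ?n 3) (?U 2) (?U 3)
        + phi0 (mk8 0 0 0 0 1 0 0 0) (frame_deriv YS ?n nu (\<lambda>_. 0) N 2) (?U 3)
        + phi0 (mk8 0 0 0 0 1 0 0 0) (?U 2) (frame_deriv YS ?n nu (\<lambda>_. 0) N 3)
        = (3 * 1 - 2 * 1) * nu 1 - (1 * N 2 3 - 1 * N 3 2)"
      "phi0 (nu 1 *\<^sub>R ?n 1 + nu 2 *\<^sub>R ?n 2 + nu 3 *\<^sub>R ?n 3) (?U 3) (?U 1)
        + phi0 (mk8 0 0 0 0 1 0 0 0) (frame_deriv YS ?n nu (\<lambda>_. 0) N 3) (?U 1)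
        + phi0 (mk8 0 0 0 0 1 0 0 0) (?U 3) (frame_deriv YS ?n nu (\<lambda>_. 0) N 1)
        = (3 * 1 - 2 * 1) * nu 2 - (1 * N 3 1 - 1 * N 1 3)"
    by (simp_all add: D phi0_def dx3_def det3_def)
  show "(1 / 1) *\<^sub>R (YS 1 *v ?U 1) + (1 / 1) *\<^sub>R (YS 2 *v ?U 2) + (1 / 1) *\<^sub>R (YS 3 *v ?U 3) = - 3 *\<^sub>R mk8 0 0 0 0 1 0 0 0"
    by (simp add: YS_def matrix_skew8_mult skew8_def mk8_scaleR mk8_add mk8_eq_iff)
next
  fix f :: "quat \<Rightarrow> real" and p q :: nat and \<alpha> \<beta> :: complex
  assume lin: "\<And>w. mean (\<lambda>g. f g * (w \<bullet> rhoS g (mk8 0 0 0 0 1 0 0 0))) = 0"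
    and ev: "(real p - real q)\<^sup>2 / 1 + 2 * (2 * real p * real q + real p + real q) / 1 = 3"
  define n where "n = real p + real q"
  \<comment> \<open>The eigenvalue condition is n (n + 2) = 3, so n = 1; X and Y are themselves
    restrictions of linear functions.\<close>
  have "(n + 3) * (n - 1) = 0"
    using ev eigenvalue_round[of "real p" "real q"] by (simp add: n_def power2_eq_square algebra_simps)
  then have "p + q = 1"
    by (auto simp: n_def)
  then consider "p = 1" "q = 0" | "p = 0" "q = 1"
    by linarith
  then show "mean (\<lambda>g. f g * Re (MM \<alpha> \<beta> p q g)) = 0 \<and> mean (\<lambda>g. f g * Im (MM \<alpha> \<beta> p q g)) = 0"
  proof cases
    case 1
    show ?thesis
    proof (intro conjI mean_linear_part[OF lin])
      show "Re (MM \<alpha> \<beta> p q g) = mk8 0 0 0 0 (Re \<alpha>) (- Im \<alpha>) (Re \<beta>) (- Im \<beta>) \<bullet> rhoS g (mk8 0 0 0 0 1 0 0 0)" for g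
        by (simp add: 1 MM_def XX_def rhoS_def Let_def mk8_inner)
      show "Im (MM \<alpha> \<beta> p q g) = mk8 0 0 0 0 (Im \<alpha>) (Re \<alpha>) (Im \<beta>) (Re \<beta>) \<bullet> rhoS g (mk8 0 0 0 0 1 0 0 0)" for g
        by (simp add: 1 MM_def XX_def rhoS_def Let_def mk8_inner)
    qed
  next
    case 2
    show ?thesis
    proof (intro conjI mean_linear_part[OF lin])
      show "Re (MM \<alpha> \<beta> p q g) = mk8 0 0 0 0 (Re \<beta>) (Im \<beta>) (- Re \<alpha>) (- Im \<alpha>) \<bullet> rhoS g (mk8 0 0 0 0 1 0 0 0)" for g
        by (simp add: 2 MM_def YY_def rhoS_def Let_def mk8_inner)
      show "Im (MM \<alpha> \<beta> p q g) = mk8 0 0 0 0 (Im \<beta>) (- Re \<beta>) (- Im \<alpha>) (Re \<alpha>) \<bullet> rhoS g (mk8 0 0 0 0 1 0 0 0)" for g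
        by (simp add: 2 MM_def YY_def rhoS_def Let_def mk8_inner)
    qed
  qed
qed

section \<open>The orbit L1\<close>

lemma sqrt5: "sqrt 5 * (sqrt 5 * x) = 5 * x" for x :: real
  by (simp flip: mult.assoc)

text \<open>The action \<open>act1\<close> on a point given by coordinates, with the coordinate 0
  added as a fixed one and the squared moduli expanded into polynomials. As a representation R^7
  splits into a 3-dimensional and a 4-dimensional real summand.\<close>

definition rho1 :: "quat \<Rightarrow> real^8 \<Rightarrow> real^8" where
  "rho1 g x = (let a = fst g; b = snd g; z1 = Complex (x$2) (x$3); z2 = Complex (x$4) (x$5); z3 = Complex (x$6) (x$7);
      y1 = 2 * \<i> * cnj a * b * of_real (x$1) + (cnj a)\<^sup>2 * z1 + b\<^sup>2 * cnj z1;
      y2 = a * z2 - cnj b * cnj z3; y3 = cnj b * cnj z2 + a * z3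
    in mk8 (x$0) (((Re a)\<^sup>2 + (Im a)\<^sup>2 - (Re b)\<^sup>2 - (Im b)\<^sup>2) * x$1 - 2 * Im (cnj a * cnj b * z1))
      (Re y1) (Im y1) (Re y2) (Im y2) (Re y3) (Im y3))"

definition Y1 :: "3 \<Rightarrow> real^8^8" where
  "Y1 = pick (matrix (skew8 0 0 0 0 0 0 2 0 0 0 0 0 0 0 0 (-1) 0 0 0 0 (-1)))
    (matrix (skew8 0 (-2) 0 0 0 0 0 0 0 0 0 0 0 0 0 0 (-1) 0 0 1 0))
    (matrix (skew8 2 0 0 0 0 0 0 0 0 0 0 0 0 0 0 0 0 1 1 0 0))"

lemma L1_homogeneous:
  "homogeneous_lagrangian rho1 Y1 (mk8 0 (sqrt 5 / 3) 0 0 (2 / 3) 0 0 0) (pick (4/9) (8/3) (8/3)) (16/9) L1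
     (pick (mk8 0 0 0 0 0 (2/3) 0 0) (mk8 0 0 0 (2 * sqrt 5 / 3) 0 0 (2/3) 0) (mk8 0 0 (- 2 * sqrt 5 / 3) 0 0 0 0 (- 2/3)))
     (pick (mk8 0 (4/9) 0 0 (- 2 * sqrt 5 / 9) 0 0 0) (mk8 0 0 (- 2/3) 0 0 0 0 (2 * sqrt 5 / 3)) (mk8 0 0 0 (- 2/3) 0 0 (2 * sqrt 5 / 3) 0))"
proof (rule homogeneous_lagrangian.intro)
  fix g h :: quat and x :: "real^8" and u :: "real^3" and k i j :: 3 and r s :: 8
  let ?p = "mk8 0 (sqrt 5 / 3) 0 0 (2 / 3) 0 0 0"
  let ?U = "(pick (mk8 0 0 0 0 0 (2/3) 0 0) (mk8 0 0 0 (2 * sqrt 5 / 3) 0 0 (2/3) 0) (mk8 0 0 (- 2 * sqrt 5 / 3) 0 0 0 0 (- 2/3)))"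
  let ?n = "(pick (mk8 0 (4/9) 0 0 (- 2 * sqrt 5 / 9) 0 0 0) (mk8 0 0 (- 2/3) 0 0 0 0 (2 * sqrt 5 / 3)) (mk8 0 0 0 (- 2/3) 0 0 (2 * sqrt 5 / 3) 0))"
  let ?m = "(pick (4/9) (8/3) (8/3)) :: 3 \<Rightarrow> real"
  show "linear (rho1 g)"
    by (rule linearI) (simp_all add: rho1_def Let_def mk8_add mk8_scaleR mk8_eq_iff algebra_simps)
  show "rho1 (qmult g h) x = rho1 g (rho1 h x)"
    by (simp add: rho1_def Let_def qmult_def mk8_eq_iff power2_eq_square) (simp add: algebra_simps)
  show "rho1 (1, 0) x = x"
    by (simp add: rho1_def Let_def vec_eq_iff forall_8)
  show "continuous_on S3q (\<lambda>g. rho1 g x)"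
    unfolding rho1_def Let_def by (intro continuous_on_mk8 continuous_intros)
  show "((\<lambda>t. rho1 (rot u t) x) has_vector_derivative
      (u$1 *\<^sub>R (Y1 1 *v x) + u$2 *\<^sub>R (Y1 2 *v x) + u$3 *\<^sub>R (Y1 3 *v x))) (at 0)"
    unfolding Y1_def pick_simps matrix_skew8_mult skew8_def mk8_scaleR mk8_add rho1_def Let_def rot_def
    by (rule has_vector_derivative_mk8) (auto intro!: derivative_eq_intros simp: power2_eq_square)
  show "Y1 k $ r $ s = - Y1 k $ s $ r"
    unfolding Y1_def pick_def by (auto intro: matrix_skew8_skew)
  show "Y1 k \<in> spin7"
    unfolding Y1_def pick_def by (auto intro: matrix_skew8_spin7)
  show "Y1 k *v axis 0 1 = 0"
    unfolding Y1_def pick_def by (auto intro: matrix_skew8_axis0)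
  show "Y1 1 *v (Y1 2 *v x) - Y1 2 *v (Y1 1 *v x) = - 2 *\<^sub>R (Y1 3 *v x)"
    "Y1 2 *v (Y1 3 *v x) - Y1 3 *v (Y1 2 *v x) = - 2 *\<^sub>R (Y1 1 *v x)"
    "Y1 3 *v (Y1 1 *v x) - Y1 1 *v (Y1 3 *v x) = - 2 *\<^sub>R (Y1 2 *v x)"
    unfolding Y1_def pick_simps matrix_skew8_mult
    by (simp_all add: skew8_def mk8_diff mk8_scaleR mk8_eq_iff algebra_simps sqrt5)
  show "norm ?p = 1"
    by (simp add: norm_eq_1 mk8_inner power2_eq_square sqrt5)
  show "?p $ 0 = 0"
    by simp
  show "L1 = (\<lambda>g. rho1 g ?p) ` S3q"
  proof -
    have "act1 a b (sqrt 5 / 3) 0 (2/3) 0 = rho1 (a, b) ?p" for a b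
      by (simp add: act1_def from7_def rho1_def Let_def mk8_eq_iff cmod_power2)
    moreover have "su2 = S3q"
      by (auto simp: su2_def S3q_def)
    ultimately show ?thesis
      by (force simp: L1_def)
  qed
  show "0 < ?m k" "?m 2 = ?m 3" "((16/9)::real) \<noteq> 0"
    by (simp_all add: pick_def)
  show "?U k = Y1 k *v ?p"
    unfolding Y1_def pick_def by (simp add: matrix_skew8_mult skew8_def mk8_eq_iff sqrt5)
  show "?n k = Jmap ?p (?U k)"
    unfolding pick_def by (simp add: Jmap_def sigmaNK_def phi0_def dx3_def det3_def vec_eq_iff forall_8 axis_def algebra_simps sqrt5)
  show "?U i \<bullet> ?U j = (if i = j then ?m i else 0)"
    using exhaust_3[of i] exhaust_3[of j] by (auto simp: mk8_inner sqrt5)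
  show "Jmap ?p (?n k) = - ?U k"
    unfolding pick_def by (simp add: Jmap_def sigmaNK_def phi0_def dx3_def det3_def vec_eq_iff forall_8 axis_def algebra_simps sqrt5)
  show "x = (x \<bullet> ?p) *\<^sub>R ?p + x $ 0 *\<^sub>R axis 0 1
        + ((x \<bullet> ?U 1) / ?m 1) *\<^sub>R ?U 1 + ((x \<bullet> ?U 2) / ?m 2) *\<^sub>R ?U 2 + ((x \<bullet> ?U 3) / ?m 3) *\<^sub>R ?U 3
        + ((x \<bullet> ?n 1) / ?m 1) *\<^sub>R ?n 1 + ((x \<bullet> ?n 2) / ?m 2) *\<^sub>R ?n 2 + ((x \<bullet> ?n 3) / ?m 3) *\<^sub>R ?n 3"
    by (simp add: vec_eq_iff forall_8 mk8_inner_right axis_def algebra_simps add_divide_distrib diff_divide_distrib sqrt5)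
qed

lemma L1_rigid:
  "rigid_lagrangian rho1 Y1 (mk8 0 (sqrt 5 / 3) 0 0 (2 / 3) 0 0 0) (pick (4/9) (8/3) (8/3)) (16/9) L1
     (pick (mk8 0 0 0 0 0 (2/3) 0 0) (mk8 0 0 0 (2 * sqrt 5 / 3) 0 0 (2/3) 0) (mk8 0 0 (- 2 * sqrt 5 / 3) 0 0 0 0 (- 2/3)))
     (pick (mk8 0 (4/9) 0 0 (- 2 * sqrt 5 / 9) 0 0 0) (mk8 0 0 (- 2/3) 0 0 0 0 (2 * sqrt 5 / 3)) (mk8 0 0 0 (- 2/3) 0 0 (2 * sqrt 5 / 3) 0))"
proof (rule rigid_lagrangian.intro[OF L1_homogeneous], rule rigid_lagrangian_axioms.intro)
  fix nu F :: "3 \<Rightarrow> real" and N :: "3 \<Rightarrow> 3 \<Rightarrow> real"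
  let ?p = "mk8 0 (sqrt 5 / 3) 0 0 (2 / 3) 0 0 0"
  let ?U = "(pick (mk8 0 0 0 0 0 (2/3) 0 0) (mk8 0 0 0 (2 * sqrt 5 / 3) 0 0 (2/3) 0) (mk8 0 0 (- 2 * sqrt 5 / 3) 0 0 0 0 (- 2/3)))"
  let ?n = "(pick (mk8 0 (4/9) 0 0 (- 2 * sqrt 5 / 9) 0 0 0) (mk8 0 0 (- 2/3) 0 0 0 0 (2 * sqrt 5 / 3)) (mk8 0 0 0 (- 2/3) 0 0 (2 * sqrt 5 / 3) 0))"
  let ?m = "(pick (4/9) (8/3) (8/3)) :: 3 \<Rightarrow> real"
  let ?v = "(16/9) :: real"
  note expand = frame_deriv_def Y1_def matrix_skew8_mult skew8_def axis0_mk8 mk8_scaleR mk8_add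
  show "Phi0 ?p (?U 1) (?U 2) (?U 3) = ?v"
    by (simp add: Phi0_dx4 dx4_def dx3_def det3_def sqrt5)
  show "assoc_form ?U (axis 0 1) (frame_deriv Y1 ?n nu F N) = ?v * (N 1 1 + N 2 2 + N 3 3)"
    by (simp add: assoc_form_def expand Phi0_dx4 dx4_def dx3_def det3_def algebra_simps sqrt5)
  show "assoc_form ?U (?n 1) (frame_deriv Y1 ?n nu F N) = ?v * (?m 1 * nu 1) - ?v * F 1
        - ?m 1 * ((3 * ?v - 2 * ?m 1) * nu 1 - (?m 3 * N 2 3 - ?m 2 * N 3 2))"
    by (simp add: assoc_form_def expand Phi0_dx4 dx4_def dx3_def det3_def algebra_simps sqrt5)
  show "assoc_form ?U (?n 2) (frame_deriv Y1 ?n nu F N) = ?v * (?m 2 * nu 2) - ?v * F 2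
        - ?m 2 * ((3 * ?v - 2 * ?m 2) * nu 2 - (?m 1 * N 3 1 - ?m 3 * N 1 3))"
    by (simp add: assoc_form_def expand Phi0_dx4 dx4_def dx3_def det3_def algebra_simps sqrt5)
  show "assoc_form ?U (?n 3) (frame_deriv Y1 ?n nu F N) = ?v * (?m 3 * nu 3) - ?v * F 3
        - ?m 3 * ((3 * ?v - 2 * ?m 3) * nu 3 - (?m 2 * N 1 2 - ?m 1 * N 2 1))"
    by (simp add: assoc_form_def expand Phi0_dx4 dx4_def dx3_def det3_def algebra_simps sqrt5)
  show "phi0 (nu 1 *\<^sub>R ?n 1 + nu 2 *\<^sub>R ?n 2 + nu 3 *\<^sub>R ?n 3) (?U 1) (?U 2)
        + phi0 ?p (frame_deriv Y1 ?n nu (\<lambda>_. 0) N 1) (?U 2) + phi0 ?p (?U 1) (frame_deriv Y1 ?n nu (\<lambda>_. 0) N 2)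
        = (3 * ?v - 2 * ?m 3) * nu 3 - (?m 2 * N 1 2 - ?m 1 * N 2 1)"
    "phi0 (nu 1 *\<^sub>R ?n 1 + nu 2 *\<^sub>R ?n 2 + nu 3 *\<^sub>R ?n 3) (?U 2) (?U 3)
        + phi0 ?p (frame_deriv Y1 ?n nu (\<lambda>_. 0) N 2) (?U 3) + phi0 ?p (?U 2) (frame_deriv Y1 ?n nu (\<lambda>_. 0) N 3)
        = (3 * ?v - 2 * ?m 1) * nu 1 - (?m 3 * N 2 3 - ?m 2 * N 3 2)"
    "phi0 (nu 1 *\<^sub>R ?n 1 + nu 2 *\<^sub>R ?n 2 + nu 3 *\<^sub>R ?n 3) (?U 3) (?U 1)
        + phi0 ?p (frame_deriv Y1 ?n nu (\<lambda>_. 0) N 3) (?U 1) + phi0 ?p (?U 3) (frame_deriv Y1 ?n nu (\<lambda>_. 0) N 1)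
        = (3 * ?v - 2 * ?m 2) * nu 2 - (?m 1 * N 3 1 - ?m 3 * N 1 3)"
    by (simp_all add: expand phi0_def dx3_def det3_def algebra_simps sqrt5)
  show "(1 / ?m 1) *\<^sub>R (Y1 1 *v ?U 1) + (1 / ?m 2) *\<^sub>R (Y1 2 *v ?U 2) + (1 / ?m 3) *\<^sub>R (Y1 3 *v ?U 3) = - 3 *\<^sub>R ?p"
    by (simp add: expand mk8_eq_iff sqrt5)
next
  fix f :: "quat \<Rightarrow> real" and p q :: nat and \<alpha> \<beta> :: complex
  let ?p = "mk8 0 (sqrt 5 / 3) 0 0 (2 / 3) 0 0 0"
  let ?m = "(pick (4/9) (8/3) (8/3)) :: 3 \<Rightarrow> real"
  assume cont: "continuous_on S3q f"
    and inv: "\<And>g h. g \<in> S3q \<Longrightarrow> h \<in> S3q \<Longrightarrow> rho1 g ?p = rho1 h ?p \<Longrightarrow> f g = f h"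
    and lin: "\<And>w. mean (\<lambda>g. f g * (w \<bullet> rho1 g ?p)) = 0"
    and ev: "(real p - real q)\<^sup>2 / ?m 1 + 2 * (2 * real p * real q + real p + real q) / ?m 3 = 3"
  have e: "3 * (real p - real q)\<^sup>2 + (2 * (real p * real q) + real p + real q) = 4"
    using ev by (simp add: pick_def field_simps)
  \<comment> \<open>All terms in \<open>e\<close> are nonnegative, so p and q are bounded and
    finitely many pairs remain to be tested.\<close>
  have "real p \<le> 4" "real q \<le> 4"
    using e zero_le_power2[of "real p - real q"] mult_nonneg_nonneg[of "real p" "real q", OF of_nat_0_le_iff of_nat_0_le_iff] by linarith+
  then have "p \<in> {0, 1, 2, 3, 4}" "q \<in> {0, 1, 2, 3, 4}"
    by auto
  \<comment> \<open>The first two pairs give coordinates of the 4-dimensional summand, the third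
    pair coordinates of the 3-dimensional one.\<close>
  then consider "p = 1" "q = 0" | "p = 0" "q = 1" | "p = 1" "q = 1"
    using e by auto
  then show "mean (\<lambda>g. f g * Re (MM \<alpha> \<beta> p q g)) = 0 \<and> mean (\<lambda>g. f g * Im (MM \<alpha> \<beta> p q g)) = 0"
  proof cases
    case 1
    show ?thesis
    proof (intro conjI mean_linear_part[OF lin])
      \<comment> \<open>The factor 3/2 undoes the coordinate 2/3 of the base point.\<close>
      show "Re (MM \<alpha> \<beta> p q g) = (3/2) *\<^sub>R mk8 0 0 0 0 (Re \<alpha>) (- Im \<alpha>) (Re \<beta>) (Im \<beta>) \<bullet> rho1 g ?p" for g
        by (simp add: 1 MM_def XX_def rho1_def Let_def mk8_inner algebra_simps)
      show "Im (MM \<alpha> \<beta> p q g) = (3/2) *\<^sub>R mk8 0 0 0 0 (Im \<alpha>) (Re \<alpha>) (Im \<beta>) (- Re \<beta>) \<bullet> rho1 g ?p" for g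
        by (simp add: 1 MM_def XX_def rho1_def Let_def mk8_inner algebra_simps)
    qed
  next
    case 2
    show ?thesis
    proof (intro conjI mean_linear_part[OF lin])
      show "Re (MM \<alpha> \<beta> p q g) = (3/2) *\<^sub>R mk8 0 0 0 0 (Re \<beta>) (Im \<beta>) (- Re \<alpha>) (Im \<alpha>) \<bullet> rho1 g ?p" for g
        by (simp add: 2 MM_def YY_def rho1_def Let_def mk8_inner algebra_simps)
      show "Im (MM \<alpha> \<beta> p q g) = (3/2) *\<^sub>R mk8 0 0 0 0 (Im \<beta>) (- Re \<beta>) (- Im \<alpha>) (- Re \<alpha>) \<bullet> rho1 g ?p" for g
        by (simp add: 2 MM_def YY_def rho1_def Let_def mk8_inner algebra_simps)
    qed
  next
    case 3
    let ?A = "\<alpha>\<^sup>2" and ?B = "\<beta>\<^sup>2" and ?P = "\<alpha> * \<beta>"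
    show ?thesis
    proof (intro conjI mean_linear_part[OF lin])
      show "Re (MM \<alpha> \<beta> p q g) = (3 / (2 * sqrt 5)) *\<^sub>R mk8 0 (2 * Re ?P) (Im ?B + Im ?A) (Re ?B - Re ?A) 0 0 0 0 \<bullet> rho1 g ?p" for g
        by (simp add: 3 MM_def XX_def YY_def rho1_def Let_def mk8_inner power2_eq_square) (simp add: field_simps)
      show "Im (MM \<alpha> \<beta> p q g) = (3 / (2 * sqrt 5)) *\<^sub>R mk8 0 (2 * Im ?P) (- Re ?B - Re ?A) (Im ?B - Im ?A) 0 0 0 0 \<bullet> rho1 g ?p" for g
        by (simp add: 3 MM_def XX_def YY_def rho1_def Let_def mk8_inner power2_eq_square) (simp add: field_simps)
    qed
  qed
qed

section \<open>The orbit L2\<close>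

lemma sqrt2: "sqrt 2 * (sqrt 2 * x) = 2 * x" for x :: real
  by (simp flip: mult.assoc)

text \<open>The rotation \<open>varpi\<close> acting on C^3 as the complexification of R^3, that is,
  on real and imaginary parts separately; the coordinate \<open>x_1\<close> is fixed.\<close>

definition rho2 :: "quat \<Rightarrow> real^8 \<Rightarrow> real^8" where
  "rho2 g x = (let a = fst g; b = snd g in mk8 (x$0) (x$1)
     (((Re a)\<^sup>2 + (Im a)\<^sup>2 - (Re b)\<^sup>2 - (Im b)\<^sup>2) * x$2 + (2 * Im (a * b)) * x$4 + (- 2 * Re (a * b)) * x$6)
     (((Re a)\<^sup>2 + (Im a)\<^sup>2 - (Re b)\<^sup>2 - (Im b)\<^sup>2) * x$3 + (2 * Im (a * b)) * x$5 + (- 2 * Re (a * b)) * x$7)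
     ((- 2 * Im (cnj a * b)) * x$2 + (Re (a\<^sup>2 + b\<^sup>2)) * x$4 + (Im (a\<^sup>2 + b\<^sup>2)) * x$6)
     ((- 2 * Im (cnj a * b)) * x$3 + (Re (a\<^sup>2 + b\<^sup>2)) * x$5 + (Im (a\<^sup>2 + b\<^sup>2)) * x$7)
     ((2 * Re (cnj a * b)) * x$2 + (Im (b\<^sup>2 - a\<^sup>2)) * x$4 + (Re (a\<^sup>2 - b\<^sup>2)) * x$6)
     ((2 * Re (cnj a * b)) * x$3 + (Im (b\<^sup>2 - a\<^sup>2)) * x$5 + (Re (a\<^sup>2 - b\<^sup>2)) * x$7))"

definition Y2 :: "3 \<Rightarrow> real^8^8" where
  "Y2 = pick (matrix (skew8 0 0 0 0 0 0 0 0 0 0 0 0 0 0 0 0 2 0 0 2 0))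
    (matrix (skew8 0 0 0 0 0 0 0 0 0 (-2) 0 0 0 0 (-2) 0 0 0 0 0 0))
    (matrix (skew8 0 0 0 0 0 0 0 2 0 0 0 0 2 0 0 0 0 0 0 0 0))"

text \<open>The base point is the isotropic vector (0, 1, \<i>) scaled to length 1; its rotations
  are quadratic in the spinor (a, b).\<close>

lemma rho2_base:
  "rho2 (a, b) (mk8 0 0 0 0 (sqrt 2 / 2) 0 0 (sqrt 2 / 2))
    = from7 0 (- \<i> * of_real (sqrt 2) * (a * b)) (of_real (sqrt 2 / 2) * (a\<^sup>2 + b\<^sup>2)) (\<i> * of_real (sqrt 2 / 2) * (a\<^sup>2 - b\<^sup>2))"
  by (simp add: rho2_def from7_def mk8_eq_iff algebra_simps)

text \<open>A point of the orbit is the square of a spinor \<open>(a, b)\<close>, recovered by complex square roots.\<close>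

lemma L2_orbit: "L2 = (\<lambda>g. rho2 g (mk8 0 0 0 0 (sqrt 2 / 2) 0 0 (sqrt 2 / 2))) ` S3q"
proof (intro equalityI subsetI)
  fix x assume "x \<in> L2"
  then obtain z1 z2 z3 where x: "x = from7 0 z1 z2 z3" and n: "(cmod z1)\<^sup>2 + (cmod z2)\<^sup>2 + (cmod z3)\<^sup>2 = 1"
    and z: "z1\<^sup>2 + z2\<^sup>2 + z3\<^sup>2 = 0"
    by (auto simp: L2_def)
  define s where "s = complex_of_real (sqrt 2)"
  have s: "s * s = 2" "s \<noteq> 0"
    by (simp_all add: s_def flip: of_real_mult)
  define a where "a = csqrt ((z2 - \<i> * z3) / s)"
  define b0 where "b0 = csqrt ((z2 + \<i> * z3) / s)"
  have ab: "a\<^sup>2 = (z2 - \<i> * z3) / s" "b0\<^sup>2 = (z2 + \<i> * z3) / s"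
    by (simp_all add: a_def b0_def)
  have "(- \<i> * s * (a * b0))\<^sup>2 = - (s * s) * (a\<^sup>2 * b0\<^sup>2)"
    by (simp add: power_mult_distrib) (simp add: power2_eq_square)
  also have "\<dots> = - ((z2 - \<i> * z3) * (z2 + \<i> * z3))"
    unfolding ab using s(2) by simp
  also have "\<dots> = - (z2\<^sup>2 + z3\<^sup>2)"
    by (simp add: power2_eq_square algebra_simps)
  also have "\<dots> = z1\<^sup>2"
    using eq_neg_iff_add_eq_0[of "z1\<^sup>2" "z2\<^sup>2 + z3\<^sup>2"] z by (simp add: add.assoc)
  finally have "- \<i> * s * (a * b0) = z1 \<or> - \<i> * s * (a * b0) = - z1"
    unfolding power2_eq_iff .
  \<comment> \<open>The squares of a and b leave the relative sign undetermined; it is chosen so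
    that the product of a and b gives \<open>z1\<close> rather than its negative.\<close>
  then obtain b where b: "b\<^sup>2 = b0\<^sup>2" "- \<i> * s * (a * b) = z1"
  proof
    assume "- \<i> * s * (a * b0) = z1"
    then show thesis
      using that[of b0] by simp
  next
    assume "- \<i> * s * (a * b0) = - z1"
    then show thesis
      using that[of "- b0"] by simp
  qed
  have z2: "of_real (sqrt 2 / 2) * (a\<^sup>2 + b\<^sup>2) = z2" "\<i> * of_real (sqrt 2 / 2) * (a\<^sup>2 - b\<^sup>2) = z3"
    unfolding b(1) ab using s by (simp_all add: s_def[symmetric] field_simps)
  have "(a, b) \<in> S3q"
  proof -
    have c: "cmod s = sqrt 2" "(cmod s)\<^sup>2 = 2"
      by (simp_all add: s_def)
    have c2: "(cmod (z2 - \<i> * z3))\<^sup>2 + (cmod (z2 + \<i> * z3))\<^sup>2 = 2 * ((cmod z2)\<^sup>2 + (cmod z3)\<^sup>2)"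
      by (simp add: cmod_power2) (simp add: power2_eq_square algebra_simps)
    have a4: "((cmod a)\<^sup>2)\<^sup>2 = (cmod (z2 - \<i> * z3))\<^sup>2 / 2"
      using arg_cong[OF ab(1), of "\<lambda>z. (cmod z)\<^sup>2"] by (simp add: norm_power norm_divide power_divide c)
    have b4: "((cmod b)\<^sup>2)\<^sup>2 = (cmod (z2 + \<i> * z3))\<^sup>2 / 2"
      using arg_cong[OF b(1)[unfolded ab(2)], of "\<lambda>z. (cmod z)\<^sup>2"] by (simp add: norm_power norm_divide power_divide c)
    have m: "2 * ((cmod a)\<^sup>2 * (cmod b)\<^sup>2) = (cmod z1)\<^sup>2"
      using arg_cong[OF b(2), of "\<lambda>z. (cmod z)\<^sup>2"] by (simp add: norm_mult power_mult_distrib c)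
    have "((cmod a)\<^sup>2 + (cmod b)\<^sup>2)\<^sup>2 = ((cmod a)\<^sup>2)\<^sup>2 + ((cmod b)\<^sup>2)\<^sup>2 + 2 * ((cmod a)\<^sup>2 * (cmod b)\<^sup>2)"
      by (simp add: power2_sum)
    also have "\<dots> = 1"
      unfolding a4 b4 m using c2 n by simp
    finally have "(cmod a)\<^sup>2 + (cmod b)\<^sup>2 = 1"
      using power2_eq_1_iff[of "(cmod a)\<^sup>2 + (cmod b)\<^sup>2"] zero_le_power2[of "cmod a"] zero_le_power2[of "cmod b"] by linarith
    then show ?thesis
      by (simp add: S3q_def)
  qed
  moreover have "x = rho2 (a, b) (mk8 0 0 0 0 (sqrt 2 / 2) 0 0 (sqrt 2 / 2))"
    unfolding rho2_base z2 x using b(2) by (simp add: s_def)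
  ultimately show "x \<in> (\<lambda>g. rho2 g (mk8 0 0 0 0 (sqrt 2 / 2) 0 0 (sqrt 2 / 2))) ` S3q"
    by blast
next
  fix x assume "x \<in> (\<lambda>g. rho2 g (mk8 0 0 0 0 (sqrt 2 / 2) 0 0 (sqrt 2 / 2))) ` S3q"
  then obtain a b where g: "(a, b) \<in> S3q" and x: "x = rho2 (a, b) (mk8 0 0 0 0 (sqrt 2 / 2) 0 0 (sqrt 2 / 2))"
    by auto
  define s where "s = complex_of_real (sqrt 2)"
  have s: "s * s = 2"
    by (simp add: s_def flip: of_real_mult)
  let ?z1 = "- \<i> * of_real (sqrt 2) * (a * b)" and ?z2 = "of_real (sqrt 2 / 2) * (a\<^sup>2 + b\<^sup>2)"
    and ?z3 = "\<i> * of_real (sqrt 2 / 2) * (a\<^sup>2 - b\<^sup>2)"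
  have z: "?z1\<^sup>2 + ?z2\<^sup>2 + ?z3\<^sup>2 = 0"
  proof -
    have "?z1\<^sup>2 + ?z2\<^sup>2 + ?z3\<^sup>2 = s * s * (((a\<^sup>2 + b\<^sup>2)\<^sup>2 - (a\<^sup>2 - b\<^sup>2)\<^sup>2) / 4 - (a * b)\<^sup>2)"
      by (simp add: s_def[symmetric] power2_eq_square algebra_simps add_divide_distrib diff_divide_distrib)
    also have "(a\<^sup>2 + b\<^sup>2)\<^sup>2 - (a\<^sup>2 - b\<^sup>2)\<^sup>2 = 4 * (a * b)\<^sup>2"
      by (simp add: power2_eq_square algebra_simps)
    also have "s * s * (4 * (a * b)\<^sup>2 / 4 - (a * b)\<^sup>2) = 0"
      by simp
    finally show ?thesis .
  qed
  have para: "(cmod (x + y))\<^sup>2 + (cmod (x - y))\<^sup>2 = 2 * ((cmod x)\<^sup>2 + (cmod y)\<^sup>2)" for x y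
    by (simp add: cmod_power2) (simp add: power2_eq_square algebra_simps)
  have "(cmod ?z1)\<^sup>2 + (cmod ?z2)\<^sup>2 + (cmod ?z3)\<^sup>2 = 2 * ((cmod a)\<^sup>2 * (cmod b)\<^sup>2)
      + ((cmod (a\<^sup>2 + b\<^sup>2))\<^sup>2 + (cmod (a\<^sup>2 - b\<^sup>2))\<^sup>2) / 2"
    by (simp add: norm_mult power_mult_distrib power_divide)
  also have "(cmod (a\<^sup>2 + b\<^sup>2))\<^sup>2 + (cmod (a\<^sup>2 - b\<^sup>2))\<^sup>2 = 2 * ((cmod (a\<^sup>2))\<^sup>2 + (cmod (b\<^sup>2))\<^sup>2)"
    by (rule para)
  also have "2 * ((cmod a)\<^sup>2 * (cmod b)\<^sup>2) + 2 * ((cmod (a\<^sup>2))\<^sup>2 + (cmod (b\<^sup>2))\<^sup>2) / 2 = ((cmod a)\<^sup>2 + (cmod b)\<^sup>2)\<^sup>2"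
    by (simp add: norm_power power2_sum)
  also have "\<dots> = 1"
    using g by (simp add: S3q_def)
  finally show "x \<in> L2"
    unfolding x rho2_base L2_def using z by blast
qed

lemma L2_homogeneous:
  "homogeneous_lagrangian rho2 Y2 (mk8 0 0 0 0 (sqrt 2 / 2) 0 0 (sqrt 2 / 2)) (pick (4) (2) (2)) 4 L2
     (pick (mk8 0 0 0 0 0 (sqrt 2) (- sqrt 2) 0) (mk8 0 0 0 (- sqrt 2) 0 0 0 0) (mk8 0 0 (sqrt 2) 0 0 0 0 0))
     (pick (mk8 0 2 0 0 0 0 0 0) (mk8 0 0 0 0 1 0 0 (-1)) (mk8 0 0 0 0 0 (-1) (-1) 0))"
proof (rule homogeneous_lagrangian.intro)
  fix g h :: quat and x :: "real^8" and u :: "real^3" and k i j :: 3 and r s :: 8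
  let ?p = "mk8 0 0 0 0 (sqrt 2 / 2) 0 0 (sqrt 2 / 2)"
  let ?U = "(pick (mk8 0 0 0 0 0 (sqrt 2) (- sqrt 2) 0) (mk8 0 0 0 (- sqrt 2) 0 0 0 0) (mk8 0 0 (sqrt 2) 0 0 0 0 0))"
  let ?n = "(pick (mk8 0 2 0 0 0 0 0 0) (mk8 0 0 0 0 1 0 0 (-1)) (mk8 0 0 0 0 0 (-1) (-1) 0))"
  let ?m = "(pick (4) (2) (2)) :: 3 \<Rightarrow> real"
  show "linear (rho2 g)"
    by (rule linearI) (simp_all add: rho2_def Let_def mk8_add mk8_scaleR mk8_eq_iff algebra_simps)
  show "rho2 (qmult g h) x = rho2 g (rho2 h x)"
    by (simp add: rho2_def Let_def qmult_def mk8_eq_iff power2_eq_square) (simp add: algebra_simps)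
  show "rho2 (1, 0) x = x"
    by (simp add: rho2_def Let_def vec_eq_iff forall_8)
  show "continuous_on S3q (\<lambda>g. rho2 g x)"
    unfolding rho2_def Let_def by (intro continuous_on_mk8 continuous_intros)
  show "((\<lambda>t. rho2 (rot u t) x) has_vector_derivative
      (u$1 *\<^sub>R (Y2 1 *v x) + u$2 *\<^sub>R (Y2 2 *v x) + u$3 *\<^sub>R (Y2 3 *v x))) (at 0)"
    unfolding Y2_def pick_simps matrix_skew8_mult skew8_def mk8_scaleR mk8_add rho2_def Let_def rot_def
    by (rule has_vector_derivative_mk8) (auto intro!: derivative_eq_intros simp: power2_eq_square)
  show "Y2 k $ r $ s = - Y2 k $ s $ r"
    unfolding Y2_def pick_def by (auto intro: matrix_skew8_skew)
  show "Y2 k \<in> spin7"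
    unfolding Y2_def pick_def by (auto intro: matrix_skew8_spin7)
  show "Y2 k *v axis 0 1 = 0"
    unfolding Y2_def pick_def by (auto intro: matrix_skew8_axis0)
  show "Y2 1 *v (Y2 2 *v x) - Y2 2 *v (Y2 1 *v x) = - 2 *\<^sub>R (Y2 3 *v x)"
    "Y2 2 *v (Y2 3 *v x) - Y2 3 *v (Y2 2 *v x) = - 2 *\<^sub>R (Y2 1 *v x)"
    "Y2 3 *v (Y2 1 *v x) - Y2 1 *v (Y2 3 *v x) = - 2 *\<^sub>R (Y2 2 *v x)"
    unfolding Y2_def pick_simps matrix_skew8_mult
    by (simp_all add: skew8_def mk8_diff mk8_scaleR mk8_eq_iff algebra_simps sqrt2)
  show "norm ?p = 1"
    by (simp add: norm_eq_1 mk8_inner power2_eq_square sqrt2)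
  show "?p $ 0 = 0"
    by simp
  show "L2 = (\<lambda>g. rho2 g ?p) ` S3q"
    by (rule L2_orbit)
  show "0 < ?m k" "?m 2 = ?m 3" "(4::real) \<noteq> 0"
    by (simp_all add: pick_def)
  show "?U k = Y2 k *v ?p"
    unfolding Y2_def pick_def by (simp add: matrix_skew8_mult skew8_def mk8_eq_iff sqrt2)
  show "?n k = Jmap ?p (?U k)"
    unfolding pick_def by (simp add: Jmap_def sigmaNK_def phi0_def dx3_def det3_def vec_eq_iff forall_8 axis_def algebra_simps sqrt2)
  show "?U i \<bullet> ?U j = (if i = j then ?m i else 0)"
    using exhaust_3[of i] exhaust_3[of j] by (auto simp: mk8_inner sqrt2)
  show "Jmap ?p (?n k) = - ?U k"
    unfolding pick_def by (simp add: Jmap_def sigmaNK_def phi0_def dx3_def det3_def vec_eq_iff forall_8 axis_def algebra_simps sqrt2)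
  show "x = (x \<bullet> ?p) *\<^sub>R ?p + x $ 0 *\<^sub>R axis 0 1
        + ((x \<bullet> ?U 1) / ?m 1) *\<^sub>R ?U 1 + ((x \<bullet> ?U 2) / ?m 2) *\<^sub>R ?U 2 + ((x \<bullet> ?U 3) / ?m 3) *\<^sub>R ?U 3
        + ((x \<bullet> ?n 1) / ?m 1) *\<^sub>R ?n 1 + ((x \<bullet> ?n 2) / ?m 2) *\<^sub>R ?n 2 + ((x \<bullet> ?n 3) / ?m 3) *\<^sub>R ?n 3"
    by (simp add: vec_eq_iff forall_8 mk8_inner_right axis_def algebra_simps add_divide_distrib diff_divide_distrib sqrt2)
qed

lemma L2_rigid:
  "rigid_lagrangian rho2 Y2 (mk8 0 0 0 0 (sqrt 2 / 2) 0 0 (sqrt 2 / 2)) (pick (4) (2) (2)) 4 L2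
     (pick (mk8 0 0 0 0 0 (sqrt 2) (- sqrt 2) 0) (mk8 0 0 0 (- sqrt 2) 0 0 0 0) (mk8 0 0 (sqrt 2) 0 0 0 0 0))
     (pick (mk8 0 2 0 0 0 0 0 0) (mk8 0 0 0 0 1 0 0 (-1)) (mk8 0 0 0 0 0 (-1) (-1) 0))"
proof (rule rigid_lagrangian.intro[OF L2_homogeneous], rule rigid_lagrangian_axioms.intro)
  fix nu F :: "3 \<Rightarrow> real" and N :: "3 \<Rightarrow> 3 \<Rightarrow> real"
  let ?p = "mk8 0 0 0 0 (sqrt 2 / 2) 0 0 (sqrt 2 / 2)"
  let ?U = "(pick (mk8 0 0 0 0 0 (sqrt 2) (- sqrt 2) 0) (mk8 0 0 0 (- sqrt 2) 0 0 0 0) (mk8 0 0 (sqrt 2) 0 0 0 0 0))"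
  let ?n = "(pick (mk8 0 2 0 0 0 0 0 0) (mk8 0 0 0 0 1 0 0 (-1)) (mk8 0 0 0 0 0 (-1) (-1) 0))"
  let ?m = "(pick (4) (2) (2)) :: 3 \<Rightarrow> real"
  let ?v = "4 :: real"
  note expand = frame_deriv_def Y2_def matrix_skew8_mult skew8_def axis0_mk8 mk8_scaleR mk8_add
  show "Phi0 ?p (?U 1) (?U 2) (?U 3) = ?v"
    by (simp add: Phi0_dx4 dx4_def dx3_def det3_def sqrt2)
  show "assoc_form ?U (axis 0 1) (frame_deriv Y2 ?n nu F N) = ?v * (N 1 1 + N 2 2 + N 3 3)"
    by (simp add: assoc_form_def expand Phi0_dx4 dx4_def dx3_def det3_def algebra_simps sqrt2)
  show "assoc_form ?U (?n 1) (frame_deriv Y2 ?n nu F N) = ?v * (?m 1 * nu 1) - ?v * F 1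
        - ?m 1 * ((3 * ?v - 2 * ?m 1) * nu 1 - (?m 3 * N 2 3 - ?m 2 * N 3 2))"
    by (simp add: assoc_form_def expand Phi0_dx4 dx4_def dx3_def det3_def algebra_simps sqrt2)
  show "assoc_form ?U (?n 2) (frame_deriv Y2 ?n nu F N) = ?v * (?m 2 * nu 2) - ?v * F 2
        - ?m 2 * ((3 * ?v - 2 * ?m 2) * nu 2 - (?m 1 * N 3 1 - ?m 3 * N 1 3))"
    by (simp add: assoc_form_def expand Phi0_dx4 dx4_def dx3_def det3_def algebra_simps sqrt2)
  show "assoc_form ?U (?n 3) (frame_deriv Y2 ?n nu F N) = ?v * (?m 3 * nu 3) - ?v * F 3
        - ?m 3 * ((3 * ?v - 2 * ?m 3) * nu 3 - (?m 2 * N 1 2 - ?m 1 * N 2 1))"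
    by (simp add: assoc_form_def expand Phi0_dx4 dx4_def dx3_def det3_def algebra_simps sqrt2)
  show "phi0 (nu 1 *\<^sub>R ?n 1 + nu 2 *\<^sub>R ?n 2 + nu 3 *\<^sub>R ?n 3) (?U 1) (?U 2)
        + phi0 ?p (frame_deriv Y2 ?n nu (\<lambda>_. 0) N 1) (?U 2) + phi0 ?p (?U 1) (frame_deriv Y2 ?n nu (\<lambda>_. 0) N 2)
        = (3 * ?v - 2 * ?m 3) * nu 3 - (?m 2 * N 1 2 - ?m 1 * N 2 1)"
    "phi0 (nu 1 *\<^sub>R ?n 1 + nu 2 *\<^sub>R ?n 2 + nu 3 *\<^sub>R ?n 3) (?U 2) (?U 3)
        + phi0 ?p (frame_deriv Y2 ?n nu (\<lambda>_. 0) N 2) (?U 3) + phi0 ?p (?U 2) (frame_deriv Y2 ?n nu (\<lambda>_. 0) N 3)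
        = (3 * ?v - 2 * ?m 1) * nu 1 - (?m 3 * N 2 3 - ?m 2 * N 3 2)"
    "phi0 (nu 1 *\<^sub>R ?n 1 + nu 2 *\<^sub>R ?n 2 + nu 3 *\<^sub>R ?n 3) (?U 3) (?U 1)
        + phi0 ?p (frame_deriv Y2 ?n nu (\<lambda>_. 0) N 3) (?U 1) + phi0 ?p (?U 3) (frame_deriv Y2 ?n nu (\<lambda>_. 0) N 1)
        = (3 * ?v - 2 * ?m 2) * nu 2 - (?m 1 * N 3 1 - ?m 3 * N 1 3)"
    by (simp_all add: expand phi0_def dx3_def det3_def algebra_simps sqrt2)
  show "(1 / ?m 1) *\<^sub>R (Y2 1 *v ?U 1) + (1 / ?m 2) *\<^sub>R (Y2 2 *v ?U 2) + (1 / ?m 3) *\<^sub>R (Y2 3 *v ?U 3) = - 3 *\<^sub>R ?p"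
    by (simp add: expand mk8_eq_iff sqrt2)
next
  fix f :: "quat \<Rightarrow> real" and p q :: nat and \<alpha> \<beta> :: complex
  let ?p = "mk8 0 0 0 0 (sqrt 2 / 2) 0 0 (sqrt 2 / 2)"
  let ?m = "(pick (4) (2) (2)) :: 3 \<Rightarrow> real"
  assume cont: "continuous_on S3q f"
    and inv: "\<And>g h. g \<in> S3q \<Longrightarrow> h \<in> S3q \<Longrightarrow> rho2 g ?p = rho2 h ?p \<Longrightarrow> f g = f h"
    and lin: "\<And>w. mean (\<lambda>g. f g * (w \<bullet> rho2 g ?p)) = 0"
    and ev: "(real p - real q)\<^sup>2 / ?m 1 + 2 * (2 * real p * real q + real p + real q) / ?m 3 = 3"
  have e: "(real p - real q)\<^sup>2 + 4 * (2 * (real p * real q) + real p + real q) = 12"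
    using ev by (simp add: pick_def field_simps)
  have "D + 8 * P + 4 * real p + 4 * real q = 12 \<Longrightarrow> 0 \<le> D \<Longrightarrow> 0 \<le> P \<Longrightarrow> real p \<le> 3 \<and> real q \<le> 3" for D P
    by auto
  from this[of "(real p - real q)\<^sup>2" "real p * real q"] e have "real p \<le> 3" "real q \<le> 3"
    by simp_all
  then have "p \<in> {0, 1, 2, 3}" "q \<in> {0, 1, 2, 3}"
    by auto
  \<comment> \<open>The surviving products are squares of X or of Y, hence quadratic in the spinor
    and linear in the point of the orbit.\<close>
  then consider "p = 2" "q = 0" | "p = 0" "q = 2"
    using e by auto
  then show "mean (\<lambda>g. f g * Re (MM \<alpha> \<beta> p q g)) = 0 \<and> mean (\<lambda>g. f g * Im (MM \<alpha> \<beta> p q g)) = 0"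
  proof cases
    let ?S = "\<alpha>\<^sup>2 + \<beta>\<^sup>2" and ?D = "\<alpha>\<^sup>2 - \<beta>\<^sup>2" and ?P = "\<alpha> * \<beta>"
    case 1
    show ?thesis
    proof (intro conjI mean_linear_part[OF lin])
      show "Re (MM \<alpha> \<beta> p q g) = (sqrt 2 / 2) *\<^sub>R mk8 0 0 (- 2 * Im ?P) (- 2 * Re ?P) (Re ?S) (- Im ?S) (Im ?D) (Re ?D) \<bullet> rho2 g ?p" for g
        by (simp add: 1 MM_def XX_def rho2_def Let_def mk8_inner power2_eq_square) (simp add: algebra_simps add_divide_distrib diff_divide_distrib sqrt2)
      show "Im (MM \<alpha> \<beta> p q g) = (sqrt 2 / 2) *\<^sub>R mk8 0 0 (2 * Re ?P) (- 2 * Im ?P) (Im ?S) (Re ?S) (- Re ?D) (Im ?D) \<bullet> rho2 g ?p" for g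
        by (simp add: 1 MM_def XX_def rho2_def Let_def mk8_inner power2_eq_square) (simp add: algebra_simps add_divide_distrib diff_divide_distrib sqrt2)
    qed
  next
    let ?S = "\<alpha>\<^sup>2 + \<beta>\<^sup>2" and ?D = "\<alpha>\<^sup>2 - \<beta>\<^sup>2" and ?P = "\<alpha> * \<beta>"
    case 2
    show ?thesis
    proof (intro conjI mean_linear_part[OF lin])
      show "Re (MM \<alpha> \<beta> p q g) = (sqrt 2 / 2) *\<^sub>R mk8 0 0 (- 2 * Im ?P) (2 * Re ?P) (Re ?S) (Im ?S) (Im ?D) (- Re ?D) \<bullet> rho2 g ?p" for g
        by (simp add: 2 MM_def YY_def rho2_def Let_def mk8_inner power2_eq_square) (simp add: algebra_simps add_divide_distrib diff_divide_distrib sqrt2)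
      show "Im (MM \<alpha> \<beta> p q g) = (sqrt 2 / 2) *\<^sub>R mk8 0 0 (2 * Re ?P) (2 * Im ?P) (Im ?S) (- Re ?S) (- Re ?D) (- Im ?D) \<bullet> rho2 g ?p" for g
        by (simp add: 2 MM_def YY_def rho2_def Let_def mk8_inner power2_eq_square) (simp add: algebra_simps add_divide_distrib diff_divide_distrib sqrt2)
    qed
  qed
qed

section \<open>Harmonic cubics\<close>

definition cubic_of :: "real^8 \<Rightarrow> real \<Rightarrow> real \<Rightarrow> real \<Rightarrow> real" where
  "cubic_of q x y z = (\<Sum>i\<in>UNIV. q $ i * hcubic i x y z)"

text \<open>Recovers the coefficients of a harmonic cubic from its values at a few integer points;
  for instance, the alternating sum over signs isolates the monomial xyz. Being linear in the
  values, it carries continuity and differentiability over from the values to the coefficient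
  vector.\<close>

definition coeffs_of :: "(real \<Rightarrow> real \<Rightarrow> real \<Rightarrow> real) \<Rightarrow> real^8" where
  "coeffs_of P = (let
      k4 = - (sqrt 15 / 6) * ((P 1 1 0 - P 1 (-1) 0) / 2 - P 0 1 0);
      k5 = - (sqrt 15 / 6) * ((P 1 0 1 - P 1 0 (-1)) / 2 - P 0 0 1)
    in mk8 0 (sqrt 10 / 2 * P 1 0 0)
      (- (sqrt 6 / 24) * (P 1 1 1 - P 1 1 (-1) - P 1 (-1) 1 + P 1 (-1) (-1)))
      (sqrt 6 / 12 * (P 1 1 0 + P 1 (-1) 0 - P 1 0 1 - P 1 0 (-1)))
      k4 k5 (2 * P 0 1 0 - sqrt 15 / 5 * k4) (2 * P 0 0 1 - sqrt 15 / 5 * k5))"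

lemma cubic_of_expand: "cubic_of q x y z = q$1 * (sqrt 10 / 10 * x * (2*x^2 - 3*y^2 - 3*z^2)) + q$2 * (- sqrt 6 * x * y * z)
    + q$3 * (sqrt 6 / 2 * x * (y^2 - z^2)) + q$4 * (- sqrt 15 / 10 * y * (4*x^2 - y^2 - z^2))
    + q$5 * (- sqrt 15 / 10 * z * (4*x^2 - y^2 - z^2)) + q$6 * (1/2 * y * (y^2 - 3*z^2)) + q$7 * (1/2 * z * (z^2 - 3*y^2))"
  by (simp add: cubic_of_def sum_8 hcubic_def)

lemma sqrt_squares: "sqrt 6 * (sqrt 6 * x) = 6 * x" "sqrt 10 * (sqrt 10 * x) = 10 * x" "sqrt 15 * (sqrt 15 * x) = 15 * x"
  for x :: real
  by (simp_all flip: mult.assoc)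

lemma coeffs_of_cubic_of: "q $ 0 = 0 \<Longrightarrow> coeffs_of (cubic_of q) = q"
  by (simp add: vec_eq_iff forall_8 coeffs_of_def Let_def cubic_of_expand algebra_simps add_divide_distrib diff_divide_distrib sqrt_squares)

lemma coeffs_of_add: "coeffs_of (\<lambda>x y z. P x y z + Q x y z) = coeffs_of P + coeffs_of Q"
  and coeffs_of_scale: "coeffs_of (\<lambda>x y z. r * P x y z) = r *\<^sub>R coeffs_of P"
  by (simp_all add: vec_eq_iff forall_8 coeffs_of_def Let_def field_simps)

text \<open>A homogeneous cubic for which half of the Laplacian is the linear form with coefficients
  t1, t2, t3. It is harmonic exactly when all three are 0.\<close>

definition tr_cubic :: "(real \<Rightarrow> real \<Rightarrow> real \<Rightarrow> real) \<Rightarrow> real \<Rightarrow> real \<Rightarrow> real \<Rightarrow> bool" where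
  "tr_cubic P t1 t2 t3 \<longleftrightarrow> (\<exists>a b c d e f g h i j. t1 = 3*a + f + h \<and> t2 = 3*b + d + i \<and> t3 = 3*c + e + g \<and>
     (\<forall>x y z. P x y z = a*x^3 + b*y^3 + c*z^3 + d*x^2*y + e*x^2*z + f*x*y^2 + g*y^2*z + h*x*z^2 + i*y*z^2 + j*x*y*z))"

lemma tr_cubicI:
  assumes "\<And>x y z. P x y z = a*x^3 + b*y^3 + c*z^3 + d*x^2*y + e*x^2*z + f*x*y^2 + g*y^2*z + h*x*z^2 + i*y*z^2 + j*x*y*z"
    and "t1 = 3*a + f + h" "t2 = 3*b + d + i" "t3 = 3*c + e + g"
  shows "tr_cubic P t1 t2 t3"
  unfolding tr_cubic_def
  by (rule exI[of _ a], rule exI[of _ b], rule exI[of _ c], rule exI[of _ d], rule exI[of _ e], rule exI[of _ f],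
      rule exI[of _ g], rule exI[of _ h], rule exI[of _ i], rule exI[of _ j]) (intro conjI allI assms)

lemma tr_cubicE:
  assumes "tr_cubic P t1 t2 t3"
  obtains a b c d e f g h i j where
    "P = (\<lambda>x y z. a*x^3 + b*y^3 + c*z^3 + d*x^2*y + e*x^2*z + f*x*y^2 + g*y^2*z + h*x*z^2 + i*y*z^2 + j*x*y*z)"
    "t1 = 3*a + f + h" "t2 = 3*b + d + i" "t3 = 3*c + e + g"
proof -
  from assms obtain a b c d e f g h i j where
    "t1 = 3*a + f + h \<and> t2 = 3*b + d + i \<and> t3 = 3*c + e + g \<and> (\<forall>x y z. P x y z = a*x^3 + b*y^3 + c*z^3 + d*x^2*y + e*x^2*z + f*x*y^2 + g*y^2*z + h*x*z^2 + i*y*z^2 + j*x*y*z)"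
    unfolding tr_cubic_def by (elim exE)
  then show ?thesis
    by (intro that[of a b c d e f g h i j]) (auto simp: fun_eq_iff)
qed

lemma tr_cubic_add:
  assumes "tr_cubic P t1 t2 t3" "tr_cubic Q s1 s2 s3"
  shows "tr_cubic (\<lambda>x y z. P x y z + Q x y z) (t1 + s1) (t2 + s2) (t3 + s3)"
proof -
  obtain a b c d e f g h i j where P: "P = (\<lambda>x y z. a*x^3 + b*y^3 + c*z^3 + d*x^2*y + e*x^2*z + f*x*y^2 + g*y^2*z + h*x*z^2 + i*y*z^2 + j*x*y*z)"
    and t: "t1 = 3*a + f + h" "t2 = 3*b + d + i" "t3 = 3*c + e + g"
    using assms(1) by (rule tr_cubicE)
  obtain a' b' c' d' e' f' g' h' i' j' where Q: "Q = (\<lambda>x y z. a'*x^3 + b'*y^3 + c'*z^3 + d'*x^2*y + e'*x^2*z + f'*x*y^2 + g'*y^2*z + h'*x*z^2 + i'*y*z^2 + j'*x*y*z)"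
    and s: "s1 = 3*a' + f' + h'" "s2 = 3*b' + d' + i'" "s3 = 3*c' + e' + g'"
    using assms(2) by (rule tr_cubicE)
  show ?thesis
  proof (rule tr_cubicI)
    show "P x y z + Q x y z = (a+a')*x^3 + (b+b')*y^3 + (c+c')*z^3 + (d+d')*x^2*y + (e+e')*x^2*z + (f+f')*x*y^2
        + (g+g')*y^2*z + (h+h')*x*z^2 + (i+i')*y*z^2 + (j+j')*x*y*z" for x y z
      by (simp only: P Q distrib_right add_ac)
  qed (simp_all add: t s)
qed

lemma tr_cubic_scale:
  assumes "tr_cubic P t1 t2 t3"
  shows "tr_cubic (\<lambda>x y z. r * P x y z) (r * t1) (r * t2) (r * t3)"
proof -
  obtain a b c d e f g h i j where P: "P = (\<lambda>x y z. a*x^3 + b*y^3 + c*z^3 + d*x^2*y + e*x^2*z + f*x*y^2 + g*y^2*z + h*x*z^2 + i*y*z^2 + j*x*y*z)"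
    and t: "t1 = 3*a + f + h" "t2 = 3*b + d + i" "t3 = 3*c + e + g"
    using assms(1) by (rule tr_cubicE)
  show ?thesis
  proof (rule tr_cubicI)
    show "r * P x y z = (r*a)*x^3 + (r*b)*y^3 + (r*c)*z^3 + (r*d)*x^2*y + (r*e)*x^2*z + (r*f)*x*y^2
        + (r*g)*y^2*z + (r*h)*x*z^2 + (r*i)*y*z^2 + (r*j)*x*y*z" for x y z
      by (simp only: P distrib_left mult.assoc)
  qed (simp_all add: t distrib_left)
qed

lemma tr_cubic_harmonic:
  assumes "tr_cubic P 0 0 0"
  shows "P = cubic_of (coeffs_of P)"
proof -
  obtain a b c d e f g h i j where
    P: "P = (\<lambda>x y z. a*x^3 + b*y^3 + c*z^3 + d*x^2*y + e*x^2*z + f*x*y^2 + g*y^2*z + h*x*z^2 + i*y*z^2 + j*x*y*z)"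
    and t: "0 = 3*a + f + h" "0 = 3*b + d + i" "0 = 3*c + e + g"
    using assms by (rule tr_cubicE)
  have e: "f = - 3*a - h" "i = - 3*b - d" "g = - 3*c - e"
    using t by linarith+
  show ?thesis
    unfolding fun_eq_iff
    by (intro allI) (simp add: cubic_of_expand coeffs_of_def Let_def P e power2_eq_square power3_eq_cube algebra_simps add_divide_distrib diff_divide_distrib sqrt_squares)
qed

text \<open>Half of the Laplacian of a product of three linear forms u, v, w is (u, v) w + (u, w) v
  + (v, w) u.\<close>

lemma tr_cubic_prod:
  "tr_cubic (\<lambda>x y z. (x * u1 + y * u2 + z * u3) * (x * v1 + y * v2 + z * v3) * (x * w1 + y * w2 + z * w3))
     ((u1 * v1 + u2 * v2 + u3 * v3) * w1 + (u1 * w1 + u2 * w2 + u3 * w3) * v1 + (v1 * w1 + v2 * w2 + v3 * w3) * u1)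
     ((u1 * v1 + u2 * v2 + u3 * v3) * w2 + (u1 * w1 + u2 * w2 + u3 * w3) * v2 + (v1 * w1 + v2 * w2 + v3 * w3) * u2)
     ((u1 * v1 + u2 * v2 + u3 * v3) * w3 + (u1 * w1 + u2 * w2 + u3 * w3) * v3 + (v1 * w1 + v2 * w2 + v3 * w3) * u3)"
  by (rule tr_cubicI[where a = "u1 * v1 * w1" and b = "u2 * v2 * w2" and c = "u3 * v3 * w3"
        and d = "u1 * v1 * w2 + u1 * v2 * w1 + u2 * v1 * w1" and e = "u1 * v1 * w3 + u1 * v3 * w1 + u3 * v1 * w1"
        and f = "u2 * v2 * w1 + u2 * v1 * w2 + u1 * v2 * w2" and g = "u2 * v2 * w3 + u2 * v3 * w2 + u3 * v2 * w2"
        and h = "u3 * v3 * w1 + u3 * v1 * w3 + u1 * v3 * w3" and i = "u3 * v3 * w2 + u3 * v2 * w3 + u2 * v3 * w3"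
        and j = "u1 * v2 * w3 + u1 * v3 * w2 + u2 * v1 * w3 + u2 * v3 * w1 + u3 * v1 * w2 + u3 * v2 * w1"])
    (simp_all add: power2_eq_square power3_eq_cube algebra_simps)

text \<open>Entries with an index 1 are also given in the form \<open>Suc 0\<close>, to which the
  simplifier may rewrite that index.\<close>

lemma varpi_entries:
  "varpi a b 1 1 = Re a * Re a + Im a * Im a - Re b * Re b - Im b * Im b"
  "varpi a b (Suc 0) (Suc 0) = Re a * Re a + Im a * Im a - Re b * Re b - Im b * Im b"
  "varpi a b 1 2 = 2 * (Re a * Im b + Im a * Re b)"
  "varpi a b (Suc 0) 2 = 2 * (Re a * Im b + Im a * Re b)"
  "varpi a b 1 3 = - 2 * (Re a * Re b - Im a * Im b)"
  "varpi a b (Suc 0) 3 = - 2 * (Re a * Re b - Im a * Im b)"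
  "varpi a b 2 1 = - 2 * (Re a * Im b - Im a * Re b)"
  "varpi a b 2 (Suc 0) = - 2 * (Re a * Im b - Im a * Re b)"
  "varpi a b 2 2 = Re a * Re a - Im a * Im a + Re b * Re b - Im b * Im b"
  "varpi a b 2 3 = 2 * (Re a * Im a + Re b * Im b)"
  "varpi a b 3 1 = 2 * (Re a * Re b + Im a * Im b)"
  "varpi a b 3 (Suc 0) = 2 * (Re a * Re b + Im a * Im b)"
  "varpi a b 3 2 = 2 * (Re b * Im b - Re a * Im a)"
  "varpi a b 3 3 = Re a * Re a - Im a * Im a - Re b * Re b + Im b * Im b"
  unfolding varpi_def cmod_power2 by (simp_all add: power2_eq_square)

lemma varpi_orthonormal:
  assumes "(a, b) \<in> S3q" and k: "k \<in> {1, 2, 3}" "l \<in> {1, 2, 3}"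
  shows "varpi a b 1 k * varpi a b 1 l + varpi a b 2 k * varpi a b 2 l + varpi a b 3 k * varpi a b 3 l = (if k = l then 1 else 0)"
proof -
  \<comment> \<open>The identity is homogeneous of degree four in the entries of a and b and holds
    with \<open>n * n\<close> for every pair, so n = 1 is substituted only at the end.\<close>
  define n where "n = (Re a)\<^sup>2 + (Im a)\<^sup>2 + (Re b)\<^sup>2 + (Im b)\<^sup>2"
  have n: "n = 1"
    using assms(1) by (simp add: S3q_sq n_def)
  have "varpi a b 1 k * varpi a b 1 l + varpi a b 2 k * varpi a b 2 l + varpi a b 3 k * varpi a b 3 l = (if k = l then n * n else 0)"
    using k by (elim insertE emptyE) (simp_all add: varpi_entries n_def power2_eq_square algebra_simps)
  then show ?thesis
    by (simp add: n)
qed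

lemma varpi_qmult:
  assumes "r \<in> {1, 2, 3}" "s \<in> {1, 2, 3}"
  shows "varpi (fst (qmult g h)) (snd (qmult g h)) r s =
    varpi (fst g) (snd g) r 1 * varpi (fst h) (snd h) 1 s + varpi (fst g) (snd g) r 2 * varpi (fst h) (snd h) 2 s
    + varpi (fst g) (snd g) r 3 * varpi (fst h) (snd h) 3 s"
  using assms by (elim insertE emptyE)
    (simp_all add: varpi_entries qmult_def algebra_simps)

section \<open>The representation of SU(2) on harmonic cubics\<close>

definition actq :: "quat \<Rightarrow> (real \<Rightarrow> real \<Rightarrow> real \<Rightarrow> real) \<Rightarrow> real \<Rightarrow> real \<Rightarrow> real \<Rightarrow> real" where
  "actq g f = act_cubic (fst g) (snd g) f"

lemma actq_qmult: "actq (qmult g h) f = actq g (actq h f)"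
  unfolding actq_def act_cubic_def fun_eq_iff
  by (intro allI, rule arg_cong3[where f = f]) (simp_all add: varpi_qmult algebra_simps)

lemma actq_one: "actq (1, 0) f = f"
  by (simp add: actq_def act_cubic_def varpi_entries fun_eq_iff)

text \<open>Written with scaled sums of products of three factors only, so that rules for sums,
  scalar multiples and triple products apply to it syntactically.\<close>

lemma cubic_of_prod: "cubic_of q X Y Z =
      (q$1 * sqrt 10 / 10) * (2 * (X * X * X) + (- 3 * (X * Y * Y) + - 3 * (X * Z * Z)))
    + (q$2 * - sqrt 6) * (X * Y * Z)
    + (q$3 * sqrt 6 / 2) * (X * Y * Y + - 1 * (X * Z * Z))
    + (q$4 * - sqrt 15 / 10) * (4 * (X * X * Y) + (- 1 * (Y * Y * Y) + - 1 * (Y * Z * Z)))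
    + (q$5 * - sqrt 15 / 10) * (4 * (X * X * Z) + (- 1 * (Y * Y * Z) + - 1 * (Z * Z * Z)))
    + (q$6 / 2) * (Y * Y * Y + - 3 * (Y * Z * Z))
    + (q$7 / 2) * (Z * Z * Z + - 3 * (Y * Y * Z))"
  by (simp add: cubic_of_expand power2_eq_square algebra_simps add_divide_distrib diff_divide_distrib)

text \<open>Rotations preserve harmonicity: the rotated coordinates are orthonormal linear forms, so
  the Laplacians of their products combine, and cancel, as those of the original coordinates
  do.\<close>

lemma actq_cubic_of:
  assumes g: "g \<in> S3q"
  shows "actq g (cubic_of q) = cubic_of (coeffs_of (actq g (cubic_of q)))"
proof (rule tr_cubic_harmonic)
  define u where "u = (\<lambda>r k. varpi (fst g) (snd g) r k)"
  define L where "L = (\<lambda>k x y z. x * u 1 k + y * u 2 k + z * u 3 k)"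
  define \<delta> :: "nat \<Rightarrow> nat \<Rightarrow> real" where "\<delta> = (\<lambda>k l. if k = l then 1 else 0)"
  define T where "T = (\<lambda>k l m r. \<delta> k l * u r m + \<delta> k m * u r l + \<delta> l m * u r k)"
  have o: "u 1 k * u 1 l + u 2 k * u 2 l + u 3 k * u 3 l = \<delta> k l" if "k \<in> {1, 2, 3}" "l \<in> {1, 2, 3}" for k l
    unfolding u_def \<delta>_def using varpi_orthonormal[of "fst g" "snd g", OF _ that] g by simp
  have P: "tr_cubic (\<lambda>x y z. L k x y z * L l x y z * L m x y z) (T k l m 1) (T k l m 2) (T k l m 3)"
    if "k \<in> {1, 2, 3}" "l \<in> {1, 2, 3}" "m \<in> {1, 2, 3}" for k l m
    using tr_cubic_prod[of "u 1 k" "u 2 k" "u 3 k" "u 1 l" "u 2 l" "u 3 l" "u 1 m" "u 2 m" "u 3 m"]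
    unfolding o[OF that(1,2)] o[OF that(1,3)] o[OF that(2,3)] L_def T_def .
  have m: "1 \<in> {1, 2, 3 :: nat}" "2 \<in> {1, 2, 3 :: nat}" "3 \<in> {1, 2, 3 :: nat}"
    by simp_all
  have "actq g (cubic_of q) = (\<lambda>x y z. cubic_of q (L 1 x y z) (L 2 x y z) (L 3 x y z))"
    unfolding fun_eq_iff actq_def act_cubic_def L_def u_def by simp
  moreover
  let ?t = "\<lambda>r. (q$1 * sqrt 10 / 10) * (2 * T 1 1 1 r + (- 3 * T 1 2 2 r + - 3 * T 1 3 3 r))
    + (q$2 * - sqrt 6) * T 1 2 3 r
    + (q$3 * sqrt 6 / 2) * (T 1 2 2 r + - 1 * T 1 3 3 r)
    + (q$4 * - sqrt 15 / 10) * (4 * T 1 1 2 r + (- 1 * T 2 2 2 r + - 1 * T 2 3 3 r))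
    + (q$5 * - sqrt 15 / 10) * (4 * T 1 1 3 r + (- 1 * T 2 2 3 r + - 1 * T 3 3 3 r))
    + (q$6 / 2) * (T 2 2 2 r + - 3 * T 2 3 3 r)
    + (q$7 / 2) * (T 3 3 3 r + - 3 * T 2 2 3 r)"
  have "tr_cubic (\<lambda>x y z. cubic_of q (L 1 x y z) (L 2 x y z) (L 3 x y z)) (?t 1) (?t 2) (?t 3)"
    unfolding cubic_of_prod by (intro tr_cubic_add tr_cubic_scale P m)
  moreover have "?t r = 0" for r
    by (simp add: T_def \<delta>_def algebra_simps)
  ultimately show "tr_cubic (actq g (cubic_of q)) 0 0 0"
    by simp
qed

text \<open>The action on cubics, transported to coefficient vectors and extended by fixing the
  coordinate 0.\<close>

definition rho3 :: "quat \<Rightarrow> real^8 \<Rightarrow> real^8" where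
  "rho3 g q = q $ 0 *\<^sub>R axis 0 1 + coeffs_of (actq g (cubic_of q))"

lemma coeffs_of_0 [simp]: "coeffs_of P $ 0 = 0"
  by (simp add: coeffs_of_def Let_def)

lemma rho3_0 [simp]: "rho3 g q $ 0 = q $ 0"
  by (simp add: rho3_def axis_def)

lemma cubic_of_add: "cubic_of (p + q) = (\<lambda>x y z. cubic_of p x y z + cubic_of q x y z)"
  and cubic_of_scale: "cubic_of (r *\<^sub>R q) = (\<lambda>x y z. r * cubic_of q x y z)"
  by (simp_all add: cubic_of_def fun_eq_iff distrib_right sum.distrib sum_distrib_left mult.assoc)

lemma cubic_of_rho3: "g \<in> S3q \<Longrightarrow> cubic_of (rho3 g q) = actq g (cubic_of q)"
  unfolding rho3_def by (subst (2) actq_cubic_of) (simp_all add: cubic_of_expand axis_def fun_eq_iff)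

lemma actq_add: "actq g (\<lambda>x y z. P x y z + Q x y z) = (\<lambda>x y z. actq g P x y z + actq g Q x y z)"
  and actq_scale: "actq g (\<lambda>x y z. r * P x y z) = (\<lambda>x y z. r * actq g P x y z)"
  by (simp_all add: actq_def act_cubic_def fun_eq_iff)

lemma linear_rho3: "linear (rho3 g)"
  by (rule linearI) (simp_all add: rho3_def cubic_of_add cubic_of_scale actq_add actq_scale coeffs_of_add coeffs_of_scale algebra_simps)

lemma rho3_qmult: "g \<in> S3q \<Longrightarrow> h \<in> S3q \<Longrightarrow> rho3 (qmult g h) q = rho3 g (rho3 h q)"
  by (subst (1 2) rho3_def) (simp add: cubic_of_rho3 actq_qmult)

lemma rho3_fixI:
  assumes "actq g (cubic_of q) = cubic_of q"
  shows "rho3 g q = q"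
proof -
  have "coeffs_of (cubic_of (q - q $ 0 *\<^sub>R axis 0 1)) = q - q $ 0 *\<^sub>R axis 0 1"
    by (rule coeffs_of_cubic_of) (simp add: axis_def)
  moreover have "cubic_of (q - q $ 0 *\<^sub>R axis 0 1) = cubic_of q"
    by (simp add: fun_eq_iff cubic_of_expand axis_def)
  ultimately show ?thesis
    unfolding rho3_def assms by simp
qed

lemma continuous_on_coeffs_of:
  assumes "\<And>x y z. continuous_on S (\<lambda>g. P g x y z)"
  shows "continuous_on S (\<lambda>g. coeffs_of (P g))"
  unfolding coeffs_of_def Let_def
  by (rule continuous_on_mk8 assms continuous_on_const continuous_on_add continuous_on_diff continuous_on_minus continuous_on_mult continuous_on_divide | simp)+

lemma continuous_on_rho3: "continuous_on S (\<lambda>g. rho3 g q)"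
  unfolding rho3_def
proof (intro continuous_on_add continuous_on_const continuous_on_coeffs_of)
  show "continuous_on S (\<lambda>g. actq g (cubic_of q) x y z)" for x y z
    unfolding actq_def act_cubic_def cubic_of_prod varpi_entries by (intro continuous_intros) simp_all
qed

text \<open>The first generator turns the coordinate planes (2,3), (4,5) and (6,7) with speeds 4, 2
  and 6. These are twice the weights 2, 1 and 3 of a rotation about the x-axis, the doubling being
  that of the double cover \<open>varpi\<close>.\<close>

definition Y3 :: "3 \<Rightarrow> real^8^8" where
  "Y3 = pick (matrix (skew8 0 0 0 0 0 0 4 0 0 0 0 0 0 0 0 2 0 0 0 0 (-6)))
    (matrix (skew8 0 0 0 (2 * sqrt 6) 0 0 0 (sqrt 10) 0 (- sqrt 6) 0 0 (sqrt 10) 0 (sqrt 6) 0 0 0 0 0 0))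
    (matrix (skew8 0 0 (- 2 * sqrt 6) 0 0 0 0 0 (- sqrt 10) 0 (sqrt 6) (sqrt 10) 0 (sqrt 6) 0 0 0 0 0 0 0))"

text \<open>Multiplication table of the three surds in the positions where normalised terms contain
  them; \<open>sqrt_products_mid\<close> supplies those with a factor in between.\<close>

lemma sqrt_products:
  "sqrt 6 * (sqrt 10 * x) = 2 * (sqrt 15 * x)" "sqrt 10 * (sqrt 6 * x) = 2 * (sqrt 15 * x)" "sqrt 6 * sqrt 10 = 2 * sqrt 15" "sqrt 10 * sqrt 6 = 2 * sqrt 15"
  "sqrt 6 * (sqrt 15 * x) = 3 * (sqrt 10 * x)" "sqrt 15 * (sqrt 6 * x) = 3 * (sqrt 10 * x)" "sqrt 6 * sqrt 15 = 3 * sqrt 10" "sqrt 15 * sqrt 6 = 3 * sqrt 10"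
  "sqrt 10 * (sqrt 15 * x) = 5 * (sqrt 6 * x)" "sqrt 15 * (sqrt 10 * x) = 5 * (sqrt 6 * x)" "sqrt 10 * sqrt 15 = 5 * sqrt 6" "sqrt 15 * sqrt 10 = 5 * sqrt 6"
  for x :: real
proof -
  have e: "sqrt 6 = sqrt 2 * sqrt 3" "sqrt 10 = sqrt 2 * sqrt 5" "sqrt 15 = sqrt 3 * sqrt 5"
    using real_sqrt_mult[of 2 3] real_sqrt_mult[of 2 5] real_sqrt_mult[of 3 5] by simp_all
  have "sqrt 6 * sqrt 10 = (sqrt 2 * sqrt 2) * (sqrt 3 * sqrt 5)"
    "sqrt 6 * sqrt 15 = (sqrt 3 * sqrt 3) * (sqrt 2 * sqrt 5)"
    "sqrt 10 * sqrt 15 = (sqrt 5 * sqrt 5) * (sqrt 2 * sqrt 3)"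
    by (simp_all only: e mult_ac)
  then show p: "sqrt 6 * sqrt 10 = 2 * sqrt 15" "sqrt 6 * sqrt 15 = 3 * sqrt 10" "sqrt 10 * sqrt 15 = 5 * sqrt 6"
    by (simp_all only: e[symmetric]) simp_all
  then show q: "sqrt 10 * sqrt 6 = 2 * sqrt 15" "sqrt 15 * sqrt 6 = 3 * sqrt 10" "sqrt 15 * sqrt 10 = 5 * sqrt 6"
    by (simp_all only: mult.commute)
  show "sqrt 6 * (sqrt 10 * x) = 2 * (sqrt 15 * x)" "sqrt 10 * (sqrt 6 * x) = 2 * (sqrt 15 * x)"
    "sqrt 6 * (sqrt 15 * x) = 3 * (sqrt 10 * x)" "sqrt 15 * (sqrt 6 * x) = 3 * (sqrt 10 * x)"
    "sqrt 10 * (sqrt 15 * x) = 5 * (sqrt 6 * x)" "sqrt 15 * (sqrt 10 * x) = 5 * (sqrt 6 * x)"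
    by (simp_all only: mult.assoc[symmetric] p q)
qed

lemma sqrt_products_mid: "sqrt 6 * (r * sqrt 10) = 2 * (r * sqrt 15)" "sqrt 10 * (r * sqrt 6) = 2 * (r * sqrt 15)"
  "sqrt 6 * (r * sqrt 15) = 3 * (r * sqrt 10)" "sqrt 15 * (r * sqrt 6) = 3 * (r * sqrt 10)"
  "sqrt 10 * (r * sqrt 15) = 5 * (r * sqrt 6)" "sqrt 15 * (r * sqrt 10) = 5 * (r * sqrt 6)"
  "sqrt 6 * (r * sqrt 6) = 6 * r" "sqrt 10 * (r * sqrt 10) = 10 * r" "sqrt 15 * (r * sqrt 15) = 15 * r"
  for r :: real
  by (simp_all add: mult.left_commute[of _ r] sqrt_products)

lemma actq_rot_deriv:
  "((\<lambda>t. actq (rot u t) (cubic_of q) x y z) has_real_derivative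
     cubic_of (u$1 *\<^sub>R (Y3 1 *v q) + u$2 *\<^sub>R (Y3 2 *v q) + u$3 *\<^sub>R (Y3 3 *v q)) x y z) (at 0)"
proof -
  define X where "X = (\<lambda>t s. x * varpi (fst (rot u t)) (snd (rot u t)) 1 s + y * varpi (fst (rot u t)) (snd (rot u t)) 2 s
      + z * varpi (fst (rot u t)) (snd (rot u t)) 3 s)"
  \<comment> \<open>The velocity is twice the cross product of \<open>u\<close> with (x, y,
    z).\<close>
  have d: "((\<lambda>t. X t 1) has_real_derivative 2 * u$2 * z - 2 * u$3 * y) (at 0)"
    "((\<lambda>t. X t 2) has_real_derivative 2 * u$3 * x - 2 * u$1 * z) (at 0)"
    "((\<lambda>t. X t 3) has_real_derivative 2 * u$1 * y - 2 * u$2 * x) (at 0)"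
    unfolding X_def varpi_entries rot_def by (auto intro!: derivative_eq_intros simp: algebra_simps)
  have X0: "X 0 1 = x" "X 0 (Suc 0) = x" "X 0 2 = y" "X 0 3 = z"
    by (simp_all add: X_def varpi_entries rot_def)
  have "((\<lambda>t. cubic_of q (X t 1) (X t 2) (X t 3)) has_real_derivative
      cubic_of (u$1 *\<^sub>R (Y3 1 *v q) + u$2 *\<^sub>R (Y3 2 *v q) + u$3 *\<^sub>R (Y3 3 *v q)) x y z) (at 0)"
    unfolding cubic_of_prod[of q]
    apply (rule derivative_eq_intros d refl)+
    unfolding X0
    by (simp add: X0 Y3_def matrix_skew8_mult skew8_def cubic_of_expand power2_eq_square algebra_simps add_divide_distrib diff_divide_distrib
        sqrt_squares sqrt_products sqrt_products_mid)
  then show ?thesis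
    by (simp only: actq_def act_cubic_def X_def)
qed

lemma coeffs_of_deriv:
  assumes "\<And>x y z. ((\<lambda>t. P t x y z) has_real_derivative Q x y z) (at s)"
  shows "((\<lambda>t. coeffs_of (P t)) has_vector_derivative coeffs_of Q) (at s)"
  unfolding coeffs_of_def Let_def
  by (rule has_vector_derivative_mk8) (rule DERIV_const DERIV_cmult DERIV_cdivide DERIV_diff DERIV_add assms)+

lemma rho3_deriv:
  "((\<lambda>t. rho3 (rot u t) q) has_vector_derivative
     (u$1 *\<^sub>R (Y3 1 *v q) + u$2 *\<^sub>R (Y3 2 *v q) + u$3 *\<^sub>R (Y3 3 *v q))) (at 0)"
proof -
  let ?v = "u$1 *\<^sub>R (Y3 1 *v q) + u$2 *\<^sub>R (Y3 2 *v q) + u$3 *\<^sub>R (Y3 3 *v q)"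
  have "coeffs_of (cubic_of ?v) = ?v"
    by (rule coeffs_of_cubic_of) (simp add: Y3_def matrix_skew8_mult skew8_def)
  then show ?thesis
    using has_vector_derivative_add[OF has_vector_derivative_const coeffs_of_deriv[of "\<lambda>t. actq (rot u t) (cubic_of q)", OF actq_rot_deriv[of u q]],
        of "q $ 0 *\<^sub>R axis 0 1"]
    by (simp add: rho3_def)
qed

lemma cubic_orbit_eq:
  assumes "cubic_of p = hcubic k" "p $ 0 = 0"
  shows "cubic_orbit k = (\<lambda>g. rho3 g p) ` S3q"
proof -
  have o: "cubic_orbit k = {q. q $ 0 = 0 \<and> (\<exists>g\<in>S3q. cubic_of q = actq g (cubic_of p))}"
    by (auto simp: cubic_orbit_def su2_def S3q_def cubic_of_def[symmetric] actq_def assms(1)[symmetric] fun_eq_iff)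
  have "q = rho3 g p" if "q $ 0 = 0" "cubic_of q = actq g (cubic_of p)" for q g
    using coeffs_of_cubic_of[OF that(1)] by (simp add: rho3_def assms(2) that(2))
  then show ?thesis
    unfolding o by (auto simp: assms(2) cubic_of_rho3)
qed

section \<open>Complexified cubics evaluated at isotropic vectors\<close>

definition ccubic :: "real^8 \<Rightarrow> complex \<Rightarrow> complex \<Rightarrow> complex \<Rightarrow> complex" where
  "ccubic q x y z = of_real (q$1) * (of_real (sqrt 10 / 10) * (x * (2 * (x * x) - 3 * (y * y) - 3 * (z * z))))
    + of_real (q$2) * (- of_real (sqrt 6) * (x * y * z))
    + of_real (q$3) * (of_real (sqrt 6 / 2) * (x * (y * y - z * z)))
    + of_real (q$4) * (of_real (- sqrt 15 / 10) * (y * (4 * (x * x) - y * y - z * z)))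
    + of_real (q$5) * (of_real (- sqrt 15 / 10) * (z * (4 * (x * x) - y * y - z * z)))
    + of_real (q$6) * (of_real (1 / 2) * (y * (y * y - 3 * (z * z))))
    + of_real (q$7) * (of_real (1 / 2) * (z * (z * z - 3 * (y * y))))"

text \<open>The complex extension of a homogeneous real cubic, by polarisation. With real part x and
  imaginary part y of the argument, the values at x + y and x - y supply the mixed terms P(x, y, y)
  and P(x, x, y) of the symmetric trilinear form. It lets the action on real cubics be carried over
  to complex arguments.\<close>

definition polar :: "(real \<Rightarrow> real \<Rightarrow> real \<Rightarrow> real) \<Rightarrow> complex \<Rightarrow> complex \<Rightarrow> complex \<Rightarrow> complex" where
  "polar P x y z = (let u = P (Re x) (Re y) (Re z); v = P (Im x) (Im y) (Im z);
      s = P (Re x + Im x) (Re y + Im y) (Re z + Im z); d = P (Re x - Im x) (Re y - Im y) (Re z - Im z)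
    in Complex (2 * u - (s + d) / 2) ((s - d) / 2 - 2 * v))"

lemma polar_add: "polar (\<lambda>x y z. P x y z + Q x y z) x y z = polar P x y z + polar Q x y z"
  and polar_scale: "polar (\<lambda>x y z. r * P x y z) x y z = of_real r * polar P x y z"
  by (simp_all add: polar_def Let_def complex_eq_iff algebra_simps add_divide_distrib diff_divide_distrib)

lemma polar_monomials:
  "polar (\<lambda>x y z. x * x * x) x y z = x * x * x" "polar (\<lambda>x y z. x * y * y) x y z = x * y * y"
  "polar (\<lambda>x y z. x * z * z) x y z = x * z * z" "polar (\<lambda>x y z. x * y * z) x y z = x * y * z"
  "polar (\<lambda>x y z. x * x * y) x y z = x * x * y" "polar (\<lambda>x y z. x * x * z) x y z = x * x * z"
  "polar (\<lambda>x y z. y * y * y) x y z = y * y * y" "polar (\<lambda>x y z. y * z * z) x y z = y * z * z"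
  "polar (\<lambda>x y z. y * y * z) x y z = y * y * z" "polar (\<lambda>x y z. z * z * z) x y z = z * z * z"
  by (simp_all add: polar_def Let_def complex_eq_iff algebra_simps add_divide_distrib diff_divide_distrib)

lemma ccubic_polar: "ccubic q x y z = polar (cubic_of q) x y z"
  unfolding cubic_of_prod[abs_def] polar_add polar_scale polar_monomials
  by (simp add: ccubic_def algebra_simps add_divide_distrib diff_divide_distrib)

lemma ccubic_rho3:
  assumes "g \<in> S3q"
  defines "u \<equiv> \<lambda>r s. of_real (varpi (fst g) (snd g) r s) :: complex"
  shows "ccubic (rho3 g q) x y z = ccubic q (x * u 1 1 + y * u 2 1 + z * u 3 1) (x * u 1 2 + y * u 2 2 + z * u 3 2)
    (x * u 1 3 + y * u 2 3 + z * u 3 3)"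
  by (simp add: ccubic_polar cubic_of_rho3[OF assms(1)] polar_def Let_def actq_def act_cubic_def u_def algebra_simps)

text \<open>The vector (2\<i>\<alpha>\<beta>, \<alpha>^2 + \<beta>^2, -\<i>(\<alpha>^2 - \<beta>^2))
  is the square of the spinor (\<alpha>, \<beta>). Rotating it amounts to multiplying the spinor by
  \<open>g\<close>, that is, to replacing (\<alpha>, \<beta>) by (X, Y).\<close>

lemma isotropic_varpi:
  fixes g :: quat and \<alpha> \<beta> :: complex
  defines "u \<equiv> \<lambda>r s. of_real (varpi (fst g) (snd g) r s) :: complex"
    and "x \<equiv> 2 * \<i> * (\<alpha> * \<beta>)" and "y \<equiv> \<alpha> * \<alpha> + \<beta> * \<beta>" and "z \<equiv> - \<i> * (\<alpha> * \<alpha> - \<beta> * \<beta>)"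
    and "X \<equiv> XX \<alpha> \<beta> g" and "Y \<equiv> YY \<alpha> \<beta> g"
  shows "x * u 1 1 + y * u 2 1 + z * u 3 1 = 2 * \<i> * (X * Y)" "x * u 1 2 + y * u 2 2 + z * u 3 2 = X * X + Y * Y"
    "x * u 1 3 + y * u 2 3 + z * u 3 3 = - \<i> * (X * X - Y * Y)"
  unfolding complex_eq_iff assms XX_def YY_def varpi_entries
  by (simp_all add: algebra_simps)

lemma ccubic_isotropic:
  assumes "g \<in> S3q"
  shows "ccubic (rho3 g q) (2 * \<i> * (\<alpha> * \<beta>)) (\<alpha> * \<alpha> + \<beta> * \<beta>) (- \<i> * (\<alpha> * \<alpha> - \<beta> * \<beta>)) =
    ccubic q (2 * \<i> * (XX \<alpha> \<beta> g * YY \<alpha> \<beta> g)) (XX \<alpha> \<beta> g * XX \<alpha> \<beta> g + YY \<alpha> \<beta> g * YY \<alpha> \<beta> g)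
      (- \<i> * (XX \<alpha> \<beta> g * XX \<alpha> \<beta> g - YY \<alpha> \<beta> g * YY \<alpha> \<beta> g))"
  unfolding ccubic_rho3[OF assms] isotropic_varpi ..

text \<open>The value of the complexified cubic at a fixed point is linear in the coefficient
  vector, so its real and imaginary parts are restrictions of linear functions. At isotropic points
  these are combinations of the \<open>MM\<close> with p + q = 6.\<close>

lemma mean_ccubic:
  assumes lin: "\<And>w. mean (\<lambda>g. f g * (w \<bullet> r g)) = 0"
    and h: "\<And>g. g \<in> S3q \<Longrightarrow> c * ccubic (r g) x y z = h g"
  shows "mean (\<lambda>g. f g * Re (h g)) = 0" "mean (\<lambda>g. f g * Im (h g)) = 0"
proof -
  have e: "\<exists>w. \<forall>q :: real^8. Re (c * (of_real (q$1) * k1 + of_real (q$2) * k2 + of_real (q$3) * k3 + of_real (q$4) * k4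
      + of_real (q$5) * k5 + of_real (q$6) * k6 + of_real (q$7) * k7)) = w \<bullet> q" for c k1 k2 k3 k4 k5 k6 k7
    by (rule exI[of _ "mk8 0 (Re (c * k1)) (Re (c * k2)) (Re (c * k3)) (Re (c * k4)) (Re (c * k5)) (Re (c * k6)) (Re (c * k7))"])
      (simp add: mk8_inner algebra_simps)
  obtain w where w: "\<And>q. Re (c * ccubic q x y z) = w \<bullet> q"
    using e unfolding ccubic_def by meson
  obtain w' where w': "\<And>q. Re ((- \<i> * c) * ccubic q x y z) = w' \<bullet> q"
    using e unfolding ccubic_def by meson
  show "mean (\<lambda>g. f g * Re (h g)) = 0"
    by (rule mean_linear_part[OF lin, of _ w]) (simp only: w flip: h)
  show "mean (\<lambda>g. f g * Im (h g)) = 0"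
  proof (rule mean_linear_part[OF lin, of _ w'])
    fix g assume "g \<in> S3q"
    have "Im (h g) = Re (- \<i> * (c * ccubic (r g) x y z))"
      by (simp add: h[OF \<open>g \<in> S3q\<close>])
    then show "Im (h g) = w' \<bullet> r g"
      by (simp only: w'[symmetric] mult.assoc)
  qed
qed

section \<open>Consequences of invariance under the stabiliser\<close>

lemma mean_stabiliser:
  assumes "continuous_on S3q f" "continuous_on S3q h" "u \<in> S3q" "\<And>g. g \<in> S3q \<Longrightarrow> f (qmult g u) = f g"
  shows "mean (\<lambda>g. f g * h (qmult g u)) = mean (\<lambda>g. f g * h g)"
proof -
  have "mean (\<lambda>g. f (qmult g u) * h (qmult g u)) = mean (\<lambda>g. f g * h g)"
    by (rule mean_right_mult) (intro continuous_intros assms)+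
  moreover have "mean (\<lambda>g. f (qmult g u) * h (qmult g u)) = mean (\<lambda>g. f g * h (qmult g u))"
    by (rule mean_cong) (simp add: assms)
  ultimately show ?thesis
    by simp
qed

text \<open>The first unit acts by the weight, the second interchanges X and Y up to sign.\<close>

lemma MM_right_mult:
  "MM \<alpha> \<beta> p q (qmult g (\<i>, 0)) = \<i> ^ p * (- \<i>) ^ q * MM \<alpha> \<beta> p q g"
  "MM \<alpha> \<beta> p q (qmult g (0, 1)) = (- 1) ^ q * MM \<alpha> \<beta> q p g"
proof -
  have "XX \<alpha> \<beta> (qmult g (\<i>, 0)) = \<i> * XX \<alpha> \<beta> g" "YY \<alpha> \<beta> (qmult g (\<i>, 0)) = - \<i> * YY \<alpha> \<beta> g"
    by (simp_all add: XX_def YY_def qmult_def algebra_simps)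
  then show "MM \<alpha> \<beta> p q (qmult g (\<i>, 0)) = \<i> ^ p * (- \<i>) ^ q * MM \<alpha> \<beta> p q g"
    by (simp only: MM_def power_mult_distrib mult_ac)
  have "XX \<alpha> \<beta> (qmult g (0, 1)) = YY \<alpha> \<beta> g" "YY \<alpha> \<beta> (qmult g (0, 1)) = - 1 * XX \<alpha> \<beta> g"
    by (simp_all add: XX_def YY_def qmult_def algebra_simps)
  then show "MM \<alpha> \<beta> p q (qmult g (0, 1)) = (- 1) ^ q * MM \<alpha> \<beta> q p g"
    by (simp only: MM_def power_mult_distrib mult_ac)
qed

section \<open>The orbits L3 and L4\<close>

lemma L3_homogeneous:
  "homogeneous_lagrangian rho3 Y3 (mk8 0 0 1 0 0 0 0 0) (pick (16) (16) (16)) 64 L3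
     (pick (mk8 0 0 0 (-4) 0 0 0 0) (mk8 0 0 0 0 (- sqrt 10) 0 (sqrt 6) 0) (mk8 0 0 0 0 0 (sqrt 10) 0 (- sqrt 6)))
     (pick (mk8 0 (-4) 0 0 0 0 0 0) (mk8 0 0 0 0 (- sqrt 6) 0 (- sqrt 10) 0) (mk8 0 0 0 0 0 (- sqrt 6) 0 (- sqrt 10)))"
proof (rule homogeneous_lagrangian.intro)
  fix g h :: quat and x :: "real^8" and u :: "real^3" and k i j :: 3 and r s :: 8
  let ?p = "mk8 0 0 1 0 0 0 0 0"
  let ?U = "(pick (mk8 0 0 0 (-4) 0 0 0 0) (mk8 0 0 0 0 (- sqrt 10) 0 (sqrt 6) 0) (mk8 0 0 0 0 0 (sqrt 10) 0 (- sqrt 6)))"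
  let ?n = "(pick (mk8 0 (-4) 0 0 0 0 0 0) (mk8 0 0 0 0 (- sqrt 6) 0 (- sqrt 10) 0) (mk8 0 0 0 0 0 (- sqrt 6) 0 (- sqrt 10)))"
  let ?m = "(pick (16) (16) (16)) :: 3 \<Rightarrow> real"
  show "linear (rho3 g)"
    by (rule linear_rho3)
  show "rho3 (qmult g h) x = rho3 g (rho3 h x)" if "g \<in> S3q" "h \<in> S3q"
    using that by (rule rho3_qmult)
  show "rho3 (1, 0) x = x"
    by (rule rho3_fixI) (rule actq_one)
  show "continuous_on S3q (\<lambda>g. rho3 g x)"
    by (rule continuous_on_rho3)
  show "((\<lambda>t. rho3 (rot u t) x) has_vector_derivative
      (u$1 *\<^sub>R (Y3 1 *v x) + u$2 *\<^sub>R (Y3 2 *v x) + u$3 *\<^sub>R (Y3 3 *v x))) (at 0)"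
    by (rule rho3_deriv)
  show "Y3 k $ r $ s = - Y3 k $ s $ r"
    unfolding Y3_def pick_def by (auto intro: matrix_skew8_skew)
  show "Y3 k \<in> spin7"
    unfolding Y3_def pick_def by (auto intro: matrix_skew8_spin7)
  show "Y3 k *v axis 0 1 = 0"
    unfolding Y3_def pick_def by (auto intro: matrix_skew8_axis0)
  show "Y3 1 *v (Y3 2 *v x) - Y3 2 *v (Y3 1 *v x) = - 2 *\<^sub>R (Y3 3 *v x)"
    "Y3 2 *v (Y3 3 *v x) - Y3 3 *v (Y3 2 *v x) = - 2 *\<^sub>R (Y3 1 *v x)"
    "Y3 3 *v (Y3 1 *v x) - Y3 1 *v (Y3 3 *v x) = - 2 *\<^sub>R (Y3 2 *v x)"
    unfolding Y3_def pick_simps matrix_skew8_mult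
    by (simp_all add: skew8_def mk8_diff mk8_scaleR mk8_eq_iff algebra_simps sqrt_squares sqrt_products sqrt_products_mid)
  show "norm ?p = 1"
    by (simp add: norm_eq_1 mk8_inner power2_eq_square sqrt_squares sqrt_products sqrt_products_mid)
  show "?p $ 0 = 0"
    by simp
  show "L3 = (\<lambda>g. rho3 g ?p) ` S3q"
    unfolding L3_def by (rule cubic_orbit_eq) (simp_all add: fun_eq_iff cubic_of_expand hcubic_def)
  show "0 < ?m k" "?m 2 = ?m 3" "(64::real) \<noteq> 0"
    by (simp_all add: pick_def)
  show "?U k = Y3 k *v ?p"
    unfolding Y3_def pick_def by (simp add: matrix_skew8_mult skew8_def mk8_eq_iff sqrt_squares sqrt_products sqrt_products_mid)
  show "?n k = Jmap ?p (?U k)"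
    unfolding pick_def by (simp add: Jmap_def sigmaNK_def phi0_def dx3_def det3_def vec_eq_iff forall_8 axis_def algebra_simps sqrt_squares sqrt_products sqrt_products_mid)
  show "?U i \<bullet> ?U j = (if i = j then ?m i else 0)"
    using exhaust_3[of i] exhaust_3[of j] by (auto simp: mk8_inner sqrt_squares sqrt_products sqrt_products_mid)
  show "Jmap ?p (?n k) = - ?U k"
    unfolding pick_def by (simp add: Jmap_def sigmaNK_def phi0_def dx3_def det3_def vec_eq_iff forall_8 axis_def algebra_simps sqrt_squares sqrt_products sqrt_products_mid)
  show "x = (x \<bullet> ?p) *\<^sub>R ?p + x $ 0 *\<^sub>R axis 0 1
        + ((x \<bullet> ?U 1) / ?m 1) *\<^sub>R ?U 1 + ((x \<bullet> ?U 2) / ?m 2) *\<^sub>R ?U 2 + ((x \<bullet> ?U 3) / ?m 3) *\<^sub>R ?U 3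
        + ((x \<bullet> ?n 1) / ?m 1) *\<^sub>R ?n 1 + ((x \<bullet> ?n 2) / ?m 2) *\<^sub>R ?n 2 + ((x \<bullet> ?n 3) / ?m 3) *\<^sub>R ?n 3"
    by (simp add: vec_eq_iff forall_8 mk8_inner_right axis_def algebra_simps add_divide_distrib diff_divide_distrib sqrt_squares sqrt_products sqrt_products_mid)
qed

lemma L3_rigid:
  "rigid_lagrangian rho3 Y3 (mk8 0 0 1 0 0 0 0 0) (pick (16) (16) (16)) 64 L3
     (pick (mk8 0 0 0 (-4) 0 0 0 0) (mk8 0 0 0 0 (- sqrt 10) 0 (sqrt 6) 0) (mk8 0 0 0 0 0 (sqrt 10) 0 (- sqrt 6)))
     (pick (mk8 0 (-4) 0 0 0 0 0 0) (mk8 0 0 0 0 (- sqrt 6) 0 (- sqrt 10) 0) (mk8 0 0 0 0 0 (- sqrt 6) 0 (- sqrt 10)))"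
proof (rule rigid_lagrangian.intro[OF L3_homogeneous], rule rigid_lagrangian_axioms.intro)
  fix nu F :: "3 \<Rightarrow> real" and N :: "3 \<Rightarrow> 3 \<Rightarrow> real"
  let ?p = "mk8 0 0 1 0 0 0 0 0"
  let ?U = "(pick (mk8 0 0 0 (-4) 0 0 0 0) (mk8 0 0 0 0 (- sqrt 10) 0 (sqrt 6) 0) (mk8 0 0 0 0 0 (sqrt 10) 0 (- sqrt 6)))"
  let ?n = "(pick (mk8 0 (-4) 0 0 0 0 0 0) (mk8 0 0 0 0 (- sqrt 6) 0 (- sqrt 10) 0) (mk8 0 0 0 0 0 (- sqrt 6) 0 (- sqrt 10)))"
  let ?m = "(pick (16) (16) (16)) :: 3 \<Rightarrow> real"
  let ?v = "64 :: real"
  note expand = frame_deriv_def Y3_def matrix_skew8_mult skew8_def axis0_mk8 mk8_scaleR mk8_add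
  show "Phi0 ?p (?U 1) (?U 2) (?U 3) = ?v"
    by (simp add: Phi0_dx4 dx4_def dx3_def det3_def sqrt_squares sqrt_products sqrt_products_mid)
  show "assoc_form ?U (axis 0 1) (frame_deriv Y3 ?n nu F N) = ?v * (N 1 1 + N 2 2 + N 3 3)"
    by (simp add: assoc_form_def expand Phi0_dx4 dx4_def dx3_def det3_def algebra_simps sqrt_squares sqrt_products sqrt_products_mid)
  show "assoc_form ?U (?n 1) (frame_deriv Y3 ?n nu F N) = ?v * (?m 1 * nu 1) - ?v * F 1
        - ?m 1 * ((3 * ?v - 2 * ?m 1) * nu 1 - (?m 3 * N 2 3 - ?m 2 * N 3 2))"
    by (simp add: assoc_form_def expand Phi0_dx4 dx4_def dx3_def det3_def algebra_simps sqrt_squares sqrt_products sqrt_products_mid)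
  show "assoc_form ?U (?n 2) (frame_deriv Y3 ?n nu F N) = ?v * (?m 2 * nu 2) - ?v * F 2
        - ?m 2 * ((3 * ?v - 2 * ?m 2) * nu 2 - (?m 1 * N 3 1 - ?m 3 * N 1 3))"
    by (simp add: assoc_form_def expand Phi0_dx4 dx4_def dx3_def det3_def algebra_simps sqrt_squares sqrt_products sqrt_products_mid)
  show "assoc_form ?U (?n 3) (frame_deriv Y3 ?n nu F N) = ?v * (?m 3 * nu 3) - ?v * F 3
        - ?m 3 * ((3 * ?v - 2 * ?m 3) * nu 3 - (?m 2 * N 1 2 - ?m 1 * N 2 1))"
    by (simp add: assoc_form_def expand Phi0_dx4 dx4_def dx3_def det3_def algebra_simps sqrt_squares sqrt_products sqrt_products_mid)
  show "phi0 (nu 1 *\<^sub>R ?n 1 + nu 2 *\<^sub>R ?n 2 + nu 3 *\<^sub>R ?n 3) (?U 1) (?U 2)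
        + phi0 ?p (frame_deriv Y3 ?n nu (\<lambda>_. 0) N 1) (?U 2) + phi0 ?p (?U 1) (frame_deriv Y3 ?n nu (\<lambda>_. 0) N 2)
        = (3 * ?v - 2 * ?m 3) * nu 3 - (?m 2 * N 1 2 - ?m 1 * N 2 1)"
    "phi0 (nu 1 *\<^sub>R ?n 1 + nu 2 *\<^sub>R ?n 2 + nu 3 *\<^sub>R ?n 3) (?U 2) (?U 3)
        + phi0 ?p (frame_deriv Y3 ?n nu (\<lambda>_. 0) N 2) (?U 3) + phi0 ?p (?U 2) (frame_deriv Y3 ?n nu (\<lambda>_. 0) N 3)
        = (3 * ?v - 2 * ?m 1) * nu 1 - (?m 3 * N 2 3 - ?m 2 * N 3 2)"
    "phi0 (nu 1 *\<^sub>R ?n 1 + nu 2 *\<^sub>R ?n 2 + nu 3 *\<^sub>R ?n 3) (?U 3) (?U 1)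
        + phi0 ?p (frame_deriv Y3 ?n nu (\<lambda>_. 0) N 3) (?U 1) + phi0 ?p (?U 3) (frame_deriv Y3 ?n nu (\<lambda>_. 0) N 1)
        = (3 * ?v - 2 * ?m 2) * nu 2 - (?m 1 * N 3 1 - ?m 3 * N 1 3)"
    by (simp_all add: expand phi0_def dx3_def det3_def algebra_simps sqrt_squares sqrt_products sqrt_products_mid)
  show "(1 / ?m 1) *\<^sub>R (Y3 1 *v ?U 1) + (1 / ?m 2) *\<^sub>R (Y3 2 *v ?U 2) + (1 / ?m 3) *\<^sub>R (Y3 3 *v ?U 3) = - 3 *\<^sub>R ?p"
    by (simp add: expand mk8_eq_iff sqrt_squares sqrt_products sqrt_products_mid)
next
  fix f :: "quat \<Rightarrow> real" and p q :: nat and \<alpha> \<beta> :: complex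
  let ?p = "mk8 0 0 1 0 0 0 0 0"
  let ?m = "(pick (16) (16) (16)) :: 3 \<Rightarrow> real"
  assume cont: "continuous_on S3q f"
    and inv: "\<And>g h. g \<in> S3q \<Longrightarrow> h \<in> S3q \<Longrightarrow> rho3 g ?p = rho3 h ?p \<Longrightarrow> f g = f h"
    and lin: "\<And>w. mean (\<lambda>g. f g * (w \<bullet> rho3 g ?p)) = 0"
    and ev: "(real p - real q)\<^sup>2 / ?m 1 + 2 * (2 * real p * real q + real p + real q) / ?m 3 = 3"
  \<comment> \<open>The elements (0, 1) and (\<i>, 0) cover half-turns about coordinate axes; each
    changes two signs and so fixes the cubic xyz.\<close>
  have fj: "f (qmult g (0, 1)) = f g" if "g \<in> S3q" for g
  proof (rule inv)
    have u: "(0, 1) \<in> S3q"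
      by (simp add: S3q_def)
    show "qmult g (0, 1) \<in> S3q" "g \<in> S3q"
      using that u by simp_all
    have "rho3 (0, 1) ?p = ?p"
      by (rule rho3_fixI) (simp add: actq_def act_cubic_def varpi_entries cubic_of_expand fun_eq_iff)
    then show "rho3 (qmult g (0, 1)) ?p = rho3 g ?p"
      using rho3_qmult[OF that u] by simp
  qed
  have fi: "f (qmult g (\<i>, 0)) = f g" if "g \<in> S3q" for g
  proof (rule inv)
    have u: "(\<i>, 0) \<in> S3q"
      by (simp add: S3q_def)
    show "qmult g (\<i>, 0) \<in> S3q" "g \<in> S3q"
      using that u by simp_all
    have "rho3 (\<i>, 0) ?p = ?p"
      by (rule rho3_fixI) (simp add: actq_def act_cubic_def varpi_entries cubic_of_expand fun_eq_iff)
    then show "rho3 (qmult g (\<i>, 0)) ?p = rho3 g ?p"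
      using rho3_qmult[OF that u] by simp
  qed
  have mfj: "mean (\<lambda>g. f g * h (qmult g (0, 1))) = mean (\<lambda>g. f g * h g)" if "continuous_on S3q h" for h :: "quat \<Rightarrow> real"
    by (rule mean_stabiliser[OF cont that]) (simp_all add: S3q_def fj)
  have mfi: "mean (\<lambda>g. f g * h (qmult g (\<i>, 0))) = mean (\<lambda>g. f g * h g)" if "continuous_on S3q h" for h :: "quat \<Rightarrow> real"
    by (rule mean_stabiliser[OF cont that]) (simp_all add: S3q_def fi)
  have cM: "continuous_on S3q (\<lambda>g. Re (MM \<alpha> \<beta> a b g))" "continuous_on S3q (\<lambda>g. Im (MM \<alpha> \<beta> a b g))" for a b
    by (intro continuous_intros)+
  have swap: "mean (\<lambda>g. f g * Re (MM \<alpha> \<beta> a b g)) = (- 1) ^ b * mean (\<lambda>g. f g * Re (MM \<alpha> \<beta> b a g))"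
    "mean (\<lambda>g. f g * Im (MM \<alpha> \<beta> a b g)) = (- 1) ^ b * mean (\<lambda>g. f g * Im (MM \<alpha> \<beta> b a g))" for a b
  proof -
    have e: "(- 1) ^ b = complex_of_real ((- 1) ^ b)"
      by simp
    have "f g * Re (MM \<alpha> \<beta> a b (qmult g (0, 1))) = (- 1) ^ b * (f g * Re (MM \<alpha> \<beta> b a g))"
      "f g * Im (MM \<alpha> \<beta> a b (qmult g (0, 1))) = (- 1) ^ b * (f g * Im (MM \<alpha> \<beta> b a g))" for g
      unfolding MM_right_mult e by (simp_all del: of_real_power)
    then show "mean (\<lambda>g. f g * Re (MM \<alpha> \<beta> a b g)) = (- 1) ^ b * mean (\<lambda>g. f g * Re (MM \<alpha> \<beta> b a g))"
      "mean (\<lambda>g. f g * Im (MM \<alpha> \<beta> a b g)) = (- 1) ^ b * mean (\<lambda>g. f g * Im (MM \<alpha> \<beta> b a g))"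
      using mfj[OF cM(1)[of a b]] mfj[OF cM(2)[of a b]] by (simp_all only: mean_cmult)
  qed
  \<comment> \<open>At the isotropic point xyz becomes 2 (X^5 Y - X Y^5); the constant cancels the
    resulting factor -2 sqrt 6.\<close>
  have l: "complex_of_real (- sqrt 6 / 12) * ccubic (rho3 g ?p) (2 * \<i> * (\<alpha> * \<beta>)) (\<alpha> * \<alpha> + \<beta> * \<beta>) (- \<i> * (\<alpha> * \<alpha> - \<beta> * \<beta>)) = MM \<alpha> \<beta> 5 1 g - MM \<alpha> \<beta> 1 5 g"
    if "g \<in> S3q" for g
    unfolding ccubic_isotropic[OF that] MM_def by (simp add: ccubic_def) (simp add: complex_eq_iff power_numeral_reduce algebra_simps sqrt_squares sqrt_products_mid)
  note lr = mean_ccubic[OF lin l]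
  have "mean (\<lambda>g. f g * Re (MM \<alpha> \<beta> 5 1 g)) - mean (\<lambda>g. f g * Re (MM \<alpha> \<beta> 1 5 g)) = 0"
    "mean (\<lambda>g. f g * Im (MM \<alpha> \<beta> 5 1 g)) - mean (\<lambda>g. f g * Im (MM \<alpha> \<beta> 1 5 g)) = 0"
    using lr by (simp_all add: mean_diff cont cM continuous_on_mult distrib_left right_diff_distrib)
  note rel = this
  \<comment> \<open>The condition says that a - b is 2 modulo 4. Then invariance under (\<i>, 0)
    makes the pairing equal to its own negative.\<close>
  have half: "mean (\<lambda>g. f g * Re (MM \<alpha> \<beta> a b g)) = 0 \<and> mean (\<lambda>g. f g * Im (MM \<alpha> \<beta> a b g)) = 0"
    if "\<i> ^ a * (- \<i>) ^ b = - 1" for a b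
  proof -
    have "f g * Re (MM \<alpha> \<beta> a b (qmult g (\<i>, 0))) = - 1 * (f g * Re (MM \<alpha> \<beta> a b g))"
      "f g * Im (MM \<alpha> \<beta> a b (qmult g (\<i>, 0))) = - 1 * (f g * Im (MM \<alpha> \<beta> a b g))" for g
      unfolding MM_right_mult that by simp_all
    then have "- 1 * mean (\<lambda>g. f g * Re (MM \<alpha> \<beta> a b g)) = mean (\<lambda>g. f g * Re (MM \<alpha> \<beta> a b g))"
      "- 1 * mean (\<lambda>g. f g * Im (MM \<alpha> \<beta> a b g)) = mean (\<lambda>g. f g * Im (MM \<alpha> \<beta> a b g))"
      using mfi[OF cM(1)[of a b]] mfi[OF cM(2)[of a b]] by (simp_all only: mean_cmult)
    then show ?thesis
      by simp
  qed
  have "(real p - real q)\<^sup>2 + 2 * (2 * (real p * real q) + real p + real q) = 48"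
    using ev by (simp add: pick_def field_simps)
  then have "(real p + real q)\<^sup>2 + 2 * (real p + real q) = 48"
    by (simp add: power2_eq_square algebra_simps)
  then have "(real p + real q - 6) * (real p + real q + 8) = 0"
    by (simp add: power2_eq_square algebra_simps)
  then have "p + q = 6"
    by auto
  then have "p \<in> {0, 1, 2, 3, 4, 5, 6}" "q = 6 - p"
    by auto
  \<comment> \<open>For p + q = 6 the last case covers even p. The pair (3, 3) is antisymmetric
    under (0, 1). For (5, 1) and (1, 5) invariance makes the pairings opposite while the linear
    function makes them equal, so both are 0.\<close>
  then consider "p = 1" "q = 5" | "p = 5" "q = 1" | "p = 3" "q = 3" | "\<i> ^ p * (- \<i>) ^ q = - 1"
    by (auto simp: power_numeral_reduce)
  then show "mean (\<lambda>g. f g * Re (MM \<alpha> \<beta> p q g)) = 0 \<and> mean (\<lambda>g. f g * Im (MM \<alpha> \<beta> p q g)) = 0"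
  proof cases
    case 1
    then show ?thesis
      using rel swap[of 5 1] by simp
  next
    case 2
    then show ?thesis
      using rel swap[of 5 1] by simp
  next
    case 3
    then show ?thesis
      using swap[of 3 3] by simp
  next
    case 4
    then show ?thesis
      by (rule half)
  qed
qed

text \<open>The negative volume only records that the frame U 1, U 2, U 3 has the opposite
  orientation.\<close>

lemma L4_homogeneous:
  "homogeneous_lagrangian rho3 Y3 (mk8 0 0 0 0 0 0 1 0) (pick (36) (6) (6)) (-36) L4
     (pick (mk8 0 0 0 0 0 0 0 6) (mk8 0 0 (- sqrt 6) 0 0 0 0 0) (mk8 0 0 0 (sqrt 6) 0 0 0 0))
     (pick (mk8 0 6 0 0 0 0 0 0) (mk8 0 0 0 0 (- sqrt 6) 0 0 0) (mk8 0 0 0 0 0 (- sqrt 6) 0 0))"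
proof (rule homogeneous_lagrangian.intro)
  fix g h :: quat and x :: "real^8" and u :: "real^3" and k i j :: 3 and r s :: 8
  let ?p = "mk8 0 0 0 0 0 0 1 0"
  let ?U = "(pick (mk8 0 0 0 0 0 0 0 6) (mk8 0 0 (- sqrt 6) 0 0 0 0 0) (mk8 0 0 0 (sqrt 6) 0 0 0 0))"
  let ?n = "(pick (mk8 0 6 0 0 0 0 0 0) (mk8 0 0 0 0 (- sqrt 6) 0 0 0) (mk8 0 0 0 0 0 (- sqrt 6) 0 0))"
  let ?m = "(pick (36) (6) (6)) :: 3 \<Rightarrow> real"
  show "linear (rho3 g)"
    by (rule linear_rho3)
  show "rho3 (qmult g h) x = rho3 g (rho3 h x)" if "g \<in> S3q" "h \<in> S3q"
    using that by (rule rho3_qmult)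
  show "rho3 (1, 0) x = x"
    by (rule rho3_fixI) (rule actq_one)
  show "continuous_on S3q (\<lambda>g. rho3 g x)"
    by (rule continuous_on_rho3)
  show "((\<lambda>t. rho3 (rot u t) x) has_vector_derivative
      (u$1 *\<^sub>R (Y3 1 *v x) + u$2 *\<^sub>R (Y3 2 *v x) + u$3 *\<^sub>R (Y3 3 *v x))) (at 0)"
    by (rule rho3_deriv)
  show "Y3 k $ r $ s = - Y3 k $ s $ r"
    unfolding Y3_def pick_def by (auto intro: matrix_skew8_skew)
  show "Y3 k \<in> spin7"
    unfolding Y3_def pick_def by (auto intro: matrix_skew8_spin7)
  show "Y3 k *v axis 0 1 = 0"
    unfolding Y3_def pick_def by (auto intro: matrix_skew8_axis0)
  show "Y3 1 *v (Y3 2 *v x) - Y3 2 *v (Y3 1 *v x) = - 2 *\<^sub>R (Y3 3 *v x)"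
    "Y3 2 *v (Y3 3 *v x) - Y3 3 *v (Y3 2 *v x) = - 2 *\<^sub>R (Y3 1 *v x)"
    "Y3 3 *v (Y3 1 *v x) - Y3 1 *v (Y3 3 *v x) = - 2 *\<^sub>R (Y3 2 *v x)"
    unfolding Y3_def pick_simps matrix_skew8_mult
    by (simp_all add: skew8_def mk8_diff mk8_scaleR mk8_eq_iff algebra_simps sqrt_squares sqrt_products sqrt_products_mid)
  show "norm ?p = 1"
    by (simp add: norm_eq_1 mk8_inner power2_eq_square sqrt_squares sqrt_products sqrt_products_mid)
  show "?p $ 0 = 0"
    by simp
  show "L4 = (\<lambda>g. rho3 g ?p) ` S3q"
    unfolding L4_def by (rule cubic_orbit_eq) (simp_all add: fun_eq_iff cubic_of_expand hcubic_def)
  show "0 < ?m k" "?m 2 = ?m 3" "((-36)::real) \<noteq> 0"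
    by (simp_all add: pick_def)
  show "?U k = Y3 k *v ?p"
    unfolding Y3_def pick_def by (simp add: matrix_skew8_mult skew8_def mk8_eq_iff sqrt_squares sqrt_products sqrt_products_mid)
  show "?n k = Jmap ?p (?U k)"
    unfolding pick_def by (simp add: Jmap_def sigmaNK_def phi0_def dx3_def det3_def vec_eq_iff forall_8 axis_def algebra_simps sqrt_squares sqrt_products sqrt_products_mid)
  show "?U i \<bullet> ?U j = (if i = j then ?m i else 0)"
    using exhaust_3[of i] exhaust_3[of j] by (auto simp: mk8_inner sqrt_squares sqrt_products sqrt_products_mid)
  show "Jmap ?p (?n k) = - ?U k"
    unfolding pick_def by (simp add: Jmap_def sigmaNK_def phi0_def dx3_def det3_def vec_eq_iff forall_8 axis_def algebra_simps sqrt_squares sqrt_products sqrt_products_mid)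
  show "x = (x \<bullet> ?p) *\<^sub>R ?p + x $ 0 *\<^sub>R axis 0 1
        + ((x \<bullet> ?U 1) / ?m 1) *\<^sub>R ?U 1 + ((x \<bullet> ?U 2) / ?m 2) *\<^sub>R ?U 2 + ((x \<bullet> ?U 3) / ?m 3) *\<^sub>R ?U 3
        + ((x \<bullet> ?n 1) / ?m 1) *\<^sub>R ?n 1 + ((x \<bullet> ?n 2) / ?m 2) *\<^sub>R ?n 2 + ((x \<bullet> ?n 3) / ?m 3) *\<^sub>R ?n 3"
    by (simp add: vec_eq_iff forall_8 mk8_inner_right axis_def algebra_simps add_divide_distrib diff_divide_distrib sqrt_squares sqrt_products sqrt_products_mid)
qed

lemma L4_rigid:
  "rigid_lagrangian rho3 Y3 (mk8 0 0 0 0 0 0 1 0) (pick (36) (6) (6)) (-36) L4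
     (pick (mk8 0 0 0 0 0 0 0 6) (mk8 0 0 (- sqrt 6) 0 0 0 0 0) (mk8 0 0 0 (sqrt 6) 0 0 0 0))
     (pick (mk8 0 6 0 0 0 0 0 0) (mk8 0 0 0 0 (- sqrt 6) 0 0 0) (mk8 0 0 0 0 0 (- sqrt 6) 0 0))"
proof (rule rigid_lagrangian.intro[OF L4_homogeneous], rule rigid_lagrangian_axioms.intro)
  fix nu F :: "3 \<Rightarrow> real" and N :: "3 \<Rightarrow> 3 \<Rightarrow> real"
  let ?p = "mk8 0 0 0 0 0 0 1 0"
  let ?U = "(pick (mk8 0 0 0 0 0 0 0 6) (mk8 0 0 (- sqrt 6) 0 0 0 0 0) (mk8 0 0 0 (sqrt 6) 0 0 0 0))"
  let ?n = "(pick (mk8 0 6 0 0 0 0 0 0) (mk8 0 0 0 0 (- sqrt 6) 0 0 0) (mk8 0 0 0 0 0 (- sqrt 6) 0 0))"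
  let ?m = "(pick (36) (6) (6)) :: 3 \<Rightarrow> real"
  let ?v = "(-36) :: real"
  note expand = frame_deriv_def Y3_def matrix_skew8_mult skew8_def axis0_mk8 mk8_scaleR mk8_add
  show "Phi0 ?p (?U 1) (?U 2) (?U 3) = ?v"
    by (simp add: Phi0_dx4 dx4_def dx3_def det3_def sqrt_squares sqrt_products sqrt_products_mid)
  show "assoc_form ?U (axis 0 1) (frame_deriv Y3 ?n nu F N) = ?v * (N 1 1 + N 2 2 + N 3 3)"
    by (simp add: assoc_form_def expand Phi0_dx4 dx4_def dx3_def det3_def algebra_simps sqrt_squares sqrt_products sqrt_products_mid)
  show "assoc_form ?U (?n 1) (frame_deriv Y3 ?n nu F N) = ?v * (?m 1 * nu 1) - ?v * F 1
        - ?m 1 * ((3 * ?v - 2 * ?m 1) * nu 1 - (?m 3 * N 2 3 - ?m 2 * N 3 2))"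
    by (simp add: assoc_form_def expand Phi0_dx4 dx4_def dx3_def det3_def algebra_simps sqrt_squares sqrt_products sqrt_products_mid)
  show "assoc_form ?U (?n 2) (frame_deriv Y3 ?n nu F N) = ?v * (?m 2 * nu 2) - ?v * F 2
        - ?m 2 * ((3 * ?v - 2 * ?m 2) * nu 2 - (?m 1 * N 3 1 - ?m 3 * N 1 3))"
    by (simp add: assoc_form_def expand Phi0_dx4 dx4_def dx3_def det3_def algebra_simps sqrt_squares sqrt_products sqrt_products_mid)
  show "assoc_form ?U (?n 3) (frame_deriv Y3 ?n nu F N) = ?v * (?m 3 * nu 3) - ?v * F 3
        - ?m 3 * ((3 * ?v - 2 * ?m 3) * nu 3 - (?m 2 * N 1 2 - ?m 1 * N 2 1))"
    by (simp add: assoc_form_def expand Phi0_dx4 dx4_def dx3_def det3_def algebra_simps sqrt_squares sqrt_products sqrt_products_mid)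
  show "phi0 (nu 1 *\<^sub>R ?n 1 + nu 2 *\<^sub>R ?n 2 + nu 3 *\<^sub>R ?n 3) (?U 1) (?U 2)
        + phi0 ?p (frame_deriv Y3 ?n nu (\<lambda>_. 0) N 1) (?U 2) + phi0 ?p (?U 1) (frame_deriv Y3 ?n nu (\<lambda>_. 0) N 2)
        = (3 * ?v - 2 * ?m 3) * nu 3 - (?m 2 * N 1 2 - ?m 1 * N 2 1)"
    "phi0 (nu 1 *\<^sub>R ?n 1 + nu 2 *\<^sub>R ?n 2 + nu 3 *\<^sub>R ?n 3) (?U 2) (?U 3)
        + phi0 ?p (frame_deriv Y3 ?n nu (\<lambda>_. 0) N 2) (?U 3) + phi0 ?p (?U 2) (frame_deriv Y3 ?n nu (\<lambda>_. 0) N 3)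
        = (3 * ?v - 2 * ?m 1) * nu 1 - (?m 3 * N 2 3 - ?m 2 * N 3 2)"
    "phi0 (nu 1 *\<^sub>R ?n 1 + nu 2 *\<^sub>R ?n 2 + nu 3 *\<^sub>R ?n 3) (?U 3) (?U 1)
        + phi0 ?p (frame_deriv Y3 ?n nu (\<lambda>_. 0) N 3) (?U 1) + phi0 ?p (?U 3) (frame_deriv Y3 ?n nu (\<lambda>_. 0) N 1)
        = (3 * ?v - 2 * ?m 2) * nu 2 - (?m 1 * N 3 1 - ?m 3 * N 1 3)"
    by (simp_all add: expand phi0_def dx3_def det3_def algebra_simps sqrt_squares sqrt_products sqrt_products_mid)
  show "(1 / ?m 1) *\<^sub>R (Y3 1 *v ?U 1) + (1 / ?m 2) *\<^sub>R (Y3 2 *v ?U 2) + (1 / ?m 3) *\<^sub>R (Y3 3 *v ?U 3) = - 3 *\<^sub>R ?p"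
    by (simp add: expand mk8_eq_iff sqrt_squares sqrt_products sqrt_products_mid)
next
  fix f :: "quat \<Rightarrow> real" and p q :: nat and \<alpha> \<beta> :: complex
  let ?p = "mk8 0 0 0 0 0 0 1 0"
  let ?m = "(pick (36) (6) (6)) :: 3 \<Rightarrow> real"
  assume cont: "continuous_on S3q f"
    and inv: "\<And>g h. g \<in> S3q \<Longrightarrow> h \<in> S3q \<Longrightarrow> rho3 g ?p = rho3 h ?p \<Longrightarrow> f g = f h"
    and lin: "\<And>w. mean (\<lambda>g. f g * (w \<bullet> rho3 g ?p)) = 0"
    and ev: "(real p - real q)\<^sup>2 / ?m 1 + 2 * (2 * real p * real q + real p + real q) / ?m 3 = 3"
  \<comment> \<open>(0, 1) covers the half-turn about the y-axis, which fixes y and changes the sign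
    of z, and so preserves y (y^2 - 3 z^2).\<close>
  have fj: "f (qmult g (0, 1)) = f g" if "g \<in> S3q" for g
  proof (rule inv)
    have u: "(0, 1) \<in> S3q"
      by (simp add: S3q_def)
    show "qmult g (0, 1) \<in> S3q" "g \<in> S3q"
      using that u by simp_all
    have "rho3 (0, 1) ?p = ?p"
      by (rule rho3_fixI) (simp add: actq_def act_cubic_def varpi_entries cubic_of_expand fun_eq_iff)
    then show "rho3 (qmult g (0, 1)) ?p = rho3 g ?p"
      using rho3_qmult[OF that u] by simp
  qed
  have mfj: "mean (\<lambda>g. f g * h (qmult g (0, 1))) = mean (\<lambda>g. f g * h g)" if "continuous_on S3q h" for h :: "quat \<Rightarrow> real"
    by (rule mean_stabiliser[OF cont that]) (simp_all add: S3q_def fj)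
  have cM: "continuous_on S3q (\<lambda>g. Re (MM \<alpha> \<beta> a b g))" "continuous_on S3q (\<lambda>g. Im (MM \<alpha> \<beta> a b g))" for a b
    by (intro continuous_intros)+
  have swap: "mean (\<lambda>g. f g * Re (MM \<alpha> \<beta> a b g)) = (- 1) ^ b * mean (\<lambda>g. f g * Re (MM \<alpha> \<beta> b a g))"
    "mean (\<lambda>g. f g * Im (MM \<alpha> \<beta> a b g)) = (- 1) ^ b * mean (\<lambda>g. f g * Im (MM \<alpha> \<beta> b a g))" for a b
  proof -
    have e: "(- 1) ^ b = complex_of_real ((- 1) ^ b)"
      by simp
    have "f g * Re (MM \<alpha> \<beta> a b (qmult g (0, 1))) = (- 1) ^ b * (f g * Re (MM \<alpha> \<beta> b a g))"
      "f g * Im (MM \<alpha> \<beta> a b (qmult g (0, 1))) = (- 1) ^ b * (f g * Im (MM \<alpha> \<beta> b a g))" for g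
      unfolding MM_right_mult e by (simp_all del: of_real_power)
    then show "mean (\<lambda>g. f g * Re (MM \<alpha> \<beta> a b g)) = (- 1) ^ b * mean (\<lambda>g. f g * Re (MM \<alpha> \<beta> b a g))"
      "mean (\<lambda>g. f g * Im (MM \<alpha> \<beta> a b g)) = (- 1) ^ b * mean (\<lambda>g. f g * Im (MM \<alpha> \<beta> b a g))"
      using mfj[OF cM(1)[of a b]] mfj[OF cM(2)[of a b]] by (simp_all only: mean_cmult)
  qed
  \<comment> \<open>At the isotropic point the cubic becomes 2 (X^6 + Y^6). Invariance under (0, 1)
    makes the two pairings equal, and orthogonality to this linear function makes them
    opposite.\<close>
  have l: "(1/2) * ccubic (rho3 g ?p) (2 * \<i> * (\<alpha> * \<beta>)) (\<alpha> * \<alpha> + \<beta> * \<beta>) (- \<i> * (\<alpha> * \<alpha> - \<beta> * \<beta>)) = MM \<alpha> \<beta> 6 0 g + MM \<alpha> \<beta> 0 6 g"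
    if "g \<in> S3q" for g
    unfolding ccubic_isotropic[OF that] MM_def by (simp add: ccubic_def) (simp add: power_numeral_reduce algebra_simps)
  note lr = mean_ccubic[OF lin l]
  have "mean (\<lambda>g. f g * Re (MM \<alpha> \<beta> 6 0 g)) + mean (\<lambda>g. f g * Re (MM \<alpha> \<beta> 0 6 g)) = 0"
    "mean (\<lambda>g. f g * Im (MM \<alpha> \<beta> 6 0 g)) + mean (\<lambda>g. f g * Im (MM \<alpha> \<beta> 0 6 g)) = 0"
    using lr by (simp_all add: mean_add cont cM continuous_on_mult distrib_left right_diff_distrib)
  note rel = this
  have e: "(real p - real q)\<^sup>2 + 12 * (2 * (real p * real q) + real p + real q) = 108"
    using ev by (simp add: pick_def field_simps)
  have "real ((p + q) * (p + q) + 12 * (p + q) + 20 * (p * q)) = real 108"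
    using e by (simp add: power2_eq_square algebra_simps)
  then have n: "(p + q) * (p + q) + 12 * (p + q) + 20 * (p * q) = 108"
    by (simp only: of_nat_eq_iff)
  \<comment> \<open>Here s = p + q and P = p q. The solution s = 2, P = 4 is spurious, since two
    naturals with sum 2 have product at most 1.\<close>
  have "s = 6 \<and> P = 0 \<or> s = 2 \<and> P = 4" if "s * s + 12 * s + 20 * P = 108" for s P :: nat
  proof -
    have "12 * s \<le> 108"
      using that by linarith
    then have "s \<in> {0, 1, 2, 3, 4, 5, 6, 7, 8, 9}"
      by auto
    then consider "s = 0" | "s = 1" | "s = 2" | "s = 3" | "s = 4" | "s = 5" | "s = 6" | "s = 7" | "s = 8" | "s = 9"
      by blast
    then show ?thesis
      by cases (use that in \<open>simp; presburger?\<close>)+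
  qed
  from this[OF n] have "p = 6 \<and> q = 0 \<or> p = 0 \<and> q = 6"
  proof
    assume a: "p + q = 2 \<and> p * q = 4"
    then have "p = 0 \<or> p = 1 \<or> p = 2"
      by linarith
    then show ?thesis
      using a by auto
  qed auto
  then show "mean (\<lambda>g. f g * Re (MM \<alpha> \<beta> p q g)) = 0 \<and> mean (\<lambda>g. f g * Im (MM \<alpha> \<beta> p q g)) = 0"
    using rel swap[of 6 0] by auto
qed

theorem theorem1p2:
  assumes "M \<in> {S3_tg, L1, L2, L3, L4}"
    and "assoc_inf_deformation M V"
  shows "\<exists>v X. lag_inf_deformation M v \<and> X \<in> spin7 \<and>
           (\<forall>p\<in>M. V p - Jmap p (v p) - X *v p \<in> tangent_space M p)"
proof -
  from assms(1) consider "M = S3_tg" | "M = L1" | "M = L2" | "M = L3" | "M = L4"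
    by blast
  then show ?thesis
  proof cases
    case 1
    show ?thesis
      using rigid_lagrangian.infinitesimal_rigidity[OF S3_rigid] assms(2) unfolding 1 by blast
  next
    case 2
    show ?thesis
      using rigid_lagrangian.infinitesimal_rigidity[OF L1_rigid] assms(2) unfolding 2 by blast
  next
    case 3
    show ?thesis
      using rigid_lagrangian.infinitesimal_rigidity[OF L2_rigid] assms(2) unfolding 3 by blast
  next
    case 4
    show ?thesis
      using rigid_lagrangian.infinitesimal_rigidity[OF L3_rigid] assms(2) unfolding 4 by blast
  next
    case 5
    show ?thesis
      using rigid_lagrangian.infinitesimal_rigidity[OF L4_rigid] assms(2) unfolding 5 by blast
  qed
qed

end
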